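(* Let $N\ge 2$, let $\Omega\subset\mathbb{R}^N$ be a bounded open set and let $1<p<N$. Let $a:\Omega\times\mathbb{R}^N\to\mathbb{R}^N$ be a Carathéodory function for which there exist $\alpha,\beta>0$ such that, for almost every $x\in\Omega$ and all $\xi\ne\xi'$ in $\mathbb{R}^N$, $$a(x,\xi)\cdot\xi\ge\alpha|\xi|^p,\qquad |a(x,\xi)|\le\beta|\xi|^{p-1},\qquad (a(x,\xi)-a(x,\xi'))\cdot(\xi-\xi')>0.$$ Let $0\le\mu\in\mathcal{M}(\Omega)$, with decomposition $\mu=\mu_d+\mu_c$ ($\mu_d$ diffuse with respect to the $p$-capacity, $\mu_c$ concentrated on a set of zero $p$-capacity), be such that $\mu_c\equiv0$. Let $h:[0,\infty)\to(0,\infty]$ be continuous, finite outside the origin and non-increasing, such that there exist $0\le\gamma\le1$ and $c_1,s_1>0$ with $h(s)\le c_1s^{-\gamma}$ for $s<s_1$. Then there is at most one renormalized solution of $$-\operatorname{div}(a(x,\nabla u))=h(u)\mu\ \text{ in }\Omega,\qquad u=0\ \text{ on }\partial\Omega.$$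
   Context: $\mathcal{M}(\Omega)$ is the space of real-valued Borel measures on $\Omega$ with bounded total variation. The $p$-capacity (relative to $\Omega$) of a compact $K\subset\Omega$ is $\operatorname{cap}_p(K)=\inf\{\int_\Omega|\nabla\varphi|^p:\varphi\in C^\infty_c(\Omega),\ \varphi\ge1\text{ on }K\}$; for $U$ open, $\operatorname{cap}_p(U)$ is the supremum of $\operatorname{cap}_p(K)$ over compact $K\subset U$; for a Borel set, it is the infimum over open supersets in $\Omega$. A measure is diffuse with respect to the $p$-capacity if it vanishes on Borel sets of zero $p$-capacity; it is concentrated on a Borel set $E$ if $\mu(B)=\mu(B\cap E)$ for all Borel $B$. Every $\mu\in\mathcal{M}(\Omega)$ decomposes uniquely as $\mu_d+\mu_c$ as in the claim. Functions in $W^{1,p}$, and functions all of whose truncations are in $W^{1,p}$, are always taken in their $\operatorname{cap}_p$-quasi continuous representative when evaluated with respect to $\mu_d$. $T_k(s)=\max(-k,\min(s,k))$. If $u$ is measurable and a.e. finite with $T_k(u)\in W^{1,p}_0(\Omega)$ for all $k>0$, $\nabla u$ is the measurable vector field $v$ with $\nabla T_k(u)=v\chi_{\{|u|\le k\}}$ for all $k$. $C_b(\Omega)$ is the space of bounded continuous functions on $\Omega$, and $h(\infty):=\limsup_{s\to\infty}h(s)$. A nonnegative, almost everywhere finite function $u$ on $\Omega$ is a renormalized solution of the problem if $T_k(u)\in W^{1,p}_0(\Omega)$ for every $k>0$; for every $S\in W^{1,\infty}(\mathbb{R})$ with compact support and every $\varphi\in W^{1,p}_0(\Omega)\cap L^\infty(\Omega)$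 one has $h(u)S(u)\varphi\in L^1(\Omega,\mu_d)$ and $$\int_\Omega a(x,\nabla u)\cdot\nabla\varphi\,S(u)+\int_\Omega a(x,\nabla u)\cdot\nabla u\,S'(u)\varphi=\int_\Omega h(u)S(u)\varphi\,d\mu_d;$$ and $$\lim_{m\to\infty}\frac1m\int_{\{m<u<2m\}}a(x,\nabla u)\cdot\nabla u\,\varphi=h(\infty)\int_\Omega\varphi\,d\mu_c\qquad\text{for all }\varphi\in C_b(\Omega).$$ *)

theory Defs
  imports "HOL-Analysis.Analysis"
begin

(* Throughout, functions on an open set \<Omega> are total functions of which only the values on \<Omega>
   matter, and \<Omega> carries Lebesgue measure lebesgue_on \<Omega>. *)

subsection \<open>Test functions and Sobolev spaces\<close>

definition grad :: "('a::euclidean_space \<Rightarrow> real) \<Rightarrow> 'a \<Rightarrow> 'a" where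
  "grad f x = (THE D. GDERIV f x :> D)"

primrec Ck :: "nat \<Rightarrow> ('a::euclidean_space \<Rightarrow> real) \<Rightarrow> bool" where
  "Ck 0 f \<longleftrightarrow> continuous_on UNIV f"
| "Ck (Suc k) f \<longleftrightarrow> (\<forall>x. f differentiable (at x)) \<and> (\<forall>b\<in>Basis. Ck k (\<lambda>x. grad f x \<bullet> b))"

(* C_c^\<infinity>(\<Omega>), extended by zero outside \<Omega> *)
definition test_functions :: "'a::euclidean_space set \<Rightarrow> ('a \<Rightarrow> real) set" where
  "test_functions \<Omega> =
     {\<phi>. (\<forall>k. Ck k \<phi>) \<and> compact (closure {x. \<phi> x \<noteq> 0}) \<and> closure {x. \<phi> x \<noteq> 0} \<subseteq> \<Omega>}"

definition Lp :: "'a::euclidean_space set \<Rightarrow> real \<Rightarrow> ('a \<Rightarrow> 'b::euclidean_space) set" where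
  "Lp \<Omega> p = {f \<in> borel_measurable (lebesgue_on \<Omega>).
               integrable (lebesgue_on \<Omega>) (\<lambda>x. norm (f x) powr p)}"

definition Linfty :: "'a::euclidean_space set \<Rightarrow> ('a \<Rightarrow> 'b::euclidean_space) set" where
  "Linfty \<Omega> = {f \<in> borel_measurable (lebesgue_on \<Omega>).
                 \<exists>C. AE x in lebesgue_on \<Omega>. norm (f x) \<le> C}"

definition locally_integrable ::
    "'a::euclidean_space set \<Rightarrow> ('a \<Rightarrow> 'b::euclidean_space) \<Rightarrow> bool" where
  "locally_integrable \<Omega> f \<longleftrightarrow> (\<forall>K. compact K \<and> K \<subseteq> \<Omega> \<longrightarrow> set_integrable lebesgue K f)"

definition has_weak_gradient ::
    "'a::euclidean_space set \<Rightarrow> ('a \<Rightarrow> real) \<Rightarrow> ('a \<Rightarrow> 'a) \<Rightarrow> bool" where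
  "has_weak_gradient \<Omega> u v \<longleftrightarrow>
     locally_integrable \<Omega> u \<and> locally_integrable \<Omega> v \<and>
     (\<forall>\<phi>\<in>test_functions \<Omega>.
        (LINT x|lebesgue_on \<Omega>. u x *\<^sub>R grad \<phi> x) = - (LINT x|lebesgue_on \<Omega>. \<phi> x *\<^sub>R v x))"

(* unique up to Lebesgue-null subsets of \<Omega> whenever it exists *)
definition weak_grad :: "'a::euclidean_space set \<Rightarrow> ('a \<Rightarrow> real) \<Rightarrow> 'a \<Rightarrow> 'a" where
  "weak_grad \<Omega> u = (SOME v. has_weak_gradient \<Omega> u v)"

definition W1p :: "'a::euclidean_space set \<Rightarrow> real \<Rightarrow> ('a \<Rightarrow> real) set" where
  "W1p \<Omega> p = {u \<in> Lp \<Omega> p. \<exists>v\<in>Lp \<Omega> p. has_weak_gradient \<Omega> u v}"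

(* closure of C_c^\<infinity>(\<Omega>) in W^{1,p}(\<Omega>) *)
definition W1p_zero :: "'a::euclidean_space set \<Rightarrow> real \<Rightarrow> ('a \<Rightarrow> real) set" where
  "W1p_zero \<Omega> p = {u \<in> W1p \<Omega> p. \<exists>\<phi>::nat \<Rightarrow> 'a \<Rightarrow> real.
     (\<forall>n. \<phi> n \<in> test_functions \<Omega>) \<and>
     (\<lambda>n. LINT x|lebesgue_on \<Omega>. \<bar>\<phi> n x - u x\<bar> powr p) \<longlonglongrightarrow> 0 \<and>
     (\<lambda>n. LINT x|lebesgue_on \<Omega>. norm (grad (\<phi> n) x - weak_grad \<Omega> u x) powr p) \<longlonglongrightarrow> 0}"

definition W1infty :: "'a::euclidean_space set \<Rightarrow> ('a \<Rightarrow> real) set" where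
  "W1infty \<Omega> = {u \<in> Linfty \<Omega>. \<exists>v\<in>Linfty \<Omega>. has_weak_gradient \<Omega> u v}"

subsection \<open>Capacity\<close>

definition cap_compact :: "'a::euclidean_space set \<Rightarrow> real \<Rightarrow> 'a set \<Rightarrow> ennreal" where
  "cap_compact \<Omega> p K =
     (INF \<phi>\<in>{\<phi> \<in> test_functions \<Omega>. \<forall>x\<in>K. \<phi> x \<ge> 1}.
        \<integral>\<^sup>+x. ennreal (norm (grad \<phi> x) powr p) \<partial>lebesgue_on \<Omega>)"

definition cap_open :: "'a::euclidean_space set \<Rightarrow> real \<Rightarrow> 'a set \<Rightarrow> ennreal" where
  "cap_open \<Omega> p U = (SUP K\<in>{K. compact K \<and> K \<subseteq> U}. cap_compact \<Omega> p K)"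

definition cap :: "'a::euclidean_space set \<Rightarrow> real \<Rightarrow> 'a set \<Rightarrow> ennreal" where
  "cap \<Omega> p E = (INF U\<in>{U. open U \<and> E \<subseteq> U \<and> U \<subseteq> \<Omega>}. cap_open \<Omega> p U)"

(* The values of f may lie in the extended reals: a function whose truncations are all in W^{1,p}
   has a quasi continuous representative, but that may be infinite on a set of positive capacity. *)
definition quasi_continuous ::
    "'a::euclidean_space set \<Rightarrow> real \<Rightarrow> ('a \<Rightarrow> 'b::topological_space) \<Rightarrow> bool" where
  "quasi_continuous \<Omega> p f \<longleftrightarrow>
     (\<forall>\<epsilon>>0. \<exists>U. open U \<and> U \<subseteq> \<Omega> \<and> cap \<Omega> p U < ennreal \<epsilon> \<and> continuous_on (\<Omega> - U) f)"

(* unique up to sets of zero capacity whenever it exists *)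
definition qc_rep ::
    "'a::euclidean_space set \<Rightarrow> real \<Rightarrow> ('a \<Rightarrow> 'b::topological_space) \<Rightarrow> 'a \<Rightarrow> 'b" where
  "qc_rep \<Omega> p u =
     (SOME v. quasi_continuous \<Omega> p v \<and> (AE x in lebesgue_on \<Omega>. v x = u x))"

subsection \<open>Measures\<close>

(* the nonnegative elements of M(\<Omega>) *)
definition bounded_borel_measure :: "'a::euclidean_space set \<Rightarrow> 'a measure \<Rightarrow> bool" where
  "bounded_borel_measure \<Omega> \<mu> \<longleftrightarrow> sets \<mu> = sets (restrict_space borel \<Omega>) \<and> finite_measure \<mu>"

definition diffuse :: "'a::euclidean_space set \<Rightarrow> real \<Rightarrow> 'a measure \<Rightarrow> bool" where
  "diffuse \<Omega> p \<mu> \<longleftrightarrow>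
     (\<forall>B\<in>sets (restrict_space borel \<Omega>). cap \<Omega> p B = 0 \<longrightarrow> emeasure \<mu> B = 0)"

definition concentrated_on :: "'a::euclidean_space set \<Rightarrow> 'a measure \<Rightarrow> 'a set \<Rightarrow> bool" where
  "concentrated_on \<Omega> \<mu> E \<longleftrightarrow>
     E \<in> sets (restrict_space borel \<Omega>) \<and>
     (\<forall>B\<in>sets (restrict_space borel \<Omega>). emeasure \<mu> B = emeasure \<mu> (B \<inter> E))"

(* For a nonnegative \<mu>, both parts of its unique decomposition are nonnegative. *)
definition capacity_decomposition ::
    "'a::euclidean_space set \<Rightarrow> real \<Rightarrow> 'a measure \<Rightarrow> 'a measure \<Rightarrow> 'a measure \<Rightarrow> bool" where
  "capacity_decomposition \<Omega> p \<mu> \<mu>d \<mu>c \<longleftrightarrow>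
     bounded_borel_measure \<Omega> \<mu>d \<and> bounded_borel_measure \<Omega> \<mu>c \<and>
     (\<forall>B\<in>sets (restrict_space borel \<Omega>). emeasure \<mu> B = emeasure \<mu>d B + emeasure \<mu>c B) \<and>
     diffuse \<Omega> p \<mu>d \<and> (\<exists>E. cap \<Omega> p E = 0 \<and> concentrated_on \<Omega> \<mu>c E)"

subsection \<open>Renormalized solutions\<close>

definition caratheodory ::
    "'a::euclidean_space set \<Rightarrow> ('a \<Rightarrow> 'b::euclidean_space \<Rightarrow> 'c::euclidean_space) \<Rightarrow> bool" where
  "caratheodory \<Omega> a \<longleftrightarrow>
     (\<forall>\<xi>. (\<lambda>x. a x \<xi>) \<in> borel_measurable (lebesgue_on \<Omega>)) \<and>
     (AE x in lebesgue_on \<Omega>. continuous_on UNIV (a x))"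

definition trunc :: "real \<Rightarrow> ereal \<Rightarrow> real" where
  "trunc k s = real_of_ereal (max (- ereal k) (min s (ereal k)))"

definition trunc_grad :: "'a::euclidean_space set \<Rightarrow> ('a \<Rightarrow> ereal) \<Rightarrow> 'a \<Rightarrow> 'a" where
  "trunc_grad \<Omega> u = (SOME v. v \<in> borel_measurable (lebesgue_on \<Omega>) \<and>
     (\<forall>k>0. AE x in lebesgue_on \<Omega>.
        weak_grad \<Omega> (\<lambda>y. trunc k (u y)) x = indicat_real {y. \<bar>u y\<bar> \<le> ereal k} x *\<^sub>R v x))"

definition h_ext :: "(real \<Rightarrow> ennreal) \<Rightarrow> ereal \<Rightarrow> ennreal" where
  "h_ext h s = (if s = \<infinity> then Limsup at_top h else h (real_of_ereal s))"

(* evaluation at extended reals of a function with compact support *)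
definition zero_ext :: "(real \<Rightarrow> real) \<Rightarrow> ereal \<Rightarrow> real" where
  "zero_ext S s = (if \<bar>s\<bar> = \<infinity> then 0 else S (real_of_ereal s))"

(* Since h(0) may be infinite, h(u) S(u) \<phi> takes values in the extended reals, where 0 * \<infinity> = 0. *)
definition source_term ::
    "'a::euclidean_space set \<Rightarrow> real \<Rightarrow> (real \<Rightarrow> ennreal) \<Rightarrow> (real \<Rightarrow> real) \<Rightarrow>
     ('a \<Rightarrow> ereal) \<Rightarrow> ('a \<Rightarrow> real) \<Rightarrow> 'a \<Rightarrow> ereal" where
  "source_term \<Omega> p h S u \<phi> x =
     enn2ereal (h_ext h (qc_rep \<Omega> p u x)) *
     ereal (zero_ext S (qc_rep \<Omega> p u x)) * ereal (qc_rep \<Omega> p \<phi> x)"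

(* Quasi continuous functions need not be Borel, but they are measurable with respect to the
   completion of a diffuse measure. An element S of W^{1,\<infinity>}(R) is taken in its continuous
   representative; S'(u) is ambiguous only where trunc_grad \<Omega> u = 0 almost everywhere. *)
definition renormalized_solution ::
    "'a::euclidean_space set \<Rightarrow> real \<Rightarrow> ('a \<Rightarrow> 'a \<Rightarrow> 'a) \<Rightarrow> (real \<Rightarrow> ennreal) \<Rightarrow>
     'a measure \<Rightarrow> 'a measure \<Rightarrow> ('a \<Rightarrow> ereal) \<Rightarrow> bool" where
  "renormalized_solution \<Omega> p a h \<mu>d \<mu>c u \<longleftrightarrow>
     u \<in> borel_measurable (lebesgue_on \<Omega>) \<and>
     (AE x in lebesgue_on \<Omega>. 0 \<le> u x \<and> u x < \<infinity>) \<and>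
     (\<forall>k>0. (\<lambda>x. trunc k (u x)) \<in> W1p_zero \<Omega> p) \<and>
     (\<forall>S \<phi>. S \<in> W1infty UNIV \<and> continuous_on UNIV S \<and> compact (closure {s. S s \<noteq> 0}) \<and>
        \<phi> \<in> W1p_zero \<Omega> p \<inter> Linfty \<Omega> \<longrightarrow>
        (AE x in completion \<mu>d. \<bar>source_term \<Omega> p h S u \<phi> x\<bar> \<noteq> \<infinity>) \<and>
        integrable (completion \<mu>d) (\<lambda>x. real_of_ereal (source_term \<Omega> p h S u \<phi> x)) \<and>
        (LINT x|lebesgue_on \<Omega>.
           (a x (trunc_grad \<Omega> u x) \<bullet> weak_grad \<Omega> \<phi> x) * zero_ext S (u x)) +
        (LINT x|lebesgue_on \<Omega>.
           (a x (trunc_grad \<Omega> u x) \<bullet> trunc_grad \<Omega> u x) *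
           zero_ext (weak_grad UNIV S) (u x) * \<phi> x) =
        (LINT x|completion \<mu>d. real_of_ereal (source_term \<Omega> p h S u \<phi> x))) \<and>
     (\<forall>\<phi>. continuous_on \<Omega> \<phi> \<and> bounded (\<phi> ` \<Omega>) \<longrightarrow>
        (\<lambda>m::nat. (1 / real m) *
           (LINT x|lebesgue_on \<Omega>. indicat_real {y. ereal m < u y \<and> u y < ereal (2 * m)} x *
              ((a x (trunc_grad \<Omega> u x) \<bullet> trunc_grad \<Omega> u x) * \<phi> x)))
        \<longlonglongrightarrow> enn2real (Limsup at_top h) * (LINT x|\<mu>c. \<phi> x))"

end

theory Submission
  imports Defs
begin

text \<open>
  Let \<open>S\<close> be a smooth cutoff which is \<open>1\<close> on \<open>[-m, m]\<close> and \<open>0\<close> outside \<open>[-2m, 2m]\<close>. The function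
  \<open>arctan (u - v) S(u) S(v)\<close> is a bounded element of \<open>W\<^sub>0\<close>, admissible in both equations with a second cutoff
  which is \<open>1\<close> on its support, so that the terms with the derivative of this second cutoff vanish. Subtracting the
  equations, the right-hand side is nonpositive because \<open>h\<close> is non-increasing, and the terms containing the
  derivative of \<open>S\<close> are bounded by the energies of \<open>u\<close> and \<open>v\<close> below the level \<open>2m\<close>, divided by \<open>m\<close>. Since
  the singular part of the measure vanishes, the energy on \<open>{m < u < 2m}\<close> is \<open>o(m)\<close>; summing over dyadic levels, so is
  the energy below the level \<open>2m\<close>. Letting \<open>m\<close> tend to infinity along powers of two, strict monotonicity gives
  equality of the gradients. The same test functions then have gradients tending to \<open>0\<close> in \<open>L\<^sup>p\<close>, and the Poincare
  inequality yields \<open>arctan (u - v) = 0\<close>.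

  The sign of the right-hand side is read off from quasi continuous representatives, which must therefore be shown
  to exist (the one of \<open>u\<close> is obtained from \<open>arctan u\<close>, which lies in \<open>W\<^sub>0\<close>) and to be unique up to sets that are null
  for the diffuse measure.
\<close>

subsection \<open>Smooth functions\<close>

text \<open>\<open>weak_grad\<close>, \<open>trunc_grad\<close> and \<open>qc_rep\<close> are
  arbitrary choices, so the equation says nothing usable until existence and uniqueness of each is
  known; most of the work goes there. W_0 is a closure of test functions, and compositions are
  justified by composing the approximating test functions. This dictates smooth substitutes for the
  usual Lipschitz ones: arctan in place of a truncation of u - v (bounded, strictly increasing,
  positive derivative), smooth cutoffs in place of piecewise linear ones, a smooth cap in place of a
  minimum in capacity estimates. The price is that capacity inequalities carry constants larger than
  1, which geometric weights absorb. Powers of two appear because the energy satisfies E(2m) <= E(m)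
  + o(m), so E(m)/m is contracted by 1/2, up to a vanishing error, at each doubling. As h(0) may be
  infinite, the right-hand sides are compared pointwise only where both source terms are finite; the
  definition of a solution provides this almost everywhere for the diffuse measure.\<close>

lemma grad_eqI: "GDERIV f x :> D \<Longrightarrow> grad f x = D"
  unfolding grad_def gderiv_def
  by (rule the_equality, assumption)
     (metis has_derivative_unique euclidean_eqI inner_commute)

lemma GDERIV_grad:
  assumes "f differentiable (at x)"
  shows "GDERIV f x :> grad f x"
proof -
  obtain f' where f': "(f has_derivative f') (at x)"
    using assms by (auto simp: differentiable_def)
  interpret bounded_linear f' using f' by (rule has_derivative_bounded_linear)
  define D where "D = (\<Sum>b\<in>Basis. f' b *\<^sub>R b)"
  have "f' h = h \<bullet> D" for h
  proof -
    have "f' h = f' (\<Sum>b\<in>Basis. (h \<bullet> b) *\<^sub>R b)" by (simp add: euclidean_representation)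
    also have "\<dots> = (\<Sum>b\<in>Basis. (h \<bullet> b) * f' b)" by (simp add: sum scaleR)
    finally show ?thesis by (simp add: D_def inner_sum_right mult.commute)
  qed
  then have "GDERIV f x :> D" using f' unfolding gderiv_def by presburger
  then show ?thesis using grad_eqI by metis
qed

lemma GDERIV_imp_differentiable: "GDERIV f x :> D \<Longrightarrow> f differentiable (at x)"
  by (auto simp: gderiv_def differentiable_def)

lemma Ck_SucI:
  assumes "\<And>x. GDERIV f x :> D x" "\<And>b. b \<in> Basis \<Longrightarrow> Ck k (\<lambda>x. D x \<bullet> b)"
  shows "Ck (Suc k) f"
proof -
  have "grad f = D" using assms(1) grad_eqI by blast
  then show ?thesis using assms GDERIV_imp_differentiable[OF assms(1)] by simp
qed

lemma Ck_imp_continuous: "Ck k f \<Longrightarrow> continuous_on UNIV f"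
  by (cases k) (simp_all add: continuous_at_imp_continuous_on differentiable_imp_continuous_within)

lemma Ck_Suc_imp: "Ck (Suc k) f \<Longrightarrow> Ck k f"
proof (induction k arbitrary: f)
  case 0
  show ?case using Ck_imp_continuous[OF 0] by simp
next
  case (Suc k) then show ?case by auto
qed

lemma Ck_const: "Ck k (\<lambda>x. c)"
proof (induction k arbitrary: c)
  case (Suc k)
  show ?case by (rule Ck_SucI[where D = "\<lambda>x. 0"]) (auto simp: GDERIV_const Suc)
qed simp

lemma Ck_inner: "Ck k (\<lambda>x. x \<bullet> c)"
proof (cases k)
  case (Suc j)
  show ?thesis unfolding Suc
    by (rule Ck_SucI[where D = "\<lambda>x. c"]) (auto simp: gderiv_def Ck_const intro!: derivative_eq_intros)
qed (auto intro!: continuous_intros)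

lemma Ck_add: "Ck k f \<Longrightarrow> Ck k g \<Longrightarrow> Ck k (\<lambda>x. f x + g x)"
proof (induction k arbitrary: f g)
  case (Suc k)
  show ?case
    by (rule Ck_SucI[where D = "\<lambda>x. grad f x + grad g x"])
       (use Suc in \<open>auto intro!: GDERIV_add GDERIV_grad simp: inner_add_left\<close>)
qed (auto intro!: continuous_intros)

lemma Ck_mult: "Ck k f \<Longrightarrow> Ck k g \<Longrightarrow> Ck k (\<lambda>x. f x * g x)"
proof (induction k arbitrary: f g)
  case (Suc k)
  have 1: "Ck k f" "Ck k g" using Suc.prems by (blast intro: Ck_Suc_imp)+
  show ?case
    by (rule Ck_SucI[where D = "\<lambda>x. f x *\<^sub>R grad g x + g x *\<^sub>R grad f x"])
       (use Suc 1 in \<open>auto intro!: GDERIV_mult GDERIV_grad Ck_add simp: inner_add_left\<close>)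
qed (auto intro!: continuous_intros)

lemma Ck_minus: "Ck k f \<Longrightarrow> Ck k (\<lambda>x. - f x)"
  using Ck_mult[OF Ck_const[of k "-1"], of f] by simp

lemma Ck_diff: "Ck k f \<Longrightarrow> Ck k g \<Longrightarrow> Ck k (\<lambda>x. f x - g x)"
  using Ck_add[of k f "\<lambda>x. - g x"] Ck_minus[of k g] by simp

lemma Ck_power: "Ck k f \<Longrightarrow> Ck k (\<lambda>x. f x ^ n)"
  by (induction n) (auto intro: Ck_mult Ck_const)

lemma Ck_sum: "(\<And>i. i \<in> I \<Longrightarrow> Ck k (f i)) \<Longrightarrow> Ck k (\<lambda>x. \<Sum>i\<in>I. f i x)"
  by (induction I rule: infinite_finite_induct) (auto intro: Ck_add Ck_const)

lemma Ck_inverse: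
  assumes "\<And>x. f x \<noteq> 0"
  shows "Ck k f \<Longrightarrow> Ck k (\<lambda>x. inverse (f x))"
proof (induction k)
  case 0 then show ?case using assms by (auto intro!: continuous_intros)
next
  case (Suc k)
  have 1: "Ck k f" using Suc.prems by (blast intro: Ck_Suc_imp)
  then have 2: "Ck k (\<lambda>x. inverse (f x))" using Suc by blast
  show ?case
  proof (rule Ck_SucI[where D = "\<lambda>x. - (inverse (f x))\<^sup>2 *\<^sub>R grad f x"])
    show "GDERIV (\<lambda>x. inverse (f x)) x :> - (inverse (f x))\<^sup>2 *\<^sub>R grad f x" for x
      using Suc assms by (intro GDERIV_inverse GDERIV_grad) auto
    show "b \<in> Basis \<Longrightarrow> Ck k (\<lambda>x. - (inverse (f x))\<^sup>2 *\<^sub>R grad f x \<bullet> b)" for b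
      using Ck_minus[OF Ck_mult[OF Ck_power[OF 2], of "\<lambda>x. grad f x \<bullet> b" 2]] Suc by simp
  qed
qed

lemma DERIV_grad_real: "Ck (Suc k) g \<Longrightarrow> DERIV g (x::real) :> grad g x"
  using GDERIV_grad[of g x] by auto

lemma Ck_SucI_real:
  assumes "\<And>x::real. DERIV g x :> g' x" "Ck k g'"
  shows "Ck (Suc k) g"
  by (rule Ck_SucI[where D = g']) (use assms in auto)

lemma Ck_grad_real: "Ck (Suc k) (g::real\<Rightarrow>real) \<Longrightarrow> Ck k (grad g)"
  by simp

lemma Ck_compose:
  fixes g :: "real \<Rightarrow> real"
  shows "Ck k g \<Longrightarrow> Ck k f \<Longrightarrow> Ck k (\<lambda>x. g (f x))"
proof (induction k arbitrary: g)
  case 0 then show ?case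
    using continuous_on_compose2[of UNIV g UNIV f] by simp
next
  case (Suc k)
  have f: "Ck k f" using Suc.prems by (blast intro: Ck_Suc_imp)
  have "Ck k (\<lambda>x. grad g (f x))" using Suc.IH[OF Ck_grad_real[OF Suc.prems(1)] f] .
  then show ?case
    by (intro Ck_SucI[where D = "\<lambda>x. grad g (f x) *\<^sub>R grad f x"])
       (use Suc.prems in \<open>auto intro!: GDERIV_DERIV_compose[OF GDERIV_grad DERIV_grad_real] Ck_mult\<close>)
qed

lemma Ck_arctan: "Ck k arctan"
proof (cases k)
  case (Suc j)
  have "Ck j (\<lambda>x::real. inverse (1 + x\<^sup>2))"
    using Ck_inner[of j "1::real"]
    by (intro Ck_inverse Ck_add Ck_const Ck_power) (auto, metis add_pos_nonneg zero_le_power2 zero_less_one less_irrefl)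
  then show ?thesis unfolding Suc
    by (rule Ck_SucI_real[rotated]) (rule DERIV_arctan)
qed (auto intro!: continuous_intros)

text \<open>The case n = 0 is the classical flat function exp(-1/t). The powers of 1/t are carried
  along so that derivatives of members of the family are linear combinations of members; smoothness
  then follows by one induction over all n at once.\<close>

definition expinv :: "nat \<Rightarrow> real \<Rightarrow> real" where
  "expinv n t = (if t > 0 then inverse t ^ n * exp (- inverse t) else 0)"

lemma expinv_tendsto: "((\<lambda>t. inverse t ^ n * exp (- inverse t)) \<longlongrightarrow> (0::real)) (at_right 0)"
proof -
  have "((\<lambda>y::real. y ^ n / exp y) \<longlongrightarrow> 0) at_top" by (rule tendsto_power_div_exp_0)
  then have "((\<lambda>t. inverse t ^ n / exp (inverse t)) \<longlongrightarrow> (0::real)) (at_right 0)"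
    by (rule filterlim_compose) (rule filterlim_inverse_at_top_right)
  then show ?thesis by (simp add: exp_minus divide_inverse)
qed

lemma DERIV_expinv: "DERIV (expinv n) t :> expinv (n + 2) t - real n * expinv (n + 1) t"
proof -
  consider "t > 0" | "t < 0" | "t = 0" by linarith
  then show ?thesis
  proof cases
    case 1
    have "DERIV (\<lambda>t. inverse t ^ n * exp (- inverse t)) t :> expinv (n + 2) t - real n * expinv (n + 1) t"
    proof (cases n)
      case 0
      then show ?thesis using 1 by (auto intro!: derivative_eq_intros simp: expinv_def power2_eq_square)
    next
      case (Suc m)
      have "DERIV (\<lambda>t. inverse t ^ Suc m) t :> - (1 + real m) * (inverse t ^ (m + 2))"
        using DERIV_power_Suc[OF DERIV_inverse[of t UNIV], of m] 1
        by (simp add: power2_eq_square algebra_simps)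
      moreover have "DERIV (\<lambda>t. exp (- inverse t)) t :> exp (- inverse t) * inverse t ^ 2"
        using 1 by (auto intro!: derivative_eq_intros simp: power2_eq_square)
      ultimately have "DERIV (\<lambda>t. inverse t ^ Suc m * exp (- inverse t)) t :>
          - (1 + real m) * (inverse t ^ (m + 2)) * exp (- inverse t) +
          exp (- inverse t) * inverse t ^ 2 * inverse t ^ Suc m"
        by (rule DERIV_mult)
      then show ?thesis unfolding Suc
        by (rule DERIV_cong) (use 1 in \<open>simp add: expinv_def power2_eq_square algebra_simps\<close>)
    qed
    then show ?thesis
      by (rule has_field_derivative_transform_within_open[where S = "{0<..}"]) (use 1 in \<open>auto simp: expinv_def\<close>)
  next
    case 2
    have "DERIV (\<lambda>t. 0) t :> expinv (n + 2) t - real n * expinv (n + 1) t" using 2 by (simp add: expinv_def)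
    then show ?thesis
      by (rule has_field_derivative_transform_within_open[where S = "{..<0}"]) (use 2 in \<open>auto simp: expinv_def\<close>)
  next
    case 3
    have "((\<lambda>h. expinv n h / h) \<longlongrightarrow> 0) (at 0)"
      unfolding filterlim_at_split
    proof
      show "((\<lambda>h. expinv n h / h) \<longlongrightarrow> 0) (at_left 0)"
        by (rule tendsto_eventually) (auto simp: expinv_def eventually_at_filter)
      \<comment> \<open>For h > 0 the quotient equals
        \<open>inverse h ^ Suc n * exp (- inverse h)\<close>, so this is
        \<open>expinv_tendsto\<close> with the exponent raised by one.\<close>
      show "((\<lambda>h. expinv n h / h) \<longlongrightarrow> 0) (at_right 0)"
        by (rule Lim_transform_eventually[OF expinv_tendsto[of "Suc n"]])
           (auto simp: expinv_def eventually_at_filter divide_inverse)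
    qed
    then show ?thesis using 3 by (simp add: DERIV_def expinv_def)
  qed
qed

lemma Ck_expinv: "Ck k (expinv n)"
proof (induction k arbitrary: n)
  case 0
  have "continuous_on UNIV (expinv n)"
    by (intro continuous_at_imp_continuous_on ballI DERIV_isCont) (rule DERIV_expinv)
  then show ?case by simp
next
  case (Suc k)
  show ?case by (rule Ck_SucI_real[OF DERIV_expinv]) (intro Ck_diff Ck_mult Ck_const Suc)
qed

text \<open>The standard smooth transition from 0 to 1 across the unit interval. The denominator is
  positive because t and 1 - t are never both nonpositive.\<close>

definition smooth_step :: "real \<Rightarrow> real" where
  "smooth_step t = expinv 0 t * inverse (expinv 0 t + expinv 0 (1 - t))"

lemma expinv_nonneg: "expinv n t \<ge> 0" by (simp add: expinv_def)
lemma expinv_pos: "t > 0 \<Longrightarrow> expinv n t > 0" by (simp add: expinv_def)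
lemma expinv_0: "t \<le> 0 \<Longrightarrow> expinv n t = 0" by (simp add: expinv_def)

lemma smooth_step_denom: "expinv 0 t + expinv 0 (1 - t) > 0"
  using expinv_pos[of t 0] expinv_pos[of "1 - t" 0] expinv_nonneg[of 0 t] expinv_nonneg[of 0 "1 - t"]
  by (cases "t > 0") auto

lemma smooth_step_0: "t \<le> 0 \<Longrightarrow> smooth_step t = 0"
  by (simp add: smooth_step_def expinv_0)

lemma smooth_step_1: "t \<ge> 1 \<Longrightarrow> smooth_step t = 1"
  using expinv_pos[of t 0] by (simp add: smooth_step_def expinv_0)

lemma smooth_step_ge_0: "smooth_step t \<ge> 0"
  using smooth_step_denom[of t] by (simp add: smooth_step_def expinv_nonneg)

lemma smooth_step_le_1: "smooth_step t \<le> 1"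
  using smooth_step_denom[of t] expinv_nonneg[of 0 "1-t"] by (simp add: smooth_step_def field_simps)

lemma Ck_smooth_step: "Ck k smooth_step"
proof -
  have "Ck k (\<lambda>t. expinv 0 (1 - t))"
    using Ck_inner[of k "1::real"] by (intro Ck_compose[OF Ck_expinv] Ck_diff Ck_const) auto
  then show ?thesis unfolding smooth_step_def[abs_def]
    by (intro Ck_mult Ck_inverse Ck_add Ck_expinv) (metis smooth_step_denom less_irrefl)
qed

definition smooth_step' :: "real \<Rightarrow> real" where
  "smooth_step' = grad smooth_step"

lemma DERIV_smooth_step: "DERIV smooth_step t :> smooth_step' t"
  unfolding smooth_step'_def by (rule DERIV_grad_real) (rule Ck_smooth_step)

lemma continuous_smooth_step': "continuous_on UNIV smooth_step'"
  using Ck_smooth_step[of "Suc 0"] unfolding smooth_step'_def by simp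

lemma smooth_step'_0: 
  assumes "t < 0 \<or> t > 1"
  shows "smooth_step' t = 0"
  using assms
proof
  assume "t < 0"
  have "DERIV smooth_step t :> 0"
    by (rule has_field_derivative_transform_within_open[where S = "{..<0}" and f = "\<lambda>_. 0"])
       (use \<open>t < 0\<close> in \<open>auto simp: smooth_step_0\<close>)
  then show ?thesis using DERIV_smooth_step DERIV_unique by blast
next
  assume "t > 1"
  have "DERIV smooth_step t :> 0"
    by (rule has_field_derivative_transform_within_open[where S = "{1<..}" and f = "\<lambda>_. 1"])
       (use \<open>t > 1\<close> in \<open>auto simp: smooth_step_1\<close>)
  then show ?thesis using DERIV_smooth_step DERIV_unique by blast
qed

lemma smooth_step'_bounded: obtains C where "C > 0" "\<And>t. \<bar>smooth_step' t\<bar> \<le> C"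
proof -
  have "compact (smooth_step' ` {0..1})"
    by (intro compact_continuous_image continuous_on_subset[OF continuous_smooth_step']) auto
  then obtain C where C: "C > 0" "\<And>t. t \<in> {0..1} \<Longrightarrow> \<bar>smooth_step' t\<bar> \<le> C"
    using bounded_pos[of "smooth_step' ` {0..1}"] compact_imp_bounded by auto
  have "\<bar>smooth_step' t\<bar> \<le> C" for t
    using C(2)[of t] smooth_step'_0[of t] C(1) by (cases "t \<in> {0..1}") auto
  then show ?thesis using C(1) that by blast
qed

subsection \<open>Test functions and integration by parts\<close>

lemma test_functionsI:
  assumes "\<And>k. Ck k \<phi>" "compact K" "K \<subseteq> \<Omega>" "\<And>x. x \<notin> K \<Longrightarrow> \<phi> x = 0"
  shows "\<phi> \<in> test_functions \<Omega>"
proof -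
  have "closure {x. \<phi> x \<noteq> 0} \<subseteq> K"
    using assms(2,4) by (intro closure_minimal compact_imp_closed) auto
  moreover from this have "compact (closure {x. \<phi> x \<noteq> 0})"
    using compact_Int_closed[OF assms(2) closed_closure] by (metis inf.absorb_iff2)
  ultimately show ?thesis using assms(1,3) unfolding test_functions_def by blast
qed

text \<open>One compact set serves for the function and its gradient: it is the closed support, and
  on its open complement the function is locally constant.\<close>

lemma test_functionsE:
  assumes "\<phi> \<in> test_functions \<Omega>"
  obtains K where "compact K" "K \<subseteq> \<Omega>" "\<And>x. x \<notin> K \<Longrightarrow> \<phi> x = 0" "\<And>x. x \<notin> K \<Longrightarrow> grad \<phi> x = 0"
proof -
  define K where "K = closure {x. \<phi> x \<noteq> 0}"
  have K: "compact K" "K \<subseteq> \<Omega>" using assms by (auto simp: test_functions_def K_def)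
  have z: "\<phi> x = 0" if "x \<notin> K" for x
    using that closure_subset[of "{x. \<phi> x \<noteq> 0}"] unfolding K_def by auto
  have "grad \<phi> x = 0" if "x \<notin> K" for x
  proof (rule grad_eqI)
    have "((\<lambda>x. 0) has_derivative (\<lambda>h. h \<bullet> 0)) (at x)" by simp
    then have "(\<phi> has_derivative (\<lambda>h. h \<bullet> 0)) (at x)"
      by (rule has_derivative_transform_within_open[where s = "- K"])
         (use that z K compact_imp_closed in auto)
    then show "GDERIV \<phi> x :> 0" by (simp add: gderiv_def)
  qed
  then show ?thesis using that K z by blast
qed

lemma test_Ck: "\<phi> \<in> test_functions \<Omega> \<Longrightarrow> Ck k \<phi>"
  by (auto simp: test_functions_def)

lemma test_GDERIV: "\<phi> \<in> test_functions \<Omega> \<Longrightarrow> GDERIV \<phi> x :> grad \<phi> x"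
  using test_Ck[of \<phi> \<Omega> "Suc 0"] by (intro GDERIV_grad) auto

lemma test_continuous: "\<phi> \<in> test_functions \<Omega> \<Longrightarrow> continuous_on UNIV \<phi>"
  using test_Ck[of \<phi> \<Omega> 0] by auto

lemma test_grad_continuous:
  assumes "\<phi> \<in> test_functions \<Omega>" shows "continuous_on UNIV (grad \<phi>)"
proof -
  have "continuous_on UNIV (\<lambda>x. grad \<phi> x \<bullet> b)" if "b \<in> Basis" for b
    using test_Ck[OF assms, of "Suc 0"] that by auto
  then have "continuous_on UNIV (\<lambda>x. \<Sum>b\<in>Basis. (grad \<phi> x \<bullet> b) *\<^sub>R b)"
    by (intro continuous_on_sum continuous_on_scaleR continuous_on_const) auto
  then show ?thesis by (simp add: euclidean_representation)
qed

lemma continuous_compact_support_bounded: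
  fixes f :: "'a::euclidean_space \<Rightarrow> 'b::real_normed_vector"
  assumes "continuous_on UNIV f" "compact K" "\<And>x. x \<notin> K \<Longrightarrow> f x = 0"
  obtains C where "C > 0" "\<And>x. norm (f x) \<le> C"
proof -
  have "compact (f ` K)"
    by (intro compact_continuous_image continuous_on_subset[OF assms(1)] assms) auto
  then obtain C where C: "C > 0" "\<And>t. t \<in> K \<Longrightarrow> norm (f t) \<le> C"
    using bounded_pos[of "f ` K"] compact_imp_bounded by auto
  have "norm (f t) \<le> C" for t
    using C(2)[of t] assms(3)[of t] C(1) by (cases "t \<in> K") auto
  then show ?thesis using C(1) that by blast
qed

lemma test_bounded:
  assumes "\<phi> \<in> test_functions \<Omega>"
  obtains C where "C > 0" "\<And>x. \<bar>\<phi> x\<bar> \<le> C" "\<And>x. norm (grad \<phi> x) \<le> C"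
proof -
  obtain K where K: "compact K" "K \<subseteq> \<Omega>" "\<And>x. x \<notin> K \<Longrightarrow> \<phi> x = 0" "\<And>x. x \<notin> K \<Longrightarrow> grad \<phi> x = 0"
    using test_functionsE[OF assms] by blast
  obtain C1 where C1: "C1 > 0" "\<And>x. norm (\<phi> x) \<le> C1"
    using continuous_compact_support_bounded[OF test_continuous[OF assms] K(1,3)] by blast
  obtain C2 where C2: "C2 > 0" "\<And>x. norm (grad \<phi> x) \<le> C2"
    using continuous_compact_support_bounded[OF test_grad_continuous[OF assms] K(1,4)] by blast
  have "norm (\<phi> x) \<le> max C1 C2" "norm (grad \<phi> x) \<le> max C1 C2" for x
    using C1(2)[of x] C2(2)[of x] by linarith+
  then show ?thesis using C1(1) by (intro that[of "max C1 C2"]) simp_all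
qed

lemma test_compose:
  assumes "\<phi> \<in> test_functions \<Omega>" "\<And>k. Ck k F" "F 0 = 0"
  shows "(\<lambda>x. F (\<phi> x)) \<in> test_functions \<Omega>"
proof -
  obtain K where K: "compact K" "K \<subseteq> \<Omega>" "\<And>x. x \<notin> K \<Longrightarrow> \<phi> x = 0" "\<And>x. x \<notin> K \<Longrightarrow> grad \<phi> x = 0"
    using test_functionsE[OF assms(1)] by blast
  show ?thesis
    by (rule test_functionsI[OF _ K(1,2)]) (auto simp: K(3) assms(3) intro: Ck_compose[OF assms(2) test_Ck[OF assms(1)]])
qed

lemma test_mult:
  assumes "\<phi> \<in> test_functions \<Omega>" "\<And>k. Ck k \<psi>"
  shows "(\<lambda>x. \<phi> x * \<psi> x) \<in> test_functions \<Omega>"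
proof -
  obtain K where K: "compact K" "K \<subseteq> \<Omega>" "\<And>x. x \<notin> K \<Longrightarrow> \<phi> x = 0" "\<And>x. x \<notin> K \<Longrightarrow> grad \<phi> x = 0"
    using test_functionsE[OF assms(1)] by blast
  show ?thesis
    by (rule test_functionsI[OF _ K(1,2)]) (auto simp: K(3) intro: Ck_mult[OF test_Ck[OF assms(1)] assms(2)])
qed

lemma test_add:
  assumes "\<phi> \<in> test_functions \<Omega>" "\<psi> \<in> test_functions \<Omega>"
  shows "(\<lambda>x. \<phi> x + \<psi> x) \<in> test_functions \<Omega>"
proof -
  obtain K where K: "compact K" "K \<subseteq> \<Omega>" "\<And>x. x \<notin> K \<Longrightarrow> \<phi> x = 0" "\<And>x. x \<notin> K \<Longrightarrow> grad \<phi> x = 0"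
    using test_functionsE[OF assms(1)] by blast
  obtain L where L: "compact L" "L \<subseteq> \<Omega>" "\<And>x. x \<notin> L \<Longrightarrow> \<psi> x = 0" "\<And>x. x \<notin> L \<Longrightarrow> grad \<psi> x = 0"
    using test_functionsE[OF assms(2)] by blast
  show ?thesis
    by (rule test_functionsI[of _ "K \<union> L"]) (use K L in \<open>auto intro: Ck_add[OF test_Ck[OF assms(1)] test_Ck[OF assms(2)]]\<close>)
qed

lemma test_cmult:
  assumes "\<phi> \<in> test_functions \<Omega>" shows "(\<lambda>x. c * \<phi> x) \<in> test_functions \<Omega>"
  using test_mult[OF assms Ck_const[of _ c]] by (simp add: mult.commute)

lemma test_diff:
  assumes "\<phi> \<in> test_functions \<Omega>" "\<psi> \<in> test_functions \<Omega>"
  shows "(\<lambda>x. \<phi> x - \<psi> x) \<in> test_functions \<Omega>"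
  using test_add[OF assms(1) test_cmult[OF assms(2), of "-1"]] by simp

lemma test_zero: "(\<lambda>x. 0) \<in> test_functions \<Omega>"
  by (rule test_functionsI[of _ "{}"]) (auto intro: Ck_const)

section \<open>Integration by parts on the whole space\<close>

lemma has_derivative_line:
  assumes "GDERIV f x :> D"
  shows "(\<lambda>n. real (Suc n) * (f (x + (1 / real (Suc n)) *\<^sub>R b) - f x)) \<longlonglongrightarrow> D \<bullet> b"
proof -
  have "((\<lambda>t. x + t *\<^sub>R b) has_derivative (\<lambda>t. t *\<^sub>R b)) (at 0)"
    by (auto intro!: derivative_eq_intros)
  moreover have "(f has_derivative (\<lambda>h. h \<bullet> D)) (at (x + 0 *\<^sub>R b))"
    using assms by (simp add: gderiv_def)
  ultimately have "((\<lambda>t. f (x + t *\<^sub>R b)) has_derivative (\<lambda>t. (t *\<^sub>R b) \<bullet> D)) (at 0)"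
    by (rule has_derivative_compose[of _ _ _ UNIV f, simplified])
  then have "DERIV (\<lambda>t. f (x + t *\<^sub>R b)) 0 :> D \<bullet> b"
    by (simp add: has_field_derivative_def inner_commute mult.commute[of _ "D \<bullet> b"] mult_commute_abs)
  then have "((\<lambda>h. (f (x + h *\<^sub>R b) - f x) / h) \<longlongrightarrow> D \<bullet> b) (at 0)"
    by (simp add: DERIV_def)
  moreover have "filterlim (\<lambda>n. 1 / real (Suc n)) (at 0) sequentially"
    using LIMSEQ_inverse_real_of_nat by (auto simp: filterlim_at inverse_eq_divide)
  ultimately have "(\<lambda>n. (f (x + (1 / real (Suc n)) *\<^sub>R b) - f x) / (1 / real (Suc n))) \<longlonglongrightarrow> D \<bullet> b"
    by (rule filterlim_compose)
  then show ?thesis by (simp add: mult.commute)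
qed

lemma lborel_integral_translation:
  fixes f :: "'a::euclidean_space \<Rightarrow> 'b::euclidean_space"
  assumes "f \<in> borel_measurable borel"
  shows "(LINT x|lborel. f (x + c)) = (LINT x|lborel. f x)"
proof -
  have "(LINT x|lborel. f x) = (LINT x|distr lborel borel ((+) c). f x)"
    by (subst lborel_distr_plus) simp
  also have "\<dots> = (LINT x|lborel. f (c + x))"
    by (rule integral_distr) (use assms in auto)
  finally show ?thesis by (simp add: add.commute)
qed

lemma nn_integral_lborel_translation:
  fixes f :: "'a::euclidean_space \<Rightarrow> ennreal"
  assumes "f \<in> borel_measurable borel"
  shows "(\<integral>\<^sup>+x. f (x + c) \<partial>lborel) = (\<integral>\<^sup>+x. f x \<partial>lborel)"
proof -
  have "(\<integral>\<^sup>+x. f x \<partial>lborel) = (\<integral>\<^sup>+x. f x \<partial>distr lborel borel ((+) c))"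
    by (subst lborel_distr_plus) simp
  also have "\<dots> = (\<integral>\<^sup>+x. f (c + x) \<partial>lborel)"
    by (rule nn_integral_distr) (use assms in auto)
  finally show ?thesis by (simp add: add.commute)
qed

lemma integrable_continuous_compact_support:
  fixes f :: "'a::euclidean_space \<Rightarrow> 'b::euclidean_space"
  assumes "continuous_on UNIV f" "compact K" "\<And>x. x \<notin> K \<Longrightarrow> f x = 0"
  shows "integrable lborel f"
proof -
  have "integrable lborel (\<lambda>x. indicator K x *\<^sub>R f x)"
    by (intro borel_integrable_compact assms continuous_on_subset[OF assms(1)]) auto
  moreover have "(\<lambda>x. indicator K x *\<^sub>R f x) = f"
    using assms(3) by (auto simp: indicator_def fun_eq_iff)
  ultimately show ?thesis by simp
qed

lemma GDERIV_lipschitz: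
  assumes "\<And>x. GDERIV f x :> D x" "\<And>x. norm (D x) \<le> M"
  shows "\<bar>f x - f y\<bar> \<le> M * norm (x - y)"
proof -
  have "norm (f x - f y) \<le> M * norm (x - y)"
  proof (rule differentiable_bound[of UNIV f "\<lambda>x h. h \<bullet> D x"])
    show "onorm (\<lambda>h. h \<bullet> D x) \<le> M" for x
    proof (rule onorm_bound)
      show "0 \<le> M" using assms(2)[of x] norm_ge_zero order_trans by blast
      show "norm (h \<bullet> D x) \<le> M * norm h" for h
        using Cauchy_Schwarz_ineq2[of h "D x"] mult_left_mono[OF assms(2)[of x], of "norm h"] 
        by (simp add: mult.commute)
    qed
  qed (use assms in \<open>auto simp: gderiv_def\<close>)
  then show ?thesis by simp
qed

text \<open>By translation invariance every difference quotient has integral zero, and dominated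
  convergence carries this over to the directional derivatives. No iterated integration over
  coordinates is involved.\<close>

lemma integral_gradient_zero:
  fixes f :: "'a::euclidean_space \<Rightarrow> real"
  assumes f: "\<And>x. GDERIV f x :> D x" and D: "continuous_on UNIV D"
    and K: "compact K" "\<And>x. x \<notin> K \<Longrightarrow> f x = 0"
  shows "integrable lborel D" "(LINT x|lborel. D x) = 0"
proof -
  have D0: "D x = 0" if "x \<notin> K" for x
  proof -
    have "((\<lambda>x. 0) has_derivative (\<lambda>h. h \<bullet> 0)) (at x)" by simp
    then have "(f has_derivative (\<lambda>h. h \<bullet> 0)) (at x)"
      by (rule has_derivative_transform_within_open[where s = "- K"]) 
         (use that K compact_imp_closed in auto)
    then have "grad f x = 0" by (intro grad_eqI) (simp add: gderiv_def)
    then show ?thesis using f grad_eqI by metis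
  qed
  show int: "integrable lborel D" by (rule integrable_continuous_compact_support[OF D K(1) D0])
  have fc: "continuous_on UNIV f"
    using GDERIV_imp_differentiable[OF f] by (simp add: continuous_at_imp_continuous_on differentiable_imp_continuous_within)
  then have fm: "f \<in> borel_measurable borel" by (rule borel_measurable_continuous_onI)
  have fi: "integrable lborel f" by (rule integrable_continuous_compact_support[OF fc K])
  obtain M where M: "M > 0" "\<And>x. norm (D x) \<le> M"
    using continuous_compact_support_bounded[OF D K(1) D0] by blast
  obtain R where R: "R > 0" "\<And>x. x \<in> K \<Longrightarrow> norm x \<le> R"
    using compact_imp_bounded[OF K(1)] bounded_pos by blast
  have "(LINT x|lborel. D x) \<bullet> b = 0" if b: "b \<in> Basis" for b
  proof -
    let ?q = "\<lambda>n x. real (Suc n) * (f (x + (1 / real (Suc n)) *\<^sub>R b) - f x)"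
    have q0: "(LINT x|lborel. ?q n x) = 0" for n
    proof -
      have i: "integrable lborel (\<lambda>x. f (x + c))" for c
      proof (rule integrable_continuous_compact_support[of _ "(\<lambda>x. x - c) ` K"])
        show "continuous_on UNIV (\<lambda>x. f (x + c))"
          by (rule continuous_on_compose2[OF fc]) (auto intro!: continuous_intros)
        show "compact ((\<lambda>x. x - c) ` K)"
          by (intro compact_continuous_image K) (auto intro!: continuous_intros)
        show "f (x + c) = 0" if "x \<notin> (\<lambda>x. x - c) ` K" for x
        proof (rule K(2), rule notI)
          assume "x + c \<in> K"
          then have "x + c - c \<in> (\<lambda>x. x - c) ` K" by blast
          then show False using that by simp
        qed
      qed
      show ?thesis using i[of "(1 / real (Suc n)) *\<^sub>R b"] fi
        by (simp add: lborel_integral_translation[OF fm])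
    qed
    \<comment> \<open>The steps have length at most 1, so all quotients vanish outside the ball of
      radius R + 1; inside it the Lipschitz constant M bounds them.\<close>
    have "(\<lambda>n. LINT x|lborel. ?q n x) \<longlonglongrightarrow> (LINT x|lborel. D x \<bullet> b)"
    proof (rule integral_dominated_convergence[where w = "\<lambda>x. indicator (cball 0 (R+1)) x * M"])
      show "(\<lambda>x. ?q n x) \<in> borel_measurable lborel" for n
        using fm by measurable
      show "(\<lambda>x. D x \<bullet> b) \<in> borel_measurable lborel"
        using borel_measurable_continuous_onI[OF D] by measurable
      show "integrable lborel (\<lambda>x. indicator (cball (0::'a) (R+1)) x * M)"
        using borel_integrable_compact[of "cball (0::'a) (R+1)" "\<lambda>_. M"] by simp
      show "AE x in lborel. (\<lambda>n. ?q n x) \<longlonglongrightarrow> D x \<bullet> b"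
        using has_derivative_line[OF f] by simp
      show "AE x in lborel. norm (?q n x) \<le> indicator (cball 0 (R+1)) x * M" for n
      proof (rule AE_I2)
        fix x
        let ?c = "(1 / real (Suc n)) *\<^sub>R b"
        have nc: "norm ?c = 1 / real (Suc n)" using b by simp
        show "norm (?q n x) \<le> indicator (cball 0 (R+1)) x * M"
        proof (cases "norm x \<le> R + 1")
          case True
          have "\<bar>f (x + ?c) - f x\<bar> \<le> M * norm (x + ?c - x)"
            by (rule GDERIV_lipschitz[OF f M(2)])
          also have "\<dots> = M * (1 / real (Suc n))" using nc by simp
          finally have "real (Suc n) * \<bar>f (x + ?c) - f x\<bar> \<le> M"
            by (simp add: field_simps)
          then show ?thesis using True by (simp add: abs_mult)
        next
          case False
          have "norm ?c \<le> 1" using nc by simp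
          moreover have "norm x \<le> norm (x + ?c) + norm ?c"
            using norm_triangle_ineq4[of "x + ?c" ?c] by (simp only: add_diff_cancel_right')
          ultimately have "norm (x + ?c) > R" using False by linarith
          then have "f (x + ?c) = 0" "f x = 0" using R(2) K(2) False by force+
          then show ?thesis using M(1) by simp
        qed
      qed
    qed
    then have "(\<lambda>n::nat. 0) \<longlonglongrightarrow> (LINT x|lborel. D x \<bullet> b)" unfolding q0 .
    then have "(LINT x|lborel. D x \<bullet> b) = 0" using LIMSEQ_unique tendsto_const by blast
    then show ?thesis using int by simp
  qed
  then show "(LINT x|lborel. D x) = 0" using euclidean_all_zero_iff[of "LINT x|lborel. D x"] by blast
qed

lemma integral_lebesgue_on_zero_outside:
  fixes f :: "'a::euclidean_space \<Rightarrow> 'b::euclidean_space"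
  assumes "f \<in> borel_measurable borel" "\<Omega> \<in> sets lebesgue" "\<And>x. x \<notin> \<Omega> \<Longrightarrow> f x = 0"
  shows "(LINT x|lebesgue_on \<Omega>. f x) = (LINT x|lborel. f x)"
proof -
  have "(LINT x|lebesgue_on \<Omega>. f x) = (LINT x|lebesgue. indicator \<Omega> x *\<^sub>R f x)"
    using assms(2) by (subst integral_restrict_space) auto
  also have "(\<lambda>x. indicator \<Omega> x *\<^sub>R f x) = f" using assms(3) by (auto simp: indicator_def)
  also have "(LINT x|lebesgue. f x) = (LINT x|lborel. f x)"
    using assms(1) by (intro integral_completion) simp
  finally show ?thesis by simp
qed

text \<open>The product of \<open>f\<close> and \<open>\<psi>\<close> inherits compact support from
  \<open>\<psi>\<close>, so \<open>integral_gradient_zero\<close> applies to it. This lets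
  \<open>f\<close> be a composition that does not vanish near the boundary, or a cutoff on the real
  line.\<close>

lemma integration_by_parts:
  fixes f :: "'a::euclidean_space \<Rightarrow> real"
  assumes f: "\<And>x. GDERIV f x :> D x" and D: "continuous_on UNIV D"
    and \<psi>: "\<psi> \<in> test_functions \<Omega>" and \<Omega>: "open \<Omega>"
  shows "(LINT x|lebesgue_on \<Omega>. f x *\<^sub>R grad \<psi> x) = - (LINT x|lebesgue_on \<Omega>. \<psi> x *\<^sub>R D x)"
proof -
  obtain K where K: "compact K" "K \<subseteq> \<Omega>" "\<And>x. x \<notin> K \<Longrightarrow> \<psi> x = 0" "\<And>x. x \<notin> K \<Longrightarrow> grad \<psi> x = 0"
    using test_functionsE[OF \<psi>] by blast
  have fc: "continuous_on UNIV f"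
    using GDERIV_imp_differentiable[OF f] by (simp add: continuous_at_imp_continuous_on differentiable_imp_continuous_within)
  have c: "continuous_on UNIV (\<lambda>x. f x *\<^sub>R grad \<psi> x)" "continuous_on UNIV (\<lambda>x. \<psi> x *\<^sub>R D x)"
    by (intro continuous_intros fc D test_continuous[OF \<psi>] test_grad_continuous[OF \<psi>])+
  have i: "integrable lborel (\<lambda>x. f x *\<^sub>R grad \<psi> x)" "integrable lborel (\<lambda>x. \<psi> x *\<^sub>R D x)"
    by (rule integrable_continuous_compact_support[OF c(1) K(1)], simp add: K)
       (rule integrable_continuous_compact_support[OF c(2) K(1)], simp add: K)
  have "(LINT x|lborel. f x *\<^sub>R grad \<psi> x + \<psi> x *\<^sub>R D x) = 0"
    by (rule integral_gradient_zero(2)[of "\<lambda>x. f x * \<psi> x" _ K])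
       (auto intro!: GDERIV_mult f test_GDERIV[OF \<psi>] continuous_intros c K(1) simp: K)
  then have "(LINT x|lborel. f x *\<^sub>R grad \<psi> x) = - (LINT x|lborel. \<psi> x *\<^sub>R D x)"
    using i by (simp add: eq_neg_iff_add_eq_0)
  moreover have "(LINT x|lebesgue_on \<Omega>. f x *\<^sub>R grad \<psi> x) = (LINT x|lborel. f x *\<^sub>R grad \<psi> x)"
    by (rule integral_lebesgue_on_zero_outside)
       (use c \<Omega> K in \<open>auto intro: borel_measurable_continuous_onI\<close>)
  moreover have "(LINT x|lebesgue_on \<Omega>. \<psi> x *\<^sub>R D x) = (LINT x|lborel. \<psi> x *\<^sub>R D x)"
    by (rule integral_lebesgue_on_zero_outside)
       (use c \<Omega> K in \<open>auto intro: borel_measurable_continuous_onI\<close>)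
  ultimately show ?thesis by simp
qed

text \<open>A finite sum of bumps over balls covering \<open>K\<close> is at least some c > 0 on
  \<open>K\<close> by compactness. Dividing by c and applying \<open>smooth_step\<close> flattens it
  to 1 on \<open>K\<close> and keeps 0 outside the balls.\<close>

lemma exists_cutoff:
  fixes K W :: "'a::euclidean_space set"
  assumes "compact K" "open W" "K \<subseteq> W"
  obtains \<eta> where "\<eta> \<in> test_functions W" "\<And>x. 0 \<le> \<eta> x" "\<And>x. \<eta> x \<le> 1" "\<And>x. x \<in> K \<Longrightarrow> \<eta> x = 1"
proof -
  \<comment> \<open>The squared norm is a polynomial in the coordinates, hence smooth also at the
    centre z.\<close>
  define b where "b z r y = expinv 0 (r\<^sup>2 - (norm (y - z))\<^sup>2)" for z y :: 'a and r
  have bpos: "b z r y > 0" if "norm (y - z) < r" for z y r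
    unfolding b_def using that by (intro expinv_pos) (simp add: power_strict_mono)
  have bge: "b z r y \<ge> 0" for z y r unfolding b_def by (rule expinv_nonneg)
  have b0: "b z r y = 0" if "norm (y - z) \<ge> r" "r > 0" for z y r
    unfolding b_def using that by (intro expinv_0) (simp add: power_mono)
  have bC: "Ck k (b z r)" for k z r
  proof -
    have "(norm (y - z))\<^sup>2 = (\<Sum>e\<in>Basis. (y \<bullet> e - z \<bullet> e)\<^sup>2)" for y
      by (subst power2_norm_eq_inner, subst euclidean_inner) (simp add: inner_diff_left power2_eq_square)
    then have "b z r = (\<lambda>y. expinv 0 (r\<^sup>2 - (\<Sum>e\<in>Basis. (y \<bullet> e - z \<bullet> e)\<^sup>2)))"
      by (simp add: b_def fun_eq_iff)
    then show ?thesis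
      by (simp only:) (intro Ck_compose[OF Ck_expinv] Ck_diff Ck_sum Ck_power Ck_const Ck_inner)
  qed
  have "\<exists>r>0. cball z r \<subseteq> W" if "z \<in> K" for z
    using assms that open_contains_cball by blast
  then obtain r where r: "\<And>z. z \<in> K \<Longrightarrow> r z > 0" "\<And>z. z \<in> K \<Longrightarrow> cball z (r z) \<subseteq> W" by metis
  have cov: "K \<subseteq> (\<Union>z\<in>K. ball z (r z))" using r(1) by force
  obtain I where I: "I \<subseteq> K" "finite I" "K \<subseteq> (\<Union>z\<in>I. ball z (r z))"
    by (rule compactE_image[OF assms(1) _ cov]) auto
  define \<beta> where "\<beta> y = (\<Sum>z\<in>I. b z (r z) y)" for y
  have \<beta>C: "Ck k \<beta>" for k unfolding \<beta>_def[abs_def] by (intro Ck_sum bC)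
  have \<beta>pos: "\<beta> y > 0" if "y \<in> K" for y
  proof -
    have "y \<in> (\<Union>z\<in>I. ball z (r z))" using I(3) that by (rule subsetD)
    then obtain z where "z \<in> I" "y \<in> ball z (r z)" by (rule UN_E)
    then show ?thesis unfolding \<beta>_def
      by (intro sum_pos2[OF I(2)] bpos bge) (auto simp: dist_norm norm_minus_commute)
  qed
  obtain c where c: "c > 0" "\<And>y. y \<in> K \<Longrightarrow> c \<le> \<beta> y"
  proof (cases "K = {}")
    case True then show ?thesis using that[of 1] by simp
  next
    case False
    have "continuous_on K \<beta>" using \<beta>C[of 0] continuous_on_subset by auto
    then obtain y0 where "y0 \<in> K" "\<And>y. y \<in> K \<Longrightarrow> \<beta> y0 \<le> \<beta> y"
      using continuous_attains_inf[OF assms(1) False] by blast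
    then show ?thesis using that[of "\<beta> y0"] \<beta>pos by blast
  qed
  let ?\<eta> = "\<lambda>y. smooth_step (\<beta> y * inverse c)"
  show ?thesis
  proof
    show "?\<eta> \<in> test_functions W"
    proof (rule test_functionsI)
      show "Ck k ?\<eta>" for k by (intro Ck_compose[OF Ck_smooth_step] Ck_mult \<beta>C Ck_const)
      show "compact (\<Union>z\<in>I. cball z (r z))" using I by auto
      show "(\<Union>z\<in>I. cball z (r z)) \<subseteq> W" using I(1) r(2) by blast
      show "?\<eta> x = 0" if "x \<notin> (\<Union>z\<in>I. cball z (r z))" for x
      proof -
        have "b z (r z) x = 0" if "z \<in> I" for z
          using that \<open>x \<notin> _\<close> r I by (intro b0) (auto simp: dist_norm norm_minus_commute intro: less_imp_le)
        then have "\<beta> x = 0" by (simp add: \<beta>_def)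
        then show ?thesis by (simp add: smooth_step_0)
      qed
    qed
    show "?\<eta> x = 1" if "x \<in> K" for x
      using c that by (intro smooth_step_1) (simp add: field_simps)
  qed (auto simp: smooth_step_ge_0 smooth_step_le_1)
qed

text \<open>Inner regularity: a compact subset of the set where g > 0 carries zero integral of a
  positive function, hence is null, and such subsets exhaust the set up to arbitrarily small
  measure.\<close>

lemma AE_not_pos_of_compact_integrals:
  fixes g :: "'a::euclidean_space \<Rightarrow> real"
  assumes g: "integrable lebesgue g" and K0: "compact K0" "\<And>x. x \<notin> K0 \<Longrightarrow> g x = 0"
    and 0: "\<And>K. compact K \<Longrightarrow> K \<subseteq> K0 \<Longrightarrow> (LINT x|lebesgue. indicator K x * g x) = 0"
  shows "AE x in lebesgue. \<not> g x > 0"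
proof -
  let ?A = "{x. g x > 0}"
  have A: "?A \<in> sets lebesgue"
    using borel_measurable_less[OF borel_measurable_const[of 0] borel_measurable_integrable[OF g]] by simp
  have "emeasure lebesgue ?A \<le> 0 + ennreal e" if e: "e > 0" for e
  proof -
    obtain T where T: "closed T" "T \<subseteq> ?A" "?A - T \<in> lmeasurable" "emeasure lebesgue (?A - T) < ennreal e"
      using sets_lebesgue_inner_closed[OF A e] by blast
    have TK: "T \<subseteq> K0" using T(2) K0(2) by force
    then have cT: "compact T" using T(1) K0(1) by (metis compact_Int_closed inf.absorb_iff2)
    have Ts: "T \<in> sets lebesgue" using T(1) by auto
    have "integrable lebesgue (\<lambda>x. indicator T x * g x)"
      using integrable_mult_indicator[OF Ts g] by simp
    then have "AE x in lebesgue. indicator T x * g x = 0"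
      using 0[OF cT TK] T(2)
      by (subst integral_nonneg_eq_0_iff_AE[symmetric]) (auto simp: indicator_def intro!: AE_I2 less_imp_le)
    then have "AE x in lebesgue. x \<notin> T"
      by eventually_elim (use T(2) in \<open>auto simp: indicator_def split: if_splits\<close>)
    then have "emeasure lebesgue T = 0"
      using Ts by (subst (asm) AE_iff_measurable[of T]) auto
    moreover have "emeasure lebesgue ?A \<le> emeasure lebesgue T + emeasure lebesgue (?A - T)"
      using emeasure_subadditive[OF Ts fmeasurableD[OF T(3)]] T(2)
      by (simp add: Un_absorb1)
    ultimately show ?thesis using T(4) by (simp add: less_imp_le order_trans)
  qed
  then have "emeasure lebesgue ?A \<le> 0" by (rule ennreal_le_epsilon)
  then show ?thesis using A by (subst AE_iff_measurable[of ?A]) auto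
qed

text \<open>Test functions decreasing to the indicator of a compact set show that every integral of
  \<open>v\<close> over a compact set is zero; the sign argument of
  \<open>AE_not_pos_of_compact_integrals\<close> then applies componentwise, and a compact
  exhaustion of the open set finishes.\<close>

lemma fundamental_lemma:
  fixes v :: "'a::euclidean_space \<Rightarrow> 'b::euclidean_space"
  assumes \<Omega>: "open \<Omega>" and v: "locally_integrable \<Omega> v"
    and 0: "\<And>\<psi>. \<psi> \<in> test_functions \<Omega> \<Longrightarrow> (LINT x|lebesgue_on \<Omega>. \<psi> x *\<^sub>R v x) = 0"
  shows "AE x in lebesgue_on \<Omega>. v x = 0"
proof -
  have \<Omega>s: "\<Omega> \<in> sets lebesgue" using \<Omega> by auto
  have int0: "(LINT x|lebesgue. indicator K x *\<^sub>R v x) = 0" if K: "compact K" "K \<subseteq> \<Omega>" for K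
  proof -
    obtain d where d: "d > 0" "(\<Union>x\<in>K. cball x d) \<subseteq> \<Omega>"
      using compact_subset_open_imp_cball_epsilon_subset[OF K(1) \<Omega> K(2)] by blast
    define L where "L = (\<Union>x\<in>K. cball x d)"
    have L: "compact L" "L \<subseteq> \<Omega>" unfolding L_def using compact_minkowski_sum_cball[OF K(1)] d by auto
    \<comment> \<open>Neighbourhoods shrinking to \<open>K\<close> inside the fixed compact set
      \<open>L\<close>. Cutoffs equal to 1 on \<open>K\<close> and supported in \<open>W n\<close>
      converge pointwise to the indicator of \<open>K\<close>, dominated by the norm of
      \<open>v\<close> on \<open>L\<close>.\<close>
    define W where "W n = (\<Union>x\<in>K. ball x (d / real (Suc n)))" for n
    have dn: "d / real (Suc n) \<le> d" for n using d(1) by (simp add: field_simps)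
    have WL: "W n \<subseteq> L" for n unfolding W_def L_def using dn[of n] by (force simp: mem_ball)
    have "\<exists>\<eta>. \<eta> \<in> test_functions (W n) \<and> (\<forall>x. 0 \<le> \<eta> x \<and> \<eta> x \<le> 1) \<and> (\<forall>x\<in>K. \<eta> x = 1)" for n
    proof -
      have "open (W n)" unfolding W_def by auto
      moreover have "K \<subseteq> W n" unfolding W_def using d(1) by force
      ultimately show ?thesis using exists_cutoff[OF K(1)] by metis
    qed
    then obtain \<eta> where \<eta>: "\<And>n. \<eta> n \<in> test_functions (W n)" "\<And>n x. 0 \<le> \<eta> n x" "\<And>n x. \<eta> n x \<le> 1"
      "\<And>n x. x \<in> K \<Longrightarrow> \<eta> n x = 1" by metis
    have \<eta>W: "\<eta> n x = 0" if "x \<notin> W n" for n x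
      using \<eta>(1)[of n] that closure_subset[of "{x. \<eta> n x \<noteq> 0}"]
      unfolding test_functions_def by (blast dest: subsetD)
    have \<eta>\<Omega>: "\<eta> n \<in> test_functions \<Omega>" for n
      using \<eta>(1)[of n] WL[of n] L unfolding test_functions_def by auto
    have vL: "integrable lebesgue (\<lambda>x. indicator L x *\<^sub>R v x)"
      using v L unfolding locally_integrable_def set_integrable_def by auto
    have \<eta>m: "\<eta> n \<in> borel_measurable lebesgue" for n
      using measurable_completion[of "\<eta> n" lborel borel] borel_measurable_continuous_onI[OF test_continuous[OF \<eta>(1)[of n]]]
      by simp
    have eq: "\<eta> n x *\<^sub>R v x = \<eta> n x *\<^sub>R (indicator L x *\<^sub>R v x)" for n x
      using \<eta>W[of x n] WL[of n] by (auto simp: indicator_def)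
    have "(LINT x|lebesgue. \<eta> n x *\<^sub>R v x) = 0" for n
    proof -
      have "(LINT x|lebesgue. \<eta> n x *\<^sub>R v x) = (LINT x|lebesgue. indicator \<Omega> x *\<^sub>R (\<eta> n x *\<^sub>R v x))"
        by (rule Bochner_Integration.integral_cong) (use \<eta>W[of _ n] WL[of n] L in \<open>auto simp: indicator_def\<close>)
      also have "\<dots> = (LINT x|lebesgue_on \<Omega>. \<eta> n x *\<^sub>R v x)"
        using \<Omega>s by (subst integral_restrict_space) auto
      finally show ?thesis using 0[OF \<eta>\<Omega>] by simp
    qed
    moreover have "(\<lambda>n. LINT x|lebesgue. \<eta> n x *\<^sub>R v x) \<longlonglongrightarrow> (LINT x|lebesgue. indicator K x *\<^sub>R v x)"
    proof (rule integral_dominated_convergence[where w = "\<lambda>x. norm (indicator L x *\<^sub>R v x)"])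
      show "(\<lambda>x. \<eta> n x *\<^sub>R v x) \<in> borel_measurable lebesgue" for n
        unfolding eq using \<eta>m vL by measurable
      show "(\<lambda>x. indicator K x *\<^sub>R v x) \<in> borel_measurable lebesgue"
        using v K unfolding locally_integrable_def set_integrable_def by auto
      show "integrable lebesgue (\<lambda>x. norm (indicator L x *\<^sub>R v x))" by (rule integrable_norm[OF vL])
      show "AE x in lebesgue. norm (\<eta> n x *\<^sub>R v x) \<le> norm (indicator L x *\<^sub>R v x)" for n
        unfolding eq[of n] norm_scaleR[of "\<eta> n _"] using \<eta>(2,3)
        by (intro AE_I2 mult_left_le_one_le) auto
      show "AE x in lebesgue. (\<lambda>n. \<eta> n x *\<^sub>R v x) \<longlonglongrightarrow> indicator K x *\<^sub>R v x"
      proof (rule AE_I2)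
        fix x
        show "(\<lambda>n. \<eta> n x *\<^sub>R v x) \<longlonglongrightarrow> indicator K x *\<^sub>R v x"
        proof (cases "x \<in> K")
          case True then show ?thesis using \<eta>(4) by simp
        next
          case False
          then obtain e where e: "e > 0" "\<And>y. y \<in> K \<Longrightarrow> dist x y \<ge> e"
            using separate_point_closed[OF compact_imp_closed[OF K(1)]] by metis
          obtain N where N: "d / e < real N" using reals_Archimedean2 by blast
          have "x \<notin> W n" if "n \<ge> N" for n
          proof
            assume "x \<in> W n"
            then obtain y where "y \<in> K" "dist x y < d / real (Suc n)" by (auto simp: W_def dist_commute)
            then have "dist x y * real (Suc n) < d" "e * real (Suc n) \<le> dist x y * real (Suc n)"
              using e(2)[of y] by (simp add: field_simps, intro mult_right_mono, auto)
            then have "e * real (Suc n) < d" by linarith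
            moreover have "d < e * real N" using N e(1) by (simp add: field_simps)
            moreover have "e * real N \<le> e * real (Suc n)" using that e(1) by simp
            ultimately show False by linarith
          qed
          then have "eventually (\<lambda>n. \<eta> n x *\<^sub>R v x = indicator K x *\<^sub>R v x) sequentially"
            using \<eta>W False by (auto simp: eventually_sequentially)
          then show ?thesis by (rule tendsto_eventually)
        qed
      qed
    qed
    ultimately have "(\<lambda>n::nat. 0) \<longlonglongrightarrow> (LINT x|lebesgue. indicator K x *\<^sub>R v x)" by simp
    then show ?thesis using LIMSEQ_unique tendsto_const by blast
  qed
  have K0: "AE x in lebesgue. x \<in> K \<longrightarrow> v x = 0" if K: "compact K" "K \<subseteq> \<Omega>" for K
  proof -
    have vK: "integrable lebesgue (\<lambda>x. indicator K x *\<^sub>R v x)"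
      using v K unfolding locally_integrable_def set_integrable_def by auto
    have pos: "AE x in lebesgue. \<not> (indicator K x *\<^sub>R v x) \<bullet> b > 0" for b
    proof (rule AE_not_pos_of_compact_integrals[OF _ K(1)])
      show "integrable lebesgue (\<lambda>x. (indicator K x *\<^sub>R v x) \<bullet> b)" by (rule integrable_inner_left) (rule vK)
      fix T assume T: "compact T" "T \<subseteq> K"
      have vT: "integrable lebesgue (\<lambda>x. indicator T x *\<^sub>R v x)"
        using v K T unfolding locally_integrable_def set_integrable_def by auto
      have "(LINT x|lebesgue. indicator T x * ((indicator K x *\<^sub>R v x) \<bullet> b)) 
          = (LINT x|lebesgue. (indicator T x *\<^sub>R v x) \<bullet> b)"
        by (rule Bochner_Integration.integral_cong) (use T in \<open>auto simp: indicator_def\<close>)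
      also have "\<dots> = (LINT x|lebesgue. indicator T x *\<^sub>R v x) \<bullet> b"
        by (rule integral_inner_left) (rule vT)
      also have "\<dots> = 0" using int0[of T] T K by simp
      finally show "(LINT x|lebesgue. indicator T x * ((indicator K x *\<^sub>R v x) \<bullet> b)) = 0" .
    qed auto
    \<comment> \<open>Testing with both b and -b excludes either sign of each component.\<close>
    have "AE x in lebesgue. \<forall>b\<in>Basis. \<not> (indicator K x *\<^sub>R v x) \<bullet> b > 0 \<and> \<not> (indicator K x *\<^sub>R v x) \<bullet> (- b) > 0"
      by (intro AE_finite_allI AE_conjI pos) auto
    then show ?thesis
    proof (rule eventually_mono)
      fix x assume h: "\<forall>b\<in>Basis. \<not> (indicator K x *\<^sub>R v x) \<bullet> b > 0 \<and> \<not> (indicator K x *\<^sub>R v x) \<bullet> (- b) > 0"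
      show "x \<in> K \<longrightarrow> v x = 0"
      proof
        assume "x \<in> K"
        then have "\<forall>b\<in>Basis. v x \<bullet> b = 0" using h by (simp add: not_less antisym)
        then show "v x = 0" using euclidean_all_zero_iff[of "v x"] by blast
      qed
    qed
  qed
  obtain C :: "nat \<Rightarrow> 'a set" where C: "\<And>n. compact (C n)" "\<And>n. C n \<subseteq> \<Omega>" "\<Union>(range C) = \<Omega>"
    using open_Union_compact_subsets[OF \<Omega>] by metis
  have "AE x in lebesgue. \<forall>n. x \<in> C n \<longrightarrow> v x = 0"
    unfolding AE_all_countable using K0 C by blast
  then have "AE x in lebesgue. x \<in> \<Omega> \<longrightarrow> v x = 0"
    by eventually_elim (use C(3) in blast)
  then show ?thesis using \<Omega>s by (simp add: AE_restrict_space_iff)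
qed

subsection \<open>Convergence in Lebesgue spaces and weak gradients\<close>

lemma norm_add_powr_le:
  fixes a b :: "'b::real_normed_vector"
  assumes "p \<ge> 0"
  shows "norm (a + b) powr p \<le> 2 powr p * (norm a powr p + norm b powr p)"
proof -
  have "norm (a + b) \<le> 2 * max (norm a) (norm b)"
    using norm_triangle_ineq[of a b] by linarith
  then have "norm (a + b) powr p \<le> (2 * max (norm a) (norm b)) powr p"
    using assms by (intro powr_mono2) auto
  also have "\<dots> = 2 powr p * max (norm a) (norm b) powr p" by (simp add: powr_mult)
  also have "\<dots> \<le> 2 powr p * (norm a powr p + norm b powr p)"
    by (intro mult_left_mono) (auto simp: max_def)
  finally show ?thesis .
qed

text \<open>A linearised form of the inequalities of Hoelder and Jensen: integrating it over a set
  of finite measure and then choosing e yields both, up to constants.\<close>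

lemma le_eps_powr:
  fixes t e p :: real
  assumes "e > 0" "t \<ge> 0" "p > 1"
  shows "t \<le> e + e powr (1 - p) * t powr p"
proof (cases "t \<le> e")
  case True then show ?thesis using assms by (simp add: add_increasing2)
next
  case False
  then have t: "t > 0" "e < t" using assms by auto
  have "t powr (1 - p) \<le> e powr (1 - p)" using t assms by (intro powr_mono2') auto
  then have "t powr (1 - p) * t powr p \<le> e powr (1 - p) * t powr p" by (intro mult_right_mono) auto
  moreover have "t powr (1 - p) * t powr p = t" using t by (simp add: powr_add[symmetric])
  ultimately show ?thesis using assms by simp
qed

lemma lebesgue_measurable_AE_cong:
  fixes f g :: "'a::euclidean_space \<Rightarrow> 'b::topological_space"
  assumes g: "g \<in> borel_measurable lebesgue" and ae: "AE x in lebesgue. g x = f x"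
  shows "f \<in> borel_measurable lebesgue"
proof (rule measurableI)
  fix S :: "'b set" assume S: "S \<in> sets borel"
  have "AE x in lebesgue. x \<in> g -` S \<longleftrightarrow> x \<in> f -` S"
    using ae by eventually_elim auto
  moreover have "g -` S \<in> sets lebesgue" using measurable_sets[OF g S] by simp
  ultimately have "f -` S \<in> sets lebesgue" by (rule completion.in_sets_AE) simp
  then show "f -` S \<inter> space lebesgue \<in> sets lebesgue" by simp
qed simp

lemma locally_integrable_test_mult:
  fixes v :: "'a::euclidean_space \<Rightarrow> 'b::euclidean_space"
  assumes \<Omega>: "open \<Omega>" and v: "locally_integrable \<Omega> v" and \<psi>: "\<psi> \<in> test_functions \<Omega>"
  shows "integrable (lebesgue_on \<Omega>) (\<lambda>x. \<psi> x *\<^sub>R v x)"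
proof -
  obtain K where K: "compact K" "K \<subseteq> \<Omega>" "\<And>x. x \<notin> K \<Longrightarrow> \<psi> x = 0" "\<And>x. x \<notin> K \<Longrightarrow> grad \<psi> x = 0"
    using test_functionsE[OF \<psi>] by blast
  obtain C where C: "C > 0" "\<And>x. \<bar>\<psi> x\<bar> \<le> C" "\<And>x. norm (grad \<psi> x) \<le> C" using test_bounded[OF \<psi>] by blast
  have i: "integrable lebesgue (\<lambda>x. indicator K x *\<^sub>R v x)"
    using v K unfolding locally_integrable_def set_integrable_def by blast
  have m: "\<psi> \<in> borel_measurable lebesgue"
    by (intro measurable_completion) (use borel_measurable_continuous_onI[OF test_continuous[OF \<psi>]] in simp)
  have "integrable lebesgue (\<lambda>x. \<psi> x *\<^sub>R (indicator K x *\<^sub>R v x))"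
  proof (rule Bochner_Integration.integrable_bound)
    show "integrable lebesgue (\<lambda>x. C * norm (indicator K x *\<^sub>R v x))"
      by (intro integrable_mult_right integrable_norm i)
    show "(\<lambda>x. \<psi> x *\<^sub>R (indicator K x *\<^sub>R v x)) \<in> borel_measurable lebesgue"
      by (intro borel_measurable_scaleR m borel_measurable_integrable i)
    show "AE x in lebesgue. norm (\<psi> x *\<^sub>R (indicator K x *\<^sub>R v x)) \<le> norm (C * norm (indicator K x *\<^sub>R v x))"
    proof (rule AE_I2)
      fix x
      have "\<bar>\<psi> x\<bar> * norm (indicator K x *\<^sub>R v x) \<le> C * norm (indicator K x *\<^sub>R v x)"
        using C(2)[of x] by (rule mult_right_mono) simp
      then show "norm (\<psi> x *\<^sub>R (indicator K x *\<^sub>R v x)) \<le> norm (C * norm (indicator K x *\<^sub>R v x))"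
        using C(1) by (simp only: norm_scaleR real_norm_def abs_mult abs_norm_cancel)
    qed
  qed
  moreover have "(\<lambda>x. \<psi> x *\<^sub>R (indicator K x *\<^sub>R v x)) = (\<lambda>x. indicator \<Omega> x *\<^sub>R (\<psi> x *\<^sub>R v x))"
  proof
    fix x show "\<psi> x *\<^sub>R (indicator K x *\<^sub>R v x) = indicator \<Omega> x *\<^sub>R (\<psi> x *\<^sub>R v x)"
      using K(2) K(3)[of x] by (cases "x \<in> K") auto
  qed
  ultimately show ?thesis using \<Omega> by (subst integrable_restrict_space) auto
qed

text \<open>Formulated for any open set because it serves twice: on the domain, and on the real
  line, where it identifies the weak derivative of a cutoff S.\<close>

lemma weak_gradient_unique_open:
  fixes \<Omega> :: "'a::euclidean_space set"
  assumes \<Omega>: "open \<Omega>" and w: "has_weak_gradient \<Omega> f G" "has_weak_gradient \<Omega> f H"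
  shows "AE x in lebesgue_on \<Omega>. G x = H x"
proof -
  have l: "locally_integrable \<Omega> G" "locally_integrable \<Omega> H" using w by (auto simp: has_weak_gradient_def)
  have "AE x in lebesgue_on \<Omega>. G x - H x = 0"
  proof (rule fundamental_lemma[OF \<Omega>])
    show "locally_integrable \<Omega> (\<lambda>x. G x - H x)"
      using l unfolding locally_integrable_def set_integrable_def by (auto simp: scaleR_diff_right)
    fix \<psi> assume \<psi>: "\<psi> \<in> test_functions \<Omega>"
    have "(LINT x|lebesgue_on \<Omega>. \<psi> x *\<^sub>R G x) = (LINT x|lebesgue_on \<Omega>. \<psi> x *\<^sub>R H x)"
      using w \<psi> unfolding has_weak_gradient_def by (metis neg_equal_iff_equal)
    then show "(LINT x|lebesgue_on \<Omega>. \<psi> x *\<^sub>R (G x - H x)) = 0"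
      using locally_integrable_test_mult[OF \<Omega> l(1) \<psi>] locally_integrable_test_mult[OF \<Omega> l(2) \<psi>]
      by (simp add: scaleR_diff_right)
  qed
  then show ?thesis by simp
qed

lemma weak_grad_eq_open:
  fixes \<Omega> :: "'a::euclidean_space set"
  shows "open \<Omega> \<Longrightarrow> has_weak_gradient \<Omega> f G \<Longrightarrow> AE x in lebesgue_on \<Omega>. weak_grad \<Omega> f x = G x"
  unfolding weak_grad_def by (rule weak_gradient_unique_open[OF _ someI[of "has_weak_gradient \<Omega> f"]])

section \<open>Spaces of p-integrable functions over a bounded open set\<close>

locale sobolev_domain =
  fixes \<Omega> :: "'a::euclidean_space set" and p :: real
  assumes open_dom: "open \<Omega>" and bounded_dom: "bounded \<Omega>" and p_gt_1: "1 < p"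
begin

abbreviation "M \<equiv> lebesgue_on \<Omega>"

lemma dom_sets: "\<Omega> \<in> sets lebesgue" using open_dom by auto

lemma finite_measure_dom: "finite_measure M"
proof
  have lm: "\<Omega> \<in> lmeasurable" using bounded_dom open_dom by (intro bounded_set_imp_lmeasurable) auto
  have "emeasure lebesgue \<Omega> \<noteq> \<infinity>" using fmeasurableD2[OF lm] unfolding infinity_ennreal_def .
  moreover have "emeasure M (space M) = emeasure lebesgue \<Omega>"
    using dom_sets by (subst emeasure_restrict_space) (auto simp: space_restrict_space)
  ultimately show "emeasure M (space M) \<noteq> \<infinity>" by (simp only: not_False_eq_True)
qed

lemma integrable_const_dom: "integrable M (\<lambda>x. c::'b::euclidean_space)"
  using finite_measure.integrable_const[OF finite_measure_dom] .

lemma measurable_dom_borel: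
  "f \<in> borel_measurable borel \<Longrightarrow> f \<in> borel_measurable M"
  by (intro measurable_restrict_space1 measurable_completion) simp

lemma LpD: 
  assumes "f \<in> Lp \<Omega> p"
  shows "f \<in> borel_measurable M" "integrable M (\<lambda>x. norm (f x) powr p)"
  using assms by (auto simp: Lp_def)

lemma LpI: "f \<in> borel_measurable M \<Longrightarrow> integrable M (\<lambda>x. norm (f x) powr p) \<Longrightarrow> f \<in> Lp \<Omega> p"
  by (auto simp: Lp_def)

lemma powr_measurable: "f \<in> borel_measurable M \<Longrightarrow> (\<lambda>x. norm (f x) powr p) \<in> borel_measurable M"
  by measurable

lemma Lp_dominated:
  assumes f: "f \<in> borel_measurable M" and w: "integrable M w" and le: "AE x in M. norm (f x) powr p \<le> w x"
  shows "f \<in> Lp \<Omega> p"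
proof (rule LpI[OF f])
  show "integrable M (\<lambda>x. norm (f x) powr p)"
    by (rule Bochner_Integration.integrable_bound[OF w powr_measurable[OF f]])
       (use le in \<open>eventually_elim, auto\<close>)
qed

lemma Lp_dominated_norm:
  assumes f: "f \<in> borel_measurable M" and w: "w \<in> Lp \<Omega> p" and le: "AE x in M. norm (f x) \<le> C * norm (w x)" 
  shows "f \<in> Lp \<Omega> p"
proof (rule Lp_dominated[OF f])
  show "integrable M (\<lambda>x. \<bar>C\<bar> powr p * norm (w x) powr p)" using LpD(2)[OF w] by simp
  show "AE x in M. norm (f x) powr p \<le> \<bar>C\<bar> powr p * norm (w x) powr p"
    using le
  proof eventually_elim
    case (elim x)
    have "C * norm (w x) \<le> \<bar>C\<bar> * norm (w x)" by (intro mult_right_mono) auto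
    then have "norm (f x) powr p \<le> (\<bar>C\<bar> * norm (w x)) powr p"
      using elim p_gt_1 by (intro powr_mono2) auto
    then show ?case by (simp add: powr_mult)
  qed
qed

lemma Lp_add: 
  assumes "f \<in> Lp \<Omega> p" "g \<in> Lp \<Omega> p" shows "(\<lambda>x. f x + g x) \<in> Lp \<Omega> p"
proof (rule Lp_dominated)
  show "(\<lambda>x. f x + g x) \<in> borel_measurable M" using LpD(1)[OF assms(1)] LpD(1)[OF assms(2)] by measurable
  show "integrable M (\<lambda>x. 2 powr p * (norm (f x) powr p + norm (g x) powr p))"
    using LpD(2)[OF assms(1)] LpD(2)[OF assms(2)] by simp
  show "AE x in M. norm (f x + g x) powr p \<le> 2 powr p * (norm (f x) powr p + norm (g x) powr p)"
    using p_gt_1 by (intro AE_I2 norm_add_powr_le) auto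
qed

lemma Lp_scaleR: 
  assumes "f \<in> Lp \<Omega> p" shows "(\<lambda>x. c *\<^sub>R f x) \<in> Lp \<Omega> p"
proof (rule Lp_dominated_norm[OF _ assms, of _ "\<bar>c\<bar>"])
  show "(\<lambda>x. c *\<^sub>R f x) \<in> borel_measurable M" using LpD(1)[OF assms] by measurable
qed simp

lemma Lp_diff: 
  assumes "f \<in> Lp \<Omega> p" "g \<in> Lp \<Omega> p" shows "(\<lambda>x. f x - g x) \<in> Lp \<Omega> p"
  using Lp_add[OF assms(1) Lp_scaleR[OF assms(2), of "-1"]] by simp

lemma Lp_bounded:
  assumes "f \<in> borel_measurable M" "AE x in M. norm (f x) \<le> C" shows "f \<in> Lp \<Omega> p"
proof (rule Lp_dominated[OF assms(1) integrable_const_dom[of "C powr p"]])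
  show "AE x in M. norm (f x) powr p \<le> C powr p"
    using assms(2) by eventually_elim (use p_gt_1 in \<open>auto intro: powr_mono2\<close>)
qed

lemma Lp_bounded_mult:
  assumes f: "f \<in> Lp \<Omega> p" and c: "c \<in> borel_measurable M" "AE x in M. \<bar>c x\<bar> \<le> C"
  shows "(\<lambda>x. c x *\<^sub>R f x) \<in> Lp \<Omega> p"
proof (rule Lp_dominated_norm[OF _ f, of _ C])
  show "(\<lambda>x. c x *\<^sub>R f x) \<in> borel_measurable M" using LpD(1)[OF f] c by measurable
  show "AE x in M. norm (c x *\<^sub>R f x) \<le> C * norm (f x)"
    using c(2) by eventually_elim (auto intro: mult_right_mono)
qed

lemma Lp_integrable: assumes "f \<in> Lp \<Omega> p" shows "integrable M f"
proof (rule Bochner_Integration.integrable_bound)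
  show "integrable M (\<lambda>x. 1 + norm (f x) powr p)"
    using LpD(2)[OF assms] integrable_const_dom[of "1::real"] by simp
  show "f \<in> borel_measurable M" using LpD(1)[OF assms] .
  show "AE x in M. norm (f x) \<le> norm (1 + norm (f x) powr p)"
    using le_eps_powr[of 1 "norm (f _)" p] p_gt_1 by (intro AE_I2) simp
qed

lemma integrable_imp_locally_integrable:
  assumes "integrable M f" shows "locally_integrable \<Omega> f"
  unfolding locally_integrable_def set_integrable_def
proof (intro allI impI, elim conjE)
  fix K assume K: "compact K" "K \<subseteq> \<Omega>"
  have i: "integrable lebesgue (\<lambda>x. indicator \<Omega> x *\<^sub>R f x)"
    using assms dom_sets by (subst (asm) integrable_restrict_space) auto
  have "closed K" using K(1) by (rule compact_imp_closed)
  then have Ks: "K \<in> sets lebesgue" by auto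
  have "integrable lebesgue (\<lambda>x. indicator K x *\<^sub>R (indicator \<Omega> x *\<^sub>R f x))"
    by (rule integrable_mult_indicator[OF Ks i])
  also have "(\<lambda>x. indicator K x *\<^sub>R (indicator \<Omega> x *\<^sub>R f x)) = (\<lambda>x. indicator K x *\<^sub>R f x)"
  proof
    fix x show "indicator K x *\<^sub>R (indicator \<Omega> x *\<^sub>R f x) = indicator K x *\<^sub>R f x"
      using K(2) by (cases "x \<in> K") auto
  qed
  finally show "integrable lebesgue (\<lambda>x. indicator K x *\<^sub>R f x)" .
qed

lemmas Lp_locally_integrable = integrable_imp_locally_integrable[OF Lp_integrable]

lemma test_in_Lp:
  assumes "\<phi> \<in> test_functions \<Omega>"
  shows "\<phi> \<in> Lp \<Omega> p" "grad \<phi> \<in> Lp \<Omega> p" "\<phi> \<in> borel_measurable M" "grad \<phi> \<in> borel_measurable M"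
proof -
  obtain C where C: "C > 0" "\<And>x. \<bar>\<phi> x\<bar> \<le> C" "\<And>x. norm (grad \<phi> x) \<le> C" using test_bounded[OF assms] by blast
  show m: "\<phi> \<in> borel_measurable M" "grad \<phi> \<in> borel_measurable M"
    by (intro measurable_dom_borel borel_measurable_continuous_onI test_continuous[OF assms] test_grad_continuous[OF assms])+
  show "\<phi> \<in> Lp \<Omega> p" "grad \<phi> \<in> Lp \<Omega> p"
    using C by (auto intro!: Lp_bounded[OF m(1), of C] Lp_bounded[OF m(2), of C])
qed

text \<open>Convergence in \<open>L\<^sup>p\<close>; meaningful only when all functions involved lie in \<^const>\<open>Lp\<close>.\<close>

definition Lp_tendsto :: "(nat \<Rightarrow> 'a \<Rightarrow> 'b::euclidean_space) \<Rightarrow> ('a \<Rightarrow> 'b) \<Rightarrow> bool" where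
  "Lp_tendsto f g \<longleftrightarrow> (\<lambda>n. LINT x|M. norm (f n x - g x) powr p) \<longlonglongrightarrow> 0"

lemma Lp_tendsto_subseq: "Lp_tendsto f g \<Longrightarrow> strict_mono r \<Longrightarrow> Lp_tendsto (\<lambda>n. f (r n)) g"
  unfolding Lp_tendsto_def using LIMSEQ_subseq_LIMSEQ[of _ 0 r] by (auto simp: o_def)

lemma Lp_tendsto_AE_subseq:
  assumes "Lp_tendsto f g" "\<And>n. f n \<in> Lp \<Omega> p" "g \<in> Lp \<Omega> p"
  obtains r where "strict_mono r" "AE x in M. (\<lambda>n. f (r n) x) \<longlonglongrightarrow> g x"
proof -
  have i: "integrable M (\<lambda>x. norm (f n x - g x) powr p)" for n
    by (rule LpD(2)[OF Lp_diff[OF assms(2,3)]])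
  have "(\<lambda>n. LINT x|M. norm (norm (f n x - g x) powr p)) \<longlonglongrightarrow> 0" using assms(1) by (simp add: Lp_tendsto_def)
  then obtain r where r: "strict_mono r" "AE x in M. (\<lambda>n. norm (f (r n) x - g x) powr p) \<longlonglongrightarrow> 0"
    using tendsto_L1_AE_subseq[of M "\<lambda>n x. norm (f n x - g x) powr p", OF i] by blast
  have "AE x in M. (\<lambda>n. f (r n) x) \<longlonglongrightarrow> g x"
    using r(2)
  proof eventually_elim
    case (elim x)
    have "(\<lambda>n. (norm (f (r n) x - g x) powr p) powr (1/p)) \<longlonglongrightarrow> 0"
      using tendsto_powr'[OF elim tendsto_const[of "1/p"]] p_gt_1 by simp
    then have "(\<lambda>n. norm (f (r n) x - g x)) \<longlonglongrightarrow> 0" using p_gt_1 by (simp add: powr_powr)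
    then show ?case using LIM_zero_iff tendsto_norm_zero_iff by blast
  qed
  then show ?thesis by (rule that[OF r(1)])
qed

lemma Lp_tendsto_dominated:
  assumes f: "\<And>n. f n \<in> borel_measurable M" and g: "g \<in> borel_measurable M" and w: "integrable M w"
    and le: "\<And>n. AE x in M. norm (f n x - g x) powr p \<le> w x"
    and lim: "AE x in M. (\<lambda>n. f n x) \<longlonglongrightarrow> g x"
  shows "Lp_tendsto f g"
proof -
  have "(\<lambda>n. LINT x|M. norm (f n x - g x) powr p) \<longlonglongrightarrow> (LINT x|M. 0)"
  proof (rule integral_dominated_convergence[OF _ _ w])
    show "(\<lambda>x. norm (f n x - g x) powr p) \<in> borel_measurable M" for n using f[of n] g by measurable
    show "AE x in M. (\<lambda>n. norm (f n x - g x) powr p) \<longlonglongrightarrow> 0" 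
      using lim
    proof eventually_elim
      case (elim x)
      have "(\<lambda>n. norm (f n x - g x)) \<longlonglongrightarrow> 0" by (rule tendsto_norm_zero[OF LIM_zero[OF elim]])
      then show ?case using tendsto_powr'[of "\<lambda>n. norm (f n x - g x)" 0 sequentially "\<lambda>_. p" p] p_gt_1 by simp
    qed
    show "AE x in M. norm (norm (f n x - g x) powr p) \<le> w x" for n using le[of n] by simp
  qed simp
  then show ?thesis by (simp add: Lp_tendsto_def)
qed

text \<open>The common shape of the limit passages below: a pointwise estimate of the difference by
  two known differences. It takes the place of Minkowski's inequality.\<close>

lemma Lp_tendsto_sum_bound:
  assumes h: "\<And>n. h n \<in> borel_measurable M" "k \<in> borel_measurable M"
    and f: "\<And>n. f n \<in> Lp \<Omega> p" "f' \<in> Lp \<Omega> p" "Lp_tendsto f f'"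
    and g: "\<And>n. g n \<in> Lp \<Omega> p" "g' \<in> Lp \<Omega> p" "Lp_tendsto g g'"
    and le: "\<And>n. AE x in M. norm (h n x - k x) \<le> C * (norm (f n x - f' x) + norm (g n x - g' x))"
  shows "Lp_tendsto h k"
proof -
  let ?B = "\<lambda>n x. \<bar>C\<bar> powr p * (2 powr p * (norm (f n x - f' x) powr p + norm (g n x - g' x) powr p))"
  have i: "integrable M (\<lambda>x. norm (f n x - f' x) powr p)" "integrable M (\<lambda>x. norm (g n x - g' x) powr p)" for n
    using LpD(2)[OF Lp_diff[OF f(1,2)]] LpD(2)[OF Lp_diff[OF g(1,2)]] by auto
  have Bi: "integrable M (?B n)" for n using i by simp
  have le': "AE x in M. norm (h n x - k x) powr p \<le> ?B n x" for n
    using le[of n]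
  proof eventually_elim
    case (elim x)
    let ?s = "norm (f n x - f' x) + norm (g n x - g' x)"
    have "C * ?s \<le> \<bar>C\<bar> * ?s" by (intro mult_right_mono) auto
    then have "norm (h n x - k x) powr p \<le> (\<bar>C\<bar> * ?s) powr p"
      using elim p_gt_1 by (intro powr_mono2) auto
    also have "\<dots> = \<bar>C\<bar> powr p * ?s powr p" by (simp add: powr_mult)
    also have "\<dots> \<le> ?B n x"
      using norm_add_powr_le[of p "norm (f n x - f' x)" "norm (g n x - g' x)"] p_gt_1
      by (intro mult_left_mono) auto
    finally show ?case .
  qed
  have "(LINT x|M. norm (h n x - k x) powr p) \<le> (LINT x|M. ?B n x)" for n
  proof (rule integral_mono_AE)
    have "(\<lambda>x. h n x - k x) \<in> borel_measurable M" using h(1)[of n] h(2) by measurable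
    then have "(\<lambda>x. h n x - k x) \<in> Lp \<Omega> p" by (rule Lp_dominated[OF _ Bi le'])
    then show "integrable M (\<lambda>x. norm (h n x - k x) powr p)" by (rule LpD(2))
  qed (fact Bi, fact le')
  then have 1: "\<forall>\<^sub>F n in sequentially. (LINT x|M. norm (h n x - k x) powr p) \<le> (LINT x|M. ?B n x)"
    by (intro always_eventually allI)
  have "(\<lambda>n. \<bar>C\<bar> powr p * (2 powr p * ((LINT x|M. norm (f n x - f' x) powr p) + (LINT x|M. norm (g n x - g' x) powr p))))
     \<longlonglongrightarrow> \<bar>C\<bar> powr p * (2 powr p * (0 + 0))"
    using f(3) g(3) unfolding Lp_tendsto_def by (intro tendsto_intros)
  then have 2: "(\<lambda>n. LINT x|M. ?B n x) \<longlonglongrightarrow> 0" using i by simp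
  have "\<forall>\<^sub>F n in sequentially. 0 \<le> (LINT x|M. norm (h n x - k x) powr p)" by simp
  from tendsto_sandwich[OF this 1 tendsto_const 2] show ?thesis unfolding Lp_tendsto_def .
qed

text \<open>Integrate \<open>le_eps_powr\<close> over the domain, which has finite measure: the
  constant term takes one half of the tolerance, the convergent p-th power term the other.\<close>

lemma Lp_tendsto_L1:
  assumes "Lp_tendsto f g" "\<And>n. f n \<in> Lp \<Omega> p" "g \<in> Lp \<Omega> p"
  shows "(\<lambda>n. LINT x|M. norm (f n x - g x)) \<longlonglongrightarrow> 0"
proof (rule LIMSEQ_I)
  fix r :: real assume r: "r > 0"
  define m where "m = measure M (space M)"
  have m: "m \<ge> 0" by (simp add: m_def)
  \<comment> \<open>The denominator contains m + 1 instead of m so that an empty domain, of measure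
    0, is covered.\<close>
  define e where "e = r / (2 * (m + 1))"
  have e: "e > 0" "e * m < r / 2"
    using r m by (auto simp: e_def field_simps)
  have "\<forall>\<^sub>F n in sequentially. (LINT x|M. norm (f n x - g x) powr p) < r / 2 / e powr (1 - p)"
    using assms(1) r e unfolding Lp_tendsto_def by (intro order_tendstoD(2)) auto
  then obtain N where N: "\<And>n. n \<ge> N \<Longrightarrow> (LINT x|M. norm (f n x - g x) powr p) < r / 2 / e powr (1 - p)"
    unfolding eventually_sequentially by blast
  show "\<exists>no. \<forall>n\<ge>no. norm ((LINT x|M. norm (f n x - g x)) - 0) < r"
  proof (intro exI allI impI)
    fix n assume n: "n \<ge> N"
    have d: "(\<lambda>x. f n x - g x) \<in> Lp \<Omega> p" by (rule Lp_diff[OF assms(2,3)])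
    have "(LINT x|M. norm (f n x - g x)) \<le> (LINT x|M. e + e powr (1 - p) * norm (f n x - g x) powr p)"
      using integrable_norm[OF Lp_integrable[OF d]] LpD(2)[OF d] integrable_const_dom[of e] e p_gt_1
      by (intro integral_mono) (auto intro: le_eps_powr)
    also have "\<dots> = e * m + e powr (1 - p) * (LINT x|M. norm (f n x - g x) powr p)"
      using LpD(2)[OF d] integrable_const_dom[of e] by (simp add: m_def)
    also have "\<dots> < r / 2 + r / 2"
      using N[OF n] e by (intro add_strict_mono) (auto simp: field_simps)
    finally show "norm ((LINT x|M. norm (f n x - g x)) - 0) < r" by simp
  qed
qed

lemma L1_pairing_tendsto:
  fixes f :: "nat \<Rightarrow> 'a \<Rightarrow> 'b::euclidean_space" and c :: "'a \<Rightarrow> real"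
  assumes lim: "(\<lambda>n. LINT x|M. norm (f n x - g x)) \<longlonglongrightarrow> 0"
    and f: "\<And>n. integrable M (f n)" "integrable M g"
    and c: "c \<in> borel_measurable M" "\<And>x. \<bar>c x\<bar> \<le> C"
  shows "(\<lambda>n. LINT x|M. c x *\<^sub>R f n x) \<longlonglongrightarrow> (LINT x|M. c x *\<^sub>R g x)"
proof -
  have i: "integrable M (\<lambda>x. c x *\<^sub>R k x)" if "integrable M k" for k :: "'a \<Rightarrow> 'b"
  proof (rule Bochner_Integration.integrable_bound)
    show "integrable M (\<lambda>x. C * norm (k x))" using that by simp
    show "(\<lambda>x. c x *\<^sub>R k x) \<in> borel_measurable M" using c that by measurable
    show "AE x in M. norm (c x *\<^sub>R k x) \<le> norm (C * norm (k x))"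
    proof (rule AE_I2)
      fix x show "norm (c x *\<^sub>R k x) \<le> norm (C * norm (k x))"
        using mult_right_mono[OF order_trans[OF c(2)[of x] abs_ge_self[of C]], of "norm (k x)"] by (simp add: abs_mult)
    qed
  qed
  have "norm ((LINT x|M. c x *\<^sub>R f n x) - (LINT x|M. c x *\<^sub>R g x)) \<le> C * (LINT x|M. norm (f n x - g x))" for n
  proof -
    have "(LINT x|M. c x *\<^sub>R f n x) - (LINT x|M. c x *\<^sub>R g x) = (LINT x|M. c x *\<^sub>R (f n x - g x))"
      using i[OF f(1)] i[OF f(2)] by (simp add: scaleR_diff_right)
    also have "norm \<dots> \<le> (LINT x|M. norm (c x *\<^sub>R (f n x - g x)))" by (rule integral_norm_bound)
    also have "\<dots> \<le> (LINT x|M. C * norm (f n x - g x))"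
      using i[of "\<lambda>x. f n x - g x"] f c(2) by (intro integral_mono integrable_norm) (auto intro: mult_right_mono)
    finally show ?thesis by simp
  qed
  then have "\<forall>\<^sub>F n in sequentially. norm ((LINT x|M. c x *\<^sub>R f n x) - (LINT x|M. c x *\<^sub>R g x)) \<le> C * (LINT x|M. norm (f n x - g x))"
    by simp
  moreover have "(\<lambda>n. C * (LINT x|M. norm (f n x - g x))) \<longlonglongrightarrow> 0"
    using tendsto_mult_left[OF lim, of C] by simp
  ultimately have "(\<lambda>n. (LINT x|M. c x *\<^sub>R f n x) - (LINT x|M. c x *\<^sub>R g x)) \<longlonglongrightarrow> 0"
    by (rule Lim_null_comparison)
  then show ?thesis by (simp add: LIM_zero_iff)
qed

lemmas weak_grad_eq = weak_grad_eq_open[OF open_dom]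

lemma measurable_AE_cong:
  fixes f g :: "'a \<Rightarrow> 'b::euclidean_space"
  assumes "g \<in> borel_measurable M" "AE x in M. f x = g x"
  shows "f \<in> borel_measurable M"
proof -
  have "AE x in lebesgue. indicator \<Omega> x *\<^sub>R g x = indicator \<Omega> x *\<^sub>R f x"
  proof -
    have "AE x in lebesgue. x \<in> \<Omega> \<longrightarrow> f x = g x"
      using assms(2) dom_sets by (simp add: AE_restrict_space_iff)
    then show ?thesis by eventually_elim auto
  qed
  moreover have "(\<lambda>x. indicator \<Omega> x *\<^sub>R g x) \<in> borel_measurable lebesgue"
    using assms(1) dom_sets by (simp add: borel_measurable_restrict_space_iff)
  ultimately have "(\<lambda>x. indicator \<Omega> x *\<^sub>R f x) \<in> borel_measurable lebesgue"
    by (rule lebesgue_measurable_AE_cong[rotated])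
  then show ?thesis using dom_sets by (simp add: borel_measurable_restrict_space_iff)
qed

end

subsection \<open>The Sobolev space of functions vanishing on the boundary\<close>

lemma norm_triangle3: 
  fixes a b c :: "'b::real_normed_vector"
  shows "norm (a - c) \<le> 1 * (norm (a - b - 0) + norm (b - c))"
  using norm_triangle_ineq[of "a - b" "b - c"] by simp

context sobolev_domain begin

text \<open>The gradient is carried as an explicit second argument, so that limits and chain rules
  can be formulated without reference to the choice \<open>weak_grad\<close>. Up to null sets this
  is the same as membership in \<open>W1p_zero\<close> with \<open>G\<close> the weak gradient; see
  \<open>W0_grad_weak_grad\<close>, \<open>W0_grad_W1p_zero\<close> and
  \<open>W1p_zero_W0_grad\<close>.\<close>

definition W0_grad :: "('a \<Rightarrow> real) \<Rightarrow> ('a \<Rightarrow> 'a) \<Rightarrow> bool" where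
  "W0_grad f G \<longleftrightarrow> f \<in> Lp \<Omega> p \<and> G \<in> Lp \<Omega> p \<and>
     (\<exists>\<phi>. (\<forall>n. \<phi> n \<in> test_functions \<Omega>) \<and> Lp_tendsto \<phi> f \<and> Lp_tendsto (\<lambda>n. grad (\<phi> n)) G)"

lemma H0D: assumes "W0_grad f G" shows "f \<in> Lp \<Omega> p" "G \<in> Lp \<Omega> p" "f \<in> borel_measurable M" "G \<in> borel_measurable M"
  using assms LpD(1) by (auto simp: W0_grad_def)

lemma H0E:
  assumes "W0_grad f G"
  obtains \<phi> where "\<And>n. \<phi> n \<in> test_functions \<Omega>" "Lp_tendsto \<phi> f" "Lp_tendsto (\<lambda>n. grad (\<phi> n)) G" "AE x in M. (\<lambda>n. \<phi> n x) \<longlonglongrightarrow> f x"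
proof -
  obtain \<phi> where \<phi>: "\<And>n. \<phi> n \<in> test_functions \<Omega>" "Lp_tendsto \<phi> f" "Lp_tendsto (\<lambda>n. grad (\<phi> n)) G"
    using assms by (auto simp: W0_grad_def)
  obtain r where r: "strict_mono r" "AE x in M. (\<lambda>n. \<phi> (r n) x) \<longlonglongrightarrow> f x"
    by (rule Lp_tendsto_AE_subseq[OF \<phi>(2) test_in_Lp(1)[OF \<phi>(1)] H0D(1)[OF assms]])
  show ?thesis
    by (rule that[of "\<lambda>n. \<phi> (r n)"]) (use \<phi>(1) r(2) Lp_tendsto_subseq[OF \<phi>(2) r(1)] Lp_tendsto_subseq[OF \<phi>(3) r(1)] in auto)
qed

lemma W0_grad_test: assumes "\<phi> \<in> test_functions \<Omega>" shows "W0_grad \<phi> (grad \<phi>)"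
  unfolding W0_grad_def Lp_tendsto_def using test_in_Lp[OF assms] assms by (auto intro!: exI[of _ "\<lambda>n. \<phi>"])

lemma Lp_tendsto_cong_AE:
  assumes "AE x in M. f x = g x" "\<And>n. h n \<in> borel_measurable M" "f \<in> borel_measurable M" "g \<in> borel_measurable M"
  shows "Lp_tendsto h f \<longleftrightarrow> Lp_tendsto h g"
proof -
  have "(LINT x|M. norm (h n x - f x) powr p) = (LINT x|M. norm (h n x - g x) powr p)" for n
  proof (rule integral_cong_AE)
    show "(\<lambda>x. norm (h n x - f x) powr p) \<in> borel_measurable M"
      "(\<lambda>x. norm (h n x - g x) powr p) \<in> borel_measurable M"
      using assms(2)[of n] assms(3,4) by measurable
    show "AE x in M. norm (h n x - f x) powr p = norm (h n x - g x) powr p"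
      using assms(1) by eventually_elim simp
  qed
  then show ?thesis by (simp add: Lp_tendsto_def)
qed

lemma Lp_cong_AE:
  assumes "f \<in> Lp \<Omega> p" "AE x in M. g x = f x" shows "g \<in> Lp \<Omega> p"
  by (rule Lp_dominated_norm[OF measurable_AE_cong[OF LpD(1)[OF assms(1)] assms(2)] assms(1), of 1])
     (use assms(2) in \<open>eventually_elim, auto\<close>)

lemma W0_grad_cong_AE:
  assumes "W0_grad f G" "AE x in M. f' x = f x" "AE x in M. G' x = G x"
  shows "W0_grad f' G'"
proof -
  obtain \<phi> where \<phi>: "\<And>n. \<phi> n \<in> test_functions \<Omega>" "Lp_tendsto \<phi> f" "Lp_tendsto (\<lambda>n. grad (\<phi> n)) G"
    using assms by (auto simp: W0_grad_def)
  note fL = Lp_cong_AE[OF H0D(1)[OF assms(1)] assms(2)] and GL = Lp_cong_AE[OF H0D(2)[OF assms(1)] assms(3)]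
  have "Lp_tendsto \<phi> f'"
    using Lp_tendsto_cong_AE[OF assms(2) test_in_Lp(3)[OF \<phi>(1)] LpD(1)[OF fL] H0D(3)[OF assms(1)]] \<phi>(2) by simp
  moreover have "Lp_tendsto (\<lambda>n. grad (\<phi> n)) G'"
    using Lp_tendsto_cong_AE[OF assms(3) test_in_Lp(4)[OF \<phi>(1)] LpD(1)[OF GL] H0D(4)[OF assms(1)]] \<phi>(3) by simp
  ultimately show ?thesis using \<phi>(1) fL GL unfolding W0_grad_def by blast
qed

lemma test_grad_bounded_borel:
  assumes "\<psi> \<in> test_functions \<Omega>"
  obtains C where "C > 0" "\<And>x. \<bar>\<psi> x\<bar> \<le> C" "\<And>x. norm (grad \<psi> x) \<le> C"
    "\<psi> \<in> borel_measurable M" "grad \<psi> \<in> borel_measurable M"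
proof -
  obtain C where C: "C > 0" "\<And>x. \<bar>\<psi> x\<bar> \<le> C" "\<And>x. norm (grad \<psi> x) \<le> C"
    using test_bounded[OF assms] by blast
  show ?thesis by (rule that[OF C test_in_Lp(3,4)[OF assms]])
qed

lemma scalar_pairing_tendsto:
  fixes f :: "nat \<Rightarrow> 'a \<Rightarrow> real" and c :: "'a \<Rightarrow> 'b::euclidean_space"
  assumes lim: "(\<lambda>n. LINT x|M. norm (f n x - g x)) \<longlonglongrightarrow> 0"
    and f: "\<And>n. integrable M (f n)" "integrable M g"
    and c: "c \<in> borel_measurable M" "\<And>x. norm (c x) \<le> C"
  shows "(\<lambda>n. LINT x|M. f n x *\<^sub>R c x) \<longlonglongrightarrow> (LINT x|M. g x *\<^sub>R c x)"
proof -
  have i: "integrable M (\<lambda>x. k x *\<^sub>R c x)" if k: "integrable M k" for k :: "'a \<Rightarrow> real"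
  proof (rule Bochner_Integration.integrable_bound)
    show "integrable M (\<lambda>x. C * norm (k x))" using k by simp
    show "(\<lambda>x. k x *\<^sub>R c x) \<in> borel_measurable M" using c k by measurable
    show "AE x in M. norm (k x *\<^sub>R c x) \<le> norm (C * norm (k x))"
    proof (rule AE_I2)
      fix x show "norm (k x *\<^sub>R c x) \<le> norm (C * norm (k x))"
        using mult_right_mono[OF order_trans[OF c(2)[of x] abs_ge_self[of C]], of "norm (k x)"] by (simp add: abs_mult mult.commute)
    qed
  qed
  have "norm ((LINT x|M. f n x *\<^sub>R c x) - (LINT x|M. g x *\<^sub>R c x)) \<le> C * (LINT x|M. norm (f n x - g x))" for n
  proof -
    have "(LINT x|M. f n x *\<^sub>R c x) - (LINT x|M. g x *\<^sub>R c x) = (LINT x|M. (f n x - g x) *\<^sub>R c x)"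
      using i[OF f(1)] i[OF f(2)] by (simp add: scaleR_diff_left)
    also have "norm \<dots> \<le> (LINT x|M. norm ((f n x - g x) *\<^sub>R c x))" by (rule integral_norm_bound)
    also have "\<dots> \<le> (LINT x|M. C * norm (f n x - g x))"
    proof (rule integral_mono)
      show "integrable M (\<lambda>x. norm ((f n x - g x) *\<^sub>R c x))"
        using i[of "\<lambda>x. f n x - g x"] f by (intro integrable_norm) auto
      show "integrable M (\<lambda>x. C * norm (f n x - g x))" using f by simp
      show "norm ((f n x - g x) *\<^sub>R c x) \<le> C * norm (f n x - g x)" for x
        using mult_right_mono[OF c(2)[of x], of "\<bar>f n x - g x\<bar>"] by (simp add: mult.commute)
    qed
    finally show ?thesis by simp
  qed
  then have "\<forall>\<^sub>F n in sequentially. norm ((LINT x|M. f n x *\<^sub>R c x) - (LINT x|M. g x *\<^sub>R c x)) \<le> C * (LINT x|M. norm (f n x - g x))"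
    by simp
  moreover have "(\<lambda>n. C * (LINT x|M. norm (f n x - g x))) \<longlonglongrightarrow> 0"
    using tendsto_mult_left[OF lim, of C] by simp
  ultimately have "(\<lambda>n. (LINT x|M. f n x *\<^sub>R c x) - (LINT x|M. g x *\<^sub>R c x)) \<longlonglongrightarrow> 0"
    by (rule Lim_null_comparison)
  then show ?thesis by (simp add: LIM_zero_iff)
qed

lemma has_weak_gradient_limit:
  assumes w: "\<And>n. \<psi> \<in> test_functions \<Omega> \<Longrightarrow> (LINT x|M. f n x *\<^sub>R grad \<psi> x) = - (LINT x|M. \<psi> x *\<^sub>R F n x)"
    and f: "\<And>n. integrable M (f n)" "integrable M g" "(\<lambda>n. LINT x|M. norm (f n x - g x)) \<longlonglongrightarrow> 0"
    and F: "\<And>n. integrable M (F n)" "integrable M G" "(\<lambda>n. LINT x|M. norm (F n x - G x)) \<longlonglongrightarrow> 0"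
    and \<psi>: "\<psi> \<in> test_functions \<Omega>"
  shows "(LINT x|M. g x *\<^sub>R grad \<psi> x) = - (LINT x|M. \<psi> x *\<^sub>R G x)"
proof -
  obtain C where C: "C > 0" "\<And>x. \<bar>\<psi> x\<bar> \<le> C" "\<And>x. norm (grad \<psi> x) \<le> C"
    "\<psi> \<in> borel_measurable M" "grad \<psi> \<in> borel_measurable M"
    using test_grad_bounded_borel[OF \<psi>] by blast
  have "(\<lambda>n. LINT x|M. f n x *\<^sub>R grad \<psi> x) \<longlonglongrightarrow> (LINT x|M. g x *\<^sub>R grad \<psi> x)"
    by (rule scalar_pairing_tendsto[OF f(3,1,2) C(5,3)])
  moreover have "(\<lambda>n. - (LINT x|M. \<psi> x *\<^sub>R F n x)) \<longlonglongrightarrow> - (LINT x|M. \<psi> x *\<^sub>R G x)"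
    by (rule tendsto_minus[OF L1_pairing_tendsto[OF F(3,1,2) C(4,2)]])
  ultimately show ?thesis using w[OF \<psi>] LIMSEQ_unique by (simp only:)
qed

lemma L1_tendsto_dominated:
  fixes f :: "nat \<Rightarrow> 'a \<Rightarrow> 'b::euclidean_space"
  assumes "\<And>n. f n \<in> borel_measurable M" "g \<in> borel_measurable M" "integrable M w"
    "\<And>n. AE x in M. norm (f n x - g x) \<le> w x" "AE x in M. (\<lambda>n. f n x) \<longlonglongrightarrow> g x"
  shows "(\<lambda>n. LINT x|M. norm (f n x - g x)) \<longlonglongrightarrow> 0"
proof -
  have "(\<lambda>n. LINT x|M. norm (f n x - g x)) \<longlonglongrightarrow> (LINT x|M. 0)"
  proof (rule integral_dominated_convergence[OF _ _ assms(3)])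
    show "(\<lambda>x. norm (f n x - g x)) \<in> borel_measurable M" for n using assms(1)[of n] assms(2) by measurable
    show "AE x in M. (\<lambda>n. norm (f n x - g x)) \<longlonglongrightarrow> 0"
      using assms(5)
    proof eventually_elim
      case (elim x)
      show ?case by (rule tendsto_norm_zero[OF LIM_zero[OF elim]])
    qed
    show "AE x in M. norm (norm (f n x - g x)) \<le> w x" for n using assms(4)[of n] by simp
  qed simp
  then show ?thesis by simp
qed

lemma W0_grad_weak: 
  assumes "W0_grad f G" shows "has_weak_gradient \<Omega> f G"
proof -
  obtain \<phi> where \<phi>: "\<And>n. \<phi> n \<in> test_functions \<Omega>" "Lp_tendsto \<phi> f" "Lp_tendsto (\<lambda>n. grad (\<phi> n)) G" "AE x in M. (\<lambda>n. \<phi> n x) \<longlonglongrightarrow> f x"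
    using H0E[OF assms] by blast
  show ?thesis unfolding has_weak_gradient_def
  proof (intro conjI ballI)
    show "locally_integrable \<Omega> f" "locally_integrable \<Omega> G" using H0D[OF assms] Lp_locally_integrable by auto
    fix \<psi> assume \<psi>: "\<psi> \<in> test_functions \<Omega>"
    show "(LINT x|M. f x *\<^sub>R grad \<psi> x) = - (LINT x|M. \<psi> x *\<^sub>R G x)"
    proof (rule has_weak_gradient_limit[OF _ _ _ _ _ _ _ \<psi>])
      show "(LINT x|M. \<phi> n x *\<^sub>R grad \<psi> x) = - (LINT x|M. \<psi> x *\<^sub>R grad (\<phi> n) x)" for n
        by (rule integration_by_parts[OF test_GDERIV[OF \<phi>(1)] test_grad_continuous[OF \<phi>(1)] \<psi> open_dom])
      show "integrable M (\<phi> n)" "integrable M (grad (\<phi> n))" for n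
        using Lp_integrable[OF test_in_Lp(1)[OF \<phi>(1)]] Lp_integrable[OF test_in_Lp(2)[OF \<phi>(1)]] by auto
      show "integrable M f" "integrable M G" using H0D[OF assms] Lp_integrable by auto
      show "(\<lambda>n. LINT x|M. norm (\<phi> n x - f x)) \<longlonglongrightarrow> 0"
        by (rule Lp_tendsto_L1[OF \<phi>(2) test_in_Lp(1)[OF \<phi>(1)] H0D(1)[OF assms]])
      show "(\<lambda>n. LINT x|M. norm (grad (\<phi> n) x - G x)) \<longlonglongrightarrow> 0"
        by (rule Lp_tendsto_L1[OF \<phi>(3) test_in_Lp(2)[OF \<phi>(1)] H0D(2)[OF assms]])
    qed
  qed
qed

lemma W0_grad_weak_grad: "W0_grad f G \<Longrightarrow> AE x in M. weak_grad \<Omega> f x = G x"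
  by (intro weak_grad_eq W0_grad_weak)

lemma W0_grad_W1p_zero:
  assumes "W0_grad f G" shows "f \<in> W1p_zero \<Omega> p"
proof -
  obtain \<phi> where \<phi>: "\<And>n. \<phi> n \<in> test_functions \<Omega>" "Lp_tendsto \<phi> f" "Lp_tendsto (\<lambda>n. grad (\<phi> n)) G"
    using assms by (auto simp: W0_grad_def)
  have e: "AE x in M. weak_grad \<Omega> f x = G x" by (rule W0_grad_weak_grad[OF assms])
  have "Lp_tendsto (\<lambda>n. grad (\<phi> n)) (weak_grad \<Omega> f)"
    using Lp_tendsto_cong_AE[OF e test_in_Lp(4)[OF \<phi>(1)] measurable_AE_cong[OF H0D(4)[OF assms] e] H0D(4)[OF assms]] \<phi>(3) by simp
  then show ?thesis unfolding W1p_zero_def W1p_def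
    using H0D(1,2)[OF assms] W0_grad_weak[OF assms] \<phi>(1,2) by (auto simp: Lp_tendsto_def)
qed

lemma W1p_zero_W0_grad:
  assumes "f \<in> W1p_zero \<Omega> p" shows "W0_grad f (weak_grad \<Omega> f)"
proof -
  obtain v where v: "v \<in> Lp \<Omega> p" "has_weak_gradient \<Omega> f v" and f: "f \<in> Lp \<Omega> p"
    using assms by (auto simp: W1p_zero_def W1p_def)
  have "weak_grad \<Omega> f \<in> Lp \<Omega> p" by (rule Lp_cong_AE[OF v(1) weak_grad_eq[OF v(2)]])
  then show ?thesis using assms f unfolding W0_grad_def Lp_tendsto_def W1p_zero_def by auto
qed

text \<open>A diagonal choice: the k-th member is replaced by a test function whose errors, for the
  function and for the gradient, are both below 1/(k+1).\<close>

lemma W0_grad_limit: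
  assumes H: "\<And>k. W0_grad (f k) (F k)" and g: "g \<in> Lp \<Omega> p" "Lp_tendsto f g" and G: "G \<in> Lp \<Omega> p" "Lp_tendsto F G"
  shows "W0_grad g G"
proof -
  have "\<exists>\<phi>. \<phi> \<in> test_functions \<Omega> \<and> (LINT x|M. norm (\<phi> x - f k x) powr p) < 1 / real (Suc k) \<and>
      (LINT x|M. norm (grad \<phi> x - F k x) powr p) < 1 / real (Suc k)" for k
  proof -
    obtain \<phi> where \<phi>: "\<And>n. \<phi> n \<in> test_functions \<Omega>" "Lp_tendsto \<phi> (f k)" "Lp_tendsto (\<lambda>n. grad (\<phi> n)) (F k)"
      using H[of k] by (auto simp: W0_grad_def)
    have "\<forall>\<^sub>F n in sequentially. (LINT x|M. norm (\<phi> n x - f k x) powr p) < 1 / real (Suc k) \<and>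
      (LINT x|M. norm (grad (\<phi> n) x - F k x) powr p) < 1 / real (Suc k)"
      using \<phi>(2,3) unfolding Lp_tendsto_def by (intro eventually_conj order_tendstoD(2)) auto
    then obtain n where "(LINT x|M. norm (\<phi> n x - f k x) powr p) < 1 / real (Suc k) \<and>
      (LINT x|M. norm (grad (\<phi> n) x - F k x) powr p) < 1 / real (Suc k)"
      using eventually_happens'[OF sequentially_bot] by blast
    then show ?thesis using \<phi>(1) by blast
  qed
  then have "\<forall>k. \<exists>\<phi>. \<phi> \<in> test_functions \<Omega> \<and> (LINT x|M. norm (\<phi> x - f k x) powr p) < 1 / real (Suc k) \<and>
      (LINT x|M. norm (grad \<phi> x - F k x) powr p) < 1 / real (Suc k)" by (rule allI)
  from choice[OF this] obtain \<phi> where \<phi>': "\<forall>k. \<phi> k \<in> test_functions \<Omega> \<and> 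
      (LINT x|M. norm (\<phi> k x - f k x) powr p) < 1 / real (Suc k) \<and>
      (LINT x|M. norm (grad (\<phi> k) x - F k x) powr p) < 1 / real (Suc k)" by (rule exE)
  note \<phi> = \<phi>'[rule_format, THEN conjunct1] \<phi>'[rule_format, THEN conjunct2, THEN conjunct1] 
    \<phi>'[rule_format, THEN conjunct2, THEN conjunct2]
  have inv: "(\<lambda>k. 1 / real (Suc k)) \<longlonglongrightarrow> 0"
    using LIMSEQ_inverse_real_of_nat by (simp add: inverse_eq_divide)
  have small: "h \<longlonglongrightarrow> 0" if "\<And>k. 0 \<le> h k" "\<And>k. h k < 1 / real (Suc k)" for h :: "nat \<Rightarrow> real"
    by (rule tendsto_sandwich[OF _ _ tendsto_const inv]) (use that in \<open>auto intro: always_eventually less_imp_le\<close>)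
  have z: "(\<lambda>x. 0::'b) \<in> Lp \<Omega> p" for y :: "'b::euclidean_space"
    by (rule Lp_bounded[of _ 0]) auto
  have d1: "Lp_tendsto (\<lambda>k x. \<phi> k x - f k x) (\<lambda>x. 0)"
    unfolding Lp_tendsto_def by (rule small) (use \<phi>(2) in auto)
  have d2: "Lp_tendsto (\<lambda>k x. grad (\<phi> k) x - F k x) (\<lambda>x. 0)"
    unfolding Lp_tendsto_def by (rule small) (use \<phi>(3) in auto)
  have "Lp_tendsto \<phi> g"
    by (rule Lp_tendsto_sum_bound[OF test_in_Lp(3)[OF \<phi>(1)] LpD(1)[OF g(1)] 
          Lp_diff[OF test_in_Lp(1)[OF \<phi>(1)] H0D(1)[OF H]] z d1 H0D(1)[OF H] g, where C = 1])
       (rule AE_I2, rule norm_triangle3)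
  moreover have "Lp_tendsto (\<lambda>k. grad (\<phi> k)) G"
    by (rule Lp_tendsto_sum_bound[OF test_in_Lp(4)[OF \<phi>(1)] LpD(1)[OF G(1)] 
          Lp_diff[OF test_in_Lp(2)[OF \<phi>(1)] H0D(2)[OF H]] z d2 H0D(2)[OF H] G, where C = 1])
       (rule AE_I2, rule norm_triangle3)
  ultimately show ?thesis using \<phi>(1) g(1) G(1) unfolding W0_grad_def by blast
qed

end

text \<open>Functions on the plane with continuous partial derivatives bounded by \<open>C\<close>.
  Two variables are wanted because the test function combines both solutions at once, with the sum
  of a product and a composition in its gradient.\<close>

definition C1_chain :: "(real \<Rightarrow> real \<Rightarrow> real) \<Rightarrow> (real \<Rightarrow> real \<Rightarrow> real) \<Rightarrow> (real \<Rightarrow> real \<Rightarrow> real) \<Rightarrow> real \<Rightarrow> bool" where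
  "C1_chain \<Phi> \<Phi>1 \<Phi>2 C \<longleftrightarrow>
     (\<forall>s t. ((\<lambda>z. \<Phi> (fst z) (snd z)) has_derivative (\<lambda>h. \<Phi>1 s t * fst h + \<Phi>2 s t * snd h)) (at (s, t))) \<and>
     (\<forall>s t. \<bar>\<Phi>1 s t\<bar> \<le> C \<and> \<bar>\<Phi>2 s t\<bar> \<le> C) \<and>
     continuous_on UNIV (\<lambda>z. \<Phi>1 (fst z) (snd z)) \<and> continuous_on UNIV (\<lambda>z. \<Phi>2 (fst z) (snd z))"

lemma C1_chain_lipschitz:
  assumes "C1_chain \<Phi> \<Phi>1 \<Phi>2 C"
  shows "\<bar>\<Phi> s t - \<Phi> s' t'\<bar> \<le> 2 * C * (\<bar>s - s'\<bar> + \<bar>t - t'\<bar>)"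
proof -
  have C: "\<bar>\<Phi>1 s t\<bar> \<le> C" "\<bar>\<Phi>2 s t\<bar> \<le> C" for s t using assms by (auto simp: C1_chain_def)
  have C0: "C \<ge> 0" using C(1)[of 0 0] by linarith
  have "norm (\<Phi> (fst (s,t)) (snd (s,t)) - \<Phi> (fst (s',t')) (snd (s',t'))) \<le> (2 * C) * norm ((s,t) - (s',t'))"
  proof (rule differentiable_bound[of UNIV "\<lambda>z. \<Phi> (fst z) (snd z)" "\<lambda>z h. \<Phi>1 (fst z) (snd z) * fst h + \<Phi>2 (fst z) (snd z) * snd h"])
    show "((\<lambda>z. \<Phi> (fst z) (snd z)) has_derivative (\<lambda>h. \<Phi>1 (fst z) (snd z) * fst h + \<Phi>2 (fst z) (snd z) * snd h)) (at z)" for z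
      using assms by (cases z) (simp add: C1_chain_def)
    show "onorm (\<lambda>h. \<Phi>1 (fst z) (snd z) * fst h + \<Phi>2 (fst z) (snd z) * snd h) \<le> 2 * C" for z
    proof (rule onorm_bound)
      fix h :: "real \<times> real"
      have "norm (\<Phi>1 (fst z) (snd z) * fst h + \<Phi>2 (fst z) (snd z) * snd h) \<le> \<bar>\<Phi>1 (fst z) (snd z)\<bar> * \<bar>fst h\<bar> + \<bar>\<Phi>2 (fst z) (snd z)\<bar> * \<bar>snd h\<bar>"
        by (metis abs_mult abs_triangle_ineq real_norm_def)
      also have "\<dots> \<le> C * norm h + C * norm h"
        using norm_fst_le[of "fst h" "snd h"] norm_snd_le[of "snd h" "fst h"] C C0
        by (intro add_mono mult_mono) auto
      finally show "norm (\<Phi>1 (fst z) (snd z) * fst h + \<Phi>2 (fst z) (snd z) * snd h) \<le> 2 * C * norm h" by simp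
    qed (use C0 in simp)
  qed auto
  also have "norm ((s,t) - (s',t')) \<le> \<bar>s - s'\<bar> + \<bar>t - t'\<bar>"
    using norm_Pair_le[of "s - s'" "t - t'"] by simp
  finally show ?thesis using C0 by (simp add: mult_left_mono)
qed

context sobolev_domain begin

text \<open>Since the outer function keeps the class of test functions, it can be applied to the
  approximating sequences themselves. The Lipschitz bound gives convergence of the functions; the
  gradients converge because their coefficients are bounded and converge almost everywhere along a
  subsequence.\<close>

lemma W0_grad_chain:
  assumes f: "W0_grad f F" and g: "W0_grad g G" and \<Phi>: "C1_chain \<Phi> \<Phi>1 \<Phi>2 C"
    and test: "\<And>\<phi> \<psi>. \<phi> \<in> test_functions \<Omega> \<Longrightarrow> \<psi> \<in> test_functions \<Omega> \<Longrightarrow> (\<lambda>x. \<Phi> (\<phi> x) (\<psi> x)) \<in> test_functions \<Omega>"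
  shows "W0_grad (\<lambda>x. \<Phi> (f x) (g x)) (\<lambda>x. \<Phi>1 (f x) (g x) *\<^sub>R F x + \<Phi>2 (f x) (g x) *\<^sub>R G x)"
proof -
  have C: "\<bar>\<Phi>1 s t\<bar> \<le> C" "\<bar>\<Phi>2 s t\<bar> \<le> C" for s t using \<Phi> by (auto simp: C1_chain_def)
  have C0: "C \<ge> 0" using C(1)[of 0 0] by linarith
  have cont: "continuous_on UNIV (\<lambda>z. \<Phi>1 (fst z) (snd z))" "continuous_on UNIV (\<lambda>z. \<Phi>2 (fst z) (snd z))"
    using \<Phi> by (auto simp: C1_chain_def)
  have contp: "continuous_on UNIV (\<lambda>z. \<Phi> (fst z) (snd z))"
  proof (intro continuous_at_imp_continuous_on ballI has_derivative_continuous)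
    fix z :: "real \<times> real"
    show "((\<lambda>z. \<Phi> (fst z) (snd z)) has_derivative (\<lambda>h. \<Phi>1 (fst z) (snd z) * fst h + \<Phi>2 (fst z) (snd z) * snd h)) (at z)"
      using \<Phi> by (cases z) (simp add: C1_chain_def)
  qed
  note bm = borel_measurable_continuous_onI[OF contp] borel_measurable_continuous_onI[OF cont(1)] borel_measurable_continuous_onI[OF cont(2)]
  have comp_m: "(\<lambda>x. \<Phi> (f x) (g x)) \<in> borel_measurable M" "(\<lambda>x. \<Phi>1 (f x) (g x)) \<in> borel_measurable M"
     "(\<lambda>x. \<Phi>2 (f x) (g x)) \<in> borel_measurable M"
    if "f \<in> borel_measurable M" "g \<in> borel_measurable M" for f g
    using measurable_compose[OF borel_measurable_Pair[OF that] bm(1)] measurable_compose[OF borel_measurable_Pair[OF that] bm(2)]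
      measurable_compose[OF borel_measurable_Pair[OF that] bm(3)] by auto
  have lip: "\<bar>\<Phi> s t - \<Phi> s' t'\<bar> \<le> 2 * C * (\<bar>s - s'\<bar> + \<bar>t - t'\<bar>)" for s t s' t'
    by (rule C1_chain_lipschitz[OF \<Phi>])
  obtain \<phi> where \<phi>: "\<And>n. \<phi> n \<in> test_functions \<Omega>" "Lp_tendsto \<phi> f" "Lp_tendsto (\<lambda>n. grad (\<phi> n)) F" "AE x in M. (\<lambda>n. \<phi> n x) \<longlonglongrightarrow> f x"
    using H0E[OF f] by blast
  obtain \<psi> where \<psi>: "\<And>n. \<psi> n \<in> test_functions \<Omega>" "Lp_tendsto \<psi> g" "Lp_tendsto (\<lambda>n. grad (\<psi> n)) G" "AE x in M. (\<lambda>n. \<psi> n x) \<longlonglongrightarrow> g x"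
    using H0E[OF g] by blast
  note fm = H0D(3)[OF f] and gm = H0D(3)[OF g] and Fm = H0D(4)[OF f] and Gm = H0D(4)[OF g]
  note \<phi>m = test_in_Lp(3)[OF \<phi>(1)] and \<psi>m = test_in_Lp(3)[OF \<psi>(1)]
  let ?c = "\<lambda>n x. \<Phi> (\<phi> n x) (\<psi> n x)" and ?h = "\<lambda>x. \<Phi> (f x) (g x)"
  let ?K1 = "\<lambda>x. \<Phi>1 (f x) (g x) *\<^sub>R F x" and ?K2 = "\<lambda>x. \<Phi>2 (f x) (g x) *\<^sub>R G x"
  have gr: "grad (?c n) x = \<Phi>1 (\<phi> n x) (\<psi> n x) *\<^sub>R grad (\<phi> n) x + \<Phi>2 (\<phi> n x) (\<psi> n x) *\<^sub>R grad (\<psi> n) x" for n x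
  proof (rule grad_eqI)
    have d: "((\<lambda>y. (\<phi> n y, \<psi> n y)) has_derivative (\<lambda>h. (h \<bullet> grad (\<phi> n) x, h \<bullet> grad (\<psi> n) x))) (at x)"
      using test_GDERIV[OF \<phi>(1)] test_GDERIV[OF \<psi>(1)] unfolding gderiv_def by (intro has_derivative_Pair)
    have "((\<lambda>z. \<Phi> (fst z) (snd z)) has_derivative (\<lambda>h. \<Phi>1 (\<phi> n x) (\<psi> n x) * fst h + \<Phi>2 (\<phi> n x) (\<psi> n x) * snd h)) (at (\<phi> n x, \<psi> n x))"
      using \<Phi> by (simp add: C1_chain_def)
    from has_derivative_compose[OF d this]
    show "GDERIV (?c n) x :> \<Phi>1 (\<phi> n x) (\<psi> n x) *\<^sub>R grad (\<phi> n) x + \<Phi>2 (\<phi> n x) (\<psi> n x) *\<^sub>R grad (\<psi> n) x"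
      by (simp add: gderiv_def inner_add_right)
  qed
  have hL: "?h \<in> Lp \<Omega> p"
  proof -
    have fg: "(\<lambda>x. \<bar>f x\<bar> + \<bar>g x\<bar>) \<in> Lp \<Omega> p"
      by (intro Lp_add Lp_dominated_norm[OF _ H0D(1)[OF f], of _ 1] Lp_dominated_norm[OF _ H0D(1)[OF g], of _ 1])
         (use fm gm in auto)
    have "(\<lambda>x. \<bar>\<Phi> 0 0\<bar> + (2 * C) *\<^sub>R (\<bar>f x\<bar> + \<bar>g x\<bar>)) \<in> Lp \<Omega> p"
      by (intro Lp_add[OF Lp_bounded[of _ "\<bar>\<Phi> 0 0\<bar>"] Lp_scaleR[OF fg]]) auto
    then show ?thesis
    proof (rule Lp_dominated_norm[OF comp_m(1)[OF fm gm], where C = 1], intro AE_I2)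
      fix x show "norm (?h x) \<le> 1 * norm (\<bar>\<Phi> 0 0\<bar> + (2 * C) *\<^sub>R (\<bar>f x\<bar> + \<bar>g x\<bar>))"
        using lip[of "f x" "g x" 0 0] by simp
    qed
  qed
  have cm1: "(\<lambda>x. \<Phi>1 (\<phi> n x) (\<psi> n x)) \<in> borel_measurable M" and cm2: "(\<lambda>x. \<Phi>2 (\<phi> n x) (\<psi> n x)) \<in> borel_measurable M" for n
    using comp_m[OF \<phi>m \<psi>m] by auto
  have cm1': "(\<lambda>x. \<Phi>1 (f x) (g x)) \<in> borel_measurable M" and cm2': "(\<lambda>x. \<Phi>2 (f x) (g x)) \<in> borel_measurable M"
    using comp_m[OF fm gm] by auto
  have KL: "?K1 \<in> Lp \<Omega> p" "?K2 \<in> Lp \<Omega> p"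
    using C by (auto intro!: Lp_bounded_mult[OF H0D(2)[OF f] cm1', where C = C] Lp_bounded_mult[OF H0D(2)[OF g] cm2', where C = C])
  have c1: "Lp_tendsto ?c ?h"
    by (rule Lp_tendsto_sum_bound[OF comp_m(1)[OF \<phi>m \<psi>m] comp_m(1)[OF fm gm] test_in_Lp(1)[OF \<phi>(1)] H0D(1)[OF f] \<phi>(2)
          test_in_Lp(1)[OF \<psi>(1)] H0D(1)[OF g] \<psi>(2), where C = "2 * C"]) (use lip in auto)
  \<comment> \<open>A bounded, almost everywhere convergent coefficient times a convergent gradient.
    The difference splits into the coefficient times the error of the gradient, controlled by the
    bound \<open>C\<close>, and the error of the coefficient times the fixed field \<open>T\<close>,
    controlled by dominated convergence.\<close>
  have conv: "Lp_tendsto (\<lambda>n x. c n x *\<^sub>R grad (\<theta> n) x) (\<lambda>x. c' x *\<^sub>R T x)"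
    if c: "\<And>n. c n \<in> borel_measurable M" "c' \<in> borel_measurable M" "\<And>n x. \<bar>c n x\<bar> \<le> C" "\<And>x. \<bar>c' x\<bar> \<le> C"
      "AE x in M. (\<lambda>n. c n x) \<longlonglongrightarrow> c' x" and \<theta>: "\<And>n. \<theta> n \<in> test_functions \<Omega>" "Lp_tendsto (\<lambda>n. grad (\<theta> n)) T" "T \<in> Lp \<Omega> p"
    for c c' \<theta> T
  proof -
    note Tm = LpD(1)[OF \<theta>(3)] and \<theta>m = test_in_Lp(4)[OF \<theta>(1)]
    have L1: "(\<lambda>x. c n x *\<^sub>R T x) \<in> Lp \<Omega> p" for n using c by (intro Lp_bounded_mult[OF \<theta>(3), of _ C]) auto
    have L2: "(\<lambda>x. c' x *\<^sub>R T x) \<in> Lp \<Omega> p" using c by (intro Lp_bounded_mult[OF \<theta>(3), of _ C]) auto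
    have lim: "Lp_tendsto (\<lambda>n x. c n x *\<^sub>R T x) (\<lambda>x. c' x *\<^sub>R T x)"
    proof (rule Lp_tendsto_dominated)
      show "integrable M (\<lambda>x. (2 * C) powr p * norm (T x) powr p)" using LpD(2)[OF \<theta>(3)] by simp
      show "(\<lambda>x. c n x *\<^sub>R T x) \<in> borel_measurable M" for n using L1 LpD(1) by blast
      show "(\<lambda>x. c' x *\<^sub>R T x) \<in> borel_measurable M" using L2 LpD(1) by blast
      show "AE x in M. norm (c n x *\<^sub>R T x - c' x *\<^sub>R T x) powr p \<le> (2 * C) powr p * norm (T x) powr p" for n
      proof (rule AE_I2)
        fix x
        have "\<bar>c n x - c' x\<bar> \<le> 2 * C" using c(3)[of n x] c(4)[of x] by linarith
        then have "norm (c n x *\<^sub>R T x - c' x *\<^sub>R T x) \<le> (2 * C) * norm (T x)"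
          by (simp add: scaleR_diff_left[symmetric] mult_right_mono)
        then have "norm (c n x *\<^sub>R T x - c' x *\<^sub>R T x) powr p \<le> ((2 * C) * norm (T x)) powr p"
          using p_gt_1 by (intro powr_mono2) auto
        then show "norm (c n x *\<^sub>R T x - c' x *\<^sub>R T x) powr p \<le> (2 * C) powr p * norm (T x) powr p"
          using C0 by (simp add: powr_mult)
      qed
      show "AE x in M. (\<lambda>n. c n x *\<^sub>R T x) \<longlonglongrightarrow> c' x *\<^sub>R T x"
        using c(5) by eventually_elim (intro tendsto_scaleR tendsto_const)
    qed
    show ?thesis
    proof (rule Lp_tendsto_sum_bound[OF _ LpD(1)[OF L2] test_in_Lp(2)[OF \<theta>(1)] \<theta>(3) \<theta>(2) L1 L2 lim, where C = "max C 1"])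
      show "(\<lambda>x. c n x *\<^sub>R grad (\<theta> n) x) \<in> borel_measurable M" for n using c(1)[of n] \<theta>m[of n] by measurable
      show "AE x in M. norm (c n x *\<^sub>R grad (\<theta> n) x - c' x *\<^sub>R T x) \<le> max C 1 * (norm (grad (\<theta> n) x - T x) + norm (c n x *\<^sub>R T x - c' x *\<^sub>R T x))" for n
      proof (rule AE_I2)
        fix x
        have "c n x *\<^sub>R grad (\<theta> n) x - c' x *\<^sub>R T x = c n x *\<^sub>R (grad (\<theta> n) x - T x) + (c n x *\<^sub>R T x - c' x *\<^sub>R T x)"
          by (simp add: scaleR_diff_right)
        then have "norm (c n x *\<^sub>R grad (\<theta> n) x - c' x *\<^sub>R T x) \<le> \<bar>c n x\<bar> * norm (grad (\<theta> n) x - T x) + norm (c n x *\<^sub>R T x - c' x *\<^sub>R T x)"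
          by (metis norm_scaleR norm_triangle_ineq)
        also have "\<dots> \<le> max C 1 * norm (grad (\<theta> n) x - T x) + max C 1 * norm (c n x *\<^sub>R T x - c' x *\<^sub>R T x)"
          using mult_right_mono[of 1 "max C 1" "norm (c n x *\<^sub>R T x - c' x *\<^sub>R T x)"] c(3)[of n x]
          by (intro add_mono mult_right_mono) auto
        finally show "norm (c n x *\<^sub>R grad (\<theta> n) x - c' x *\<^sub>R T x) \<le> max C 1 * (norm (grad (\<theta> n) x - T x) + norm (c n x *\<^sub>R T x - c' x *\<^sub>R T x))"
          by (simp add: distrib_left)
      qed
    qed
  qed
  have lim1: "AE x in M. (\<lambda>n. \<Phi>1 (\<phi> n x) (\<psi> n x)) \<longlonglongrightarrow> \<Phi>1 (f x) (g x)"
    and lim2: "AE x in M. (\<lambda>n. \<Phi>2 (\<phi> n x) (\<psi> n x)) \<longlonglongrightarrow> \<Phi>2 (f x) (g x)"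
  proof -
    have pr: "AE x in M. (\<lambda>n. (\<phi> n x, \<psi> n x)) \<longlonglongrightarrow> (f x, g x)"
      using \<phi>(4) \<psi>(4) by eventually_elim (rule tendsto_Pair)
    show "AE x in M. (\<lambda>n. \<Phi>1 (\<phi> n x) (\<psi> n x)) \<longlonglongrightarrow> \<Phi>1 (f x) (g x)"
      using pr by eventually_elim (use continuous_on_tendsto_compose[OF cont(1)] in fastforce)
    show "AE x in M. (\<lambda>n. \<Phi>2 (\<phi> n x) (\<psi> n x)) \<longlonglongrightarrow> \<Phi>2 (f x) (g x)"
      using pr by eventually_elim (use continuous_on_tendsto_compose[OF cont(2)] in fastforce)
  qed
  have a1: "Lp_tendsto (\<lambda>n x. \<Phi>1 (\<phi> n x) (\<psi> n x) *\<^sub>R grad (\<phi> n) x) ?K1"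
    by (rule conv[OF cm1 cm1' C(1) C(1) lim1 \<phi>(1,3) H0D(2)[OF f]])
  have a2: "Lp_tendsto (\<lambda>n x. \<Phi>2 (\<phi> n x) (\<psi> n x) *\<^sub>R grad (\<psi> n) x) ?K2"
    by (rule conv[OF cm2 cm2' C(2) C(2) lim2 \<psi>(1,3) H0D(2)[OF g]])
  have b1: "(\<lambda>x. \<Phi>1 (\<phi> n x) (\<psi> n x) *\<^sub>R grad (\<phi> n) x) \<in> Lp \<Omega> p" 
    and b2: "(\<lambda>x. \<Phi>2 (\<phi> n x) (\<psi> n x) *\<^sub>R grad (\<psi> n) x) \<in> Lp \<Omega> p" for n
    using C by (auto intro!: Lp_bounded_mult[OF test_in_Lp(2)[OF \<phi>(1)] cm1, where C = C] Lp_bounded_mult[OF test_in_Lp(2)[OF \<psi>(1)] cm2, where C = C])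
  have KL': "(\<lambda>x. ?K1 x + ?K2 x) \<in> Lp \<Omega> p" by (rule Lp_add[OF KL])
  have c2: "Lp_tendsto (\<lambda>n. grad (?c n)) (\<lambda>x. ?K1 x + ?K2 x)"
  proof (rule Lp_tendsto_sum_bound[OF test_in_Lp(4)[OF test[OF \<phi>(1) \<psi>(1)]] LpD(1)[OF KL'] b1 KL(1) a1 b2 KL(2) a2, where C = 1], intro AE_I2)
    fix n x
    show "norm (grad (?c n) x - (?K1 x + ?K2 x)) \<le> 1 * (norm (\<Phi>1 (\<phi> n x) (\<psi> n x) *\<^sub>R grad (\<phi> n) x - ?K1 x) + norm (\<Phi>2 (\<phi> n x) (\<psi> n x) *\<^sub>R grad (\<psi> n) x - ?K2 x))"
      unfolding gr using norm_diff_triangle_ineq[of "\<Phi>1 (\<phi> n x) (\<psi> n x) *\<^sub>R grad (\<phi> n) x" "\<Phi>2 (\<phi> n x) (\<psi> n x) *\<^sub>R grad (\<psi> n) x" "?K1 x" "?K2 x"] by simp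
  qed
  show ?thesis unfolding W0_grad_def
    using hL KL' c1 c2 test[OF \<phi>(1) \<psi>(1)] by (intro conjI exI[of _ ?c]) auto
qed

lemma W0_grad_compose_test:
  assumes f: "W0_grad f G" and F: "\<And>k. Ck k F" "F 0 = 0" "\<And>s. DERIV F s :> F' s" "\<And>s. \<bar>F' s\<bar> \<le> C"
  shows "W0_grad (\<lambda>x. F (f x)) (\<lambda>x. F' (f x) *\<^sub>R G x)"
proof -
  have "F' = grad F" using DERIV_grad_real[OF F(1)] F(3) DERIV_unique by blast
  then have c: "continuous_on UNIV F'" using F(1)[of "Suc 0"] by simp
  have "C1_chain (\<lambda>s t. F s) (\<lambda>s t. F' s) (\<lambda>s t. 0) C"
    unfolding C1_chain_def
  proof (intro conjI allI)
    fix s t :: real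
    have "(F has_derivative (\<lambda>h. F' s * h)) (at (fst (s, t)))" using F(3)[of s] by (simp add: has_field_derivative_def)
    from has_derivative_compose[OF has_derivative_fst[OF has_derivative_ident] this]
    show "((\<lambda>z. F (fst z)) has_derivative (\<lambda>h. F' s * fst h + 0 * snd h)) (at (s, t))" by simp
    show "\<bar>F' s\<bar> \<le> C" by (rule F(4))
    show "\<bar>0\<bar> \<le> C" using F(4)[of 0] by simp
    show "continuous_on UNIV (\<lambda>z::real\<times>real. F' (fst z))"
      by (rule continuous_on_compose2[OF c]) (auto intro!: continuous_intros)
  qed simp
  from W0_grad_chain[OF f f this test_compose[OF _ F(1) F(2)]] show ?thesis by simp
qed

end

subsection \<open>Level sets, truncations and the Poincare inequality\<close>

text \<open>The expression is the derivative of a smooth approximation of the truncation at level k,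
  obtained by replacing each |y| in (|s + k| - |s - k|)/2 by the square root of y^2 + d.\<close>

lemma sqrt_diff_bound:
  fixes s k d :: real
  assumes "d > 0"
  shows "\<bar>((s + k) / sqrt ((s + k)\<^sup>2 + d) - (s - k) / sqrt ((s - k)\<^sup>2 + d)) / 2\<bar> \<le> 1"
proof -
  have "\<bar>y / sqrt (y\<^sup>2 + d)\<bar> \<le> 1" for y
  proof -
    have "\<bar>y\<bar> \<le> sqrt (y\<^sup>2 + d)" using assms by (intro real_le_rsqrt) simp
    moreover have "sqrt (y\<^sup>2 + d) > 0" using assms by (simp add: add_nonneg_pos)
    ultimately show ?thesis by (simp add: abs_divide)
  qed
  moreover have "\<bar>a\<bar> \<le> 1 \<Longrightarrow> \<bar>b\<bar> \<le> 1 \<Longrightarrow> \<bar>(a - b) / 2\<bar> \<le> 1" for a b :: real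
    using abs_triangle_ineq4[of a b] unfolding abs_divide by simp
  ultimately show ?thesis by blast
qed

lemma antiderivative_UNIV:
  fixes g :: "real \<Rightarrow> real"
  assumes "continuous_on UNIV g"
  obtains F where "\<And>t. DERIV F t :> g t" "F 0 = 0"
proof -
  have "\<exists>F. \<forall>x. (-\<infinity>::ereal) < ereal x \<longrightarrow> ereal x < \<infinity> \<longrightarrow> (F has_vector_derivative g x) (at x)"
    by (rule einterval_antiderivative) (use assms in \<open>auto simp: continuous_on_eq_continuous_at\<close>)
  then obtain F where F: "\<And>x. (F has_vector_derivative g x) (at x)" by auto
  show ?thesis
  proof (rule that[of "\<lambda>t. F t - F 0"])
    show "DERIV (\<lambda>t. F t - F 0) t :> g t" for t
      using DERIV_diff[OF F[of t, folded has_real_derivative_iff_has_vector_derivative] DERIV_const[of "F 0"]] by simp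
  qed simp
qed

text \<open>A primitive of a density that lives on a set of small measure is nondecreasing with
  small total increase. This smallness drives \<open>gradient_on_small_level_set\<close>.\<close>

lemma antiderivative_bound:
  fixes g :: "real \<Rightarrow> real"
  assumes F: "\<And>t. DERIV F t :> g t" and g: "\<And>t. 0 \<le> g t" "\<And>t. g t \<le> indicator U t"
    and U: "U \<in> lmeasurable" "measure lebesgue U \<le> e"
  shows "\<bar>F b - F a\<bar> \<le> e"
proof -
  have le: "0 \<le> F b - F a \<and> F b - F a \<le> e" if ab: "a \<le> b" for a b
  proof -
    have i: "(g has_integral (F b - F a)) {a..b}"
      using ab F by (intro fundamental_theorem_of_calculus)
        (auto simp: has_real_derivative_iff_has_vector_derivative[symmetric] intro: has_field_derivative_at_within)
    have "0 \<le> F b - F a" by (rule has_integral_nonneg[OF i]) (use g in auto)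
    moreover have "F b - F a \<le> measure lebesgue U"
    proof (rule has_integral_le)
      show "((\<lambda>x. if x \<in> {a..b} then g x else 0) has_integral (F b - F a)) UNIV"
        using i by (subst has_integral_restrict_UNIV)
      show "(indicat_real U has_integral measure lebesgue U) UNIV"
        using U(1) by (simp add: lmeasurable_iff_has_integral)
      show "(if x \<in> {a..b} then g x else 0) \<le> indicat_real U x" for x using g(2)[of x] by simp
    qed
    ultimately show ?thesis using U(2) by simp
  qed
  show ?thesis using le[of a b] le[of b a] by (cases "a \<le> b") auto
qed

text \<open>The function p |s|^(p-1) sgn(s), the derivative of |s|^p. Writing it with positive and
  negative parts makes its continuity evident.\<close>

definition abs_powr_deriv :: "real \<Rightarrow> real \<Rightarrow> real" where
  "abs_powr_deriv p s = p * (max s 0 powr (p - 1) - max (- s) 0 powr (p - 1))"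

lemma continuous_abs_powr_deriv: "1 < p \<Longrightarrow> continuous_on UNIV (abs_powr_deriv p)"
  unfolding abs_powr_deriv_def[abs_def] by (intro continuous_intros continuous_on_powr') auto

lemma abs_abs_powr_deriv: "1 < p \<Longrightarrow> \<bar>abs_powr_deriv p s\<bar> = p * \<bar>s\<bar> powr (p - 1)"
  by (cases "s \<ge> 0") (auto simp: abs_powr_deriv_def abs_mult)

lemma DERIV_abs_powr: 
  assumes p: "1 < p"
  shows "DERIV (\<lambda>s. \<bar>s\<bar> powr p) s :> abs_powr_deriv p s"
proof -
  consider "s > 0" | "s < 0" | "s = 0" by linarith
  then show ?thesis
  proof cases
    case 1
    have "DERIV (\<lambda>s. s powr p) s :> abs_powr_deriv p s"
      using has_real_derivative_powr[OF 1, of p] 1 by (simp add: abs_powr_deriv_def)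
    then show ?thesis
      by (rule has_field_derivative_transform_within_open[where S = "{0<..}"]) (use 1 in auto)
  next
    case 2
    have "DERIV (\<lambda>s. (- s) powr p) s :> p * (- s) powr (p - 1) * (- 1)"
      by (rule DERIV_chain2[OF has_real_derivative_powr]) (use 2 in \<open>auto intro!: derivative_eq_intros\<close>)
    then have "DERIV (\<lambda>s. (- s) powr p) s :> abs_powr_deriv p s" using 2 by (simp add: abs_powr_deriv_def)
    then show ?thesis
      by (rule has_field_derivative_transform_within_open[where S = "{..<0}"]) (use 2 in auto)
  next
    case 3
    have "((\<lambda>h. \<bar>h\<bar> powr p / h) \<longlongrightarrow> 0) (at 0)"
    proof (rule Lim_null_comparison)
      show "\<forall>\<^sub>F h in at (0::real). norm (\<bar>h\<bar> powr p / h) \<le> \<bar>h\<bar> powr (p - 1)"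
        by (auto simp: eventually_at_filter powr_diff abs_divide)
      have "((\<lambda>h::real. \<bar>h\<bar> powr (p - 1)) \<longlongrightarrow> \<bar>0\<bar> powr (p - 1)) (at 0)"
        using p by (intro tendsto_powr' tendsto_intros) auto
      then show "((\<lambda>h::real. \<bar>h\<bar> powr (p - 1)) \<longlongrightarrow> 0) (at 0)" by simp
    qed
    then show ?thesis using 3 p by (simp add: DERIV_def abs_powr_deriv_def)
  qed
qed

text \<open>Young's inequality with coefficient 1/2 on the first term, so that it can be absorbed in
  the Poincare inequality. Either 2Rpb <= a, and the left side is at most half of a^p, or a < 2Rpb,
  and a is eliminated in favour of b.\<close>

lemma young_absorb:
  fixes a b R p :: real
  assumes "a \<ge> 0" "b \<ge> 0" "R > 0" "p > 1"
  shows "R * (p * a powr (p - 1)) * b \<le> a powr p / 2 + R * p * (2 * R * p) powr (p - 1) * b powr p"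
proof (cases "2 * R * p * b \<le> a")
  case True
  show ?thesis
  proof (cases "a = 0")
    case False
    have "R * (p * a powr (p - 1)) * b = a powr (p - 1) * (2 * R * p * b) / 2" by (simp add: algebra_simps)
    also have "\<dots> \<le> a powr (p - 1) * a / 2" using True by (intro divide_right_mono mult_left_mono) auto
    also have "a powr (p - 1) * a = a powr p" using False assms by (simp add: powr_diff)
    finally show ?thesis using assms by (simp add: add_increasing2)
  qed (use assms in simp)
next
  case False
  have b: "b > 0" using False assms by (cases "b = 0") auto
  have "a powr (p - 1) \<le> (2 * R * p * b) powr (p - 1)" using False assms by (intro powr_mono2) auto
  also have "\<dots> = (2 * R * p) powr (p - 1) * b powr (p - 1)" using assms by (simp add: powr_mult)
  finally have "R * (p * a powr (p - 1)) * b \<le> R * (p * ((2 * R * p) powr (p - 1) * b powr (p - 1))) * b"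
    using assms by (intro mult_right_mono mult_left_mono) auto
  also have "\<dots> = R * p * (2 * R * p) powr (p - 1) * (b powr (p - 1) * b)" by (simp add: algebra_simps)
  also have "b powr (p - 1) * b = b powr p" using b by (simp add: powr_diff)
  finally show ?thesis using powr_ge_zero[of a p] by linarith
qed

section \<open>Gradients on level sets, truncations and the Poincare inequality for W_0\<close>

context sobolev_domain begin

lemma W0_grad_integrable: assumes "W0_grad f G" shows "integrable M f" "integrable M G"
  using H0D[OF assms] Lp_integrable by auto

lemma comp_measurable:
  fixes F :: "real \<Rightarrow> 'b::topological_space"
  shows "F \<in> borel_measurable borel \<Longrightarrow> f \<in> borel_measurable M \<Longrightarrow> (\<lambda>x. F (f x)) \<in> borel_measurable M"
  by (rule measurable_compose[of f M borel F borel])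

lemma bounded_mult_integrable:
  fixes G :: "'a \<Rightarrow> 'b::euclidean_space" and c :: "'a \<Rightarrow> real"
  assumes "integrable M G" "c \<in> borel_measurable M" "\<And>x. \<bar>c x\<bar> \<le> C"
  shows "integrable M (\<lambda>x. c x *\<^sub>R G x)"
proof (rule Bochner_Integration.integrable_bound)
  show "integrable M (\<lambda>x. C * norm (G x))" using assms(1) by simp
  show "(\<lambda>x. c x *\<^sub>R G x) \<in> borel_measurable M" using assms by measurable
  show "AE x in M. norm (c x *\<^sub>R G x) \<le> norm (C * norm (G x))"
  proof (rule AE_I2)
    fix x show "norm (c x *\<^sub>R G x) \<le> norm (C * norm (G x))"
      using mult_right_mono[OF order_trans[OF assms(3)[of x] abs_ge_self[of C]], of "norm (G x)"] by (simp add: abs_mult)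
  qed
qed

lemma lipschitz_real:
  fixes F F' :: "real \<Rightarrow> real"
  assumes "\<And>s. DERIV F s :> F' s" "\<And>s. \<bar>F' s\<bar> \<le> C"
  shows "\<bar>F s - F t\<bar> \<le> C * \<bar>s - t\<bar>"
  using GDERIV_lipschitz[of F F' C s t] assms by simp

lemma C1_compose_integrable:
  assumes f: "W0_grad f G" and F: "\<And>s. DERIV F s :> F' s" "continuous_on UNIV F'" "\<And>s. \<bar>F' s\<bar> \<le> C"
  shows "integrable M (\<lambda>x. F (f x))" "integrable M (\<lambda>x. F' (f x) *\<^sub>R G x)"
proof -
  have Fc: "continuous_on UNIV F" by (intro continuous_at_imp_continuous_on ballI DERIV_isCont) (rule F(1))
  note fm = H0D(3)[OF f]
  note Fm = borel_measurable_continuous_onI[OF Fc] and F'm = borel_measurable_continuous_onI[OF F(2)]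
  show "integrable M (\<lambda>x. F' (f x) *\<^sub>R G x)"
    by (rule bounded_mult_integrable[OF W0_grad_integrable(2)[OF f] comp_measurable[OF F'm fm] F(3)])
  show "integrable M (\<lambda>x. F (f x))"
  proof (rule Bochner_Integration.integrable_bound)
    show "integrable M (\<lambda>x. \<bar>F 0\<bar> + C * \<bar>f x\<bar>)" using W0_grad_integrable(1)[OF f] integrable_const_dom[of "\<bar>F 0\<bar>"] by simp
    show "(\<lambda>x. F (f x)) \<in> borel_measurable M" by (rule comp_measurable[OF Fm fm])
    show "AE x in M. norm (F (f x)) \<le> norm (\<bar>F 0\<bar> + C * \<bar>f x\<bar>)"
    proof (rule AE_I2)
      fix x show "norm (F (f x)) \<le> norm (\<bar>F 0\<bar> + C * \<bar>f x\<bar>)"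
        using lipschitz_real[OF F(1,3), of "f x" 0] by simp
    qed
  qed
qed

text \<open>As \<open>F 0\<close> is arbitrary, the composition may leave W_0, and only its weak
  gradient is identified. The formula holds for test functions by integration by parts and survives
  convergence in L^1 of functions and gradients.\<close>

lemma weak_chain_C1:
  assumes f: "W0_grad f G" and F: "\<And>s. DERIV F s :> F' s" "continuous_on UNIV F'" "\<And>s. \<bar>F' s\<bar> \<le> C"
    and \<psi>: "\<psi> \<in> test_functions \<Omega>"
  shows "(LINT x|M. F (f x) *\<^sub>R grad \<psi> x) = - (LINT x|M. \<psi> x *\<^sub>R (F' (f x) *\<^sub>R G x))"
proof -
  have C0: "C \<ge> 0" using F(3)[of 0] by linarith
  obtain \<phi> where \<phi>: "\<And>n. \<phi> n \<in> test_functions \<Omega>" "Lp_tendsto \<phi> f" "Lp_tendsto (\<lambda>n. grad (\<phi> n)) G" "AE x in M. (\<lambda>n. \<phi> n x) \<longlonglongrightarrow> f x"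
    using H0E[OF f] by blast
  note ti = W0_grad_test[OF \<phi>(1)]
  note F'm = borel_measurable_continuous_onI[OF F(2)]
  have c: "(\<lambda>n. LINT x|M. norm (\<phi> n x - f x)) \<longlonglongrightarrow> 0" "(\<lambda>n. LINT x|M. norm (grad (\<phi> n) x - G x)) \<longlonglongrightarrow> 0"
    by (rule Lp_tendsto_L1[OF \<phi>(2) test_in_Lp(1)[OF \<phi>(1)] H0D(1)[OF f]], rule Lp_tendsto_L1[OF \<phi>(3) test_in_Lp(2)[OF \<phi>(1)] H0D(2)[OF f]])
  show ?thesis
  proof (rule has_weak_gradient_limit[OF _ _ _ _ _ _ _ \<psi>])
    fix n
    show "(LINT x|M. F (\<phi> n x) *\<^sub>R grad \<psi> x) = - (LINT x|M. \<psi> x *\<^sub>R (F' (\<phi> n x) *\<^sub>R grad (\<phi> n) x))"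
      by (rule integration_by_parts[OF GDERIV_DERIV_compose[OF test_GDERIV[OF \<phi>(1)] F(1)] _ \<psi> open_dom])
         (intro continuous_on_scaleR test_grad_continuous[OF \<phi>(1)] continuous_on_compose2[OF F(2) test_continuous[OF \<phi>(1)]], simp)
    show "integrable M (\<lambda>x. F (\<phi> n x))" "integrable M (\<lambda>x. F' (\<phi> n x) *\<^sub>R grad (\<phi> n) x)"
      by (rule C1_compose_integrable[OF ti F])+
  next
    show "integrable M (\<lambda>x. F (f x))" "integrable M (\<lambda>x. F' (f x) *\<^sub>R G x)"
      by (rule C1_compose_integrable[OF f F])+
    show "(\<lambda>n. LINT x|M. norm (F (\<phi> n x) - F (f x))) \<longlonglongrightarrow> 0"
    proof (rule Lim_null_comparison[OF always_eventually[OF allI]])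
      fix n
      have "(LINT x|M. norm (F (\<phi> n x) - F (f x))) \<le> (LINT x|M. C * norm (\<phi> n x - f x))"
        using lipschitz_real[OF F(1,3)]
        by (intro integral_mono integrable_norm Bochner_Integration.integrable_diff integrable_mult_right
            C1_compose_integrable(1)[OF f F] C1_compose_integrable(1)[OF ti F] W0_grad_integrable(1)[OF f] W0_grad_integrable(1)[OF ti]) auto
      then show "norm (LINT x|M. norm (F (\<phi> n x) - F (f x))) \<le> C * (LINT x|M. norm (\<phi> n x - f x))" by simp
      show "(\<lambda>n. C * (LINT x|M. norm (\<phi> n x - f x))) \<longlonglongrightarrow> 0"
        using tendsto_mult_left[OF c(1), of C] by simp
    qed
    show "(\<lambda>n. LINT x|M. norm (F' (\<phi> n x) *\<^sub>R grad (\<phi> n) x - F' (f x) *\<^sub>R G x)) \<longlonglongrightarrow> 0"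
    proof (rule Lim_null_comparison[OF always_eventually[OF allI]])
      fix n
      have m: "(\<lambda>x. F' (\<phi> n x)) \<in> borel_measurable M" for n by (rule comp_measurable[OF F'm H0D(3)[OF ti]])
      have i: "integrable M (\<lambda>x. F' (\<phi> n x) *\<^sub>R G x)" for n
        by (rule bounded_mult_integrable[OF W0_grad_integrable(2)[OF f] m F(3)])
      have i2: "integrable M (\<lambda>x. norm (grad (\<phi> n) x - G x))" for n
        by (intro integrable_norm Bochner_Integration.integrable_diff W0_grad_integrable(2)[OF f] W0_grad_integrable(2)[OF ti])
      have i3: "integrable M (\<lambda>x. norm (F' (\<phi> n x) *\<^sub>R G x - F' (f x) *\<^sub>R G x))" for n
        by (intro integrable_norm Bochner_Integration.integrable_diff i C1_compose_integrable(2)[OF f F])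
      have "(LINT x|M. norm (F' (\<phi> n x) *\<^sub>R grad (\<phi> n) x - F' (f x) *\<^sub>R G x))
        \<le> (LINT x|M. C * norm (grad (\<phi> n) x - G x) + norm (F' (\<phi> n x) *\<^sub>R G x - F' (f x) *\<^sub>R G x))"
      proof (rule integral_mono)
        show "integrable M (\<lambda>x. norm (F' (\<phi> n x) *\<^sub>R grad (\<phi> n) x - F' (f x) *\<^sub>R G x))"
          by (intro integrable_norm Bochner_Integration.integrable_diff C1_compose_integrable(2)[OF f F] C1_compose_integrable(2)[OF ti F])
        show "integrable M (\<lambda>x. C * norm (grad (\<phi> n) x - G x) + norm (F' (\<phi> n x) *\<^sub>R G x - F' (f x) *\<^sub>R G x))"
          by (intro Bochner_Integration.integrable_add integrable_mult_right i2 i3)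
        fix x
        have "F' (\<phi> n x) *\<^sub>R grad (\<phi> n) x - F' (f x) *\<^sub>R G x = F' (\<phi> n x) *\<^sub>R (grad (\<phi> n) x - G x) + (F' (\<phi> n x) *\<^sub>R G x - F' (f x) *\<^sub>R G x)"
          by (simp add: scaleR_diff_right)
        then have "norm (F' (\<phi> n x) *\<^sub>R grad (\<phi> n) x - F' (f x) *\<^sub>R G x) \<le> \<bar>F' (\<phi> n x)\<bar> * norm (grad (\<phi> n) x - G x) + norm (F' (\<phi> n x) *\<^sub>R G x - F' (f x) *\<^sub>R G x)"
          by (metis norm_scaleR norm_triangle_ineq)
        also have "\<dots> \<le> C * norm (grad (\<phi> n) x - G x) + norm (F' (\<phi> n x) *\<^sub>R G x - F' (f x) *\<^sub>R G x)"
          by (intro add_right_mono mult_right_mono F(3)) auto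
        finally show "norm (F' (\<phi> n x) *\<^sub>R grad (\<phi> n) x - F' (f x) *\<^sub>R G x) \<le> C * norm (grad (\<phi> n) x - G x) + norm (F' (\<phi> n x) *\<^sub>R G x - F' (f x) *\<^sub>R G x)" .
      qed
      also have "\<dots> = C * (LINT x|M. norm (grad (\<phi> n) x - G x)) + (LINT x|M. norm (F' (\<phi> n x) *\<^sub>R G x - F' (f x) *\<^sub>R G x))"
        using i2 i3 by simp
      finally show "norm (LINT x|M. norm (F' (\<phi> n x) *\<^sub>R grad (\<phi> n) x - F' (f x) *\<^sub>R G x)) \<le> \<dots>" by simp
      have "(\<lambda>n. LINT x|M. norm (F' (\<phi> n x) *\<^sub>R G x - F' (f x) *\<^sub>R G x)) \<longlonglongrightarrow> 0"
      proof (rule L1_tendsto_dominated)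
        show "integrable M (\<lambda>x. 2 * C * norm (G x))" using W0_grad_integrable(2)[OF f] by simp
        show "(\<lambda>x. F' (\<phi> n x) *\<^sub>R G x) \<in> borel_measurable M" for n using i by (rule borel_measurable_integrable)
        show "(\<lambda>x. F' (f x) *\<^sub>R G x) \<in> borel_measurable M"
          using C1_compose_integrable(2)[OF f F] by (rule borel_measurable_integrable)
        show "AE x in M. norm (F' (\<phi> n x) *\<^sub>R G x - F' (f x) *\<^sub>R G x) \<le> 2 * C * norm (G x)" for n
        proof (rule AE_I2)
          fix x
          have "\<bar>F' (\<phi> n x) - F' (f x)\<bar> \<le> 2 * C" using F(3)[of "\<phi> n x"] F(3)[of "f x"] by linarith
          then show "norm (F' (\<phi> n x) *\<^sub>R G x - F' (f x) *\<^sub>R G x) \<le> 2 * C * norm (G x)"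
            unfolding scaleR_diff_left[symmetric] norm_scaleR by (intro mult_right_mono) auto
        qed
        show "AE x in M. (\<lambda>n. F' (\<phi> n x) *\<^sub>R G x) \<longlonglongrightarrow> F' (f x) *\<^sub>R G x"
          using \<phi>(4) by eventually_elim
            (intro tendsto_scaleR tendsto_const continuous_on_tendsto_compose[OF F(2)], auto)
      qed
      with tendsto_mult_left[OF c(2), of C]
      show "(\<lambda>n. C * (LINT x|M. norm (grad (\<phi> n) x - G x)) + (LINT x|M. norm (F' (\<phi> n x) *\<^sub>R G x - F' (f x) *\<^sub>R G x))) \<longlonglongrightarrow> 0"
        using tendsto_add by fastforce
    qed
  qed
qed

text \<open>The indicator of \<open>U\<close> is a limit of continuous functions g_j below it. A
  primitive of g_j is bounded by the measure of \<open>U\<close>, and integration by parts moves the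
  gradient from this primitive of \<open>f\<close> onto \<open>\<psi>\<close>.\<close>

lemma gradient_on_small_level_set:
  assumes f: "W0_grad f G" and U: "open U" "U \<in> lmeasurable" "measure lebesgue U \<le> e" and \<psi>: "\<psi> \<in> test_functions \<Omega>"
  shows "norm (LINT x|M. \<psi> x *\<^sub>R (indicator U (f x) *\<^sub>R G x)) \<le> e * (LINT x|M. norm (grad \<psi> x))"
proof -
  note fm = H0D(3)[OF f] and Gi = W0_grad_integrable(2)[OF f]
  obtain C where C: "C > 0" "\<And>x. \<bar>\<psi> x\<bar> \<le> C" "\<And>x. norm (grad \<psi> x) \<le> C"
    "\<psi> \<in> borel_measurable M" "grad \<psi> \<in> borel_measurable M"
    using test_grad_bounded_borel[OF \<psi>] by blast
  have e: "e \<ge> 0" using U(3) measure_nonneg[of lebesgue U] by linarith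
  \<comment> \<open>By convention \<open>infdist\<close> to the empty set is 0, so the functions g_j
    below could not reach 1 if \<open>U\<close> were everything; finite measure excludes
    this.\<close>
  have ne: "- U \<noteq> {}"
  proof
    assume "- U = {}"
    then have "U = UNIV" by auto
    then show False using U(2) by (simp add: fmeasurable_def)
  qed
  define g where "g j s = min 1 (real j * infdist s (- U))" for j s
  have g: "0 \<le> g j s" "g j s \<le> 1" "g j s \<le> indicator U s" for j s
    using ne by (auto simp: g_def infdist_nonneg indicator_def)
  have gc: "continuous_on UNIV (g j)" for j
    unfolding g_def[abs_def] by (intro continuous_intros)
  have lim: "(\<lambda>j. g j s) \<longlonglongrightarrow> indicator U s" for s
  proof (cases "s \<in> U")
    case True
    have "infdist s (- U) \<noteq> 0"
      using True U(1) in_closed_iff_infdist_zero[of "- U" s] ne by auto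
    then have d: "infdist s (- U) > 0" using infdist_nonneg[of s "- U"] by linarith
    obtain N where N: "1 / infdist s (- U) < real N" using reals_Archimedean2 by blast
    have "g j s = 1" if "j \<ge> N" for j
    proof -
      have "1 < real N * infdist s (- U)" using N d by (simp add: field_simps)
      also have "\<dots> \<le> real j * infdist s (- U)" using that d by (intro mult_right_mono) auto
      finally show ?thesis by (simp add: g_def)
    qed
    then have "\<forall>\<^sub>F j in sequentially. g j s = indicator U s" using True by (auto simp: eventually_sequentially)
    then show ?thesis by (rule tendsto_eventually)
  next
    case False
    then have "g j s = 0" for j using g(1,3)[of j s] by simp
    then show ?thesis using False by simp
  qed
  have bd: "norm (LINT x|M. \<psi> x *\<^sub>R (g j (f x) *\<^sub>R G x)) \<le> e * (LINT x|M. norm (grad \<psi> x))" for j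
  proof -
    obtain F where F: "\<And>t. DERIV F t :> g j t" "F 0 = 0" using antiderivative_UNIV[OF gc] by blast
    have Fb: "\<bar>F t\<bar> \<le> e" for t using antiderivative_bound[OF F(1) g(1,3) U(2,3), of t 0] F(2) by simp
    have ab: "\<bar>g j s\<bar> \<le> 1" for s using g[of j s] by simp
    have "norm (LINT x|M. \<psi> x *\<^sub>R (g j (f x) *\<^sub>R G x)) = norm (LINT x|M. F (f x) *\<^sub>R grad \<psi> x)"
      using weak_chain_C1[OF f F(1) gc ab \<psi>] by simp
    also have "\<dots> \<le> (LINT x|M. norm (F (f x) *\<^sub>R grad \<psi> x))" by (rule integral_norm_bound)
    also have "\<dots> \<le> (LINT x|M. e * norm (grad \<psi> x))"
    proof (rule integral_mono)
      show "integrable M (\<lambda>x. e * norm (grad \<psi> x))"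
        using W0_grad_integrable(2)[OF W0_grad_test[OF \<psi>]] by simp
      have "(\<lambda>x. F (f x)) \<in> borel_measurable M"
        using C1_compose_integrable(1)[OF f F(1) gc ab] by (rule borel_measurable_integrable)
      then show "integrable M (\<lambda>x. norm (F (f x) *\<^sub>R grad \<psi> x))"
        by (intro integrable_norm bounded_mult_integrable[OF W0_grad_integrable(2)[OF W0_grad_test[OF \<psi>]] _ Fb])
      show "norm (F (f x) *\<^sub>R grad \<psi> x) \<le> e * norm (grad \<psi> x)" for x
        using mult_right_mono[OF Fb[of "f x"], of "norm (grad \<psi> x)"] by simp
    qed
    finally show ?thesis by simp
  qed
  have "(\<lambda>j. LINT x|M. \<psi> x *\<^sub>R (g j (f x) *\<^sub>R G x)) \<longlonglongrightarrow> (LINT x|M. \<psi> x *\<^sub>R (indicator U (f x) *\<^sub>R G x))"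
  proof (rule integral_dominated_convergence)
    show "integrable M (\<lambda>x. C * norm (G x))" using Gi by simp
    have gm: "(\<lambda>x. g j (f x)) \<in> borel_measurable M" for j
      by (rule comp_measurable[OF borel_measurable_continuous_onI[OF gc] fm])
    show "(\<lambda>x. \<psi> x *\<^sub>R (g j (f x) *\<^sub>R G x)) \<in> borel_measurable M" for j
      by (intro borel_measurable_scaleR C(4) gm borel_measurable_integrable Gi)
    have "(\<lambda>x. indicat_real U (f x)) \<in> borel_measurable M"
      by (rule comp_measurable[OF _ fm]) (use U(1) in auto)
    then show "(\<lambda>x. \<psi> x *\<^sub>R (indicat_real U (f x) *\<^sub>R G x)) \<in> borel_measurable M"
      by (intro borel_measurable_scaleR C(4) borel_measurable_integrable[OF Gi])
    show "AE x in M. (\<lambda>j. \<psi> x *\<^sub>R (g j (f x) *\<^sub>R G x)) \<longlonglongrightarrow> \<psi> x *\<^sub>R (indicator U (f x) *\<^sub>R G x)"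
      by (intro AE_I2 tendsto_scaleR tendsto_const lim)
    show "AE x in M. norm (\<psi> x *\<^sub>R (g j (f x) *\<^sub>R G x)) \<le> C * norm (G x)" for j
    proof (rule AE_I2)
      fix x
      have "\<bar>\<psi> x\<bar> * \<bar>g j (f x)\<bar> \<le> C * 1" using C g[of j "f x"] by (intro mult_mono) auto
      then have "(\<bar>\<psi> x\<bar> * \<bar>g j (f x)\<bar>) * norm (G x) \<le> (C * 1) * norm (G x)" by (rule mult_right_mono) simp
      then show "norm (\<psi> x *\<^sub>R (g j (f x) *\<^sub>R G x)) \<le> C * norm (G x)" by (simp add: abs_mult)
    qed
  qed
  from tendsto_norm[OF this] show ?thesis
    by (rule LIMSEQ_le_const2) (use bd in blast)
qed

text \<open>\<open>Z\<close> is enclosed in open sets of measure tending to 0, and the bound on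
  small level sets passes to the limit. The statement is proved for their intersection
  \<open>W\<close>, which is Borel; the preimage of the Lebesgue null set \<open>Z\<close> itself
  could fail to be measurable.\<close>

lemma gradient_zero_on_null_level_set:
  assumes f: "W0_grad f G" and Z: "Z \<in> null_sets lebesgue"
  shows "AE x in M. f x \<in> Z \<longrightarrow> G x = 0"
proof -
  note fm = H0D(3)[OF f] and Gi = W0_grad_integrable(2)[OF f]
  have Zs: "Z \<in> sets lebesgue" "emeasure lebesgue Z = 0" using Z by auto
  have "\<exists>T. open T \<and> Z \<subseteq> T \<and> emeasure lebesgue T \<le> ennreal (1 / real (Suc n))" for n
  proof -
    have "(1 / real (Suc n)) > 0" by simp
    then obtain T where T: "open T" "Z \<subseteq> T" "T - Z \<in> lmeasurable" "emeasure lebesgue (T - Z) < ennreal (1 / real (Suc n))"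
      using sets_lebesgue_outer_open[OF Zs(1)] by metis
    have Ts: "T \<in> sets lebesgue" using T(1) by auto
    have "emeasure lebesgue T \<le> emeasure lebesgue (T - Z) + emeasure lebesgue Z"
      using emeasure_subadditive[OF fmeasurableD[OF T(3)] Zs(1)] T(2) by (simp add: Un_absorb2)
    then have "emeasure lebesgue T \<le> ennreal (1 / real (Suc n))" using T(4) Zs(2) by simp
    then show ?thesis using T by blast
  qed
  then have "\<forall>n. \<exists>T. open T \<and> Z \<subseteq> T \<and> emeasure lebesgue T \<le> ennreal (1 / real (Suc n))" by blast
  from choice[OF this] obtain T where T: "\<And>n. open (T n)" "\<And>n. Z \<subseteq> T n" "\<And>n. emeasure lebesgue (T n) \<le> ennreal (1 / real (Suc n))"
    by blast
  \<comment> \<open>Finite intersections make the open sets decrease, so that their indicators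
    converge pointwise to that of \<open>W\<close>.\<close>
  define U where "U n = (\<Inter>i\<le>n. T i)" for n
  define W where "W = (\<Inter>n. T n)"
  have Uo: "open (U n)" for n unfolding U_def using T(1) by auto
  have Ue: "emeasure lebesgue (U n) \<le> ennreal (1 / real (Suc n))" for n
  proof -
    have "U n \<subseteq> T n" unfolding U_def by auto
    then have "emeasure lebesgue (U n) \<le> emeasure lebesgue (T n)" using T(1) by (intro emeasure_mono) auto
    then show ?thesis using T(3) order_trans by blast
  qed
  have Ul: "U n \<in> lmeasurable" for n
  proof (rule fmeasurableI)
    show "emeasure lebesgue (U n) < \<infinity>" using Ue[of n] ennreal_less_top le_less_trans infinity_ennreal_def by metis
  qed (use Uo in auto)
  have Um: "measure lebesgue (U n) \<le> 1 / real (Suc n)" for n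
    unfolding measure_def using enn2real_mono[OF Ue[of n]] by simp
  have Wb: "W \<in> sets borel" unfolding W_def using T(1) by (intro sets.countable_INT) auto
  have Wm: "(\<lambda>x. indicat_real W (f x)) \<in> borel_measurable M"
    by (rule comp_measurable[OF _ fm]) (use Wb in auto)
  have iW: "integrable M (\<lambda>x. indicat_real W (f x) *\<^sub>R G x)"
    by (rule bounded_mult_integrable[OF Gi Wm, of 1]) simp
  have "AE x in M. indicat_real W (f x) *\<^sub>R G x = 0"
  proof (rule fundamental_lemma[OF open_dom integrable_imp_locally_integrable[OF iW]])
    fix \<psi> assume \<psi>: "\<psi> \<in> test_functions \<Omega>"
    obtain C where C: "C > 0" "\<And>x. \<bar>\<psi> x\<bar> \<le> C" "\<And>x. norm (grad \<psi> x) \<le> C"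
      "\<psi> \<in> borel_measurable M" "grad \<psi> \<in> borel_measurable M"
      using test_grad_bounded_borel[OF \<psi>] by blast
    let ?I = "\<lambda>n. LINT x|M. \<psi> x *\<^sub>R (indicat_real (U n) (f x) *\<^sub>R G x)"
    have "?I \<longlonglongrightarrow> (LINT x|M. \<psi> x *\<^sub>R (indicat_real W (f x) *\<^sub>R G x))"
    proof (rule integral_dominated_convergence)
      show "integrable M (\<lambda>x. C * norm (G x))" using Gi by simp
      show "(\<lambda>x. \<psi> x *\<^sub>R (indicat_real W (f x) *\<^sub>R G x)) \<in> borel_measurable M"
        by (intro borel_measurable_scaleR C(4) Wm borel_measurable_integrable Gi)
      have "(\<lambda>x. indicat_real (U n) (f x)) \<in> borel_measurable M" for n
        by (rule comp_measurable[OF _ fm]) (use Uo in auto)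
      then show "(\<lambda>x. \<psi> x *\<^sub>R (indicat_real (U n) (f x) *\<^sub>R G x)) \<in> borel_measurable M" for n
        by (intro borel_measurable_scaleR C(4) borel_measurable_integrable[OF Gi])
      have "(\<lambda>n. indicat_real (U n) s) \<longlonglongrightarrow> indicat_real W s" for s
      proof (cases "s \<in> W")
        case True
        then have "s \<in> U n" for n by (auto simp: U_def W_def)
        then show ?thesis using True by simp
      next
        case False
        then obtain N where "s \<notin> T N" by (auto simp: W_def)
        then have "s \<notin> U n" if "n \<ge> N" for n using that by (auto simp: U_def)
        then have "\<forall>\<^sub>F n in sequentially. indicat_real (U n) s = indicat_real W s" 
          using False unfolding eventually_sequentially by (intro exI[of _ N]) simp
        then show ?thesis by (rule tendsto_eventually)
      qed
      then show "AE x in M. (\<lambda>n. \<psi> x *\<^sub>R (indicat_real (U n) (f x) *\<^sub>R G x)) \<longlonglongrightarrow> \<psi> x *\<^sub>R (indicat_real W (f x) *\<^sub>R G x)"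
        by (intro AE_I2 tendsto_scaleR tendsto_const)
      show "AE x in M. norm (\<psi> x *\<^sub>R (indicat_real (U n) (f x) *\<^sub>R G x)) \<le> C * norm (G x)" for n
      proof (rule AE_I2)
        fix x
        have "\<bar>\<psi> x\<bar> * \<bar>indicat_real (U n) (f x)\<bar> \<le> C * 1" using C by (intro mult_mono) auto
        then have "(\<bar>\<psi> x\<bar> * \<bar>indicat_real (U n) (f x)\<bar>) * norm (G x) \<le> (C * 1) * norm (G x)" by (rule mult_right_mono) simp
        then show "norm (\<psi> x *\<^sub>R (indicat_real (U n) (f x) *\<^sub>R G x)) \<le> C * norm (G x)" by (simp add: abs_mult)
      qed
    qed
    moreover have "?I \<longlonglongrightarrow> 0"
    proof (rule Lim_null_comparison[OF always_eventually[OF allI]])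
      show "norm (?I n) \<le> 1 / real (Suc n) * (LINT x|M. norm (grad \<psi> x))" for n
        by (rule gradient_on_small_level_set[OF f Uo Ul Um \<psi>])
      have "(\<lambda>n. 1 / real (Suc n) * (LINT x|M. norm (grad \<psi> x))) \<longlonglongrightarrow> 0 * (LINT x|M. norm (grad \<psi> x))"
        using LIMSEQ_inverse_real_of_nat by (intro tendsto_mult tendsto_const) (simp add: inverse_eq_divide)
      then show "(\<lambda>n. 1 / real (Suc n) * (LINT x|M. norm (grad \<psi> x))) \<longlonglongrightarrow> 0" by simp
    qed
    ultimately show "(LINT x|M. \<psi> x *\<^sub>R (indicat_real W (f x) *\<^sub>R G x)) = 0" by (rule LIMSEQ_unique)
  qed
  then show ?thesis
  proof eventually_elim
    case (elim x)
    show ?case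
    proof
      assume "f x \<in> Z"
      then have "f x \<in> W" using T(2) unfolding W_def by blast
      then show "G x = 0" using elim by simp
    qed
  qed
qed

text \<open>The truncation is (|s + k| - |s - k|)/2. Smoothing both absolute values by a square root
  gives functions to which \<open>weak_chain_C1\<close> applies, with uniformly bounded derivatives
  converging everywhere.\<close>

lemma weak_grad_truncation:
  assumes f: "W0_grad f G" and k: "k > 0"
  shows "AE x in M. weak_grad \<Omega> (\<lambda>x. max (- k) (min (f x) k)) x = indicator {s. \<bar>s\<bar> \<le> k} (f x) *\<^sub>R G x"
proof -
  note fm = H0D(3)[OF f] and Gi = W0_grad_integrable(2)[OF f] and fi = W0_grad_integrable(1)[OF f]
  define d where "d n = 1 / real (Suc n)" for n
  have d: "d n > 0" for n by (simp add: d_def)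
  have d0: "d \<longlonglongrightarrow> 0" unfolding d_def using LIMSEQ_inverse_real_of_nat by (simp add: inverse_eq_divide)
  define F where "F n s = (sqrt ((s + k)\<^sup>2 + d n) - sqrt ((s - k)\<^sup>2 + d n)) / 2" for n s
  define F' where "F' n s = ((s + k) / sqrt ((s + k)\<^sup>2 + d n) - (s - k) / sqrt ((s - k)\<^sup>2 + d n)) / 2" for n s
  define T where "T s = max (- k) (min s k)" for s
  define T' where "T' s = (sgn (s + k) - sgn (s - k)) / 2" for s
  have pos: "y\<^sup>2 + d n > 0" for y n using d[of n] by (simp add: add_nonneg_pos)
  have dF: "DERIV (F n) s :> F' n s" for n s
  proof -
    have "DERIV (\<lambda>s. sqrt ((s + c)\<^sup>2 + d n)) s :> (s + c) / sqrt ((s + c)\<^sup>2 + d n)" for c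
      using pos[of "s + c" n] by (auto intro!: derivative_eq_intros simp: divide_simps)
    from this[of k] this[of "-k"] show ?thesis unfolding F_def[abs_def] F'_def
      by (intro DERIV_cdivide DERIV_diff) auto
  qed
  have cF': "continuous_on UNIV (F' n)" for n
  proof -
    have "sqrt (y\<^sup>2 + d n) \<noteq> 0" for y using pos[of y n] by simp
    then show ?thesis unfolding F'_def[abs_def] by (intro continuous_intros) auto
  qed
  have bF': "\<bar>F' n s\<bar> \<le> 1" for n s unfolding F'_def by (rule sqrt_diff_bound[OF d])
  have F0: "F n 0 = 0" for n by (simp add: F_def)
  have bF: "\<bar>F n s\<bar> \<le> \<bar>s\<bar>" for n s using lipschitz_real[OF dF bF', of n s 0] F0 by simp
  have limF: "(\<lambda>n. F n s) \<longlonglongrightarrow> T s" for s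
  proof -
    have "(\<lambda>n. F n s) \<longlonglongrightarrow> (sqrt ((s + k)\<^sup>2 + 0) - sqrt ((s - k)\<^sup>2 + 0)) / 2"
      unfolding F_def by (intro tendsto_intros d0) simp
    also have "(sqrt ((s + k)\<^sup>2 + 0) - sqrt ((s - k)\<^sup>2 + 0)) / 2 = T s"
      using k by (auto simp: T_def max_def min_def abs_if)
    finally show ?thesis .
  qed
  have limF': "(\<lambda>n. F' n s) \<longlonglongrightarrow> T' s" for s
  proof -
    have *: "(\<lambda>n. y / sqrt (y\<^sup>2 + d n)) \<longlonglongrightarrow> sgn y" for y
    proof (cases "y = 0")
      case False
      have "(\<lambda>n. y / sqrt (y\<^sup>2 + d n)) \<longlonglongrightarrow> y / sqrt (y\<^sup>2 + 0)"
        using False by (intro tendsto_intros d0) auto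
      then show ?thesis using False by (simp add: real_sgn_eq)
    qed simp
    show ?thesis unfolding F'_def T'_def by (intro tendsto_divide tendsto_diff tendsto_const *) simp
  qed
  have Tb: "\<bar>T s\<bar> \<le> \<bar>s\<bar>" for s using k by (auto simp: T_def)
  have T'b: "\<bar>T' s\<bar> \<le> 1" for s by (auto simp: T'_def sgn_if)
  have Tm: "(\<lambda>x. T (f x)) \<in> borel_measurable M" unfolding T_def using fm by measurable
  have T'm: "(\<lambda>x. T' (f x)) \<in> borel_measurable M" unfolding T'_def sgn_if using fm by measurable
  have iT: "integrable M (\<lambda>x. T (f x))"
    by (rule Bochner_Integration.integrable_bound[OF fi Tm]) (use Tb in auto)
  have iT': "integrable M (\<lambda>x. T' (f x) *\<^sub>R G x)" by (rule bounded_mult_integrable[OF Gi T'm T'b])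
  have "has_weak_gradient \<Omega> (\<lambda>x. T (f x)) (\<lambda>x. T' (f x) *\<^sub>R G x)"
    unfolding has_weak_gradient_def
  proof (intro conjI ballI integrable_imp_locally_integrable iT iT')
    fix \<psi> assume \<psi>: "\<psi> \<in> test_functions \<Omega>"
    show "(LINT x|M. T (f x) *\<^sub>R grad \<psi> x) = - (LINT x|M. \<psi> x *\<^sub>R (T' (f x) *\<^sub>R G x))"
    proof (rule has_weak_gradient_limit[OF weak_chain_C1[OF f dF cF' bF'] C1_compose_integrable(1)[OF f dF cF' bF'] iT _
             C1_compose_integrable(2)[OF f dF cF' bF'] iT' _ \<psi>])
      note i1 = borel_measurable_integrable[OF C1_compose_integrable(1)[OF f dF cF' bF']]
      note i2 = borel_measurable_integrable[OF C1_compose_integrable(2)[OF f dF cF' bF']]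
      show "(\<lambda>n. LINT x|M. norm (F n (f x) - T (f x))) \<longlonglongrightarrow> 0"
      proof (rule L1_tendsto_dominated[OF i1 Tm])
        show "integrable M (\<lambda>x. 2 * \<bar>f x\<bar>)" using fi by simp
        show "AE x in M. norm (F n (f x) - T (f x)) \<le> 2 * \<bar>f x\<bar>" for n
        proof (rule AE_I2)
          fix x show "norm (F n (f x) - T (f x)) \<le> 2 * \<bar>f x\<bar>" using bF[of n "f x"] Tb[of "f x"] unfolding real_norm_def by linarith
        qed
      qed (intro AE_I2 limF)
      show "(\<lambda>n. LINT x|M. norm (F' n (f x) *\<^sub>R G x - T' (f x) *\<^sub>R G x)) \<longlonglongrightarrow> 0"
      proof (rule L1_tendsto_dominated[OF i2 borel_measurable_integrable[OF iT']])
        show "integrable M (\<lambda>x. 2 * norm (G x))" using Gi by simp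
        show "AE x in M. norm (F' n (f x) *\<^sub>R G x - T' (f x) *\<^sub>R G x) \<le> 2 * norm (G x)" for n
        proof (rule AE_I2)
          fix x
          have "\<bar>F' n (f x) - T' (f x)\<bar> \<le> 2" using bF'[of n "f x"] T'b[of "f x"] by linarith
          then show "norm (F' n (f x) *\<^sub>R G x - T' (f x) *\<^sub>R G x) \<le> 2 * norm (G x)"
            unfolding scaleR_diff_left[symmetric] norm_scaleR by (intro mult_right_mono) auto
        qed
      qed (intro AE_I2 tendsto_scaleR tendsto_const limF')
    qed
  qed
  from weak_grad_eq[OF this]
  have 1: "AE x in M. weak_grad \<Omega> (\<lambda>x. max (- k) (min (f x) k)) x = T' (f x) *\<^sub>R G x" by (simp add: T_def)
  \<comment> \<open>The limit derivative is 1/2 instead of 1 at s = k and s = -k. This is harmless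
    because the gradient vanishes on these two level sets.\<close>
  have "{k, -k} \<in> null_sets lebesgue" by (simp add: negligible_iff_null_sets[symmetric])
  from gradient_zero_on_null_level_set[OF f this] 1 show ?thesis
  proof eventually_elim
    case (elim x)
    have "T' (f x) = indicator {s. \<bar>s\<bar> \<le> k} (f x)" if "f x \<noteq> k" "f x \<noteq> - k"
      using that k by (auto simp: T'_def indicator_def sgn_if)
    then show ?case using elim by (cases "f x \<in> {k, -k}") auto
  qed
qed

text \<open>The gradient of the compactly supported function (x . e) |phi|^p, for a unit coordinate
  vector e, has integral zero. Its component along e consists of |phi|^p and a term containing the
  gradient of phi, in which the coordinate is bounded on the domain.\<close>

lemma test_poincare:
  obtains C where "C > 0" "\<And>\<phi>. \<phi> \<in> test_functions \<Omega> \<Longrightarrow>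
    (LINT x|M. \<bar>\<phi> x\<bar> powr p) \<le> C * (LINT x|M. norm (grad \<phi> x) powr p)"
proof -
  obtain R where R: "R > 0" "\<And>x. x \<in> \<Omega> \<Longrightarrow> norm x \<le> R" using bounded_dom bounded_pos by blast
  \<comment> \<open>The constant delivered by \<open>young_absorb\<close>. Moving half of the
    integral of |phi|^p to the left-hand side doubles it.\<close>
  define C where "C = R * p * (2 * R * p) powr (p - 1)"
  have C: "C > 0" using R p_gt_1 by (simp add: C_def)
  obtain e :: 'a where e: "e \<in> Basis" by (metis SOME_Basis)
  have "(LINT x|M. \<bar>\<phi> x\<bar> powr p) \<le> 2 * C * (LINT x|M. norm (grad \<phi> x) powr p)" if \<phi>: "\<phi> \<in> test_functions \<Omega>" for \<phi>
  proof -
    obtain K where K: "compact K" "K \<subseteq> \<Omega>" "\<And>x. x \<notin> K \<Longrightarrow> \<phi> x = 0" "\<And>x. x \<notin> K \<Longrightarrow> grad \<phi> x = 0"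
      using test_functionsE[OF \<phi>] by blast
    note cp = test_continuous[OF \<phi>] and cg = test_grad_continuous[OF \<phi>]
    let ?A = "\<lambda>x. (x \<bullet> e) *\<^sub>R (abs_powr_deriv p (\<phi> x) *\<^sub>R grad \<phi> x)" and ?B = "\<lambda>x. (\<bar>\<phi> x\<bar> powr p) *\<^sub>R e"
    have c1: "continuous_on UNIV (\<lambda>x. \<bar>\<phi> x\<bar> powr p)"
      using p_gt_1 by (intro continuous_on_powr' continuous_intros cp) auto
    have c2: "continuous_on UNIV (\<lambda>x. norm (grad \<phi> x) powr p)"
      using p_gt_1 by (intro continuous_on_powr' continuous_intros cg) auto
    have c3: "continuous_on UNIV (\<lambda>x. ?A x \<bullet> e)"
      by (intro continuous_intros cg continuous_on_compose2[OF continuous_abs_powr_deriv[OF p_gt_1] cp]) auto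
    have d: "GDERIV (\<lambda>x. (x \<bullet> e) * \<bar>\<phi> x\<bar> powr p) x :> ?A x + ?B x" for x
    proof (rule GDERIV_mult)
      show "GDERIV (\<lambda>x. x \<bullet> e) x :> e" by (auto simp: gderiv_def intro!: derivative_eq_intros)
      show "GDERIV (\<lambda>x. \<bar>\<phi> x\<bar> powr p) x :> abs_powr_deriv p (\<phi> x) *\<^sub>R grad \<phi> x"
        by (rule GDERIV_DERIV_compose[OF test_GDERIV[OF \<phi>] DERIV_abs_powr[OF p_gt_1]])
    qed
    have i1: "integrable lborel (\<lambda>x. \<bar>\<phi> x\<bar> powr p)"
      by (rule integrable_continuous_compact_support[OF c1 K(1)]) (simp add: K)
    have i2: "integrable lborel (\<lambda>x. norm (grad \<phi> x) powr p)"
      by (rule integrable_continuous_compact_support[OF c2 K(1)]) (simp add: K)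
    have i3: "integrable lborel (\<lambda>x. ?A x \<bullet> e)"
      by (rule integrable_continuous_compact_support[OF c3 K(1)]) (simp add: K)
    have cD: "continuous_on UNIV (\<lambda>x. ?A x + ?B x)"
      by (intro continuous_intros cg c1 continuous_on_compose2[OF continuous_abs_powr_deriv[OF p_gt_1] cp]) auto
    have i4: "integrable lborel (\<lambda>x. ?A x + ?B x)" and z: "(LINT x|lborel. ?A x + ?B x) = 0"
      using integral_gradient_zero[OF d cD K(1)] K(3) by auto
    have "(LINT x|lborel. (?A x + ?B x) \<bullet> e) = (LINT x|lborel. ?A x + ?B x) \<bullet> e"
      by (rule integral_inner_left) (rule i4)
    also have "(\<lambda>x. (?A x + ?B x) \<bullet> e) = (\<lambda>x. ?A x \<bullet> e + \<bar>\<phi> x\<bar> powr p)"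
      using e by (simp add: inner_add_left fun_eq_iff)
    finally have "(LINT x|lborel. \<bar>\<phi> x\<bar> powr p) = - (LINT x|lborel. ?A x \<bullet> e)"
      unfolding z Bochner_Integration.integral_add[OF i3 i1] by simp
    also have "\<dots> = (LINT x|lborel. - (?A x \<bullet> e))" by simp
    also have "\<dots> \<le> (LINT x|lborel. \<bar>\<phi> x\<bar> powr p / 2 + C * norm (grad \<phi> x) powr p)"
    proof (rule integral_mono)
      show "integrable lborel (\<lambda>x. - (?A x \<bullet> e))" by (rule Bochner_Integration.integrable_minus[OF i3])
      show "integrable lborel (\<lambda>x. \<bar>\<phi> x\<bar> powr p / 2 + C * norm (grad \<phi> x) powr p)"
        by (intro Bochner_Integration.integrable_add integrable_divide integrable_mult_right i1 i2)
      fix x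
      show "- (?A x \<bullet> e) \<le> \<bar>\<phi> x\<bar> powr p / 2 + C * norm (grad \<phi> x) powr p"
      proof (cases "x \<in> K")
        case True
        have x: "\<bar>x \<bullet> e\<bar> \<le> R" using Basis_le_norm[OF e, of x] R(2)[of x] K(2) True by force
        have "- (?A x \<bullet> e) \<le> \<bar>x \<bullet> e\<bar> * \<bar>abs_powr_deriv p (\<phi> x)\<bar> * \<bar>grad \<phi> x \<bullet> e\<bar>"
          using abs_ge_minus_self[of "?A x \<bullet> e"] by (simp add: abs_mult mult.assoc)
        also have "\<dots> \<le> R * (p * \<bar>\<phi> x\<bar> powr (p - 1)) * norm (grad \<phi> x)"
          using x Basis_le_norm[OF e, of "grad \<phi> x"] R(1) p_gt_1 
          by (intro mult_mono) (auto simp: abs_abs_powr_deriv)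
        also have "\<dots> \<le> \<bar>\<phi> x\<bar> powr p / 2 + C * norm (grad \<phi> x) powr p"
          unfolding C_def by (rule young_absorb) (use R p_gt_1 in auto)
        finally show ?thesis .
      next
        case False
        then show ?thesis using K(3,4) by simp
      qed
    qed
    also have "\<dots> = (LINT x|lborel. \<bar>\<phi> x\<bar> powr p) / 2 + C * (LINT x|lborel. norm (grad \<phi> x) powr p)"
      using i1 i2 by simp
    finally have "(LINT x|lborel. \<bar>\<phi> x\<bar> powr p) \<le> 2 * C * (LINT x|lborel. norm (grad \<phi> x) powr p)" by simp
    moreover have "(LINT x|M. \<bar>\<phi> x\<bar> powr p) = (LINT x|lborel. \<bar>\<phi> x\<bar> powr p)"
      by (rule integral_lebesgue_on_zero_outside[OF borel_measurable_continuous_onI[OF c1] dom_sets]) (use K in auto)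
    moreover have "(LINT x|M. norm (grad \<phi> x) powr p) = (LINT x|lborel. norm (grad \<phi> x) powr p)"
      by (rule integral_lebesgue_on_zero_outside[OF borel_measurable_continuous_onI[OF c2] dom_sets]) (use K in auto)
    ultimately show ?thesis by simp
  qed
  then show ?thesis using C by (intro that[of "2 * C"]) auto
qed

text \<open>Passage from test functions to the closure. Each factor 2^p comes from splitting off an
  approximation error, once for the function and once for the gradient; the errors themselves vanish
  in the limit.\<close>

lemma poincare:
  obtains C where "C > 0" "\<And>f G. W0_grad f G \<Longrightarrow> (LINT x|M. \<bar>f x\<bar> powr p) \<le> C * (LINT x|M. norm (G x) powr p)"
proof -
  obtain C where C: "C > 0" "\<And>\<phi>. \<phi> \<in> test_functions \<Omega> \<Longrightarrow>
    (LINT x|M. \<bar>\<phi> x\<bar> powr p) \<le> C * (LINT x|M. norm (grad \<phi> x) powr p)"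
    using test_poincare by blast
  have "(LINT x|M. \<bar>f x\<bar> powr p) \<le> 2 powr p * (C * 2 powr p) * (LINT x|M. norm (G x) powr p)" if H: "W0_grad f G" for f G
  proof -
    obtain \<phi> where \<phi>: "\<And>n. \<phi> n \<in> test_functions \<Omega>" "Lp_tendsto \<phi> f" "Lp_tendsto (\<lambda>n. grad (\<phi> n)) G"
      using H by (auto simp: W0_grad_def)
    have split: "(LINT x|M. norm (a x) powr p) \<le> 2 powr p * ((LINT x|M. norm (b x - a x) powr p) + (LINT x|M. norm (b x) powr p))"
      if a: "a \<in> Lp \<Omega> p" and b: "b \<in> Lp \<Omega> p" for a b :: "'a \<Rightarrow> 'b::euclidean_space"
    proof -
      have "(LINT x|M. norm (a x) powr p) \<le> (LINT x|M. 2 powr p * (norm (b x - a x) powr p + norm (b x) powr p))"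
      proof (rule integral_mono)
        show "norm (a x) powr p \<le> 2 powr p * (norm (b x - a x) powr p + norm (b x) powr p)" for x
          using norm_add_powr_le[of p "a x - b x" "b x"] p_gt_1 by (simp add: norm_minus_commute)
      qed (use LpD(2)[OF a] LpD(2)[OF b] LpD(2)[OF Lp_diff[OF b a]] in auto)
      also have "\<dots> = 2 powr p * ((LINT x|M. norm (b x - a x) powr p) + (LINT x|M. norm (b x) powr p))"
        using LpD(2)[OF b] LpD(2)[OF Lp_diff[OF b a]] by simp
      finally show ?thesis .
    qed
    let ?a = "\<lambda>n. LINT x|M. norm (\<phi> n x - f x) powr p" and ?b = "\<lambda>n. LINT x|M. norm (grad (\<phi> n) x - G x) powr p"
    have bd: "(LINT x|M. \<bar>f x\<bar> powr p) \<le> 2 powr p * (?a n + C * (2 powr p * (?b n + (LINT x|M. norm (G x) powr p))))" for n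
    proof -
      have "(LINT x|M. norm (grad (\<phi> n) x) powr p) \<le> 2 powr p * (?b n + (LINT x|M. norm (G x) powr p))"
        using split[OF test_in_Lp(2)[OF \<phi>(1)] H0D(2)[OF H], of n] by (simp add: norm_minus_commute)
      then have "(LINT x|M. \<bar>\<phi> n x\<bar> powr p) \<le> C * (2 powr p * (?b n + (LINT x|M. norm (G x) powr p)))"
        using C(2)[OF \<phi>(1), of n] C(1) by (meson less_imp_le mult_left_mono order_trans)
      then have "2 powr p * (?a n + (LINT x|M. norm (\<phi> n x) powr p)) \<le> 2 powr p * (?a n + C * (2 powr p * (?b n + (LINT x|M. norm (G x) powr p))))"
        by (intro mult_left_mono add_left_mono) auto
      then show ?thesis
        using split[OF H0D(1)[OF H] test_in_Lp(1)[OF \<phi>(1)], of n] unfolding real_norm_def by linarith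
    qed
    have lm: "(\<lambda>n. 2 powr p * (?a n + C * (2 powr p * (?b n + (LINT x|M. norm (G x) powr p)))))
       \<longlonglongrightarrow> 2 powr p * (0 + C * (2 powr p * (0 + (LINT x|M. norm (G x) powr p))))"
      using \<phi>(2,3) unfolding Lp_tendsto_def by (intro tendsto_intros)
    have "(LINT x|M. \<bar>f x\<bar> powr p) \<le> 2 powr p * (0 + C * (2 powr p * (0 + (LINT x|M. norm (G x) powr p))))"
      by (rule LIMSEQ_le_const[OF lm]) (use bd in blast)
    then show ?thesis by (simp add: algebra_simps)
  qed
  then show ?thesis using C(1) by (intro that[of "2 powr p * (C * 2 powr p)"]) auto
qed

end

subsection \<open>Capacity\<close>

text \<open>Composing with this function replaces the truncation \<open>min \<bar>s\<bar> 1\<close> inside the class of test functions.\<close>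

definition smooth_cap :: "real \<Rightarrow> real" where
  "smooth_cap s = smooth_step (s * s)"

definition smooth_cap' :: "real \<Rightarrow> real" where
  "smooth_cap' s = smooth_step' (s * s) * (2 * s)"

lemma smooth_cap_bounds: "0 \<le> smooth_cap s" "smooth_cap s \<le> 1"
  by (simp_all add: smooth_cap_def smooth_step_ge_0 smooth_step_le_1)

lemma smooth_cap_0: "smooth_cap 0 = 0" by (simp add: smooth_cap_def smooth_step_0)

lemma smooth_cap_1: "\<bar>s\<bar> \<ge> 1 \<Longrightarrow> smooth_cap s = 1"
  unfolding smooth_cap_def using mult_mono[of 1 "\<bar>s\<bar>" 1 "\<bar>s\<bar>"] by (intro smooth_step_1) simp

lemma Ck_smooth_cap: "Ck k smooth_cap"
  unfolding smooth_cap_def[abs_def] using Ck_inner[of k "1::real"]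
  by (intro Ck_compose[OF Ck_smooth_step] Ck_mult) auto

lemma DERIV_smooth_cap: "DERIV smooth_cap s :> smooth_cap' s"
  unfolding smooth_cap_def[abs_def] smooth_cap'_def
  by (rule DERIV_chain2[OF DERIV_smooth_step]) (auto intro!: derivative_eq_intros)

lemma smooth_cap'_bounded: obtains B where "B \<ge> 1" "\<And>s. \<bar>smooth_cap' s\<bar> \<le> B"
proof -
  obtain C where C: "C > 0" "\<And>t. \<bar>smooth_step' t\<bar> \<le> C" using smooth_step'_bounded by blast
  have "\<bar>smooth_cap' s\<bar> \<le> max 1 (C * 2)" for s
  proof (cases "\<bar>s\<bar> \<le> 1")
    case True
    then have "\<bar>smooth_cap' s\<bar> \<le> C * 2"
      unfolding smooth_cap'_def abs_mult using C by (intro mult_mono) auto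
    then show ?thesis by simp
  next
    case False
    then have "1 < \<bar>s\<bar> * \<bar>s\<bar>" using mult_strict_mono[of 1 "\<bar>s\<bar>" 1 "\<bar>s\<bar>"] by simp
    then have "smooth_cap' s = 0" unfolding smooth_cap'_def by (simp add: smooth_step'_0)
    then show ?thesis by simp
  qed
  then show ?thesis by (intro that[of "max 1 (C * 2)"]) auto
qed

text \<open>Averaging over the translates by a box plays the role of a mollification. As
  \<open>f\<close> is already smooth, no kernel is involved, and differentiation passes under the
  integral sign.\<close>

lemma Ck_translate_average:
  fixes f :: "'a::euclidean_space \<Rightarrow> real"
  assumes "\<And>k. Ck k f"
  shows "Ck k (\<lambda>x. integral (cbox a b) (\<lambda>y. f (x + y)))"
    "GDERIV (\<lambda>x. integral (cbox a b) (\<lambda>y. f (x + y))) x :> integral (cbox a b) (\<lambda>y. grad f (x + y))"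
proof -
  have cf: "continuous_on UNIV f" if "Ck (Suc 0) f" for f :: "'a \<Rightarrow> real" using that by (rule Ck_imp_continuous)
  have cg: "continuous_on UNIV (grad f)" if "Ck (Suc 0) f" for f :: "'a \<Rightarrow> real"
  proof -
    have "continuous_on UNIV (\<lambda>x. \<Sum>b\<in>Basis. (grad f x \<bullet> b) *\<^sub>R b)"
      using that by (intro continuous_on_sum continuous_on_scaleR continuous_on_const) auto
    then show ?thesis by (simp add: euclidean_representation)
  qed
  have int: "(\<lambda>y. h (x + y)) integrable_on cbox a b" if "continuous_on UNIV h" for h :: "'a \<Rightarrow> 'c::banach" and x
    by (intro integrable_continuous continuous_on_compose2[OF that]) (auto intro!: continuous_intros)
  have D: "GDERIV (\<lambda>x. integral (cbox a b) (\<lambda>y. f (x + y))) x :> integral (cbox a b) (\<lambda>y. grad f (x + y))"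
    if f: "Ck (Suc 0) f" for f :: "'a \<Rightarrow> real" and x
  proof -
    \<comment> \<open>The derivative appears as a bounded linear map, the form in which
      differentiation under the integral is applied. Evaluating at h and pulling the inner product
      out of the integral recovers a gradient.\<close>
    let ?b = "\<lambda>x t. blinfun_inner_left (grad f (x + t))"
    have cb: "continuous_on UNIV (\<lambda>z. blinfun_inner_left (grad f z))"
      by (rule bounded_linear.continuous_on[OF bounded_linear_blinfun_inner_left cg[OF f]])
    have der: "((\<lambda>x. integral (cbox a b) (\<lambda>y. f (x + y))) has_derivative blinfun_apply (integral (cbox a b) (?b x))) (at x within UNIV)"
    proof (rule leibniz_rule)
      fix x t :: 'a
      have "(f has_derivative (\<lambda>h. h \<bullet> grad f (x + t))) (at (x + t))"
        using f GDERIV_grad[of f "x + t"] by (simp add: gderiv_def)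
      moreover have "((\<lambda>x. x + t) has_derivative (\<lambda>h. h)) (at x)" by (auto intro!: derivative_eq_intros)
      ultimately have "((\<lambda>x. f (x + t)) has_derivative (\<lambda>h. h \<bullet> grad f (x + t))) (at x)"
        by (rule has_derivative_compose[rotated])
      moreover have "blinfun_apply (?b x t) = (\<lambda>h. h \<bullet> grad f (x + t))" by (simp add: fun_eq_iff)
      ultimately show "((\<lambda>x. f (x + t)) has_derivative blinfun_apply (?b x t)) (at x within UNIV)" by simp
    next
      show "(\<lambda>y. f (x + y)) integrable_on cbox a b" for x by (rule int[OF cf[OF f]])
      show "continuous_on (UNIV \<times> cbox a b) (\<lambda>(x, t). ?b x t)"
        unfolding case_prod_beta by (rule continuous_on_compose2[OF cb]) (auto intro!: continuous_intros)
    qed auto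
    have "blinfun_apply (integral (cbox a b) (?b x)) h = h \<bullet> integral (cbox a b) (\<lambda>y. grad f (x + y))" for h
    proof -
      have "blinfun_apply (integral (cbox a b) (?b x)) h = integral (cbox a b) (\<lambda>y. h \<bullet> grad f (x + y))"
        by (subst blinfun_apply_integral[OF int[OF cb]]) simp
      also have "\<dots> = h \<bullet> integral (cbox a b) (\<lambda>y. grad f (x + y))"
        using integral_linear[OF int[OF cg[OF f]] bounded_linear_inner_right[of h]] by (simp add: o_def)
      finally show ?thesis .
    qed
    then have "blinfun_apply (integral (cbox a b) (?b x)) = (\<lambda>h. h \<bullet> integral (cbox a b) (\<lambda>y. grad f (x + y)))" by blast
    then show ?thesis using der unfolding gderiv_def by simp
  qed
  then show "GDERIV (\<lambda>x. integral (cbox a b) (\<lambda>y. f (x + y))) x :> integral (cbox a b) (\<lambda>y. grad f (x + y))"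
    using assms by blast
  show "Ck k (\<lambda>x. integral (cbox a b) (\<lambda>y. f (x + y)))"
    using assms
  proof (induction k arbitrary: f)
    case 0
    have "continuous_on UNIV (\<lambda>x. integral (cbox a b) (\<lambda>y. f (x + y)))"
    proof (rule integral_continuous_on_param)
      show "continuous_on (UNIV \<times> cbox a b) (\<lambda>(x, t). f (x + t))"
        unfolding case_prod_beta by (rule continuous_on_compose2[OF cf[OF 0]]) (auto intro!: continuous_intros)
    qed
    then show ?case by simp
  next
    case (Suc k)
    show ?case
    proof (rule Ck_SucI[OF D[OF Suc.prems]])
      fix e :: 'a assume e: "e \<in> Basis"
      have "Ck j (\<lambda>x. grad f x \<bullet> e)" for j using Suc.prems[of "Suc j"] e by simp
      from Suc.IH[OF this]
      have "Ck k (\<lambda>x. integral (cbox a b) (\<lambda>y. grad f (x + y) \<bullet> e))" .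
      moreover have "integral (cbox a b) (\<lambda>y. grad f (x + y) \<bullet> e) = integral (cbox a b) (\<lambda>y. grad f (x + y)) \<bullet> e" for x
        using integral_linear[OF int[OF cg[OF Suc.prems[of "Suc 0"]]] bounded_linear_inner_left[of e]] by (simp add: o_def)
      ultimately show "Ck k (\<lambda>x. integral (cbox a b) (\<lambda>y. grad f (x + y)) \<bullet> e)" by simp
    qed
  qed
qed

text \<open>Jensen's inequality up to the factor 2^p. Integrating \<open>le_eps_powr\<close> over
  the box bounds the norm of the average by e + e^(1-p) I for every e > 0, where I is the average of
  the p-th power.\<close>

lemma average_powr_le:
  fixes h :: "'a::euclidean_space \<Rightarrow> 'b::euclidean_space"
  assumes h: "continuous_on UNIV h" and p: "p > 1" and V: "measure lborel (cbox a b) = V" "V > 0"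
  shows "norm ((1 / V) *\<^sub>R integral (cbox a b) h) powr p
     \<le> 2 powr p * ((1 / V) * (LINT y|lborel. indicator (cbox a b) y * norm (h y) powr p))"
proof -
  let ?Q = "cbox a b"
  define I where "I = (1 / V) * (LINT y|lborel. indicator ?Q y * norm (h y) powr p)"
  have cn: "continuous_on ?Q (\<lambda>y. norm (h y) powr p)"
    using p by (intro continuous_on_powr' continuous_intros continuous_on_subset[OF h]) auto
  have i0: "integrable lborel (\<lambda>y. indicator ?Q y *\<^sub>R h y)"
    by (intro borel_integrable_compact continuous_on_subset[OF h]) auto
  have i1: "integrable lborel (\<lambda>y. indicator ?Q y *\<^sub>R norm (h y))"
    by (intro borel_integrable_compact continuous_on_norm continuous_on_subset[OF h]) auto
  have i2: "integrable lborel (\<lambda>y. indicator ?Q y *\<^sub>R (norm (h y) powr p))"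
    by (intro borel_integrable_compact cn) auto
  have i3: "integrable lborel (\<lambda>y. indicator ?Q y *\<^sub>R (e::real))" for e
    by (intro borel_integrable_compact) auto
  have I0: "I \<ge> 0" using V by (auto simp: I_def intro!: integral_nonneg_AE)
  have eq: "integral ?Q h = (LINT y|lborel. indicator ?Q y *\<^sub>R h y)"
    using set_borel_integral_eq_integral(2)[of ?Q h] i0 by (simp add: set_integrable_def set_lebesgue_integral_def)
  have mQ: "(LINT y|lborel. indicator ?Q y *\<^sub>R e) = e * V" for e :: real
    using V by (simp add: mult.commute)
  have *: "norm ((1 / V) *\<^sub>R integral ?Q h) \<le> e + e powr (1 - p) * I" if e: "e > 0" for e
  proof -
    have "norm (integral ?Q h) \<le> (LINT y|lborel. norm (indicator ?Q y *\<^sub>R h y))"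
      unfolding eq by (rule integral_norm_bound)
    also have "\<dots> = (LINT y|lborel. indicator ?Q y *\<^sub>R norm (h y))" by simp
    also have "\<dots> \<le> (LINT y|lborel. indicator ?Q y *\<^sub>R e + e powr (1 - p) * (indicator ?Q y *\<^sub>R norm (h y) powr p))"
    proof (rule integral_mono)
      show "integrable lborel (\<lambda>y. indicator ?Q y *\<^sub>R e + e powr (1 - p) * (indicator ?Q y *\<^sub>R norm (h y) powr p))"
        by (intro Bochner_Integration.integrable_add integrable_mult_right i2 i3)
      show "indicator ?Q y *\<^sub>R norm (h y) \<le> indicator ?Q y *\<^sub>R e + e powr (1 - p) * (indicator ?Q y *\<^sub>R norm (h y) powr p)" for y
        using le_eps_powr[OF e norm_ge_zero p, of "h y"] by (simp add: indicator_def)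
    qed (rule i1)
    also have "\<dots> = e * V + e powr (1 - p) * (LINT y|lborel. indicator ?Q y *\<^sub>R norm (h y) powr p)"
      using i2 i3 mQ by simp
    also have "(LINT y|lborel. indicator ?Q y *\<^sub>R norm (h y) powr p) = V * I" using V by (simp add: I_def)
    finally have "norm (integral ?Q h) \<le> V * (e + e powr (1 - p) * I)" by (simp add: algebra_simps)
    then show ?thesis using V by (simp add: field_simps)
  qed
  have "norm ((1 / V) *\<^sub>R integral ?Q h) powr p \<le> 2 powr p * I"
  proof (cases "I = 0")
    case True
    have "norm ((1 / V) *\<^sub>R integral ?Q h) \<le> 0"
      by (rule field_le_epsilon) (use * True in auto)
    then show ?thesis using True p by simp
  next
    case False
    then have I: "I > 0" using I0 by simp
    \<comment> \<open>With this e the two summands of the bound coincide: both equal e.\<close>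
    define e where "e = I powr (1 / p)"
    have e: "e > 0" using I by (simp add: e_def)
    have ep: "e powr p = I" using I p by (simp add: e_def powr_powr)
    have "e powr (1 - p) * I = e powr (1 - p) * e powr p" using ep by simp
    also have "\<dots> = e" using e by (simp add: powr_add[symmetric])
    finally have "norm ((1 / V) *\<^sub>R integral ?Q h) \<le> 2 * e" using *[OF e] by simp
    then have "norm ((1 / V) *\<^sub>R integral ?Q h) powr p \<le> (2 * e) powr p" using p by (intro powr_mono2) auto
    also have "\<dots> = 2 powr p * I" using e ep by (simp add: powr_mult)
    finally show ?thesis .
  qed
  then show ?thesis unfolding I_def .
qed

text \<open>The bound of \<open>average_powr_le\<close> is integrated in x. After exchanging the
  integrals, translation invariance makes the inner one independent of the shift, and the volume of
  the box cancels.\<close>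

lemma average_energy_le:
  fixes h :: "'a::euclidean_space \<Rightarrow> 'b::euclidean_space"
  assumes h: "continuous_on UNIV h" and p: "p > 1" and V: "measure lborel (cbox a b) = V" "V > 0"
  shows "(\<integral>\<^sup>+x. ennreal (norm ((1 / V) *\<^sub>R integral (cbox a b) (\<lambda>y. h (x + y))) powr p) \<partial>lborel)
     \<le> ennreal (2 powr p) * (\<integral>\<^sup>+x. ennreal (norm (h x) powr p) \<partial>lborel)"
proof -
  let ?Q = "cbox a b" and ?J = "\<integral>\<^sup>+x. ennreal (norm (h x) powr p) \<partial>lborel"
  have cn: "continuous_on UNIV (\<lambda>y. norm (h y) powr p)"
    using p by (intro continuous_on_powr' continuous_intros h) auto
  have hm: "(\<lambda>y. norm (h y) powr p) \<in> borel_measurable borel" by (rule borel_measurable_continuous_onI[OF cn])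
  have hm2: "(\<lambda>z. norm (h (fst z + snd z)) powr p) \<in> borel_measurable (borel :: ('a \<times> 'a) measure)"
    by (rule borel_measurable_continuous_onI) (intro continuous_on_compose2[OF cn] continuous_intros, simp)
  have *: "ennreal (norm ((1 / V) *\<^sub>R integral ?Q (\<lambda>y. h (x + y))) powr p)
     \<le> ennreal (2 powr p * (1 / V)) * (\<integral>\<^sup>+y. indicator ?Q y * ennreal (norm (h (x + y)) powr p) \<partial>lborel)" for x
  proof -
    have c: "continuous_on UNIV (\<lambda>y. h (x + y))"
      by (rule continuous_on_compose2[OF h]) (auto intro!: continuous_intros)
    have "integrable lborel (\<lambda>y. indicator ?Q y *\<^sub>R (norm (h (x + y)) powr p))"
      using p by (intro borel_integrable_compact continuous_on_powr' continuous_intros continuous_on_subset[OF c]) auto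
    then have i: "integrable lborel (\<lambda>y. indicator ?Q y * norm (h (x + y)) powr p)" by simp
    have "ennreal (norm ((1 / V) *\<^sub>R integral ?Q (\<lambda>y. h (x + y))) powr p)
      \<le> ennreal (2 powr p * ((1 / V) * (LINT y|lborel. indicator ?Q y * norm (h (x + y)) powr p)))"
      by (intro ennreal_leI average_powr_le[OF c p V])
    also have "\<dots> = ennreal (2 powr p * (1 / V)) * ennreal (LINT y|lborel. indicator ?Q y * norm (h (x + y)) powr p)"
      using V by (subst ennreal_mult[symmetric]) (auto intro!: integral_nonneg_AE simp: mult.assoc)
    also have "ennreal (LINT y|lborel. indicator ?Q y * norm (h (x + y)) powr p) = (\<integral>\<^sup>+y. ennreal (indicator ?Q y * norm (h (x + y)) powr p) \<partial>lborel)"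
      by (rule nn_integral_eq_integral[OF i, symmetric]) auto
    also have "(\<integral>\<^sup>+y. ennreal (indicator ?Q y * norm (h (x + y)) powr p) \<partial>lborel) = (\<integral>\<^sup>+y. indicator ?Q y * ennreal (norm (h (x + y)) powr p) \<partial>lborel)"
      by (intro nn_integral_cong) (auto simp: indicator_def)
    finally show ?thesis .
  qed
  have mp: "(\<lambda>(x, y). indicator ?Q y * ennreal (norm (h (x + y)) powr p)) \<in> borel_measurable (lborel \<Otimes>\<^sub>M lborel)"
  proof -
    have "(\<lambda>z. norm (h (fst z + snd z)) powr p) \<in> borel_measurable (lborel \<Otimes>\<^sub>M lborel :: ('a \<times> 'a) measure)"
      using hm2 by (simp add: borel_prod[symmetric] cong: measurable_cong_sets)
    then show ?thesis unfolding case_prod_beta by measurable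
  qed
  have "(\<integral>\<^sup>+x. ennreal (norm ((1 / V) *\<^sub>R integral ?Q (\<lambda>y. h (x + y))) powr p) \<partial>lborel)
     \<le> (\<integral>\<^sup>+x. ennreal (2 powr p * (1 / V)) * (\<integral>\<^sup>+y. indicator ?Q y * ennreal (norm (h (x + y)) powr p) \<partial>lborel) \<partial>lborel)"
    by (intro nn_integral_mono *)
  also have "\<dots> = ennreal (2 powr p * (1 / V)) * (\<integral>\<^sup>+x. (\<integral>\<^sup>+y. indicator ?Q y * ennreal (norm (h (x + y)) powr p) \<partial>lborel) \<partial>lborel)"
    using mp by (intro nn_integral_cmult lborel.borel_measurable_nn_integral) simp
  also have "(\<integral>\<^sup>+x. (\<integral>\<^sup>+y. indicator ?Q y * ennreal (norm (h (x + y)) powr p) \<partial>lborel) \<partial>lborel)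
    = (\<integral>\<^sup>+y. (\<integral>\<^sup>+x. indicator ?Q y * ennreal (norm (h (x + y)) powr p) \<partial>lborel) \<partial>lborel)"
    using lborel_pair.Fubini'[OF mp] by simp
  also have "\<dots> = (\<integral>\<^sup>+y. indicator ?Q y * ?J \<partial>lborel)"
  proof (intro nn_integral_cong)
    fix y :: 'a
    have "(\<integral>\<^sup>+x. indicator ?Q y * ennreal (norm (h (x + y)) powr p) \<partial>lborel) = indicator ?Q y * (\<integral>\<^sup>+x. ennreal (norm (h (x + y)) powr p) \<partial>lborel)"
      using hm by (intro nn_integral_cmult) simp
    also have "(\<integral>\<^sup>+x. ennreal (norm (h (x + y)) powr p) \<partial>lborel) = ?J"
      by (rule nn_integral_lborel_translation[of "\<lambda>x. ennreal (norm (h x) powr p)"]) (use hm in simp)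
    finally show "(\<integral>\<^sup>+x. indicator ?Q y * ennreal (norm (h (x + y)) powr p) \<partial>lborel) = indicator ?Q y * ?J" .
  qed
  also have "\<dots> = ennreal V * ?J"
  proof -
    have "emeasure lborel ?Q = ennreal V"
      using V(1) emeasure_eq_ennreal_measure[of lborel ?Q] emeasure_lborel_cbox_finite[of a b] by (auto simp: less_top)
    then show ?thesis by (simp add: nn_integral_multc)
  qed
  finally have "(\<integral>\<^sup>+x. ennreal (norm ((1 / V) *\<^sub>R integral ?Q (\<lambda>y. h (x + y))) powr p) \<partial>lborel)
    \<le> ennreal (2 powr p * (1 / V)) * (ennreal V * ?J)" .
  also have "\<dots> = (ennreal (2 powr p * (1 / V)) * ennreal V) * ?J" by (simp add: mult.assoc)
  also have "ennreal (2 powr p * (1 / V)) * ennreal V = ennreal (2 powr p)"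
    using V by (subst ennreal_mult[symmetric]) auto
  finally show ?thesis .
qed

section \<open>Capacity estimates for open sets\<close>

context sobolev_domain begin

definition energy :: "('a \<Rightarrow> real) \<Rightarrow> real" where
  "energy \<phi> = (LINT x|M. norm (grad \<phi> x) powr p)"

lemma energy_nonneg: "energy \<phi> \<ge> 0" by (simp add: energy_def)

lemma energy_nn_integral:
  assumes "\<phi> \<in> test_functions \<Omega>"
  shows "(\<integral>\<^sup>+x. ennreal (norm (grad \<phi> x) powr p) \<partial>M) = ennreal (energy \<phi>)"
  unfolding energy_def by (rule nn_integral_eq_integral[OF LpD(2)[OF test_in_Lp(2)[OF assms]]]) auto

lemma energy_lborel:
  assumes \<phi>: "\<phi> \<in> test_functions \<Omega>"
  shows "(\<integral>\<^sup>+x. ennreal (norm (grad \<phi> x) powr p) \<partial>lborel) = ennreal (energy \<phi>)"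
proof -
  obtain K where K: "compact K" "K \<subseteq> \<Omega>" "\<And>x. x \<notin> K \<Longrightarrow> \<phi> x = 0" "\<And>x. x \<notin> K \<Longrightarrow> grad \<phi> x = 0"
    using test_functionsE[OF \<phi>] by blast
  have c: "continuous_on UNIV (\<lambda>x. norm (grad \<phi> x) powr p)"
    using p_gt_1 by (intro continuous_on_powr' continuous_intros test_grad_continuous[OF \<phi>]) auto
  have "integrable lborel (\<lambda>x. norm (grad \<phi> x) powr p)"
    by (rule integrable_continuous_compact_support[OF c K(1)]) (simp add: K)
  from nn_integral_eq_integral[OF this]
  have "(\<integral>\<^sup>+x. ennreal (norm (grad \<phi> x) powr p) \<partial>lborel) = ennreal (LINT x|lborel. norm (grad \<phi> x) powr p)" by simp
  also have "(LINT x|lborel. norm (grad \<phi> x) powr p) = energy \<phi>"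
    unfolding energy_def
    by (rule integral_lebesgue_on_zero_outside[OF borel_measurable_continuous_onI[OF c] dom_sets, symmetric]) (use K in auto)
  finally show ?thesis .
qed

lemma cap_compact_le:
  assumes "\<phi> \<in> test_functions \<Omega>" "\<And>x. x \<in> K \<Longrightarrow> \<phi> x \<ge> 1"
  shows "cap_compact \<Omega> p K \<le> ennreal (energy \<phi>)"
  unfolding cap_compact_def energy_nn_integral[OF assms(1), symmetric]
  by (rule INF_lower) (use assms in auto)

lemma cap_compact_lessE:
  assumes "cap_compact \<Omega> p K < c"
  obtains \<phi> where "\<phi> \<in> test_functions \<Omega>" "\<And>x. x \<in> K \<Longrightarrow> \<phi> x \<ge> 1" "ennreal (energy \<phi>) < c"
proof -
  obtain \<phi> where "\<phi> \<in> test_functions \<Omega>" "\<forall>x\<in>K. \<phi> x \<ge> 1" "(\<integral>\<^sup>+x. ennreal (norm (grad \<phi> x) powr p) \<partial>M) < c"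
    using assms unfolding cap_compact_def INF_less_iff by auto
  then show ?thesis using energy_nn_integral by (intro that[of \<phi>]) auto
qed

lemma cap_mono: "A \<subseteq> B \<Longrightarrow> cap \<Omega> p A \<le> cap \<Omega> p B"
  unfolding cap_def by (rule INF_superset_mono) auto

lemma cap_open_eq:
  assumes "open U" "U \<subseteq> \<Omega>"
  shows "cap \<Omega> p U = cap_open \<Omega> p U"
proof (rule antisym)
  show "cap \<Omega> p U \<le> cap_open \<Omega> p U" unfolding cap_def by (rule INF_lower) (use assms in auto)
  show "cap_open \<Omega> p U \<le> cap \<Omega> p U" unfolding cap_def
  proof (rule INF_greatest)
    fix W assume "W \<in> {W. open W \<and> U \<subseteq> W \<and> W \<subseteq> \<Omega>}"
    then show "cap_open \<Omega> p U \<le> cap_open \<Omega> p W" unfolding cap_open_def by (intro SUP_subset_mono) auto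
  qed
qed

lemma cap_leI:
  assumes "open U" "U \<subseteq> \<Omega>" "\<And>K. compact K \<Longrightarrow> K \<subseteq> U \<Longrightarrow> cap_compact \<Omega> p K \<le> c"
  shows "cap \<Omega> p U \<le> c"
  unfolding cap_open_eq[OF assms(1,2)] cap_open_def by (rule SUP_least) (use assms(3) in auto)

lemma cap_compact_le_cap:
  assumes "open U" "U \<subseteq> \<Omega>" "compact K" "K \<subseteq> U"
  shows "cap_compact \<Omega> p K \<le> cap \<Omega> p U"
  unfolding cap_open_eq[OF assms(1,2)] cap_open_def by (rule SUP_upper) (use assms in auto)

lemma smooth_cap_test:
  assumes \<phi>: "\<phi> \<in> test_functions \<Omega>" and B: "\<And>s. \<bar>smooth_cap' s\<bar> \<le> B"
  shows "(\<lambda>x. smooth_cap (\<phi> x)) \<in> test_functions \<Omega>"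
    "energy (\<lambda>x. smooth_cap (\<phi> x)) \<le> B powr p * energy \<phi>"
proof -
  show t: "(\<lambda>x. smooth_cap (\<phi> x)) \<in> test_functions \<Omega>"
    by (rule test_compose[OF \<phi> Ck_smooth_cap smooth_cap_0])
  have g: "grad (\<lambda>x. smooth_cap (\<phi> x)) x = smooth_cap' (\<phi> x) *\<^sub>R grad \<phi> x" for x
    by (rule grad_eqI[OF GDERIV_DERIV_compose[OF test_GDERIV[OF \<phi>] DERIV_smooth_cap]])
  have "energy (\<lambda>x. smooth_cap (\<phi> x)) \<le> (LINT x|M. B powr p * norm (grad \<phi> x) powr p)"
    unfolding energy_def
  proof (rule integral_mono)
    show "integrable M (\<lambda>x. norm (grad (\<lambda>x. smooth_cap (\<phi> x)) x) powr p)" by (rule LpD(2)[OF test_in_Lp(2)[OF t]])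
    show "integrable M (\<lambda>x. B powr p * norm (grad \<phi> x) powr p)" using LpD(2)[OF test_in_Lp(2)[OF \<phi>]] by simp
    fix x
    have "norm (grad (\<lambda>x. smooth_cap (\<phi> x)) x) powr p = \<bar>smooth_cap' (\<phi> x)\<bar> powr p * norm (grad \<phi> x) powr p"
      unfolding g by (simp add: powr_mult)
    also have "\<dots> \<le> B powr p * norm (grad \<phi> x) powr p"
      using B p_gt_1 by (intro mult_right_mono powr_mono2) auto
    finally show "norm (grad (\<lambda>x. smooth_cap (\<phi> x)) x) powr p \<le> B powr p * norm (grad \<phi> x) powr p" .
  qed
  then show "energy (\<lambda>x. smooth_cap (\<phi> x)) \<le> B powr p * energy \<phi>" by (simp add: energy_def)
qed

text \<open>Each point of \<open>K\<close> is assigned to the set whose complement is farther away.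
  The complements are assumed nonempty because \<open>infdist\<close> to the empty set is 0 by
  convention.\<close>

lemma compact_split_two_open:
  fixes K :: "'a set"
  assumes K: "compact K" and U: "open U" "open V" "K \<subseteq> U \<union> V" "- U \<noteq> {}" "- V \<noteq> {}"
  obtains K1 K2 where "compact K1" "compact K2" "K1 \<subseteq> U" "K2 \<subseteq> V" "K = K1 \<union> K2"
proof -
  let ?d1 = "\<lambda>x. infdist x (- U)" and ?d2 = "\<lambda>x. infdist x (- V)"
  let ?K1 = "K \<inter> {x. ?d2 x \<le> ?d1 x}" and ?K2 = "K \<inter> {x. ?d1 x \<le> ?d2 x}"
  have c: "closed {x. ?d2 x \<le> ?d1 x}" "closed {x. ?d1 x \<le> ?d2 x}"
    by (intro closed_Collect_le continuous_intros)+
  have z: "x \<in> U \<longleftrightarrow> ?d1 x > 0" "x \<in> V \<longleftrightarrow> ?d2 x > 0" for x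
    using in_closed_iff_infdist_zero[of "- U" x] in_closed_iff_infdist_zero[of "- V" x] U infdist_nonneg[of x "- U"] infdist_nonneg[of x "- V"]
    by (auto simp: less_le)
  have "x \<in> U" if "x \<in> ?K1" for x
    using that U(3) z[of x] by auto
  then have s1: "?K1 \<subseteq> U" by blast
  have "x \<in> V" if "x \<in> ?K2" for x
    using that U(3) z[of x] by auto
  then have s2: "?K2 \<subseteq> V" by blast
  have "K = ?K1 \<union> ?K2" by auto
  then show ?thesis
    by (rule that[OF compact_Int_closed[OF K c(1)] compact_Int_closed[OF K c(2)] s1 s2])
qed

lemma Compl_subset_dom_nonempty: "U \<subseteq> \<Omega> \<Longrightarrow> - U \<noteq> {}"
proof
  assume "U \<subseteq> \<Omega>" "- U = {}"
  then have "\<Omega> = UNIV" by auto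
  then show False using bounded_dom not_bounded_UNIV by simp
qed

text \<open>Subadditivity up to a constant. The maximum of two potentials would give the constant 1
  but is not smooth; the sum of two capped potentials stays a test function and costs 2^p for the
  sum and B^p for the cap.\<close>

lemma cap_Un:
  obtains A where "A \<ge> 1" "\<And>U V c d. \<lbrakk>open U; open V; U \<subseteq> \<Omega>; V \<subseteq> \<Omega>; cap \<Omega> p U < ennreal c; cap \<Omega> p V < ennreal d\<rbrakk>
     \<Longrightarrow> cap \<Omega> p (U \<union> V) \<le> ennreal (A * (c + d))"
proof -
  obtain B where B: "B \<ge> 1" "\<And>s. \<bar>smooth_cap' s\<bar> \<le> B" using smooth_cap'_bounded by blast
  define A where "A = 2 powr p * B powr p"
  have A1: "A \<ge> 1"
    unfolding A_def using ge_one_powr_ge_zero[of 2 p] ge_one_powr_ge_zero[of B p] B p_gt_1 mult_mono[of 1 "2 powr p" 1 "B powr p"] by simp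
  have "cap \<Omega> p (U \<union> V) \<le> ennreal (A * (c + d))"
    if UV: "open U" "open V" "U \<subseteq> \<Omega>" "V \<subseteq> \<Omega>" "cap \<Omega> p U < ennreal c" "cap \<Omega> p V < ennreal d" for U V c d
  proof (rule cap_leI)
    fix K assume K: "compact K" "K \<subseteq> U \<union> V"
    obtain K1 K2 where K12: "compact K1" "compact K2" "K1 \<subseteq> U" "K2 \<subseteq> V" "K = K1 \<union> K2"
      by (rule compact_split_two_open[OF K(1) UV(1,2) K(2) Compl_subset_dom_nonempty[OF UV(3)] Compl_subset_dom_nonempty[OF UV(4)]])
    have "cap_compact \<Omega> p K1 < ennreal c" "cap_compact \<Omega> p K2 < ennreal d"
      using cap_compact_le_cap[OF UV(1,3) K12(1,3)] cap_compact_le_cap[OF UV(2,4) K12(2,4)] UV(5,6) by auto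
    then have lt: "cap_compact \<Omega> p K1 < ennreal c" "cap_compact \<Omega> p K2 < ennreal d" .
    obtain \<phi> where \<phi>: "\<phi> \<in> test_functions \<Omega>" "\<And>x. x \<in> K1 \<Longrightarrow> \<phi> x \<ge> 1" "ennreal (energy \<phi>) < ennreal c"
      using cap_compact_lessE[OF lt(1)] by blast
    obtain \<psi> where \<psi>: "\<psi> \<in> test_functions \<Omega>" "\<And>x. x \<in> K2 \<Longrightarrow> \<psi> x \<ge> 1" "ennreal (energy \<psi>) < ennreal d"
      using cap_compact_lessE[OF lt(2)] by blast
    have cd: "energy \<phi> < c" "energy \<psi> < d"
      using \<phi>(3) \<psi>(3) energy_nonneg by (auto simp: ennreal_less_iff)
    \<comment> \<open>A potential may be negative away from its own compact set. Capping makes both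
      nonnegative, so that their sum is at least 1 on the whole union.\<close>
    let ?f = "\<lambda>x. smooth_cap (\<phi> x)" and ?g = "\<lambda>x. smooth_cap (\<psi> x)"
    note f = smooth_cap_test[OF \<phi>(1) B(2)] and g = smooth_cap_test[OF \<psi>(1) B(2)]
    have t: "(\<lambda>x. ?f x + ?g x) \<in> test_functions \<Omega>" by (rule test_add[OF f(1) g(1)])
    have gr: "grad (\<lambda>x. ?f x + ?g x) x = grad ?f x + grad ?g x" for x
      by (rule grad_eqI[OF GDERIV_add[OF test_GDERIV[OF f(1)] test_GDERIV[OF g(1)]]])
    have "energy (\<lambda>x. ?f x + ?g x) \<le> (LINT x|M. 2 powr p * (norm (grad ?f x) powr p + norm (grad ?g x) powr p))"
      unfolding energy_def gr
    proof (rule integral_mono)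
      show "integrable M (\<lambda>x. norm (grad ?f x + grad ?g x) powr p)" using LpD(2)[OF test_in_Lp(2)[OF t]] unfolding gr .
      show "integrable M (\<lambda>x. 2 powr p * (norm (grad ?f x) powr p + norm (grad ?g x) powr p))"
        using LpD(2)[OF test_in_Lp(2)[OF f(1)]] LpD(2)[OF test_in_Lp(2)[OF g(1)]] by simp
      show "norm (grad ?f x + grad ?g x) powr p \<le> 2 powr p * (norm (grad ?f x) powr p + norm (grad ?g x) powr p)" for x
        by (rule norm_add_powr_le) (use p_gt_1 in simp)
    qed
    also have "\<dots> = 2 powr p * (energy ?f + energy ?g)"
      unfolding energy_def using LpD(2)[OF test_in_Lp(2)[OF f(1)]] LpD(2)[OF test_in_Lp(2)[OF g(1)]] by simp
    also have "\<dots> \<le> 2 powr p * (B powr p * energy \<phi> + B powr p * energy \<psi>)"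
      using f(2) g(2) by (intro mult_left_mono add_mono) auto
    also have "\<dots> = A * (energy \<phi> + energy \<psi>)" by (simp add: A_def algebra_simps)
    also have "\<dots> \<le> A * (c + d)" using cd A1 by (intro mult_left_mono) auto
    finally have e: "energy (\<lambda>x. ?f x + ?g x) \<le> A * (c + d)" .
    have "?f x + ?g x \<ge> 1" if "x \<in> K" for x
      using that K12(5) \<phi>(2)[of x] \<psi>(2)[of x] smooth_cap_1[of "\<phi> x"] smooth_cap_1[of "\<psi> x"] smooth_cap_bounds(1)[of "\<phi> x"] smooth_cap_bounds(1)[of "\<psi> x"]
      by auto
    from cap_compact_le[OF t this] show "cap_compact \<Omega> p K \<le> ennreal (A * (c + d))"
      using ennreal_leI[OF e] order_trans by blast
  qed (use UV in auto)
  then show ?thesis using A1 by (intro that[of A]) auto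
qed

lemma cap_empty: "cap \<Omega> p {} = 0"
proof -
  have "grad (\<lambda>x. 0) x = 0" for x :: 'a by (rule grad_eqI[OF GDERIV_const])
  then have "energy (\<lambda>x. 0) = 0" using p_gt_1 by (simp add: energy_def)
  moreover have "cap \<Omega> p {} \<le> ennreal (energy (\<lambda>x. 0))"
    by (rule cap_leI) (auto intro!: cap_compact_le test_zero)
  ultimately show ?thesis by simp
qed

text \<open>Each further union costs the factor \<open>A\<close> of \<open>cap_Un\<close>, so the
  bounds must decay geometrically to compensate. The induction splits off the first set and treats
  the remaining ones with e replaced by e r. Compact subsets reduce the countable union to a finite
  one.\<close>

lemma cap_UN:
  obtains r where "0 < r" "r \<le> 1" "\<And>U e. \<lbrakk>\<And>i::nat. open (U i); \<And>i. U i \<subseteq> \<Omega>; \<And>i. cap \<Omega> p (U i) < ennreal (e * r ^ Suc i); 0 < e\<rbrakk>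
     \<Longrightarrow> cap \<Omega> p (\<Union>i. U i) \<le> ennreal (e / 2)"
proof -
  obtain A where A: "A \<ge> 1" "\<And>U V c d. \<lbrakk>open U; open V; U \<subseteq> \<Omega>; V \<subseteq> \<Omega>; cap \<Omega> p U < ennreal c; cap \<Omega> p V < ennreal d\<rbrakk>
     \<Longrightarrow> cap \<Omega> p (U \<union> V) \<le> ennreal (A * (c + d))" using cap_Un by blast
  \<comment> \<open>Chosen so that A (e r + e r) = e/2, which closes the induction.\<close>
  define r where "r = 1 / (4 * A)"
  have r: "0 < r" "r \<le> 1" using A(1) by (auto simp: r_def field_simps)
  have finite_part: "cap \<Omega> p (\<Union>i<n. U i) \<le> ennreal (e / 2)"
    if "\<And>i. open (U i)" "\<And>i. U i \<subseteq> \<Omega>" "\<And>i. cap \<Omega> p (U i) < ennreal (e * r ^ Suc i)" "0 < e" for U :: "nat \<Rightarrow> 'a set" and e n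
    using that
  proof (induction n arbitrary: U e)
    case 0 then show ?case by (simp add: cap_empty)
  next
    case (Suc n)
    have "cap \<Omega> p (\<Union>i<n. U (Suc i)) \<le> ennreal (e * r / 2)"
      by (rule Suc.IH) (use Suc.prems r in \<open>auto simp: mult.assoc power_Suc[symmetric] simp del: power_Suc\<close>)
    also have "\<dots> < ennreal (e * r)" using Suc.prems(4) r by (intro ennreal_lessI) auto
    finally have 1: "cap \<Omega> p (\<Union>i<n. U (Suc i)) < ennreal (e * r)" .
    have 2: "cap \<Omega> p (U 0) < ennreal (e * r)" using Suc.prems(3)[of 0] by simp
    have "(\<Union>i<Suc n. U i) = U 0 \<union> (\<Union>i<n. U (Suc i))"
      by (auto simp: less_Suc_eq_0_disj)
    then have "cap \<Omega> p (\<Union>i<Suc n. U i) \<le> ennreal (A * (e * r + e * r))"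
      using A(2)[OF _ _ _ _ 2 1] Suc.prems(1,2) by (simp add: UN_least open_UN)
    also have "A * (e * r + e * r) = e / 2" using A(1) by (simp add: r_def field_simps)
    finally show ?case .
  qed
  have "cap \<Omega> p (\<Union>i. U i) \<le> ennreal (e / 2)"
    if U: "\<And>i. open (U i)" "\<And>i. U i \<subseteq> \<Omega>" "\<And>i. cap \<Omega> p (U i) < ennreal (e * r ^ Suc i)" "0 < e" for U :: "nat \<Rightarrow> 'a set" and e
  proof (rule cap_leI)
    fix K assume K: "compact K" "K \<subseteq> (\<Union>i. U i)"
    obtain I where I: "I \<subseteq> UNIV" "finite I" "K \<subseteq> (\<Union>i\<in>I. U i)"
      by (rule compactE_image[OF K(1) _ K(2)]) (use U(1) in auto)
    obtain n where n: "I \<subseteq> {..<n}" using finite_nat_bounded[OF I(2)] by blast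
    have "K \<subseteq> (\<Union>i<n. U i)" using I(3) n by blast
    then have "cap_compact \<Omega> p K \<le> cap \<Omega> p (\<Union>i<n. U i)"
      using U(1,2) K(1) by (intro cap_compact_le_cap) auto
    also have "\<dots> \<le> ennreal (e / 2)" by (rule finite_part[OF U])
    finally show "cap_compact \<Omega> p K \<le> ennreal (e / 2)" .
  qed (use U in auto)
  then show ?thesis using r by (intro that[of r]) auto
qed

text \<open>A Chebyshev inequality for capacity: the capped function phi/e equals 1 on the
  superlevel set, and its energy is that of phi up to the factors B^p from the cap and e^(-p) from
  the scaling.\<close>

lemma cap_superlevel:
  obtains B where "B > 0" "\<And>\<phi> e. \<phi> \<in> test_functions \<Omega> \<Longrightarrow> e > 0 \<Longrightarrow>
     open {x. \<bar>\<phi> x\<bar> > e} \<and> {x. \<bar>\<phi> x\<bar> > e} \<subseteq> \<Omega> \<and> cap \<Omega> p {x. \<bar>\<phi> x\<bar> > e} \<le> ennreal (B * (1 / e) powr p * energy \<phi>)"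
proof -
  obtain B where B: "B \<ge> 1" "\<And>s. \<bar>smooth_cap' s\<bar> \<le> B" using smooth_cap'_bounded by blast
  have "open {x. \<bar>\<phi> x\<bar> > e} \<and> {x. \<bar>\<phi> x\<bar> > e} \<subseteq> \<Omega> \<and> cap \<Omega> p {x. \<bar>\<phi> x\<bar> > e} \<le> ennreal (B powr p * (1 / e) powr p * energy \<phi>)"
    if \<phi>: "\<phi> \<in> test_functions \<Omega>" and e: "e > 0" for \<phi> e
  proof (intro conjI)
    show o: "open {x. \<bar>\<phi> x\<bar> > e}"
      by (intro open_Collect_less continuous_intros test_continuous[OF \<phi>])
    obtain H where H: "compact H" "H \<subseteq> \<Omega>" "\<And>x. x \<notin> H \<Longrightarrow> \<phi> x = 0" "\<And>x. x \<notin> H \<Longrightarrow> grad \<phi> x = 0"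
      using test_functionsE[OF \<phi>] by blast
    show s: "{x. \<bar>\<phi> x\<bar> > e} \<subseteq> \<Omega>" using H(2,3) e by force
    have t: "(\<lambda>x. (1 / e) * \<phi> x) \<in> test_functions \<Omega>" by (rule test_cmult[OF \<phi>])
    have g: "grad (\<lambda>x. (1 / e) * \<phi> x) x = (1 / e) *\<^sub>R grad \<phi> x" for x
      using GDERIV_mult[OF GDERIV_const[of "1 / e" x] test_GDERIV[OF \<phi>, of x]] by (intro grad_eqI) simp
    have level_energy: "energy (\<lambda>x. (1 / e) * \<phi> x) = (1 / e) powr p * energy \<phi>"
      unfolding energy_def g using e by (simp add: powr_mult powr_divide)
    note st = smooth_cap_test[OF t B(2)]
    show "cap \<Omega> p {x. \<bar>\<phi> x\<bar> > e} \<le> ennreal (B powr p * (1 / e) powr p * energy \<phi>)"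
    proof (rule cap_leI[OF o s])
      fix K assume K: "compact K" "K \<subseteq> {x. \<bar>\<phi> x\<bar> > e}"
      have "cap_compact \<Omega> p K \<le> ennreal (energy (\<lambda>x. smooth_cap ((1 / e) * \<phi> x)))"
      proof (rule cap_compact_le[OF st(1)])
        fix x assume "x \<in> K"
        then have "\<bar>(1 / e) * \<phi> x\<bar> \<ge> 1" using K(2) e by (auto simp: abs_mult field_simps)
        then show "1 \<le> smooth_cap ((1 / e) * \<phi> x)" by (simp add: smooth_cap_1)
      qed
      also have "\<dots> \<le> ennreal (B powr p * (1 / e) powr p * energy \<phi>)"
        using st(2) unfolding level_energy by (intro ennreal_leI) (simp add: mult.assoc)
      finally show "cap_compact \<Omega> p K \<le> ennreal (B powr p * (1 / e) powr p * energy \<phi>)" .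
    qed
  qed
  then show ?thesis using B(1) by (intro that[of "B powr p"]) auto
qed

end

subsection \<open>Quasi continuous representatives\<close>

lemma emeasure_lborel_translation:
  fixes A :: "'a::euclidean_space set"
  assumes A: "A \<in> sets borel"
  shows "emeasure lborel {z. z - x \<in> A} = emeasure lborel A"
proof -
  have s: "{z. z - x \<in> A} \<in> sets borel"
  proof -
    have "(\<lambda>z. z - x) -` A \<inter> space borel \<in> sets borel"
      by (rule measurable_sets[OF _ A]) simp
    then show ?thesis by (simp add: vimage_def)
  qed
  have "emeasure lborel {z. z - x \<in> A} = (\<integral>\<^sup>+z. indicator {z. z - x \<in> A} z \<partial>lborel)" using s by simp
  also have "\<dots> = (\<integral>\<^sup>+y. indicator {z. z - x \<in> A} (y + x) \<partial>lborel)"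
    by (rule nn_integral_lborel_translation[symmetric]) (use s in simp)
  also have "\<dots> = (\<integral>\<^sup>+y. indicator A y \<partial>lborel)"
    by (intro nn_integral_cong) (simp add: indicator_def)
  finally show ?thesis using A by simp
qed

context sobolev_domain begin

text \<open>Averaging over small cubes turns a function which is at least \<open>1\<close> on most of \<open>V\<close> into one which is
  bounded below on compact subsets of \<open>V\<close>; this is why capacity does not see null sets added to an open set.\<close>

lemma cap_average:
  assumes L: "compact L" "L \<subseteq> \<Omega>"
  obtains C where "C > 0" "\<And>U V c. \<lbrakk>open U; open V; U \<subseteq> V; V \<subseteq> \<Omega>; emeasure lebesgue (V - U) = 0; cap \<Omega> p U < ennreal c\<rbrakk>
     \<Longrightarrow> cap \<Omega> p (V \<inter> interior L) \<le> ennreal (C * c)"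
proof -
  obtain B where B: "B \<ge> 1" "\<And>s. \<bar>smooth_cap' s\<bar> \<le> B" using smooth_cap'_bounded by blast
  obtain CP where CP: "CP > 0" "\<And>\<phi>. \<phi> \<in> test_functions \<Omega> \<Longrightarrow> (LINT x|M. \<bar>\<phi> x\<bar> powr p) \<le> CP * (LINT x|M. norm (grad \<phi> x) powr p)"
    using test_poincare by blast
  \<comment> \<open>This cutoff is fixed before \<open>U\<close> and \<open>V\<close>. Potentials
    multiplied by it are supported in the fixed compact set \<open>H\<close>, so their translates by
    at most \<open>r0\<close> stay inside the domain, however close to the boundary the potentials
    themselves extend.\<close>
  obtain \<eta> where \<eta>: "\<eta> \<in> test_functions \<Omega>" "\<And>x. 0 \<le> \<eta> x" "\<And>x. \<eta> x \<le> 1" "\<And>x. x \<in> L \<Longrightarrow> \<eta> x = 1"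
    using exists_cutoff[OF L(1) open_dom L(2)] by blast
  obtain E where E: "E > 0" "\<And>x. \<bar>\<eta> x\<bar> \<le> E" "\<And>x. norm (grad \<eta> x) \<le> E" using test_bounded[OF \<eta>(1)] by blast
  obtain H where H: "compact H" "H \<subseteq> \<Omega>" "\<And>x. x \<notin> H \<Longrightarrow> \<eta> x = 0" "\<And>x. x \<notin> H \<Longrightarrow> grad \<eta> x = 0"
    using test_functionsE[OF \<eta>(1)] by blast
  obtain r0 where r0: "r0 > 0" "(\<Union>x\<in>H. cball x r0) \<subseteq> \<Omega>"
    using compact_subset_open_imp_cball_epsilon_subset[OF H(1) open_dom H(2)] by blast
  \<comment> \<open>Origin of the factors: 2^p from the factor 2 in \<open>f\<close>, 2^p from
    splitting the gradient of a product, E^p CP from the gradient of the cutoff via the Poincare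
    inequality, 1 from the gradient of the potential, B^p from the cap. Averaging contributes one
    more 2^p at the end.\<close>
  define D where "D = 2 powr p * 2 powr p * (E powr p * CP + 1) * B powr p"
  have D0: "D > 0" unfolding D_def using E(1) CP(1) B(1) by (intro mult_pos_pos) (auto intro: add_nonneg_pos)
  have "cap \<Omega> p (V \<inter> interior L) \<le> ennreal ((2 powr p * D) * c)"
    if UV: "open U" "open V" "U \<subseteq> V" "V \<subseteq> \<Omega>" "emeasure lebesgue (V - U) = 0" "cap \<Omega> p U < ennreal c" for U V c
  proof (rule cap_leI)
    show "open (V \<inter> interior L)" "V \<inter> interior L \<subseteq> \<Omega>" using UV by auto
    fix K assume K: "compact K" "K \<subseteq> V \<inter> interior L"
    obtain r1 where r1: "r1 > 0" "(\<Union>x\<in>K. cball x r1) \<subseteq> V \<inter> interior L"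
      using compact_subset_open_imp_cball_epsilon_subset[OF K(1) open_Int[OF UV(2) open_interior] K(2)] by blast
    define r where "r = min r0 r1"
    have r: "r > 0" "r \<le> r0" "r \<le> r1" using r0 r1 by (auto simp: r_def)
    \<comment> \<open>The sum of the absolute coordinates bounds the norm, so the cube of half side
      r divided by the dimension lies in the ball of radius r.\<close>
    define d where "d = r / real DIM('a)"
    have d: "d > 0" using r by (simp add: d_def)
    let ?a = "- (d *\<^sub>R One) :: 'a" and ?b = "d *\<^sub>R One :: 'a"
    define Q where "Q = cbox ?a ?b"
    define vol where "vol = measure lborel Q"
    have "0 < measure lborel (cbox ?a ?b)" by (rule content_pos_lt) (use d in simp)
    then have vol: "measure lborel (cbox ?a ?b) = vol" "vol > 0"
      unfolding vol_def Q_def by - (rule refl, assumption)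
    have Qr: "norm y \<le> r" if "y \<in> Q" for y
    proof -
      have "norm y \<le> (\<Sum>i\<in>Basis. \<bar>y \<bullet> i\<bar>)" by (rule norm_le_l1)
      also have "\<dots> \<le> (\<Sum>i\<in>(Basis::'a set). d)"
        using that by (intro sum_mono) (auto simp: Q_def mem_box abs_le_iff minus_le_iff)
      also have "\<dots> = r" by (simp add: d_def)
      finally show ?thesis .
    qed
    have Us: "U \<in> sets lebesgue" and Vs: "V \<in> sets lebesgue" using UV by auto
    have "vol / 2 > 0" using vol by simp
    then obtain T where T: "closed T" "T \<subseteq> U" "U - T \<in> lmeasurable" "emeasure lebesgue (U - T) < ennreal (vol / 2)"
      using sets_lebesgue_inner_closed[OF Us] by blast
    have Ts: "T \<in> sets lebesgue" using T(1) by auto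
    have "bounded T" using T(2) UV(3,4) bounded_dom bounded_subset by (meson order_trans)
    then have Tc: "compact T" using T(1) compact_eq_bounded_closed by blast
    have "cap_compact \<Omega> p T < ennreal c"
      using cap_compact_le_cap[OF UV(1) _ Tc T(2)] UV(3,4,6) by (meson order_trans le_less_trans)
    then obtain \<phi> where \<phi>: "\<phi> \<in> test_functions \<Omega>" "\<And>x. x \<in> T \<Longrightarrow> \<phi> x \<ge> 1" "ennreal (energy \<phi>) < ennreal c"
      by (rule cap_compact_lessE) blast
    have ec: "energy \<phi> < c" using \<phi>(3) energy_nonneg by (auto simp: ennreal_less_iff)
    let ?s = "\<lambda>x. smooth_cap (\<phi> x)"
    note st = smooth_cap_test[OF \<phi>(1) B(2)]
    \<comment> \<open>The factor 2 compensates the half of a cube that may be lost: at least half of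
      each cube centred in \<open>K\<close> is shifted into \<open>T\<close>, where \<open>f\<close>
      is at least 2, so the average is at least 1.\<close>
    define f where "f = (\<lambda>x. 2 * (?s x * \<eta> x))"
    have ft: "f \<in> test_functions \<Omega>"
      unfolding f_def by (intro test_cmult test_mult st(1) test_Ck[OF \<eta>(1)])
    have fb: "0 \<le> f x" for x unfolding f_def using smooth_cap_bounds \<eta>(2) by simp
    have f2: "f z \<ge> 2" if "z \<in> T" "z \<in> L" for z
      unfolding f_def using smooth_cap_1[of "\<phi> z"] \<phi>(2)[OF that(1)] \<eta>(4)[OF that(2)] by simp
    have f0: "f z = 0" if "z \<notin> H" for z unfolding f_def using H(3)[OF that] by simp
    have fg: "grad f x = 2 *\<^sub>R (?s x *\<^sub>R grad \<eta> x + \<eta> x *\<^sub>R grad ?s x)" for x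
    proof (rule grad_eqI)
      have "GDERIV (\<lambda>x. ?s x * \<eta> x) x :> ?s x *\<^sub>R grad \<eta> x + \<eta> x *\<^sub>R grad ?s x"
        by (rule GDERIV_mult[OF test_GDERIV[OF st(1)] test_GDERIV[OF \<eta>(1)]])
      from GDERIV_mult[OF GDERIV_const[of 2 x] this]
      show "GDERIV f x :> 2 *\<^sub>R (?s x *\<^sub>R grad \<eta> x + \<eta> x *\<^sub>R grad ?s x)" unfolding f_def by simp
    qed
    define g where "g = (\<lambda>x. (1 / vol) * integral Q (\<lambda>y. f (x + y)))"
    note avg = Ck_translate_average[OF test_Ck[OF ft], where a = ?a and b = ?b, folded Q_def]
    let ?H = "\<Union>x\<in>H. cball x r"
    have gt: "g \<in> test_functions \<Omega>"
    proof (rule test_functionsI)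
      show "Ck k g" for k unfolding g_def by (intro Ck_mult Ck_const avg(1))
      show "compact ?H" by (rule compact_minkowski_sum_cball[OF H(1)])
      show "?H \<subseteq> \<Omega>" using r0(2) r(2) by force
      show "g x = 0" if "x \<notin> ?H" for x
      proof -
        have "f (x + y) = 0" if y: "y \<in> Q" for y
        proof (rule f0)
          show "x + y \<notin> H"
          proof
            assume "x + y \<in> H"
            moreover have "x \<in> cball (x + y) r" using Qr[OF y] by (simp add: dist_norm)
            ultimately show False using \<open>x \<notin> ?H\<close> by blast
          qed
        qed
        then have "integral Q (\<lambda>y. f (x + y)) = integral Q (\<lambda>y. 0)" by (intro Henstock_Kurzweil_Integration.integral_cong)
        then show ?thesis by (simp add: g_def)
      qed
    qed
    have gg: "grad g x = (1 / vol) *\<^sub>R integral Q (\<lambda>y. grad f (x + y))" for x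
      unfolding g_def
      using GDERIV_mult[OF GDERIV_const[of "1 / vol" x] avg(2)[of x]] by (intro grad_eqI) simp
    have g1: "g x \<ge> 1" if x: "x \<in> K" for x
    proof -
      have xr: "x + y \<in> V \<inter> interior L" if y: "y \<in> Q" for y
      proof -
        have "x + y \<in> cball x r1" using Qr[OF y] r(3) by (simp add: dist_norm)
        then show ?thesis using r1(2) x by blast
      qed
      define A where "A = {y \<in> Q. x + y \<notin> T}"
      have Ab: "A \<in> sets borel"
      proof -
        have "(\<lambda>y. x + y) -` (- T) \<inter> space borel \<in> sets borel"
          by (rule measurable_sets[of _ borel borel]) (use T(1) in auto)
        moreover have "A = Q \<inter> ((\<lambda>y. x + y) -` (- T) \<inter> space borel)" by (auto simp: A_def)
        ultimately show ?thesis unfolding Q_def by auto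
      qed
      \<comment> \<open>Shifted to x, the bad part of the cube lies in \<open>V\<close>. What is
        outside \<open>U\<close> is null by assumption, and the rest is in
        \<open>U - T\<close>.\<close>
      have sub: "{z. z - x \<in> A} \<subseteq> (V - U) \<union> (U - T)"
      proof
        fix z assume "z \<in> {z. z - x \<in> A}"
        then have "z - x \<in> Q" "z \<notin> T" by (auto simp: A_def)
        then show "z \<in> (V - U) \<union> (U - T)" using xr[of "z - x"] by auto
      qed
      have zb: "{z. z - x \<in> A} \<in> sets borel"
      proof -
        have "(\<lambda>z. z - x) -` A \<inter> space borel \<in> sets borel" by (rule measurable_sets[OF _ Ab]) simp
        then show ?thesis by (simp add: vimage_def)
      qed
      have "emeasure lborel A = emeasure lborel {z. z - x \<in> A}" by (rule emeasure_lborel_translation[OF Ab, symmetric])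
      also have "\<dots> = emeasure lebesgue {z. z - x \<in> A}" using zb by simp
      also have "\<dots> \<le> emeasure lebesgue ((V - U) \<union> (U - T))"
        by (intro emeasure_mono[OF sub] sets.Un sets.Diff Us Vs Ts)
      also have "\<dots> \<le> emeasure lebesgue (V - U) + emeasure lebesgue (U - T)"
        by (intro emeasure_subadditive sets.Diff Us Vs Ts)
      also have "\<dots> < ennreal (vol / 2)" using T(4) UV(5) by simp
      finally have Am: "emeasure lborel A < ennreal (vol / 2)" .
      then have mA: "measure lborel A \<le> vol / 2"
        unfolding measure_def using vol(2) by (metis enn2real_leI less_imp_le half_gt_zero)
      have finite_part: "emeasure lborel A < \<infinity>" using Am ennreal_less_top less_trans infinity_ennreal_def by metis
      have iA: "integrable lborel (indicat_real A)" using Ab finite_part by simp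
      have Qb: "Q \<in> sets borel" "emeasure lborel Q < \<infinity>" 
        unfolding Q_def using emeasure_lborel_cbox_finite[of ?a ?b] by (simp, simp only: infinity_ennreal_def)
      have iQ: "integrable lborel (indicat_real Q)" using Qb by simp
      have cf: "continuous_on Q (\<lambda>y. f (x + y))"
        by (rule continuous_on_compose2[OF test_continuous[OF ft]]) (auto intro!: continuous_intros)
      have i0: "integrable lborel (\<lambda>y. indicator Q y *\<^sub>R f (x + y))"
        using cf unfolding Q_def by (intro borel_integrable_compact) auto
      have "vol \<le> 2 * (vol - measure lborel A)" using mA by simp
      also have "\<dots> = (LINT y|lborel. 2 * (indicat_real Q y - indicat_real A y))"
        using iA iQ Ab Qb by (simp add: vol_def)
      also have "\<dots> \<le> (LINT y|lborel. indicator Q y *\<^sub>R f (x + y))"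
      proof (rule integral_mono[OF _ i0])
        show "integrable lborel (\<lambda>y. 2 * (indicat_real Q y - indicat_real A y))" using iA iQ by simp
        fix y
        show "2 * (indicat_real Q y - indicat_real A y) \<le> indicator Q y *\<^sub>R f (x + y)"
        proof (cases "y \<in> Q \<and> y \<notin> A")
          case True
          then have "x + y \<in> T" "x + y \<in> L" using xr[of y] interior_subset[of L] by (auto simp: A_def)
          then show ?thesis using True f2[of "x + y"] by simp
        next
          case False
          then have "indicat_real Q y \<le> indicat_real A y" by (auto simp: indicator_def)
          then show ?thesis using fb[of "x + y"] by (simp add: mult_nonneg_nonneg add_increasing2 indicator_def)
        qed
      qed
      also have "\<dots> = integral Q (\<lambda>y. f (x + y))"
        using set_borel_integral_eq_integral(2)[of Q "\<lambda>y. f (x + y)"] i0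
        by (simp add: set_integrable_def set_lebesgue_integral_def)
      finally show ?thesis unfolding g_def using vol(2) by (simp add: field_simps)
    qed
    have eg: "ennreal (energy g) \<le> ennreal (2 powr p) * ennreal (energy f)"
      using average_energy_le[OF test_grad_continuous[OF ft] p_gt_1 vol]
      unfolding energy_lborel[OF gt, symmetric] energy_lborel[OF ft, symmetric] gg Q_def .
    have ef: "energy f \<le> D * energy \<phi>"
    proof -
      have sl: "?s \<in> Lp \<Omega> p" "grad ?s \<in> Lp \<Omega> p" by (rule test_in_Lp[OF st(1)])+
      have i1: "integrable M (\<lambda>x. \<bar>?s x\<bar> powr p)" using LpD(2)[OF sl(1)] by simp
      have i2: "integrable M (\<lambda>x. norm (grad ?s x) powr p)" by (rule LpD(2)[OF sl(2)])
      have "energy f \<le> (LINT x|M. 2 powr p * (2 powr p * (E powr p * \<bar>?s x\<bar> powr p + norm (grad ?s x) powr p)))"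
        unfolding energy_def
      proof (rule integral_mono)
        show "integrable M (\<lambda>x. norm (grad f x) powr p)" by (rule LpD(2)[OF test_in_Lp(2)[OF ft]])
        show "integrable M (\<lambda>x. 2 powr p * (2 powr p * (E powr p * \<bar>?s x\<bar> powr p + norm (grad ?s x) powr p)))"
          using i1 i2 by simp
        fix x
        have "norm (grad f x) powr p = 2 powr p * norm (?s x *\<^sub>R grad \<eta> x + \<eta> x *\<^sub>R grad ?s x) powr p"
          unfolding fg norm_scaleR by (simp add: powr_mult)
        also have "\<dots> \<le> 2 powr p * (2 powr p * (norm (?s x *\<^sub>R grad \<eta> x) powr p + norm (\<eta> x *\<^sub>R grad ?s x) powr p))"
          using p_gt_1 by (intro mult_left_mono norm_add_powr_le) auto
        also have "\<dots> \<le> 2 powr p * (2 powr p * (E powr p * \<bar>?s x\<bar> powr p + norm (grad ?s x) powr p))"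
        proof (intro mult_left_mono add_mono)
          have "norm (?s x *\<^sub>R grad \<eta> x) \<le> E * \<bar>?s x\<bar>"
            using mult_left_mono[OF E(3)[of x] abs_ge_zero[of "?s x"]] by (simp add: mult.commute)
          then have "norm (?s x *\<^sub>R grad \<eta> x) powr p \<le> (E * \<bar>?s x\<bar>) powr p" using p_gt_1 by (intro powr_mono2) auto
          also have "\<dots> = E powr p * \<bar>?s x\<bar> powr p" using E(1) by (simp add: powr_mult)
          finally show "norm (?s x *\<^sub>R grad \<eta> x) powr p \<le> E powr p * \<bar>?s x\<bar> powr p" .
          have "norm (\<eta> x *\<^sub>R grad ?s x) \<le> norm (grad ?s x)"
            using mult_right_mono[of "\<bar>\<eta> x\<bar>" 1 "norm (grad ?s x)"] \<eta>(2,3)[of x] by simp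
          then show "norm (\<eta> x *\<^sub>R grad ?s x) powr p \<le> norm (grad ?s x) powr p" using p_gt_1 by (intro powr_mono2) auto
        qed auto
        finally show "norm (grad f x) powr p \<le> 2 powr p * (2 powr p * (E powr p * \<bar>?s x\<bar> powr p + norm (grad ?s x) powr p))" .
      qed
      also have "\<dots> = 2 powr p * (2 powr p * (E powr p * (LINT x|M. \<bar>?s x\<bar> powr p) + energy ?s))"
        using i1 i2 by (simp add: energy_def)
      also have "\<dots> \<le> 2 powr p * (2 powr p * (E powr p * (CP * energy ?s) + energy ?s))"
        using CP(2)[OF st(1)] by (intro mult_left_mono add_right_mono) (auto simp: energy_def)
      also have "\<dots> = 2 powr p * 2 powr p * (E powr p * CP + 1) * energy ?s" by (simp add: algebra_simps)
      also have "\<dots> \<le> 2 powr p * 2 powr p * (E powr p * CP + 1) * (B powr p * energy \<phi>)"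
        using st(2) CP(1) by (intro mult_left_mono) auto
      finally show ?thesis unfolding D_def by (simp add: mult.assoc)
    qed
    have "cap_compact \<Omega> p K \<le> ennreal (energy g)" by (rule cap_compact_le[OF gt g1])
    also have "\<dots> \<le> ennreal (2 powr p) * ennreal (energy f)" by (rule eg)
    also have "\<dots> \<le> ennreal (2 powr p) * ennreal (D * c)"
      using ef ec D0 by (intro mult_left_mono ennreal_leI) (auto intro: order_trans mult_left_mono less_imp_le)
    also have "\<dots> = ennreal ((2 powr p * D) * c)"
      using D0 ec energy_nonneg[of \<phi>] by (subst ennreal_mult[symmetric]) (auto simp: mult.assoc)
    finally show "cap_compact \<Omega> p K \<le> ennreal ((2 powr p * D) * c)" .
  qed
  then show ?thesis using D0 by (intro that[of "2 powr p * D"]) auto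
qed

section \<open>Quasi continuity: operations, uniqueness and existence\<close>

lemma quasi_continuousD:
  assumes "quasi_continuous \<Omega> p f" "e > 0"
  obtains U where "open U" "U \<subseteq> \<Omega>" "cap \<Omega> p U < ennreal e" "continuous_on (\<Omega> - U) f"
  using assms unfolding quasi_continuous_def by blast

lemma quasi_continuous_compose:
  assumes "quasi_continuous \<Omega> p f" "continuous_on UNIV F"
  shows "quasi_continuous \<Omega> p (\<lambda>x. F (f x))"
  unfolding quasi_continuous_def
proof (intro allI impI)
  fix e :: real assume "e > 0"
  then obtain U where U: "open U" "U \<subseteq> \<Omega>" "cap \<Omega> p U < ennreal e" "continuous_on (\<Omega> - U) f"
    by (rule quasi_continuousD[OF assms(1)])
  have "continuous_on (\<Omega> - U) (\<lambda>x. F (f x))"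
    by (rule continuous_on_compose2[OF assms(2) U(4)]) simp
  then show "\<exists>U. open U \<and> U \<subseteq> \<Omega> \<and> cap \<Omega> p U < ennreal e \<and> continuous_on (\<Omega> - U) (\<lambda>x. F (f x))"
    using U by blast
qed

lemma quasi_continuous_Pair:
  assumes "quasi_continuous \<Omega> p f" "quasi_continuous \<Omega> p g"
  shows "quasi_continuous \<Omega> p (\<lambda>x. (f x, g x))"
  unfolding quasi_continuous_def
proof (intro allI impI)
  fix e :: real assume e: "e > 0"
  obtain A where A: "A \<ge> 1" "\<And>U V c d. \<lbrakk>open U; open V; U \<subseteq> \<Omega>; V \<subseteq> \<Omega>; cap \<Omega> p U < ennreal c; cap \<Omega> p V < ennreal d\<rbrakk>
     \<Longrightarrow> cap \<Omega> p (U \<union> V) \<le> ennreal (A * (c + d))" using cap_Un by blast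
  define c where "c = e / (4 * A)"
  have c: "c > 0" using e A(1) by (simp add: c_def)
  obtain U where U: "open U" "U \<subseteq> \<Omega>" "cap \<Omega> p U < ennreal c" "continuous_on (\<Omega> - U) f"
    by (rule quasi_continuousD[OF assms(1) c])
  obtain V where V: "open V" "V \<subseteq> \<Omega>" "cap \<Omega> p V < ennreal c" "continuous_on (\<Omega> - V) g"
    by (rule quasi_continuousD[OF assms(2) c])
  have "cap \<Omega> p (U \<union> V) \<le> ennreal (A * (c + c))" by (rule A(2)[OF U(1) V(1) U(2) V(2) U(3) V(3)])
  also have "A * (c + c) = e / 2" using A(1) by (simp add: c_def field_simps)
  also have "ennreal (e / 2) < ennreal e" using e by (intro ennreal_lessI) auto
  finally have "cap \<Omega> p (U \<union> V) < ennreal e" .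
  moreover have "continuous_on (\<Omega> - (U \<union> V)) (\<lambda>x. (f x, g x))"
    by (intro continuous_on_Pair continuous_on_subset[OF U(4)] continuous_on_subset[OF V(4)]) auto
  ultimately show "\<exists>U. open U \<and> U \<subseteq> \<Omega> \<and> cap \<Omega> p U < ennreal e \<and> continuous_on (\<Omega> - U) (\<lambda>x. (f x, g x))"
    using U V by (intro exI[of _ "U \<union> V"]) auto
qed

text \<open>\<open>N\<close> may fail to be Borel. The intersection of its open neighbourhoods of
  small capacity is a Borel set of capacity zero containing it, and to this set diffuseness
  applies.\<close>

lemma diffuse_null:
  assumes \<mu>: "bounded_borel_measure \<Omega> \<mu>" "diffuse \<Omega> p \<mu>"
    and N: "\<And>e. e > 0 \<Longrightarrow> \<exists>V. open V \<and> N \<subseteq> V \<and> V \<subseteq> \<Omega> \<and> cap \<Omega> p V \<le> ennreal e"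
  shows "AE x in \<mu>. x \<notin> N"
proof -
  have "\<forall>n. \<exists>V. open V \<and> N \<subseteq> V \<and> V \<subseteq> \<Omega> \<and> cap \<Omega> p V \<le> ennreal (1 / real (Suc n))"
    using N by simp
  from choice[OF this] obtain V where V: "\<forall>n. open (V n) \<and> N \<subseteq> V n \<and> V n \<subseteq> \<Omega> \<and> cap \<Omega> p (V n) \<le> ennreal (1 / real (Suc n))"
    by (rule exE)
  define B where "B = (\<Inter>n. V n)"
  have Bs: "B \<in> sets (restrict_space borel \<Omega>)"
  proof -
    have "B \<in> sets borel" unfolding B_def using V by (intro sets.countable_INT) auto
    moreover have "B \<subseteq> \<Omega>" unfolding B_def using V by blast
    ultimately show ?thesis using open_dom by (subst sets_restrict_space_iff) auto
  qed
  have "cap \<Omega> p B \<le> 0"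
  proof (rule ennreal_le_epsilon)
    fix e :: real assume e: "e > 0"
    then obtain n where n: "1 / real (Suc n) < e" using nat_approx_posE by blast
    have "cap \<Omega> p B \<le> cap \<Omega> p (V n)" by (rule cap_mono) (auto simp: B_def)
    also have "\<dots> \<le> ennreal (1 / real (Suc n))" using V by blast
    also have "\<dots> \<le> ennreal e" using n by (intro ennreal_leI) simp
    finally show "cap \<Omega> p B \<le> 0 + ennreal e" by simp
  qed
  then have "emeasure \<mu> B = 0" using \<mu>(2) Bs unfolding diffuse_def by simp
  moreover have "B \<in> sets \<mu>" using Bs \<mu>(1) by (simp add: bounded_borel_measure_def)
  ultimately have "B \<in> null_sets \<mu>" by auto
  then have "AE x in \<mu>. x \<notin> B" by (rule AE_not_in)
  then show ?thesis
  proof (rule eventually_mono)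
    fix x assume "x \<notin> B"
    then show "x \<notin> N" using V by (auto simp: B_def)
  qed
qed

text \<open>Outside an open set \<open>U\<close> of small capacity the set where the functions
  differ is relatively open; together with \<open>U\<close> it is open and exceeds \<open>U\<close>
  only by a Lebesgue null set. By \<open>cap_average\<close> the enlargement has small capacity
  locally, and \<open>diffuse_null\<close> together with a compact exhaustion concludes. The
  completion appears because the disagreement set itself is not known to be Borel.\<close>

lemma quasi_continuous_unique:
  fixes f g :: "'a \<Rightarrow> real"
  assumes \<mu>: "bounded_borel_measure \<Omega> \<mu>" "diffuse \<Omega> p \<mu>"
    and f: "quasi_continuous \<Omega> p f" and g: "quasi_continuous \<Omega> p g" and ae: "AE x in M. f x = g x"
  shows "AE x in completion \<mu>. f x = g x"
proof -
  define h where "h x = f x - g x" for x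
  have h: "quasi_continuous \<Omega> p h"
    using quasi_continuous_compose[OF quasi_continuous_Pair[OF f g], of "\<lambda>z. fst z - snd z"]
    unfolding h_def[abs_def] by (simp add: continuous_intros)
  define N where "N = {x \<in> \<Omega>. h x \<noteq> 0}"
  have N0: "N \<in> null_sets lebesgue"
  proof -
    have "AE x in lebesgue. x \<in> \<Omega> \<longrightarrow> f x = g x" using ae dom_sets by (simp add: AE_restrict_space_iff)
    then have "AE x in lebesgue. x \<notin> N" by eventually_elim (auto simp: N_def h_def)
    then show ?thesis by (simp add: completion.null_sets_iff_AE)
  qed
  have loc: "AE x in \<mu>. x \<notin> N \<inter> interior L" if L: "compact L" "L \<subseteq> \<Omega>" for L
  proof (rule diffuse_null[OF \<mu>])
    fix e :: real assume e: "e > 0"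
    obtain C where C: "C > 0" "\<And>U V c. \<lbrakk>open U; open V; U \<subseteq> V; V \<subseteq> \<Omega>; emeasure lebesgue (V - U) = 0; cap \<Omega> p U < ennreal c\<rbrakk>
       \<Longrightarrow> cap \<Omega> p (V \<inter> interior L) \<le> ennreal (C * c)"
      using cap_average[OF L] by blast
    have "e / C > 0" using e C by simp
    then obtain U where U: "open U" "U \<subseteq> \<Omega>" "cap \<Omega> p U < ennreal (e / C)" "continuous_on (\<Omega> - U) h"
      by (rule quasi_continuousD[OF h])
    have "openin (top_of_set (\<Omega> - U)) ((\<Omega> - U) \<inter> h -` (- {0}))"
      by (rule continuous_openin_preimage_gen[OF U(4)]) auto
    then obtain W where W: "open W" "(\<Omega> - U) \<inter> h -` (- {0}) = (\<Omega> - U) \<inter> W"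
      unfolding openin_open by blast
    define V where "V = (W \<inter> \<Omega>) \<union> U"
    have V: "open V" "U \<subseteq> V" "V \<subseteq> \<Omega>" using W(1) U(1,2) open_dom by (auto simp: V_def)
    have "V - U \<subseteq> N" using W(2) unfolding V_def N_def by blast
    then have "V - U \<in> null_sets lebesgue" using N0 by (rule completion.complete2)
    then have "emeasure lebesgue (V - U) = 0" by auto
    from C(2)[OF U(1) V(1,2,3) this U(3)] have "cap \<Omega> p (V \<inter> interior L) \<le> ennreal e" using C(1) by simp
    moreover have "N \<inter> interior L \<subseteq> V \<inter> interior L" using W(2) unfolding V_def N_def by blast
    ultimately show "\<exists>V. open V \<and> N \<inter> interior L \<subseteq> V \<and> V \<subseteq> \<Omega> \<and> cap \<Omega> p V \<le> ennreal e"
      using V by (intro exI[of _ "V \<inter> interior L"]) auto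
  qed
  obtain C :: "nat \<Rightarrow> 'a set" where C: "\<And>n. compact (C n)" "\<And>n. C n \<subseteq> \<Omega>" "\<And>n. C n \<subseteq> interior (C (Suc n))" "\<Union>(range C) = \<Omega>"
    using open_Union_compact_subsets[OF open_dom] by metis
  have sp: "space \<mu> = \<Omega>" using \<mu>(1) sets_eq_imp_space_eq[of \<mu> "restrict_space borel \<Omega>"]
    by (simp add: bounded_borel_measure_def space_restrict_space)
  have "AE x in \<mu>. \<forall>n. x \<notin> N \<inter> interior (C n)"
    unfolding AE_all_countable using loc C(1,2) by blast
  then have "AE x in \<mu>. f x = g x"
  proof (rule AE_mp, intro AE_I2 impI)
    fix x assume x: "x \<in> space \<mu>" "\<forall>n. x \<notin> N \<inter> interior (C n)"
    then obtain n where "x \<in> C n" using C(4) sp by blast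
    then have "x \<notin> N" using C(3)[of n] x(2) by blast
    then show "f x = g x" using x(1) sp by (simp add: N_def h_def)
  qed
  then show ?thesis by (rule AE_completion)
qed

text \<open>An approximating sequence is chosen to converge so fast that the sets where consecutive
  terms differ by more than 2^(-n) have capacities within the reach of \<open>cap_UN\<close>.
  Outside a tail of these sets the telescoping series converges uniformly by the M-test, so its
  limit is continuous there.\<close>

lemma quasi_continuous_exists:
  assumes f: "W0_grad f G"
  obtains w where "quasi_continuous \<Omega> p w" "AE x in M. w x = f x"
proof -
  obtain B where B: "B > 0" "\<And>\<phi> e. \<phi> \<in> test_functions \<Omega> \<Longrightarrow> e > 0 \<Longrightarrow>
     open {x. \<bar>\<phi> x\<bar> > e} \<and> {x. \<bar>\<phi> x\<bar> > e} \<subseteq> \<Omega> \<and> cap \<Omega> p {x. \<bar>\<phi> x\<bar> > e} \<le> ennreal (B * (1 / e) powr p * energy \<phi>)"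
    using cap_superlevel by blast
  obtain r where r: "0 < r" "r \<le> 1" "\<And>U e. \<lbrakk>\<And>i::nat. open (U i); \<And>i. U i \<subseteq> \<Omega>; \<And>i. cap \<Omega> p (U i) < ennreal (e * r ^ Suc i); 0 < e\<rbrakk>
     \<Longrightarrow> cap \<Omega> p (\<Union>i. U i) \<le> ennreal (e / 2)" using cap_UN by blast
  \<comment> \<open>With errors c t^n the capacity bound B (2^n)^p 2^p (2 c t^n) for the n-th set
    becomes exactly 2^(-n) r^(n+1): c supplies the factor r, and 2^p t = r/2 supplies the n-th
    powers.\<close>
  define t where "t = (1 / 2) * r / 2 powr p"
  define c where "c = r / (B * (2 * 2 powr p))"
  have p2: "2 powr p \<ge> 1" using p_gt_1 by (intro ge_one_powr_ge_zero) auto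
  have t: "0 < t" "t < 1" using r p2 by (auto simp: t_def divide_simps)
  have c: "c > 0" using r B by (simp add: c_def)
  define \<delta> where "\<delta> n = c * t ^ n" for n
  have \<delta>: "\<delta> n > 0" "\<delta> (Suc n) \<le> \<delta> n" for n using t c by (auto simp: \<delta>_def mult_left_le_one_le)
  have "\<forall>n. \<exists>\<phi>. \<phi> \<in> test_functions \<Omega> \<and> (LINT x|M. norm (\<phi> x - f x) powr p) < \<delta> n \<and>
      (LINT x|M. norm (grad \<phi> x - G x) powr p) < \<delta> n"
  proof
    fix k
    obtain \<phi> where \<phi>: "\<And>n. \<phi> n \<in> test_functions \<Omega>" "Lp_tendsto \<phi> f" "Lp_tendsto (\<lambda>n. grad (\<phi> n)) G"
      using f by (auto simp: W0_grad_def)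
    have "\<forall>\<^sub>F n in sequentially. (LINT x|M. norm (\<phi> n x - f x) powr p) < \<delta> k \<and> (LINT x|M. norm (grad (\<phi> n) x - G x) powr p) < \<delta> k"
      using \<phi>(2,3) \<delta>(1) unfolding Lp_tendsto_def by (intro eventually_conj order_tendstoD(2)) auto
    then obtain n where "(LINT x|M. norm (\<phi> n x - f x) powr p) < \<delta> k \<and> (LINT x|M. norm (grad (\<phi> n) x - G x) powr p) < \<delta> k"
      using eventually_happens'[OF sequentially_bot] by blast
    then show "\<exists>\<phi>. \<phi> \<in> test_functions \<Omega> \<and> (LINT x|M. norm (\<phi> x - f x) powr p) < \<delta> k \<and>
      (LINT x|M. norm (grad \<phi> x - G x) powr p) < \<delta> k" using \<phi>(1) by blast
  qed
  from choice[OF this] obtain \<phi> where \<phi>': "\<forall>n. \<phi> n \<in> test_functions \<Omega> \<and> (LINT x|M. norm (\<phi> n x - f x) powr p) < \<delta> n \<and>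
      (LINT x|M. norm (grad (\<phi> n) x - G x) powr p) < \<delta> n" by (rule exE)
  note \<phi> = \<phi>'[rule_format, THEN conjunct1] \<phi>'[rule_format, THEN conjunct2, THEN conjunct1] \<phi>'[rule_format, THEN conjunct2, THEN conjunct2]
  have "Lp_tendsto \<phi> f" unfolding Lp_tendsto_def
  proof (rule tendsto_sandwich[OF _ _ tendsto_const])
    show "\<forall>\<^sub>F n in sequentially. 0 \<le> (LINT x|M. norm (\<phi> n x - f x) powr p)" by simp
    show "\<forall>\<^sub>F n in sequentially. (LINT x|M. norm (\<phi> n x - f x) powr p) \<le> \<delta> n"
      by (intro always_eventually allI less_imp_le \<phi>(2))
    have "(\<lambda>n. c * t ^ n) \<longlonglongrightarrow> c * 0" using t by (intro tendsto_mult tendsto_const LIMSEQ_power_zero) simp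
    then show "\<delta> \<longlonglongrightarrow> 0" by (simp add: \<delta>_def[abs_def])
  qed
  then obtain s where s: "strict_mono s" "AE x in M. (\<lambda>n. \<phi> (s n) x) \<longlonglongrightarrow> f x"
    by (rule Lp_tendsto_AE_subseq[OF _ test_in_Lp(1)[OF \<phi>(1)] H0D(1)[OF f]])
  define U where "U n = {x. \<bar>\<phi> (Suc n) x - \<phi> n x\<bar> > (1 / 2) ^ n}" for n
  have U: "open (U n)" "U n \<subseteq> \<Omega>" "cap \<Omega> p (U n) < ennreal ((1 / 2) ^ n * r ^ Suc n)" for n
  proof -
    have td: "(\<lambda>x. \<phi> (Suc n) x - \<phi> n x) \<in> test_functions \<Omega>" by (rule test_diff[OF \<phi>(1) \<phi>(1)])
    have gd: "grad (\<lambda>x. \<phi> (Suc n) x - \<phi> n x) x = grad (\<phi> (Suc n)) x - grad (\<phi> n) x" for x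
      by (rule grad_eqI[OF GDERIV_diff[OF test_GDERIV[OF \<phi>(1)] test_GDERIV[OF \<phi>(1)]]])
    have h: "(1 / 2 :: real) ^ n > 0" by simp
    from B(2)[OF td h] show "open (U n)" "U n \<subseteq> \<Omega>" unfolding U_def by blast+
    have i: "integrable M (\<lambda>x. norm (grad (\<phi> k) x - G x) powr p)" for k
      by (rule LpD(2)[OF Lp_diff[OF test_in_Lp(2)[OF \<phi>(1)] H0D(2)[OF f]]])
    have "energy (\<lambda>x. \<phi> (Suc n) x - \<phi> n x) \<le> (LINT x|M. 2 powr p * (norm (grad (\<phi> (Suc n)) x - G x) powr p + norm (grad (\<phi> n) x - G x) powr p))"
      unfolding energy_def
    proof (rule integral_mono)
      show "integrable M (\<lambda>x. norm (grad (\<lambda>x. \<phi> (Suc n) x - \<phi> n x) x) powr p)" by (rule LpD(2)[OF test_in_Lp(2)[OF td]])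
      show "integrable M (\<lambda>x. 2 powr p * (norm (grad (\<phi> (Suc n)) x - G x) powr p + norm (grad (\<phi> n) x - G x) powr p))"
        using i by simp
      fix x
      show "norm (grad (\<lambda>x. \<phi> (Suc n) x - \<phi> n x) x) powr p \<le> 2 powr p * (norm (grad (\<phi> (Suc n)) x - G x) powr p + norm (grad (\<phi> n) x - G x) powr p)"
        unfolding gd using norm_add_powr_le[of p "grad (\<phi> (Suc n)) x - G x" "G x - grad (\<phi> n) x"] p_gt_1
        by (simp add: norm_minus_commute)
    qed
    also have "\<dots> = 2 powr p * ((LINT x|M. norm (grad (\<phi> (Suc n)) x - G x) powr p) + (LINT x|M. norm (grad (\<phi> n) x - G x) powr p))"
      using i by simp
    also have "\<dots> < 2 powr p * (\<delta> (Suc n) + \<delta> n)"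
      by (intro mult_strict_left_mono add_strict_mono \<phi>(3)) simp
    also have "\<dots> \<le> 2 powr p * (2 * \<delta> n)" using \<delta>(2)[of n] by (intro mult_left_mono) auto
    finally have e: "energy (\<lambda>x. \<phi> (Suc n) x - \<phi> n x) < 2 powr p * (2 * \<delta> n)" .
    have pw: "(1 / (1 / 2) ^ n) powr p = (2 powr p) ^ n"
    proof -
      have "1 / (1 / 2 :: real) ^ n = 2 ^ n" by (simp add: power_divide)
      moreover have "(2 ^ n :: real) powr p = (2 powr p) ^ n" by (induction n) (simp_all add: powr_mult)
      ultimately show ?thesis by simp
    qed
    have "B * (1 / (1 / 2) ^ n) powr p * energy (\<lambda>x. \<phi> (Suc n) x - \<phi> n x) < B * (1 / (1 / 2) ^ n) powr p * (2 powr p * (2 * \<delta> n))"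
      using e B(1) pw by (intro mult_strict_left_mono mult_pos_pos) auto
    also have "\<dots> = (B * (2 * 2 powr p) * c) * ((2 powr p) ^ n * t ^ n)" unfolding pw \<delta>_def by (simp add: mult_ac)
    also have "B * (2 * 2 powr p) * c = r" using B(1) by (simp add: c_def)
    also have "(2 powr p) ^ n * t ^ n = (1 / 2) ^ n * r ^ n"
    proof -
      have tt: "2 powr p * t = (1 / 2) * r" unfolding t_def by simp
      show ?thesis unfolding power_mult_distrib[of "2 powr p" t n, symmetric] tt by (rule power_mult_distrib)
    qed
    also have "r * ((1 / 2) ^ n * r ^ n) = (1 / 2) ^ n * r ^ Suc n" by simp
    finally have lt: "B * (1 / (1 / 2) ^ n) powr p * energy (\<lambda>x. \<phi> (Suc n) x - \<phi> n x) < (1 / 2) ^ n * r ^ Suc n" .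
    have "cap \<Omega> p (U n) \<le> ennreal (B * (1 / (1 / 2) ^ n) powr p * energy (\<lambda>x. \<phi> (Suc n) x - \<phi> n x))"
      using B(2)[OF td h] unfolding U_def by blast
    also have "\<dots> < ennreal ((1 / 2) ^ n * r ^ Suc n)" using lt r(1) by (intro ennreal_lessI) auto
    finally show "cap \<Omega> p (U n) < ennreal ((1 / 2) ^ n * r ^ Suc n)" .
  qed
  \<comment> \<open>Where the sequence diverges, the default \<open>f x\<close> makes the almost
    everywhere identity trivial; continuity is only claimed where the sequence converges.\<close>
  define w where "w x = (if convergent (\<lambda>n. \<phi> n x) then lim (\<lambda>n. \<phi> n x) else f x)" for x
  have wf: "AE x in M. w x = f x"
    using s(2)
  proof eventually_elim
    case (elim x)
    show ?case
    proof (cases "convergent (\<lambda>n. \<phi> n x)")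
      case True
      then have "(\<lambda>n. \<phi> n x) \<longlonglongrightarrow> w x" by (simp add: w_def convergent_LIMSEQ_iff)
      from LIMSEQ_subseq_LIMSEQ[OF this s(1)] have "(\<lambda>n. \<phi> (s n) x) \<longlonglongrightarrow> w x" by (simp add: o_def)
      then show ?thesis using elim by (rule LIMSEQ_unique)
    qed (simp add: w_def)
  qed
  have cont: "continuous_on (\<Omega> - (\<Union>i. U (N + i))) w" for N
  proof -
    let ?S = "\<Omega> - (\<Union>i. U (N + i))"
    let ?g = "\<lambda>i x. \<phi> (Suc (N + i)) x - \<phi> (N + i) x"
    have b: "norm (?g i x) \<le> (1 / 2) ^ i" if "x \<in> ?S" for i x
    proof -
      have "x \<notin> U (N + i)" using that by blast
      then have "\<bar>?g i x\<bar> \<le> (1 / 2) ^ (N + i)" by (simp add: U_def)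
      also have "\<dots> \<le> (1 / 2) ^ i" by (intro power_decreasing) auto
      finally show ?thesis by simp
    qed
    have ul: "uniform_limit ?S (\<lambda>n x. \<Sum>i<n. ?g i x) (\<lambda>x. \<Sum>i. ?g i x) sequentially"
      by (rule Weierstrass_m_test[OF b]) auto
    have tel: "(\<Sum>i<n. ?g i x) = \<phi> (N + n) x - \<phi> N x" for n x
      using sum_lessThan_telescope[of "\<lambda>i. \<phi> (N + i) x" n] by simp
    have "continuous_on ?S (\<lambda>x. \<Sum>i. ?g i x)"
    proof (rule uniform_limit_theorem[OF _ ul])
      show "\<forall>\<^sub>F n in sequentially. continuous_on ?S (\<lambda>x. \<Sum>i<n. ?g i x)"
        unfolding tel by (intro always_eventually allI continuous_intros continuous_on_subset[OF test_continuous[OF \<phi>(1)]]) auto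
    qed simp
    then have "continuous_on ?S (\<lambda>x. \<phi> N x + (\<Sum>i. ?g i x))"
      by (intro continuous_intros continuous_on_subset[OF test_continuous[OF \<phi>(1)]]) auto
    moreover have "\<phi> N x + (\<Sum>i. ?g i x) = w x" if x: "x \<in> ?S" for x
    proof -
      have "(\<lambda>n. \<phi> N x + (\<phi> (N + n) x - \<phi> N x)) \<longlonglongrightarrow> \<phi> N x + (\<Sum>i. ?g i x)"
        using tendsto_uniform_limitI[OF ul x] unfolding tel by (intro tendsto_intros)
      then have "(\<lambda>n. \<phi> (n + N) x) \<longlonglongrightarrow> \<phi> N x + (\<Sum>i. ?g i x)" by (simp add: add.commute)
      then have "(\<lambda>n. \<phi> n x) \<longlonglongrightarrow> \<phi> N x + (\<Sum>i. ?g i x)" by (rule LIMSEQ_offset)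
      then show ?thesis unfolding w_def using limI convergentI by metis
    qed
    ultimately show ?thesis by (rule continuous_on_eq)
  qed
  have "quasi_continuous \<Omega> p w"
    unfolding quasi_continuous_def
  proof (intro allI impI)
    fix e :: real assume e: "e > 0"
    obtain N where N: "(1 / 2) ^ N < e" using real_arch_pow_inv[OF e, of "1 / 2"] by auto
    \<comment> \<open>\<open>cap_UN\<close> is used with e = 2^(-N). The shifted sets satisfy its
      assumption because r <= 1.\<close>
    have "cap \<Omega> p (\<Union>i. U (N + i)) \<le> ennreal ((1 / 2) ^ N / 2)"
    proof (rule r(3))
      fix i
      have "(1 / 2) ^ (N + i) * r ^ Suc (N + i) \<le> (1 / 2) ^ N * r ^ Suc i"
        using r(1,2) by (intro mult_mono power_decreasing) auto
      then show "cap \<Omega> p (U (N + i)) < ennreal ((1 / 2) ^ N * r ^ Suc i)"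
        using U(3)[of "N + i"] ennreal_leI less_le_trans by blast
    qed (use U in auto)
    also have "\<dots> < ennreal e" using N e by (intro ennreal_lessI) (auto intro: le_less_trans[rotated])
    finally show "\<exists>U. open U \<and> U \<subseteq> \<Omega> \<and> cap \<Omega> p U < ennreal e \<and> continuous_on (\<Omega> - U) w"
      using U cont[of N] by (intro exI[of _ "\<Union>i. U (N + i)"]) auto
  qed
  then show ?thesis using wf by (rule that)
qed

end

subsection \<open>Renormalized solutions\<close>

lemma trunc_ereal: "trunc k (ereal s) = max (- k) (min s k)"
  by (auto simp: trunc_def max_def min_def)

lemma trunc_trunc:
  assumes "0 < k" "k \<le> l"
  shows "trunc k s = max (- k) (min (trunc l s) k)"
  using assms by (cases s) (auto simp: trunc_def min_def max_def)

text \<open>The inequality k < l has to be strict: at k = l the left-hand side holds for every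
  s.\<close>

lemma abs_trunc_le_iff:
  assumes "0 < k" "k < l"
  shows "\<bar>trunc l s\<bar> \<le> k \<longleftrightarrow> \<bar>s\<bar> \<le> ereal k"
  using assms by (cases s) (auto simp: trunc_def min_def max_def)

lemma continuous_trunc: "continuous_on UNIV (trunc k)"
proof -
  have 1: "continuous_on UNIV (\<lambda>s. max (- ereal k) (min s (ereal k)))"
    by (intro continuous_on_max continuous_on_min continuous_on_const continuous_on_id)
  have "continuous_on UNIV (\<lambda>s. real_of_ereal (max (- ereal k) (min s (ereal k))))"
    by (rule continuous_on_compose2[OF continuous_on_real 1]) (auto simp: max_def min_def)
  then show ?thesis by (simp add: trunc_def[abs_def])
qed

text \<open>A left inverse of arctan, extended monotonically by the infinite values beyond the ends
  of its range. A quasi continuous representative of arctan u can take the values at or beyond these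
  ends on exceptional sets, so the total function is what gets composed with it. It is continuous
  because it is monotone and onto.\<close>

definition tan_ereal :: "real \<Rightarrow> ereal" where
  "tan_ereal t = (if t \<ge> pi / 2 then \<infinity> else if t \<le> - (pi / 2) then - \<infinity> else ereal (tan t))"

lemma tan_ereal_arctan: "tan_ereal (arctan s) = ereal s"
  using arctan_bounded[of s] by (simp add: tan_ereal_def tan_arctan)

lemma continuous_tan_ereal: "continuous_on UNIV tan_ereal"
proof (rule continuous_onI_mono)
  have "x \<in> range tan_ereal" for x
  proof (cases x)
    case (real r) then show ?thesis using tan_ereal_arctan[of r] by (metis rangeI)
  next
    case PInf
    have "tan_ereal (pi / 2) = \<infinity>" by (simp add: tan_ereal_def)
    then show ?thesis using PInf by (metis rangeI)
  next
    case MInf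
    have "tan_ereal (- (pi / 2)) = - \<infinity>" using pi_gt_zero by (simp add: tan_ereal_def not_le)
    then show ?thesis using MInf by (metis rangeI)
  qed
  then have "range tan_ereal = UNIV" by blast
  then show "open (range tan_ereal)" by simp
  fix x y :: real assume "x \<le> y"
  then show "tan_ereal x \<le> tan_ereal y"
    using tan_mono_le[of x y] by (auto simp: tan_ereal_def)
qed

text \<open>Once the error is below r/4, the recursion drives b below any multiple of its fixed
  point r/2 greater than one. It will be applied to the energy below the level 2^n, divided by
  2^n.\<close>

lemma contraction_tendsto_zero:
  fixes b e :: "nat \<Rightarrow> real"
  assumes b: "\<And>n. 0 \<le> b n" "\<And>n. b (Suc n) \<le> b n / 2 + e n" and e: "e \<longlonglongrightarrow> 0"
  shows "b \<longlonglongrightarrow> 0"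
proof (rule LIMSEQ_I)
  fix r :: real assume r: "r > 0"
  have "\<forall>\<^sub>F n in sequentially. e n < r / 4" using e r by (intro order_tendstoD(2)) auto
  then obtain N where N: "\<And>n. n \<ge> N \<Longrightarrow> e n < r / 4" unfolding eventually_sequentially by blast
  have *: "b (N + k) \<le> b N * (1 / 2) ^ k + r / 2" for k
  proof (induction k)
    case (Suc k)
    have "b (N + Suc k) \<le> b (N + k) / 2 + r / 4" using b(2)[of "N + k"] N[of "N + k"] by simp
    also have "\<dots> \<le> (b N * (1 / 2) ^ k + r / 2) / 2 + r / 4" using Suc by simp
    finally show ?case by (simp add: field_simps)
  qed (use r in simp)
  have "(\<lambda>k. b N * (1 / 2) ^ k) \<longlonglongrightarrow> b N * 0" by (intro tendsto_mult tendsto_const LIMSEQ_power_zero) simp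
  then have "\<forall>\<^sub>F k in sequentially. b N * (1 / 2) ^ k < r / 2" using r by (intro order_tendstoD(2)) auto
  then obtain K where K: "\<And>k. k \<ge> K \<Longrightarrow> b N * (1 / 2) ^ k < r / 2" unfolding eventually_sequentially by blast
  show "\<exists>no. \<forall>n\<ge>no. norm (b n - 0) < r"
  proof (intro exI allI impI)
    fix n assume "n \<ge> N + K"
    then have n: "n - N \<ge> K" "N + (n - N) = n" by linarith+
    then show "norm (b n - 0) < r" using *[of "n - N"] K[OF n(1)] b(1)[of n] by simp
  qed
qed

section \<open>The structural assumptions and the gradient of a solution\<close>

locale renormalized_problem = sobolev_domain \<Omega> p for \<Omega> :: "'a::euclidean_space set" and p +
  fixes a :: "'a \<Rightarrow> 'a \<Rightarrow> 'a" and h :: "real \<Rightarrow> ennreal" and \<mu>d \<mu>c :: "'a measure" and \<alpha> \<beta> :: real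
  assumes car: "caratheodory \<Omega> a" and \<alpha>_pos: "0 < \<alpha>" and \<beta>_pos: "0 < \<beta>"
    and coercive: "AE x in lebesgue_on \<Omega>. \<forall>\<xi>. \<alpha> * norm \<xi> powr p \<le> a x \<xi> \<bullet> \<xi>"
    and growth: "AE x in lebesgue_on \<Omega>. \<forall>\<xi>. norm (a x \<xi>) \<le> \<beta> * norm \<xi> powr (p - 1)"
    and strict_monotone: "AE x in lebesgue_on \<Omega>. \<forall>\<xi> \<xi>'. \<xi> \<noteq> \<xi>' \<longrightarrow> (a x \<xi> - a x \<xi>') \<bullet> (\<xi> - \<xi>') > 0"
    and \<mu>d: "bounded_borel_measure \<Omega> \<mu>d" "diffuse \<Omega> p \<mu>d"
    and \<mu>c: "emeasure \<mu>c (space \<mu>c) = 0"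
    and h_antimono: "antimono_on {0..} h"
begin

text \<open>For a simple field the composition is a finite sum over its values. Continuity in the
  second variable passes to the limit, for almost every x, and completeness of Lebesgue measure
  absorbs the exceptional set.\<close>

lemma caratheodory_measurable:
  assumes G: "G \<in> borel_measurable M"
  shows "(\<lambda>x. a x (G x)) \<in> borel_measurable M"
proof -
  obtain s where s: "\<And>i. simple_function M (s i)" "\<And>x. x \<in> space M \<Longrightarrow> (\<lambda>i. s i x) \<longlonglongrightarrow> G x"
    using borel_measurable_implies_sequence_metric[OF G, of 0] by blast
  have m: "(\<lambda>x. a x (s i x)) \<in> borel_measurable M" for i
  proof -
    let ?R = "s i ` space M"
    have finite_part: "finite ?R" using s(1) by (rule simple_functionD(1))
    have "(\<lambda>x. \<Sum>\<xi>\<in>?R. indicator (s i -` {\<xi>} \<inter> space M) x *\<^sub>R a x \<xi>) \<in> borel_measurable M"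
    proof (intro borel_measurable_sum borel_measurable_scaleR borel_measurable_indicator)
      fix \<xi>
      show "s i -` {\<xi>} \<inter> space M \<in> sets M" by (rule simple_functionD(2)[OF s(1)])
      show "(\<lambda>x. a x \<xi>) \<in> borel_measurable M" using car by (simp add: caratheodory_def)
    qed
    moreover have "(\<Sum>\<xi>\<in>?R. indicator (s i -` {\<xi>} \<inter> space M) x *\<^sub>R a x \<xi>) = a x (s i x)" if x: "x \<in> space M" for x
    proof -
      have "(\<Sum>\<xi>\<in>?R. indicator (s i -` {\<xi>} \<inter> space M) x *\<^sub>R a x \<xi>) = (\<Sum>\<xi>\<in>?R. if \<xi> = s i x then a x \<xi> else 0)"
        using x by (intro sum.cong) (auto simp: indicator_def)
      also have "\<dots> = a x (s i x)" using finite_part x by (subst sum.delta) auto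
      finally show ?thesis .
    qed
    ultimately show ?thesis by (subst measurable_cong[of M _ "\<lambda>x. \<Sum>\<xi>\<in>?R. indicator (s i -` {\<xi>} \<inter> space M) x *\<^sub>R a x \<xi>"]) auto
  qed
  show ?thesis
  proof (rule measurable_AE_cong)
    show "(\<lambda>x. lim (\<lambda>i. a x (s i x))) \<in> borel_measurable M" by (rule borel_measurable_lim_metric[OF m])
    have c: "AE x in M. continuous_on UNIV (a x)" using car by (simp add: caratheodory_def)
    show "AE x in M. a x (G x) = lim (\<lambda>i. a x (s i x))"
    proof (rule AE_mp[OF c], intro AE_I2 impI)
      fix x assume "x \<in> space M" "continuous_on UNIV (a x)"
      then have "(\<lambda>i. a x (s i x)) \<longlonglongrightarrow> a x (G x)"
        using s(2) by (intro continuous_on_tendsto_compose[of UNIV "a x"]) auto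
      then show "a x (G x) = lim (\<lambda>i. a x (s i x))" by (rule limI[symmetric])
    qed
  qed
qed

abbreviation "sol u \<equiv> renormalized_solution \<Omega> p a h \<mu>d \<mu>c u"
abbreviation "tg u \<equiv> trunc_grad \<Omega> u"

definition finite_part :: "('a \<Rightarrow> ereal) \<Rightarrow> 'a \<Rightarrow> real" where "finite_part u x = real_of_ereal (u x)"

lemma sol_finite:
  assumes "sol u"
  shows "AE x in M. u x = ereal (finite_part u x) \<and> 0 \<le> finite_part u x" "finite_part u \<in> borel_measurable M"
proof -
  have "u \<in> borel_measurable M" and ae: "AE x in M. 0 \<le> u x \<and> u x < \<infinity>"
    using assms by (auto simp: renormalized_solution_def)
  then show "finite_part u \<in> borel_measurable M" unfolding finite_part_def by measurable
  show "AE x in M. u x = ereal (finite_part u x) \<and> 0 \<le> finite_part u x"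
    using ae
  proof eventually_elim
    case (elim x)
    then show ?case by (cases "u x") (auto simp: finite_part_def)
  qed
qed

text \<open>\<open>trunc_grad\<close> is a choice, so a field with its defining property must be
  exhibited. The weak gradients of truncations at two levels agree where |u| is at most the lower
  one, and hence they glue.\<close>

lemma trunc_grad_spec:
  assumes u: "sol u"
  shows "tg u \<in> borel_measurable M"
    "k > 0 \<Longrightarrow> AE x in M. weak_grad \<Omega> (\<lambda>y. trunc k (u y)) x = indicat_real {y. \<bar>u y\<bar> \<le> ereal k} x *\<^sub>R tg u x"
proof -
  define t where "t k = (\<lambda>y. trunc k (u y))" for k
  define g where "g k = weak_grad \<Omega> (t k)" for k
  have H: "W0_grad (t k) (g k)" if "k > 0" for k
    unfolding g_def by (rule W1p_zero_W0_grad) (use u that in \<open>auto simp: renormalized_solution_def t_def\<close>)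
  have step: "AE x in M. g k x = indicat_real {s. \<bar>s\<bar> \<le> ereal k} (u x) *\<^sub>R g l x" if kl: "0 < k" "k < l" for k l
  proof -
    have tk: "t k = (\<lambda>x. max (- k) (min (t l x) k))"
      unfolding t_def using trunc_trunc[of k l] kl by auto
    have "AE x in M. g k x = indicator {s. \<bar>s\<bar> \<le> k} (t l x) *\<^sub>R g l x"
      unfolding g_def[of k] tk by (rule weak_grad_truncation[OF H]) (use kl in auto)
    then show ?thesis
      by eventually_elim (use abs_trunc_le_iff[OF kl] in \<open>simp add: t_def indicator_def\<close>)
  qed
  \<comment> \<open>At almost every point the sequence is constant as soon as the level exceeds |u|.
    Using \<open>lim\<close> makes measurability immediate.\<close>
  define v where "v x = lim (\<lambda>n. g (real (Suc n)) x)" for x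
  have vm: "v \<in> borel_measurable M"
    unfolding v_def[abs_def] by (rule borel_measurable_lim_metric) (rule H0D(4)[OF H], simp)
  have uf: "AE x in M. 0 \<le> u x \<and> u x < \<infinity>" using u by (auto simp: renormalized_solution_def)
  have vk: "AE x in M. g k x = indicat_real {s. \<bar>s\<bar> \<le> ereal k} (u x) *\<^sub>R v x" if k: "k > 0" for k
  proof -
    have "AE x in M. k < real (Suc n) \<longrightarrow> g k x = indicat_real {s. \<bar>s\<bar> \<le> ereal k} (u x) *\<^sub>R g (real (Suc n)) x" for n
      using step[OF k, of "real (Suc n)"] by (cases "k < real (Suc n)") auto
    then have "AE x in M. \<forall>n. k < real (Suc n) \<longrightarrow> g k x = indicat_real {s. \<bar>s\<bar> \<le> ereal k} (u x) *\<^sub>R g (real (Suc n)) x"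
      unfolding AE_all_countable by blast
    then show ?thesis
    proof eventually_elim
      case (elim x)
      obtain N where N: "k < real N" using reals_Archimedean2 by blast
      show ?case
      proof (cases "\<bar>u x\<bar> \<le> ereal k")
        case True
        have "g (real (Suc n)) x = g k x" if "n \<ge> N" for n
        proof -
          have "k < real (Suc n)" using N that by simp
          then show ?thesis using elim True by simp
        qed
        then have "\<forall>\<^sub>F n in sequentially. g (real (Suc n)) x = g k x"
          unfolding eventually_sequentially by blast
        then have "(\<lambda>n. g (real (Suc n)) x) \<longlonglongrightarrow> g k x" by (rule tendsto_eventually)
        then have "v x = g k x" unfolding v_def by (rule limI)
        then show ?thesis using True by simp
      next
        case False
        have "k < real (Suc N)" using N by simp
        then have "g k x = indicat_real {s. \<bar>s\<bar> \<le> ereal k} (u x) *\<^sub>R g (real (Suc N)) x" using elim by blast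
        then show ?thesis using False by simp
      qed
    qed
  qed
  have "v \<in> borel_measurable M \<and> (\<forall>k>0. AE x in M. weak_grad \<Omega> (\<lambda>y. trunc k (u y)) x = indicat_real {y. \<bar>u y\<bar> \<le> ereal k} x *\<^sub>R v x)"
    using vm vk by (auto simp: g_def t_def indicator_def)
  then have "\<exists>v. v \<in> borel_measurable M \<and> (\<forall>k>0. AE x in M. weak_grad \<Omega> (\<lambda>y. trunc k (u y)) x = indicat_real {y. \<bar>u y\<bar> \<le> ereal k} x *\<^sub>R v x)"
    by blast
  from someI_ex[OF this] show "tg u \<in> borel_measurable M"
    "k > 0 \<Longrightarrow> AE x in M. weak_grad \<Omega> (\<lambda>y. trunc k (u y)) x = indicat_real {y. \<bar>u y\<bar> \<le> ereal k} x *\<^sub>R tg u x"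
    unfolding trunc_grad_def by blast+
qed

text \<open>With \<open>ind_le\<close>, the real-valued counterparts of \<open>trunc\<close> and of
  the indicator in \<open>trunc_grad\<close>, applied to \<open>finite_part u\<close>, which agrees
  with \<open>u\<close> almost everywhere.\<close>

definition clamp :: "real \<Rightarrow> real \<Rightarrow> real" where "clamp k s = max (- k) (min s k)"
definition ind_le :: "real \<Rightarrow> real \<Rightarrow> real" where "ind_le k s = (if \<bar>s\<bar> \<le> k then 1 else 0)"

lemma sol_W0_grad:
  assumes u: "sol u" and k: "k > 0"
  shows "W0_grad (\<lambda>x. clamp k (finite_part u x)) (\<lambda>x. ind_le k (finite_part u x) *\<^sub>R tg u x)"
proof (rule W0_grad_cong_AE)
  show "W0_grad (\<lambda>y. trunc k (u y)) (weak_grad \<Omega> (\<lambda>y. trunc k (u y)))"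
    by (rule W1p_zero_W0_grad) (use u k in \<open>auto simp: renormalized_solution_def\<close>)
  show "AE x in M. clamp k (finite_part u x) = trunc k (u x)"
    using sol_finite(1)[OF u]
  proof eventually_elim
    case (elim x)
    then have "u x = ereal (finite_part u x)" by blast
    then show ?case unfolding clamp_def by (metis trunc_ereal)
  qed
  show "AE x in M. ind_le k (finite_part u x) *\<^sub>R tg u x = weak_grad \<Omega> (\<lambda>y. trunc k (u y)) x"
    using sol_finite(1)[OF u] trunc_grad_spec(2)[OF u k]
  proof eventually_elim
    case (elim x)
    have "\<bar>u x\<bar> \<le> ereal k \<longleftrightarrow> \<bar>finite_part u x\<bar> \<le> k" using elim(1) by (metis abs_ereal.simps(1) ereal_less_eq(3))
    then show ?case using elim(2) by (simp add: ind_le_def indicator_def)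
  qed
qed

text \<open>Inherited from the truncations, countably many levels being enough. It removes the
  boundaries of strips and the null sets on which the weak derivative of a cutoff is
  ambiguous.\<close>

lemma sol_gradient_null:
  assumes u: "sol u" and Z: "Z \<in> null_sets lebesgue"
  shows "AE x in M. finite_part u x \<in> Z \<longrightarrow> tg u x = 0"
proof -
  have "AE x in M. clamp (real (Suc n)) (finite_part u x) \<in> Z \<longrightarrow> ind_le (real (Suc n)) (finite_part u x) *\<^sub>R tg u x = 0" for n
    by (rule gradient_zero_on_null_level_set[OF sol_W0_grad[OF u] Z]) simp
  then have "AE x in M. \<forall>n. clamp (real (Suc n)) (finite_part u x) \<in> Z \<longrightarrow> ind_le (real (Suc n)) (finite_part u x) *\<^sub>R tg u x = 0"
    unfolding AE_all_countable by blast
  then show ?thesis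
  proof eventually_elim
    case (elim x)
    obtain N where N: "\<bar>finite_part u x\<bar> < real N" using reals_Archimedean2 by blast
    have "clamp (real (Suc N)) (finite_part u x) = finite_part u x" "ind_le (real (Suc N)) (finite_part u x) = 1"
      using N by (auto simp: clamp_def ind_le_def)
    then show ?case using elim by (metis scaleR_one)
  qed
qed

section \<open>Growth of the energy below a level\<close>

definition level_energy :: "('a \<Rightarrow> ereal) \<Rightarrow> real \<Rightarrow> real" where
  "level_energy u k = (LINT x|M. ind_le k (finite_part u x) * norm (tg u x) powr p)"

lemma level_energy_integrable:
  assumes u: "sol u" and k: "k > 0"
  shows "integrable M (\<lambda>x. ind_le k (finite_part u x) * norm (tg u x) powr p)"
proof -
  have "(\<lambda>x. norm (ind_le k (finite_part u x) *\<^sub>R tg u x) powr p) = (\<lambda>x. ind_le k (finite_part u x) * norm (tg u x) powr p)"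
    using p_gt_1 by (auto simp: ind_le_def fun_eq_iff)
  then show ?thesis using LpD(2)[OF H0D(2)[OF sol_W0_grad[OF u k]]] by simp
qed

lemma level_energy_nonneg: "level_energy u k \<ge> 0"
  unfolding level_energy_def by (intro integral_nonneg_AE AE_I2) (simp add: ind_le_def)

text \<open>On the strip between m and 2m coercivity bounds the energy density by the integrand of
  \<open>D\<close>, divided by \<open>\<alpha>\<close>. The growth condition is what makes
  \<open>D\<close> an integral of an integrable function.\<close>

lemma sol_energy_step:
  assumes u: "sol u" and m: "m > 0"
  defines "D \<equiv> (LINT x|M. indicat_real {y. ereal m < u y \<and> u y < ereal (2 * m)} x * ((a x (tg u x) \<bullet> tg u x) * 1))"
  shows "level_energy u (2 * m) \<le> level_energy u m + D / \<alpha>"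
proof -
  \<comment> \<open>The strip in \<open>D\<close> is open whereas the energy includes the level 2m;
    the gradient vanishes on that level.\<close>
  have Z: "{2 * m} \<in> null_sets lebesgue" by (simp add: negligible_iff_null_sets[symmetric])
  have Gm: "tg u \<in> borel_measurable M" by (rule trunc_grad_spec(1)[OF u])
  have fm: "finite_part u \<in> borel_measurable M" by (rule sol_finite(2)[OF u])
  have um: "u \<in> borel_measurable M" using u by (simp add: renormalized_solution_def)
  let ?I = "\<lambda>x. indicat_real {y. ereal m < u y \<and> u y < ereal (2 * m)} x"
  have Im: "?I \<in> borel_measurable M"
  proof -
    have "(\<lambda>x. if ereal m < u x \<and> u x < ereal (2 * m) then 1 else 0 :: real) \<in> borel_measurable M"
      using um by measurable
    then show ?thesis by (simp add: indicator_def of_bool_def)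
  qed
  have Dm: "(\<lambda>x. ?I x * ((a x (tg u x) \<bullet> tg u x) * 1)) \<in> borel_measurable M"
    using Im caratheodory_measurable[OF Gm] Gm by measurable
  have i1: "integrable M (\<lambda>x. ind_le m (finite_part u x) * norm (tg u x) powr p)" by (rule level_energy_integrable[OF u m])
  have i2: "integrable M (\<lambda>x. ind_le (2 * m) (finite_part u x) * norm (tg u x) powr p)" by (rule level_energy_integrable[OF u]) (use m in simp)
  have iD: "integrable M (\<lambda>x. ?I x * ((a x (tg u x) \<bullet> tg u x) * 1))"
  proof (rule Bochner_Integration.integrable_bound[OF _ Dm])
    show "integrable M (\<lambda>x. \<beta> * (ind_le (2 * m) (finite_part u x) * norm (tg u x) powr p))" using i2 by simp
    show "AE x in M. norm (?I x * ((a x (tg u x) \<bullet> tg u x) * 1)) \<le> norm (\<beta> * (ind_le (2 * m) (finite_part u x) * norm (tg u x) powr p))"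
      using growth sol_finite(1)[OF u]
    proof eventually_elim
      case (elim x)
      have "\<bar>a x (tg u x) \<bullet> tg u x\<bar> \<le> norm (a x (tg u x)) * norm (tg u x)" by (rule Cauchy_Schwarz_ineq2)
      also have "\<dots> \<le> (\<beta> * norm (tg u x) powr (p - 1)) * norm (tg u x)" using elim(1) by (intro mult_right_mono) auto
      also have "\<dots> = \<beta> * norm (tg u x) powr p" by (cases "tg u x = 0") (auto simp: powr_diff)
      finally have 1: "\<bar>a x (tg u x) \<bullet> tg u x\<bar> \<le> \<beta> * norm (tg u x) powr p" .
      show ?case
      proof (cases "ereal m < u x \<and> u x < ereal (2 * m)")
        case True
        then have "finite_part u x < 2 * m" using elim(2) by (metis ereal_less_eq(3) not_le)
        then have "ind_le (2 * m) (finite_part u x) = 1" using elim(2) by (simp add: ind_le_def)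
        then show ?thesis using True 1 \<beta>_pos by simp
      qed simp
    qed
  qed
  have "level_energy u (2 * m) \<le> (LINT x|M. ind_le m (finite_part u x) * norm (tg u x) powr p + ?I x * ((a x (tg u x) \<bullet> tg u x) * 1) / \<alpha>)"
    unfolding level_energy_def
  proof (rule integral_mono_AE[OF i2])
    show "integrable M (\<lambda>x. ind_le m (finite_part u x) * norm (tg u x) powr p + ?I x * ((a x (tg u x) \<bullet> tg u x) * 1) / \<alpha>)"
      using i1 iD by (intro Bochner_Integration.integrable_add integrable_divide) auto
    show "AE x in M. ind_le (2 * m) (finite_part u x) * norm (tg u x) powr p \<le> ind_le m (finite_part u x) * norm (tg u x) powr p + ?I x * ((a x (tg u x) \<bullet> tg u x) * 1) / \<alpha>"
      using coercive sol_finite(1)[OF u] sol_gradient_null[OF u Z]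
    proof eventually_elim
      case (elim x)
      have c: "norm (tg u x) powr p \<le> (a x (tg u x) \<bullet> tg u x) / \<alpha>" using elim(1) \<alpha>_pos by (simp add: field_simps)
      then have c0: "0 \<le> (a x (tg u x) \<bullet> tg u x) / \<alpha>" using powr_ge_zero order_trans by blast
      have f0: "0 \<le> finite_part u x" and ue: "u x = ereal (finite_part u x)" using elim(2) by auto
      consider "finite_part u x \<le> m" | "m < finite_part u x" "finite_part u x < 2 * m" | "finite_part u x = 2 * m" | "finite_part u x > 2 * m" by linarith
      then show ?case
      proof cases
        case 1
        then have "ind_le m (finite_part u x) = 1" "ind_le (2 * m) (finite_part u x) = 1" "?I x = 0" using f0 m ue by (auto simp: ind_le_def indicator_def)
        then show ?thesis by simp
      next
        case 2
        then have "ind_le m (finite_part u x) = 0" "ind_le (2 * m) (finite_part u x) = 1" "?I x = 1" using f0 m ue by (auto simp: ind_le_def indicator_def)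
        then show ?thesis using c by simp
      next
        case 3
        then have "tg u x = 0" using elim(3) by simp
        then show ?thesis using p_gt_1 by simp
      next
        case 4
        then have "ind_le (2 * m) (finite_part u x) = 0" using f0 m by (auto simp: ind_le_def)
        moreover have "?I x * (a x (tg u x) \<bullet> tg u x * 1) / \<alpha> \<ge> 0" using c0 by (simp add: indicator_def)
        ultimately show ?thesis by (simp add: ind_le_def)
      qed
    qed
  qed
  also have "\<dots> = level_energy u m + D / \<alpha>"
    unfolding level_energy_def D_def using i1 iD by (subst Bochner_Integration.integral_add) auto
  finally show ?thesis .
qed

text \<open>The decay condition of a solution, tested with the constant 1, says D(m)/m tends to 0
  since the singular part is zero. Dividing \<open>sol_energy_step\<close> by 2m turns it into the
  recursion of \<open>contraction_tendsto_zero\<close> along m = 2^j.\<close>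

lemma sol_energy_tendsto:
  assumes u: "sol u"
  shows "(\<lambda>j. level_energy u (2 ^ j) / 2 ^ j) \<longlonglongrightarrow> 0"
proof -
  define D where "D m = (LINT x|M. indicat_real {y. ereal m < u y \<and> u y < ereal (2 * m)} x * ((a x (tg u x) \<bullet> tg u x) * 1))" for m
  have "(\<lambda>m::nat. (1 / real m) * (LINT x|M. indicat_real {y. ereal m < u y \<and> u y < ereal (2 * m)} x *
              ((a x (tg u x) \<bullet> tg u x) * 1))) \<longlonglongrightarrow> enn2real (Limsup at_top h) * (LINT x|\<mu>c. 1)"
  proof -
    have "continuous_on \<Omega> (\<lambda>x. 1::real) \<and> bounded ((\<lambda>x. 1::real) ` \<Omega>)"
      by (auto intro: bounded_subset[of "{1}"])
    then show ?thesis using u unfolding renormalized_solution_def by blast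
  qed
  moreover have "(LINT x|\<mu>c. (1::real)) = 0"
    using \<mu>c by (simp add: measure_def)
  ultimately have "(\<lambda>m::nat. (1 / real m) * D (real m)) \<longlonglongrightarrow> 0" by (simp add: D_def)
  moreover have "strict_mono (\<lambda>j. 2 ^ j :: nat)" by (simp add: strict_mono_def)
  ultimately have l: "((\<lambda>m::nat. (1 / real m) * D (real m)) \<circ> (\<lambda>j. 2 ^ j)) \<longlonglongrightarrow> 0" by (rule LIMSEQ_subseq_LIMSEQ)
  have "(\<lambda>j. (1 / 2 ^ j * D (2 ^ j)) / (2 * \<alpha>)) \<longlonglongrightarrow> 0 / (2 * \<alpha>)"
    using l \<alpha>_pos by (intro tendsto_divide tendsto_const) (auto simp: o_def)
  then have e: "(\<lambda>j. (1 / 2 ^ j * D (2 ^ j)) / (2 * \<alpha>)) \<longlonglongrightarrow> 0" by simp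
  show ?thesis
  proof (rule contraction_tendsto_zero[OF _ _ e])
    show "0 \<le> level_energy u (2 ^ n) / 2 ^ n" for n using level_energy_nonneg by simp
    show "level_energy u (2 ^ Suc n) / 2 ^ Suc n \<le> level_energy u (2 ^ n) / 2 ^ n / 2 + 1 / 2 ^ n * D (2 ^ n) / (2 * \<alpha>)" for n
    proof -
      have "level_energy u (2 * 2 ^ n) \<le> level_energy u (2 ^ n) + D (2 ^ n) / \<alpha>" unfolding D_def by (rule sol_energy_step[OF u]) simp
      then have "level_energy u (2 * 2 ^ n) / (2 * 2 ^ n) \<le> (level_energy u (2 ^ n) + D (2 ^ n) / \<alpha>) / (2 * 2 ^ n)" by (intro divide_right_mono) auto
      then show ?thesis by (simp add: add_divide_distrib mult_ac)
    qed
  qed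
qed

text \<open>The gradient of arctan u carries the weight 1/(1 + u^2). On the strip between 2^j and
  2^(j+1) this is at most 4^(-j), while the energy there is O(2^j), so the contributions sum like a
  geometric series. Monotone convergence then gives p-integrability, and the truncations converge by
  domination.\<close>

lemma sol_arctan_W0_grad:
  assumes u: "sol u"
  shows "W0_grad (\<lambda>x. arctan (finite_part u x)) (\<lambda>x. inverse (1 + (finite_part u x)\<^sup>2) *\<^sub>R tg u x)"
proof -
  note fm = sol_finite(2)[OF u] and Gm = trunc_grad_spec(1)[OF u]
  let ?F = "\<lambda>x. inverse (1 + (finite_part u x)\<^sup>2) *\<^sub>R tg u x"
  let ?t = "\<lambda>j x. clamp (2 ^ j) (finite_part u x)"
  let ?Fj = "\<lambda>j x. inverse (1 + (?t j x)\<^sup>2) *\<^sub>R (ind_le (2 ^ j) (finite_part u x) *\<^sub>R tg u x)"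
  have inv1: "\<bar>inverse (1 + s\<^sup>2)\<bar> \<le> 1" for s :: real by (simp add: inverse_le_1_iff add_nonneg_nonneg)
  have Hj: "W0_grad (\<lambda>x. arctan (?t j x)) (?Fj j)" for j
    by (rule W0_grad_compose_test[OF sol_W0_grad[OF u] Ck_arctan _ DERIV_arctan inv1]) auto
  have Fj: "?Fj j x = ind_le (2 ^ j) (finite_part u x) *\<^sub>R ?F x" for j x
  proof (cases "\<bar>finite_part u x\<bar> \<le> 2 ^ j")
    case True
    then have "?t j x = finite_part u x" by (auto simp: clamp_def)
    then show ?thesis by (simp add: mult.commute)
  qed (simp add: ind_le_def)
  have Fm: "?F \<in> borel_measurable M" using fm Gm by measurable
  have ev: "\<exists>N. \<forall>j\<ge>N. \<bar>finite_part u x\<bar> \<le> 2 ^ j" for x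
  proof -
    obtain N where N: "\<bar>finite_part u x\<bar> < 2 ^ N" using real_arch_pow[of 2 "\<bar>finite_part u x\<bar>"] by auto
    have "\<bar>finite_part u x\<bar> \<le> 2 ^ j" if "j \<ge> N" for j
    proof -
      have "(2::real) ^ N \<le> 2 ^ j" using that by (simp add: power_increasing)
      then show ?thesis using N by linarith
    qed
    then show ?thesis by blast
  qed
  let ?X = "\<lambda>j. LINT x|M. ind_le (2 ^ j) (finite_part u x) * norm (?F x) powr p"
  have iX: "integrable M (\<lambda>x. ind_le (2 ^ j) (finite_part u x) * norm (?F x) powr p)" for j
  proof -
    have "(\<lambda>x. norm (?Fj j x) powr p) = (\<lambda>x. ind_le (2 ^ j) (finite_part u x) * norm (?F x) powr p)"
      unfolding Fj using p_gt_1 by (auto simp: ind_le_def fun_eq_iff)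
    then show ?thesis using LpD(2)[OF H0D(2)[OF Hj[of j]]] by simp
  qed
  have mono: "ind_le (2 ^ j) s \<le> ind_le (2 ^ Suc j) s" for j s
  proof -
    have "(2::real) ^ j \<le> 2 ^ Suc j" by simp
    then show ?thesis by (auto simp: ind_le_def)
  qed
  obtain B where B: "B > 0" "\<And>j. level_energy u (2 ^ j) / 2 ^ j \<le> B"
  proof -
    have "Bseq (\<lambda>j. level_energy u (2 ^ j) / 2 ^ j)" by (rule convergent_imp_Bseq[OF convergentI[OF sol_energy_tendsto[OF u]]])
    then obtain B where "B > 0" "\<And>j. norm (level_energy u (2 ^ j) / 2 ^ j) \<le> B" by (auto elim: BseqE)
    then show ?thesis using that[of B] by (smt (verit) real_norm_def)
  qed
  have step: "?X (Suc j) \<le> ?X j + 2 * B * (1 / 2) ^ j" for j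
  proof -
    have "?X (Suc j) \<le> (LINT x|M. ind_le (2 ^ j) (finite_part u x) * norm (?F x) powr p + (1 / 4) ^ j * (ind_le (2 ^ Suc j) (finite_part u x) * norm (tg u x) powr p))"
    proof (rule integral_mono[OF iX])
      show "integrable M (\<lambda>x. ind_le (2 ^ j) (finite_part u x) * norm (?F x) powr p + (1 / 4) ^ j * (ind_le (2 ^ Suc j) (finite_part u x) * norm (tg u x) powr p))"
        by (intro Bochner_Integration.integrable_add iX integrable_mult_right level_energy_integrable[OF u]) simp
      fix x
      show "ind_le (2 ^ Suc j) (finite_part u x) * norm (?F x) powr p \<le> ind_le (2 ^ j) (finite_part u x) * norm (?F x) powr p + (1 / 4) ^ j * (ind_le (2 ^ Suc j) (finite_part u x) * norm (tg u x) powr p)"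
      proof (cases "\<bar>finite_part u x\<bar> \<le> 2 ^ j")
        case True
        then have "ind_le (2 ^ j) (finite_part u x) = 1" "ind_le (2 ^ Suc j) (finite_part u x) = 1" by (auto simp: ind_le_def)
        then show ?thesis by simp
      next
        case False
        have pos: "1 + (finite_part u x)\<^sup>2 \<ge> 1" by simp
        have "(2 ^ j)\<^sup>2 \<le> (finite_part u x)\<^sup>2" using False power_mono[of "2 ^ j" "\<bar>finite_part u x\<bar>" 2] by simp
        then have "4 ^ j \<le> 1 + (finite_part u x)\<^sup>2" by (simp add: power_mult[symmetric] mult.commute[of _ 2] power_mult)
        then have q: "inverse (1 + (finite_part u x)\<^sup>2) \<le> (1 / 4) ^ j"
          using le_imp_inverse_le[of "4 ^ j" "1 + (finite_part u x)\<^sup>2"] by (simp add: power_divide inverse_eq_divide)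
        have i0: "0 < inverse (1 + (finite_part u x)\<^sup>2)" using less_le_trans[OF zero_less_one pos] by (rule positive_imp_inverse_positive)
        \<comment> \<open>The weight is at most 1 and p > 1, so its p-th power may be replaced by
          the weight itself; the remaining decay 4^(-j) already beats the growth of the
          energy.\<close>
        have "inverse (1 + (finite_part u x)\<^sup>2) powr p \<le> inverse (1 + (finite_part u x)\<^sup>2) powr 1"
          using i0 inv1[of "finite_part u x"] p_gt_1 by (intro powr_mono') auto
        then have "inverse (1 + (finite_part u x)\<^sup>2) powr p \<le> (1 / 4) ^ j" using q i0 by simp
        then have "norm (?F x) powr p \<le> (1 / 4) ^ j * norm (tg u x) powr p"
          using i0 by (simp add: powr_mult mult_right_mono)
        then have "ind_le (2 ^ Suc j) (finite_part u x) * norm (?F x) powr p \<le> ind_le (2 ^ Suc j) (finite_part u x) * ((1 / 4) ^ j * norm (tg u x) powr p)"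
          by (intro mult_left_mono) (auto simp: ind_le_def)
        moreover have "0 \<le> ind_le (2 ^ j) (finite_part u x) * norm (?F x) powr p" by (simp add: ind_le_def)
        ultimately show ?thesis by (simp add: mult_ac)
      qed
    qed
    also have "\<dots> = ?X j + (1 / 4) ^ j * level_energy u (2 ^ Suc j)"
      unfolding level_energy_def
      by (subst Bochner_Integration.integral_add[OF iX integrable_mult_right[OF level_energy_integrable[OF u]]]) auto
    also have "\<dots> \<le> ?X j + (1 / 4) ^ j * (B * 2 ^ Suc j)"
      using B(2)[of "Suc j"] by (intro add_left_mono mult_left_mono) (auto simp: field_simps)
    also have "(1 / 4) ^ j * (B * 2 ^ Suc j) = 2 * B * ((1 / 4) ^ j * 2 ^ j)" by simp
    also have "(1 / 4 :: real) ^ j * 2 ^ j = (1 / 2) ^ j" unfolding power_mult_distrib[of "1/4::real" 2 j, symmetric] by simp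
    finally show ?thesis .
  qed
  have bd: "?X j \<le> ?X 0 + 4 * B" for j
  proof -
    \<comment> \<open>The closed form of the partial sums of 2 B 2^(-i), in the shape that the
      induction reproduces.\<close>
    have "?X j \<le> ?X 0 + 4 * B * (1 - (1 / 2) ^ j)" for j
    proof (induction j)
      case (Suc j)
      have "?X (Suc j) \<le> ?X 0 + 4 * B * (1 - (1 / 2) ^ j) + 2 * B * (1 / 2) ^ j" using step[of j] Suc.IH by linarith
      also have "\<dots> = ?X 0 + 4 * B * (1 - (1 / 2) ^ Suc j)" by (simp add: algebra_simps)
      finally show ?case .
    qed simp
    moreover have "4 * B * (1 - (1 / 2) ^ j) \<le> 4 * B" using B(1) by (simp add: mult_left_le)
    ultimately show ?thesis by (meson add_left_mono order_trans)
  qed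
  have incX: "incseq ?X"
    by (intro incseq_SucI integral_mono iX mult_right_mono mono) simp
  then obtain L where L: "?X \<longlonglongrightarrow> L"
    using incseq_convergent[OF incX, of "?X 0 + 4 * B"] bd by blast
  have iF: "integrable M (\<lambda>x. norm (?F x) powr p)"
  proof (rule integrable_monotone_convergence[OF iX _ _ L])
    show "AE x in M. mono (\<lambda>j. ind_le (2 ^ j) (finite_part u x) * norm (?F x) powr p)"
      by (intro AE_I2 incseq_SucI mult_right_mono mono) simp
    show "AE x in M. (\<lambda>j. ind_le (2 ^ j) (finite_part u x) * norm (?F x) powr p) \<longlonglongrightarrow> norm (?F x) powr p"
    proof (intro AE_I2 tendsto_eventually)
      fix x
      show "\<forall>\<^sub>F j in sequentially. ind_le (2 ^ j) (finite_part u x) * norm (?F x) powr p = norm (?F x) powr p"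
        using ev[of x] unfolding eventually_sequentially ind_le_def by auto
    qed
    show "(\<lambda>x. norm (?F x) powr p) \<in> borel_measurable M" by (rule powr_measurable[OF Fm])
  qed
  have FL: "?F \<in> Lp \<Omega> p" by (rule LpI[OF Fm iF])
  have am: "(\<lambda>x. arctan (finite_part u x)) \<in> borel_measurable M"
    by (rule comp_measurable[OF borel_measurable_continuous_onI fm]) (intro continuous_intros)
  have ab: "\<bar>arctan s\<bar> \<le> 2" for s using arctan_bounded[of s] pi_less_4 by (simp add: abs_le_iff)
  show ?thesis
  proof (rule W0_grad_limit[OF Hj])
    show aL: "(\<lambda>x. arctan (finite_part u x)) \<in> Lp \<Omega> p" by (rule Lp_bounded[OF am, of 2]) (use ab in auto)
    show "?F \<in> Lp \<Omega> p" by (rule FL)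
    show "Lp_tendsto (\<lambda>j x. arctan (?t j x)) (\<lambda>x. arctan (finite_part u x))"
    proof (rule Lp_tendsto_dominated[OF H0D(3)[OF Hj] am integrable_const_dom[of "4 powr p"]])
      show "AE x in M. norm (arctan (?t n x) - arctan (finite_part u x)) powr p \<le> 4 powr p" for n
      proof (rule AE_I2)
        fix x
        have "norm (arctan (?t n x) - arctan (finite_part u x)) \<le> 4" using ab[of "?t n x"] ab[of "finite_part u x"] unfolding real_norm_def by linarith
        then show "norm (arctan (?t n x) - arctan (finite_part u x)) powr p \<le> 4 powr p" using p_gt_1 by (intro powr_mono2) auto
      qed
      show "AE x in M. (\<lambda>j. arctan (?t j x)) \<longlonglongrightarrow> arctan (finite_part u x)"
      proof (intro AE_I2 tendsto_eventually)
        fix x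
        obtain N where N: "\<And>j. j \<ge> N \<Longrightarrow> \<bar>finite_part u x\<bar> \<le> 2 ^ j" using ev[of x] by blast
        have "?t j x = finite_part u x" if "j \<ge> N" for j using N[OF that] by (auto simp: clamp_def)
        then show "\<forall>\<^sub>F j in sequentially. arctan (?t j x) = arctan (finite_part u x)" unfolding eventually_sequentially by metis
      qed
    qed
    show "Lp_tendsto ?Fj ?F"
    proof (rule Lp_tendsto_dominated[OF H0D(4)[OF Hj] Fm iF])
      show "AE x in M. norm (?Fj n x - ?F x) powr p \<le> norm (?F x) powr p" for n
        unfolding Fj using p_gt_1 by (intro AE_I2) (simp add: ind_le_def)
      show "AE x in M. (\<lambda>j. ?Fj j x) \<longlonglongrightarrow> ?F x"
        unfolding Fj
      proof (intro AE_I2 tendsto_eventually)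
        fix x
        show "\<forall>\<^sub>F j in sequentially. ind_le (2 ^ j) (finite_part u x) *\<^sub>R ?F x = ?F x"
          using ev[of x] unfolding eventually_sequentially ind_le_def by auto
      qed
    qed
  qed
qed

text \<open>\<open>qc_rep\<close> is a choice, and the solution itself is only known to have
  truncations in W_0. Since arctan u lies in W_0 it has a quasi continuous representative, and
  \<open>tan_ereal\<close> of that is a witness for u.\<close>

lemma sol_qc_rep:
  assumes u: "sol u"
  shows "quasi_continuous \<Omega> p (qc_rep \<Omega> p u)" "AE x in M. qc_rep \<Omega> p u x = u x"
proof -
  obtain w where w: "quasi_continuous \<Omega> p w" "AE x in M. w x = arctan (finite_part u x)"
    by (rule quasi_continuous_exists[OF sol_arctan_W0_grad[OF u]])
  have "AE x in M. tan_ereal (w x) = u x"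
    using w(2) sol_finite(1)[OF u]
  proof eventually_elim
    case (elim x)
    then show ?case using tan_ereal_arctan[of "finite_part u x"] by simp
  qed
  then have "\<exists>v. quasi_continuous \<Omega> p v \<and> (AE x in M. v x = u x)"
    using quasi_continuous_compose[OF w(1) continuous_tan_ereal] by blast
  from someI_ex[OF this] show "quasi_continuous \<Omega> p (qc_rep \<Omega> p u)" "AE x in M. qc_rep \<Omega> p u x = u x"
    unfolding qc_rep_def by blast+
qed

end

subsection \<open>Comparison of two solutions\<close>

text \<open>Equal to 1 for |s| <= m and to 0 from |s| = m sqrt(2) on, hence also for |s| >= 2m. The
  square makes it even and smooth at 0.\<close>

definition cutoff :: "real \<Rightarrow> real \<Rightarrow> real" where
  "cutoff m s = smooth_step (2 - (s / m)\<^sup>2)"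

definition cutoff' :: "real \<Rightarrow> real \<Rightarrow> real" where
  "cutoff' m s = smooth_step' (2 - (s / m)\<^sup>2) * (- 2 * s / m\<^sup>2)"

lemma cutoff_bounds: "0 \<le> cutoff m s" "cutoff m s \<le> 1"
  by (simp_all add: cutoff_def smooth_step_ge_0 smooth_step_le_1)

lemma cutoff_1: "m > 0 \<Longrightarrow> \<bar>s\<bar> \<le> m \<Longrightarrow> cutoff m s = 1"
  unfolding cutoff_def using abs_square_le_1[of "s / m"] by (intro smooth_step_1) (simp add: abs_divide)

lemma square_ge_4:
  assumes "m > 0" "\<bar>s\<bar> \<ge> 2 * m" shows "(s / m)\<^sup>2 \<ge> (4::real)"
proof -
  have "2 \<le> \<bar>s / m\<bar>" using assms by (simp add: abs_divide field_simps)
  then have "2\<^sup>2 \<le> \<bar>s / m\<bar>\<^sup>2" by (intro power_mono) auto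
  then show ?thesis by (simp only: power2_abs) simp
qed

lemma cutoff_0: "m > 0 \<Longrightarrow> \<bar>s\<bar> \<ge> 2 * m \<Longrightarrow> cutoff m s = 0"
  unfolding cutoff_def using square_ge_4[of m s] by (intro smooth_step_0) simp

lemma cutoff'_0: "m > 0 \<Longrightarrow> \<bar>s\<bar> \<ge> 2 * m \<Longrightarrow> cutoff' m s = 0"
  unfolding cutoff'_def using square_ge_4[of m s] by (simp add: smooth_step'_0)

lemma cutoff'_0_inside:
  assumes "m > 0" "\<bar>s\<bar> < m" shows "cutoff' m s = 0"
proof -
  have "\<bar>s / m\<bar> < 1" using assms by (simp add: abs_divide)
  then have "\<bar>s / m\<bar>\<^sup>2 < 1\<^sup>2" by (intro power_strict_mono) auto
  then have "2 - (s / m)\<^sup>2 > 1" by (simp only: power2_abs) simp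
  then show ?thesis unfolding cutoff'_def by (simp add: smooth_step'_0)
qed

lemma DERIV_cutoff: "m > 0 \<Longrightarrow> DERIV (cutoff m) s :> cutoff' m s"
  unfolding cutoff_def[abs_def] cutoff'_def
  by (rule DERIV_chain2[OF DERIV_smooth_step]) (auto intro!: derivative_eq_intros simp: power2_eq_square)

lemma Ck_cutoff: "Ck k (cutoff m)"
proof -
  have "Ck k (\<lambda>s::real. (s * (1 / m))\<^sup>2)"
    using Ck_inner[of k "1 / m"] by (intro Ck_power) simp
  then have "Ck k (\<lambda>s::real. 2 - (s / m)\<^sup>2)" by (intro Ck_diff Ck_const) simp
  then show ?thesis unfolding cutoff_def[abs_def] by (rule Ck_compose[OF Ck_smooth_step])
qed

lemma continuous_cutoff: "continuous_on UNIV (cutoff m)" by (rule Ck_imp_continuous[OF Ck_cutoff[of 0]])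

lemma continuous_cutoff': "m > 0 \<Longrightarrow> continuous_on UNIV (cutoff' m)"
proof -
  assume m: "m > 0"
  have "grad (cutoff m) = cutoff' m" using DERIV_cutoff[OF m] by (intro ext grad_eqI) simp
  then show ?thesis using Ck_cutoff[of "Suc 0" m] by simp
qed

text \<open>The decay 1/m, with a constant that is uniform in m, is what pairs the cutoff errors
  with energies divided by m.\<close>

lemma cutoff'_bounded: obtains C where "C > 0" "\<And>m s. m > 0 \<Longrightarrow> \<bar>cutoff' m s\<bar> \<le> C / m"
proof -
  obtain C where C: "C > 0" "\<And>t. \<bar>smooth_step' t\<bar> \<le> C" using smooth_step'_bounded by blast
  have "\<bar>cutoff' m s\<bar> \<le> 4 * C / m" if m: "m > 0" for m s
  proof (cases "\<bar>s\<bar> \<ge> 2 * m")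
    case True
    then show ?thesis using cutoff'_0[OF m] C m by simp
  next
    case False
    have "\<bar>- 2 * s / m\<^sup>2\<bar> = 2 * \<bar>s\<bar> / m\<^sup>2" by (simp add: abs_mult)
    also have "\<dots> \<le> 2 * (2 * m) / m\<^sup>2" using False by (intro divide_right_mono) auto
    also have "\<dots> = 4 / m" using m by (simp add: power2_eq_square)
    finally have "\<bar>cutoff' m s\<bar> \<le> C * (4 / m)" unfolding cutoff'_def abs_mult[of "smooth_step' _"]
      using C by (intro mult_mono) auto
    then show ?thesis by (simp add: mult.commute)
  qed
  then show ?thesis using C(1) by (intro that[of "4 * C"]) auto
qed

section \<open>Cutoffs as admissible renormalizations\<close>

lemma continuous_integrable_on_compact:
  fixes f :: "'a::euclidean_space \<Rightarrow> 'b::euclidean_space"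
  assumes "continuous_on UNIV f" "compact K"
  shows "set_integrable lebesgue K f"
proof -
  have i: "integrable lborel (\<lambda>x. indicator K x *\<^sub>R f x)"
    by (intro borel_integrable_compact assms continuous_on_subset[OF assms(1)]) auto
  then show ?thesis unfolding set_integrable_def
    using borel_measurable_integrable[OF i] by (subst integrable_completion) auto
qed

lemma cutoff_weak_gradient:
  assumes m: "m > 0"
  shows "has_weak_gradient UNIV (cutoff m) (cutoff' m)"
  unfolding has_weak_gradient_def locally_integrable_def
proof (intro conjI ballI allI impI)
  fix \<psi> :: "real \<Rightarrow> real" assume "\<psi> \<in> test_functions UNIV"
  then show "(LINT x|lebesgue_on UNIV. cutoff m x *\<^sub>R grad \<psi> x) = - (LINT x|lebesgue_on UNIV. \<psi> x *\<^sub>R cutoff' m x)"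
    by (intro integration_by_parts continuous_cutoff'[OF m]) (auto simp: DERIV_cutoff[OF m])
qed (auto intro!: continuous_integrable_on_compact continuous_cutoff continuous_cutoff'[OF m])

lemma cutoff_admissible:
  assumes m: "m > 0"
  shows "cutoff m \<in> W1infty UNIV \<and> continuous_on UNIV (cutoff m) \<and> compact (closure {s. cutoff m s \<noteq> 0})"
proof (intro conjI)
  have lm: "f \<in> borel_measurable (lebesgue_on UNIV)" if "continuous_on UNIV f" for f :: "real \<Rightarrow> real"
    using that by (intro measurable_restrict_space1 measurable_completion) (simp add: borel_measurable_continuous_onI)
  obtain C where C: "C > 0" "\<And>m s. m > 0 \<Longrightarrow> \<bar>cutoff' m s\<bar> \<le> C / m" using cutoff'_bounded by blast
  have "cutoff m \<in> Linfty UNIV" unfolding Linfty_def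
    using lm[OF continuous_cutoff] cutoff_bounds by (auto intro!: exI[of _ 1])
  moreover have "cutoff' m \<in> Linfty UNIV" unfolding Linfty_def
    using lm[OF continuous_cutoff'[OF m]] C(2)[OF m] by (auto intro!: exI[of _ "C / m"])
  ultimately show "cutoff m \<in> W1infty UNIV" unfolding W1infty_def using cutoff_weak_gradient[OF m] by blast
  show "continuous_on UNIV (cutoff m)" by (rule continuous_cutoff)
  have "{s. cutoff m s \<noteq> 0} \<subseteq> cball 0 (2 * m)"
  proof
    fix s assume "s \<in> {s. cutoff m s \<noteq> 0}"
    then show "s \<in> cball 0 (2 * m)" using cutoff_0[OF m, of s] by (cases "\<bar>s\<bar> \<ge> 2 * m") auto
  qed
  then have "bounded {s. cutoff m s \<noteq> 0}" using bounded_cball bounded_subset by blast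
  then show "compact (closure {s. cutoff m s \<noteq> 0})" by (simp add: compact_closure)
qed

text \<open>The equation contains the choice \<open>weak_grad UNIV S\<close> evaluated at u. The set
  Z of wrong values is null, and by \<open>sol_gradient_null\<close> the gradient of a solution
  vanishes where it takes values in Z.\<close>

lemma weak_grad_cutoff:
  assumes m: "m > 0"
  obtains Z where "Z \<in> null_sets lebesgue" "\<And>s. s \<notin> Z \<Longrightarrow> weak_grad UNIV (cutoff m) s = cutoff' m s"
proof -
  have "AE s in lebesgue_on UNIV. weak_grad UNIV (cutoff m) s = cutoff' m s"
    by (rule weak_grad_eq_open[OF open_UNIV cutoff_weak_gradient[OF m]])
  then have "AE s in lebesgue. weak_grad UNIV (cutoff m) s = cutoff' m s" by (simp add: AE_restrict_space_iff)
  then have "{s. weak_grad UNIV (cutoff m) s \<noteq> cutoff' m s} \<in> null_sets lebesgue"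
    unfolding completion.AE_iff_null_sets by simp
  then show ?thesis by (rule that) simp
qed

definition Phi :: "real \<Rightarrow> real \<Rightarrow> real \<Rightarrow> real" where
  "Phi m s t = arctan (s - t) * cutoff m s * cutoff m t"

text \<open>\<open>Phi1\<close> and \<open>Phi2\<close> are the partial derivatives of
  \<open>Phi\<close> in s and in t. Each summand keeps a factor \<open>cutoff\<close> or
  \<open>cutoff'\<close> in both variables, so they vanish together with \<open>Phi\<close> when |s|
  or |t| is at least 2m.\<close>

definition Phi1 :: "real \<Rightarrow> real \<Rightarrow> real \<Rightarrow> real" where
  "Phi1 m s t = inverse (1 + (s - t)\<^sup>2) * cutoff m s * cutoff m t + arctan (s - t) * cutoff' m s * cutoff m t"

definition Phi2 :: "real \<Rightarrow> real \<Rightarrow> real \<Rightarrow> real" where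
  "Phi2 m s t = - (inverse (1 + (s - t)\<^sup>2) * cutoff m s * cutoff m t) + arctan (s - t) * cutoff m s * cutoff' m t"

lemma Phi_outside:
  assumes "m > 0" "\<bar>s\<bar> \<ge> 2 * m \<or> \<bar>t\<bar> \<ge> 2 * m"
  shows "Phi m s t = 0" "Phi1 m s t = 0" "Phi2 m s t = 0"
  using assms by (auto simp: Phi_def Phi1_def Phi2_def cutoff_0 cutoff'_0)

lemma arctan_abs_le_2: "\<bar>arctan s\<bar> \<le> 2"
  using arctan_bounded[of s] pi_less_4 by (simp add: abs_le_iff)

lemma inverse_one_plus_square: "0 < inverse (1 + (s::real)\<^sup>2)" "\<bar>inverse (1 + (s::real)\<^sup>2)\<bar> \<le> 1"
proof -
  have "1 + s\<^sup>2 \<ge> 1" by simp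
  then show "0 < inverse (1 + s\<^sup>2)" by (intro positive_imp_inverse_positive) linarith
  show "\<bar>inverse (1 + s\<^sup>2)\<bar> \<le> 1" by (simp add: inverse_le_1_iff add_nonneg_nonneg)
qed

lemma Phi_bounded: "\<bar>Phi m s t\<bar> \<le> 2"
proof -
  have "\<bar>Phi m s t\<bar> \<le> 2 * 1 * 1"
    unfolding Phi_def abs_mult using cutoff_bounds[of m s] cutoff_bounds[of m t] arctan_abs_le_2
    by (intro mult_mono) auto
  then show ?thesis by simp
qed

lemma Phi_C1_chain:
  assumes m: "m > 0" and C: "C > 0" "\<And>m s. m > 0 \<Longrightarrow> \<bar>cutoff' m s\<bar> \<le> C / m"
  shows "C1_chain (Phi m) (Phi1 m) (Phi2 m) (1 + 2 * (C / m))"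
  unfolding C1_chain_def
proof (intro conjI allI)
  fix s t :: real
  have e1: "((\<lambda>z::real \<times> real. fst z - snd z) has_derivative (\<lambda>h. fst h - snd h)) (at (s, t))"
    by (auto intro!: derivative_eq_intros)
  have e2: "(arctan has_derivative (\<lambda>h. inverse (1 + (s - t)\<^sup>2) * h)) (at (fst (s, t) - snd (s, t)))"
    using DERIV_arctan[of "s - t"] by (simp add: has_field_derivative_def)
  have d1: "((\<lambda>z. arctan (fst z - snd z)) has_derivative (\<lambda>h. inverse (1 + (s - t)\<^sup>2) * (fst h - snd h))) (at (s, t))"
    by (rule has_derivative_compose[OF e1 e2])
  have c: "(cutoff m has_derivative (\<lambda>h. cutoff' m s * h)) (at s)" for s
    using DERIV_cutoff[OF m, of s] by (simp add: has_field_derivative_def)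
  have d2: "((\<lambda>z. cutoff m (fst z)) has_derivative (\<lambda>h. cutoff' m s * fst h)) (at (s, t))"
    using has_derivative_compose[OF has_derivative_fst[OF has_derivative_ident] c[of "fst (s, t)"]] by simp
  have d3: "((\<lambda>z. cutoff m (snd z)) has_derivative (\<lambda>h. cutoff' m t * snd h)) (at (s, t))"
    using has_derivative_compose[OF has_derivative_snd[OF has_derivative_ident] c[of "snd (s, t)"]] by simp
  have "((\<lambda>z. arctan (fst z - snd z) * cutoff m (fst z) * cutoff m (snd z)) has_derivative (\<lambda>h. Phi1 m s t * fst h + Phi2 m s t * snd h)) (at (s, t))"
    by (rule has_derivative_eq_rhs[OF has_derivative_mult[OF has_derivative_mult[OF d1 d2] d3]])
       (simp add: fun_eq_iff Phi1_def Phi2_def algebra_simps)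
  then show "((\<lambda>z. Phi m (fst z) (snd z)) has_derivative (\<lambda>h. Phi1 m s t * fst h + Phi2 m s t * snd h)) (at (s, t))"
    unfolding Phi_def .
  have t1: "\<bar>inverse (1 + (s - t)\<^sup>2) * cutoff m s * cutoff m t\<bar> \<le> 1 * 1 * 1"
    unfolding abs_mult using cutoff_bounds[of m s] cutoff_bounds[of m t] inverse_one_plus_square[of "s - t"] by (intro mult_mono) auto
  have t2: "\<bar>arctan (s - t) * cutoff' m s * cutoff m t\<bar> \<le> 2 * (C / m) * 1"
    unfolding abs_mult using cutoff_bounds[of m t] arctan_abs_le_2[of "s - t"] C(2)[OF m] C(1) m by (intro mult_mono) auto
  have t3: "\<bar>arctan (s - t) * cutoff m s * cutoff' m t\<bar> \<le> 2 * 1 * (C / m)"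
    unfolding abs_mult using cutoff_bounds[of m s] arctan_abs_le_2[of "s - t"] C(2)[OF m] C(1) m by (intro mult_mono) auto
  show "\<bar>Phi1 m s t\<bar> \<le> 1 + 2 * (C / m)" unfolding Phi1_def using t1 t2 by linarith
  show "\<bar>Phi2 m s t\<bar> \<le> 1 + 2 * (C / m)" unfolding Phi2_def using t1 t3 by linarith
next
  have nz: "1 + (fst z - snd z)\<^sup>2 \<noteq> 0" for z :: "real \<times> real"
    using inverse_one_plus_square(1)[of "fst z - snd z"] by force
  have c: "continuous_on UNIV (\<lambda>z::real \<times> real. h (fst z))" "continuous_on UNIV (\<lambda>z::real \<times> real. h (snd z))"
    if "continuous_on UNIV h" for h :: "real \<Rightarrow> real"
    by (rule continuous_on_compose2[OF that]; auto intro!: continuous_intros)+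
  show "continuous_on UNIV (\<lambda>z. Phi1 m (fst z) (snd z))" "continuous_on UNIV (\<lambda>z. Phi2 m (fst z) (snd z))"
    unfolding Phi1_def Phi2_def
    by (intro continuous_on_add continuous_on_mult continuous_on_minus continuous_on_inverse continuous_on_arctan continuous_on_diff
         continuous_on_power continuous_on_const continuous_on_fst continuous_on_snd continuous_on_id c continuous_cutoff continuous_cutoff'[OF m] ballI nz)+
qed

lemma continuous_Phi:
  assumes m: "m > 0" shows "continuous_on UNIV (\<lambda>z. Phi m (fst z) (snd z))"
proof -
  have c: "continuous_on UNIV (\<lambda>z::real \<times> real. h (fst z))" "continuous_on UNIV (\<lambda>z::real \<times> real. h (snd z))"
    if "continuous_on UNIV h" for h :: "real \<Rightarrow> real"
    by (rule continuous_on_compose2[OF that]; auto intro!: continuous_intros)+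
  show ?thesis unfolding Phi_def
    by (intro continuous_on_mult continuous_on_arctan continuous_on_diff continuous_on_fst continuous_on_snd continuous_on_id c continuous_cutoff)
qed

lemma test_Phi:
  assumes "\<phi> \<in> test_functions \<Omega>" "\<psi> \<in> test_functions \<Omega>"
  shows "(\<lambda>x. Phi m (\<phi> x) (\<psi> x)) \<in> test_functions \<Omega>"
  unfolding Phi_def
  by (intro test_mult test_compose[OF test_diff[OF assms] Ck_arctan] Ck_compose[OF Ck_cutoff] test_Ck[OF assms(1)] test_Ck[OF assms(2)]) simp

text \<open>A crude Young inequality for the products of the growth bound of one gradient with the
  norm of another; the larger of the two numbers replaces both.\<close>

lemma powr_mix:
  fixes x y p :: real
  assumes "x \<ge> 0" "y \<ge> 0" "p > 1"
  shows "x powr (p - 1) * y \<le> x powr p + y powr p"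
proof -
  let ?z = "max x y"
  have "x powr (p - 1) * y \<le> ?z powr (p - 1) * ?z" using assms by (intro mult_mono powr_mono2) auto
  also have "\<dots> = ?z powr p" using assms by (cases "?z = 0") (auto simp: powr_diff)
  also have "\<dots> \<le> x powr p + y powr p" by (auto simp: max_def)
  finally show ?thesis .
qed

lemma zero_ext_ereal: "zero_ext S (ereal s) = S s"
  by (simp add: zero_ext_def)

section \<open>The test function built from two solutions\<close>

locale two_solutions = renormalized_problem +
  fixes u v
  assumes u: "sol u" and v: "sol v"
begin

abbreviation "f \<equiv> finite_part u"
abbreviation "g \<equiv> finite_part v"
abbreviation "F \<equiv> tg u"
abbreviation "G \<equiv> tg v"

lemma fm: "f \<in> borel_measurable M" and gm: "g \<in> borel_measurable M"
  and Fm: "F \<in> borel_measurable M" and Gm: "G \<in> borel_measurable M"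
  using sol_finite(2)[OF u] sol_finite(2)[OF v] trunc_grad_spec(1)[OF u] trunc_grad_spec(1)[OF v] .

lemmas aF = caratheodory_measurable[OF Fm] and aG = caratheodory_measurable[OF Gm]

definition phi :: "real \<Rightarrow> 'a \<Rightarrow> real" where "phi m x = Phi m (f x) (g x)"
text \<open>The gradient of \<open>phi m\<close>, by \<open>W0_grad_phi\<close>.\<close>

definition P :: "real \<Rightarrow> 'a \<Rightarrow> 'a" where "P m x = Phi1 m (f x) (g x) *\<^sub>R F x + Phi2 m (f x) (g x) *\<^sub>R G x"
definition W :: "real \<Rightarrow> 'a \<Rightarrow> real" where "W k x = ind_le k (f x) * norm (F x) powr p + ind_le k (g x) * norm (G x) powr p"

lemma phi_P_outside:
  assumes "m > 0" "\<bar>f x\<bar> \<ge> 2 * m \<or> \<bar>g x\<bar> \<ge> 2 * m"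
  shows "phi m x = 0" "P m x = 0"
  using Phi_outside[OF assms] by (simp_all add: phi_def P_def)

lemma W_integrable: "k > 0 \<Longrightarrow> integrable M (W k)" "k > 0 \<Longrightarrow> (LINT x|M. W k x) = level_energy u k + level_energy v k"
  unfolding W_def[abs_def] level_energy_def using level_energy_integrable[OF u] level_energy_integrable[OF v] by auto

lemma W_nonneg: "W k x \<ge> 0" by (simp add: W_def ind_le_def)

lemma W_inside: "\<bar>f x\<bar> \<le> k \<Longrightarrow> \<bar>g x\<bar> \<le> k \<Longrightarrow> W k x = norm (F x) powr p + norm (G x) powr p"
  by (simp add: W_def ind_le_def)

text \<open>The chain rule is available for the truncations at level 2m, not for the solutions
  themselves. Truncating changes nothing, because \<open>Phi\<close> and its partial derivatives
  vanish as soon as one argument reaches 2m.\<close>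

lemma W0_grad_phi:
  assumes m: "m > 0"
  shows "W0_grad (phi m) (P m)"
proof -
  obtain C where C: "C > 0" "\<And>m s. m > 0 \<Longrightarrow> \<bar>cutoff' m s\<bar> \<le> C / m" using cutoff'_bounded by blast
  have m2: "2 * m > 0" using m by simp
  let ?tf = "\<lambda>x. clamp (2 * m) (f x)" and ?tg = "\<lambda>x. clamp (2 * m) (g x)"
  have H: "W0_grad (\<lambda>x. Phi m (?tf x) (?tg x)) (\<lambda>x. Phi1 m (?tf x) (?tg x) *\<^sub>R (ind_le (2 * m) (f x) *\<^sub>R F x) + Phi2 m (?tf x) (?tg x) *\<^sub>R (ind_le (2 * m) (g x) *\<^sub>R G x))"
    by (rule W0_grad_chain[OF sol_W0_grad[OF u m2] sol_W0_grad[OF v m2] Phi_C1_chain[OF m C] test_Phi])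
  have eq: "Phi m (?tf x) (?tg x) = phi m x \<and> Phi1 m (?tf x) (?tg x) *\<^sub>R (ind_le (2 * m) (f x) *\<^sub>R F x) + Phi2 m (?tf x) (?tg x) *\<^sub>R (ind_le (2 * m) (g x) *\<^sub>R G x) = P m x" for x
  proof (cases "\<bar>f x\<bar> \<le> 2 * m \<and> \<bar>g x\<bar> \<le> 2 * m")
    case True
    then have "?tf x = f x" "?tg x = g x" "ind_le (2 * m) (f x) = 1" "ind_le (2 * m) (g x) = 1" by (auto simp: clamp_def ind_le_def)
    then show ?thesis by (simp add: phi_def P_def)
  next
    case False
    then have "\<bar>?tf x\<bar> \<ge> 2 * m \<or> \<bar>?tg x\<bar> \<ge> 2 * m" "\<bar>f x\<bar> \<ge> 2 * m \<or> \<bar>g x\<bar> \<ge> 2 * m" using m by (auto simp: clamp_def)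
    then show ?thesis using Phi_outside[OF m] phi_P_outside[OF m] by simp
  qed
  show ?thesis by (rule W0_grad_cong_AE[OF H]) (use eq in auto)
qed

lemma phi_measurable: "m > 0 \<Longrightarrow> phi m \<in> borel_measurable M" and P_measurable: "m > 0 \<Longrightarrow> P m \<in> borel_measurable M"
  using H0D(3,4)[OF W0_grad_phi] by auto

section \<open>The two equations tested with \<open>phi\<close>\<close>

lemma LINT_cong_AE:
  fixes s t :: "'a \<Rightarrow> real"
  assumes "t \<in> borel_measurable M" "AE x in M. s x = t x"
  shows "(LINT x|M. s x) = (LINT x|M. t x)"
  by (rule integral_cong_AE[OF measurable_AE_cong[OF assms] assms])

text \<open>With the cutoff at level 2m as S, S(w) is 1 and S'(w) is 0 wherever \<open>phi m\<close>
  and \<open>P m\<close> can be nonzero, so the equation loses all trace of S on its left-hand side.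
  The assumption \<open>out\<close> is phrased for w so that the lemma covers both
  solutions.\<close>

lemma equation:
  assumes w: "sol w" and m: "m > 0" and out: "\<forall>x. \<bar>finite_part w x\<bar> \<ge> 2 * m \<longrightarrow> phi m x = 0 \<and> P m x = 0"
  defines "src \<equiv> source_term \<Omega> p h (cutoff (2 * m)) w (phi m)"
  shows "AE x in completion \<mu>d. \<bar>src x\<bar> \<noteq> \<infinity>"
    "integrable (completion \<mu>d) (\<lambda>x. real_of_ereal (src x))"
    "(LINT x|M. a x (tg w x) \<bullet> P m x) = (LINT x|completion \<mu>d. real_of_ereal (src x))"
proof -
  have m2: "2 * m > 0" using m by simp
  have wm: "tg w \<in> borel_measurable M" by (rule trunc_grad_spec(1)[OF w])
  note aw = caratheodory_measurable[OF wm]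
  have "phi m \<in> W1p_zero \<Omega> p" by (rule W0_grad_W1p_zero[OF W0_grad_phi[OF m]])
  moreover have "phi m \<in> Linfty \<Omega>" unfolding Linfty_def
    using phi_measurable[OF m] Phi_bounded by (auto intro!: exI[of _ 2] simp: phi_def)
  ultimately have adm: "cutoff (2 * m) \<in> W1infty UNIV \<and> continuous_on UNIV (cutoff (2 * m)) \<and> compact (closure {s. cutoff (2 * m) s \<noteq> 0}) \<and>
        phi m \<in> W1p_zero \<Omega> p \<inter> Linfty \<Omega>"
    using cutoff_admissible[OF m2] by blast
  have all: "(AE x in completion \<mu>d. \<bar>src x\<bar> \<noteq> \<infinity>) \<and>
        integrable (completion \<mu>d) (\<lambda>x. real_of_ereal (src x)) \<and>
        (LINT x|M. (a x (tg w x) \<bullet> weak_grad \<Omega> (phi m) x) * zero_ext (cutoff (2 * m)) (w x)) +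
        (LINT x|M. (a x (tg w x) \<bullet> tg w x) * zero_ext (weak_grad UNIV (cutoff (2 * m))) (w x) * phi m x) =
        (LINT x|completion \<mu>d. real_of_ereal (src x))"
    unfolding src_def
    using w[unfolded renormalized_solution_def, THEN conjunct2, THEN conjunct2, THEN conjunct2, THEN conjunct1, rule_format, OF adm] .
  then show "AE x in completion \<mu>d. \<bar>src x\<bar> \<noteq> \<infinity>" "integrable (completion \<mu>d) (\<lambda>x. real_of_ereal (src x))" by blast+
  have "(LINT x|M. (a x (tg w x) \<bullet> weak_grad \<Omega> (phi m) x) * zero_ext (cutoff (2 * m)) (w x)) = (LINT x|M. a x (tg w x) \<bullet> P m x)"
  proof (rule LINT_cong_AE)
    show "(\<lambda>x. a x (tg w x) \<bullet> P m x) \<in> borel_measurable M" by (intro borel_measurable_inner aw P_measurable[OF m])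
    show "AE x in M. (a x (tg w x) \<bullet> weak_grad \<Omega> (phi m) x) * zero_ext (cutoff (2 * m)) (w x) = a x (tg w x) \<bullet> P m x"
      using W0_grad_weak_grad[OF W0_grad_phi[OF m]] sol_finite(1)[OF w]
    proof eventually_elim
      case (elim x)
      have z: "zero_ext (cutoff (2 * m)) (w x) = cutoff (2 * m) (finite_part w x)"
        using elim(2)[THEN conjunct1] by (simp only: zero_ext_ereal)
      show ?case
      proof (cases "\<bar>finite_part w x\<bar> \<ge> 2 * m")
        case True
        then show ?thesis using out[rule_format, of x] elim(1) by simp
      next
        case False
        then have "cutoff (2 * m) (finite_part w x) = 1" by (intro cutoff_1[OF m2]) simp
        then show ?thesis using z elim(1) by simp
      qed
    qed
  qed
  moreover have "(LINT x|M. (a x (tg w x) \<bullet> tg w x) * zero_ext (weak_grad UNIV (cutoff (2 * m))) (w x) * phi m x) = (LINT x|M. 0)"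
  proof (rule LINT_cong_AE)
    \<comment> \<open>Three cases exhaust the points: \<open>phi m\<close> vanishes if |w| >= 2m,
      the gradient of w vanishes almost everywhere on w in Z, and otherwise the weak derivative
      equals \<open>cutoff' (2 * m)\<close>, which is 0 for |w| < 2m.\<close>
    obtain Z where Z: "Z \<in> null_sets lebesgue" "\<And>s. s \<notin> Z \<Longrightarrow> weak_grad UNIV (cutoff (2 * m)) s = cutoff' (2 * m) s"
      using weak_grad_cutoff[OF m2] by blast
    show "AE x in M. (a x (tg w x) \<bullet> tg w x) * zero_ext (weak_grad UNIV (cutoff (2 * m))) (w x) * phi m x = 0"
      using sol_gradient_null[OF w Z(1)] sol_finite(1)[OF w]
    proof eventually_elim
      case (elim x)
      have z: "zero_ext (weak_grad UNIV (cutoff (2 * m))) (w x) = weak_grad UNIV (cutoff (2 * m)) (finite_part w x)"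
        using elim(2)[THEN conjunct1] by (simp only: zero_ext_ereal)
      consider "\<bar>finite_part w x\<bar> \<ge> 2 * m" | "finite_part w x \<in> Z" | "\<bar>finite_part w x\<bar> < 2 * m" "finite_part w x \<notin> Z" by linarith
      then show ?case
      proof cases
        case 1 then show ?thesis using out[rule_format, of x] by simp
      next
        case 2 then show ?thesis using elim(1) by simp
      next
        case 3
        then have "weak_grad UNIV (cutoff (2 * m)) (finite_part w x) = 0" using Z(2) cutoff'_0_inside[OF m2] by simp
        then show ?thesis using z by simp
      qed
    qed
  qed simp
  ultimately show "(LINT x|M. a x (tg w x) \<bullet> P m x) = (LINT x|completion \<mu>d. real_of_ereal (src x))"
    using all by simp
qed

text \<open>The sign of w is known only up to Lebesgue null sets and is transferred to the diffuse
  measure by uniqueness. That result concerns real values, hence the bounded function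
  \<open>min 0 (trunc 1 s)\<close>, which is zero exactly for s >= 0.\<close>

lemma qc_rep_nonneg:
  assumes w: "sol w"
  shows "AE x in completion \<mu>d. 0 \<le> qc_rep \<Omega> p w x"
proof -
  have q: "quasi_continuous \<Omega> p (\<lambda>x. min 0 (trunc 1 (qc_rep \<Omega> p w x)))"
    by (rule quasi_continuous_compose[OF sol_qc_rep(1)[OF w], of "\<lambda>s. min 0 (trunc 1 s)"])
       (intro continuous_on_min continuous_on_const continuous_trunc)
  have q0: "quasi_continuous \<Omega> p (\<lambda>x. 0::real)"
    using quasi_continuous_compose[OF q, of "\<lambda>s. 0"] by (simp add: continuous_on_const)
  have "AE x in M. min 0 (trunc 1 (qc_rep \<Omega> p w x)) = 0"
    using sol_qc_rep(2)[OF w] sol_finite(1)[OF w]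
  proof eventually_elim
    case (elim x)
    then have "qc_rep \<Omega> p w x = ereal (finite_part w x)" "0 \<le> finite_part w x" by auto
    then show ?case by (simp add: trunc_ereal)
  qed
  from quasi_continuous_unique[OF \<mu>d q q0 this]
  show ?thesis
  proof eventually_elim
    case (elim x)
    show ?case
    proof (cases "qc_rep \<Omega> p w x")
      case (real r)
      then show ?thesis using elim by (auto simp: trunc_ereal min_def max_def split: if_splits)
    next
      case MInf
      then show ?thesis using elim by (simp add: trunc_def)
    qed simp
  qed
qed

text \<open>The right-hand side is a continuous function of the representatives of u and v, hence
  quasi continuous, and uniqueness identifies it with the chosen representative. Truncation at 2m
  gives infinite values a meaning and places them where \<open>Phi\<close> is 0.\<close>

lemma qc_rep_phi:
  assumes m: "m > 0"
  shows "AE x in completion \<mu>d. qc_rep \<Omega> p (phi m) x = Phi m (trunc (2 * m) (qc_rep \<Omega> p u x)) (trunc (2 * m) (qc_rep \<Omega> p v x))"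
proof -
  let ?E = "\<lambda>x. Phi m (trunc (2 * m) (qc_rep \<Omega> p u x)) (trunc (2 * m) (qc_rep \<Omega> p v x))"
  have cz: "continuous_on UNIV (\<lambda>z. Phi m (trunc (2 * m) (fst z)) (trunc (2 * m) (snd z)))"
  proof -
    have t: "continuous_on UNIV (\<lambda>z::ereal \<times> ereal. trunc (2 * m) (fst z))" "continuous_on UNIV (\<lambda>z::ereal \<times> ereal. trunc (2 * m) (snd z))"
      by (rule continuous_on_compose2[OF continuous_trunc]; auto intro!: continuous_intros)+
    have "continuous_on UNIV (\<lambda>z::ereal \<times> ereal. (trunc (2 * m) (fst z), trunc (2 * m) (snd z)))"
      by (intro continuous_on_Pair t)
    from continuous_on_compose2[OF continuous_Phi[OF m] this] show ?thesis by simp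
  qed
  have q: "quasi_continuous \<Omega> p ?E"
    using quasi_continuous_compose[OF quasi_continuous_Pair[OF sol_qc_rep(1)[OF u] sol_qc_rep(1)[OF v]] cz] by simp
  have ae: "AE x in M. ?E x = phi m x"
    using sol_qc_rep(2)[OF u] sol_finite(1)[OF u] sol_qc_rep(2)[OF v] sol_finite(1)[OF v]
  proof eventually_elim
    case (elim x)
    then have e: "qc_rep \<Omega> p u x = ereal (f x)" "qc_rep \<Omega> p v x = ereal (g x)" by auto
    show ?case
    proof (cases "\<bar>f x\<bar> \<le> 2 * m \<and> \<bar>g x\<bar> \<le> 2 * m")
      case True
      then have "trunc (2 * m) (ereal (f x)) = f x" "trunc (2 * m) (ereal (g x)) = g x" by (auto simp: trunc_ereal)
      then show ?thesis using e by (simp add: phi_def)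
    next
      case False
      then have "\<bar>trunc (2 * m) (ereal (f x))\<bar> \<ge> 2 * m \<or> \<bar>trunc (2 * m) (ereal (g x))\<bar> \<ge> 2 * m" "\<bar>f x\<bar> \<ge> 2 * m \<or> \<bar>g x\<bar> \<ge> 2 * m"
        using m by (auto simp: trunc_ereal)
      then show ?thesis using Phi_outside(1)[OF m] phi_P_outside(1)[OF m] e by simp
    qed
  qed
  have "\<exists>w. quasi_continuous \<Omega> p w \<and> (AE x in M. w x = phi m x)" using q ae by blast
  from someI_ex[OF this] have r: "quasi_continuous \<Omega> p (qc_rep \<Omega> p (phi m))" "AE x in M. qc_rep \<Omega> p (phi m) x = phi m x"
    unfolding qc_rep_def by blast+
  have "AE x in M. qc_rep \<Omega> p (phi m) x = ?E x" using r(2) ae by eventually_elim simp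
  then show ?thesis by (rule quasi_continuous_unique[OF \<mu>d r(1) q])
qed

text \<open>If q is nonzero, both values are finite and below 2m, so the cutoffs are 1. The sign of
  q is that of U - V, opposite to the sign of h(U) - h(V) because h is non-increasing.\<close>

lemma source_le:
  assumes m: "m > 0" and U: "0 \<le> U" and V: "0 \<le> V"
    and q: "q = Phi m (trunc (2 * m) U) (trunc (2 * m) V)"
    and fU: "\<bar>enn2ereal (h_ext h U) * ereal (zero_ext (cutoff (2 * m)) U) * ereal q\<bar> \<noteq> \<infinity>"
    and fV: "\<bar>enn2ereal (h_ext h V) * ereal (zero_ext (cutoff (2 * m)) V) * ereal q\<bar> \<noteq> \<infinity>"
  shows "real_of_ereal (enn2ereal (h_ext h U) * ereal (zero_ext (cutoff (2 * m)) U) * ereal q)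
    \<le> real_of_ereal (enn2ereal (h_ext h V) * ereal (zero_ext (cutoff (2 * m)) V) * ereal q)"
proof (cases "q = 0")
  case False
  have m2: "2 * m > 0" using m by simp
  have lt: "\<bar>trunc (2 * m) U\<bar> < 2 * m" "\<bar>trunc (2 * m) V\<bar> < 2 * m"
    using Phi_outside(1)[OF m, of "trunc (2 * m) U" "trunc (2 * m) V"] False q by (auto simp: not_le[symmetric])
  have red: "\<exists>s. W = ereal s \<and> 0 \<le> s \<and> s < 2 * m \<and> trunc (2 * m) W = s" if "0 \<le> W" "\<bar>trunc (2 * m) W\<bar> < 2 * m" for W
    using that m by (cases W) (auto simp: trunc_ereal trunc_def[of _ \<infinity>] min_def max_def split: if_splits)
  obtain s where s: "U = ereal s" "0 \<le> s" "s < 2 * m" "trunc (2 * m) U = s" using red[OF U lt(1)] by blast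
  obtain t where t: "V = ereal t" "0 \<le> t" "t < 2 * m" "trunc (2 * m) V = t" using red[OF V lt(2)] by blast
  have cutoff1: "zero_ext (cutoff (2 * m)) U = 1" "zero_ext (cutoff (2 * m)) V = 1"
    using s t cutoff_1[OF m2, of s] cutoff_1[OF m2, of t] by (auto simp: zero_ext_def)
  \<comment> \<open>As q is nonzero, a finite product forces a finite value of h; this disposes of
    an infinite h(0).\<close>
  have finite_part: "\<exists>r. enn2ereal H = ereal r" if "\<bar>enn2ereal H * ereal q\<bar> \<noteq> \<infinity>" for H
    using that False by (cases "enn2ereal H") (auto split: if_splits)
  have hU: "h_ext h U = h s" "h_ext h V = h t" using s t by (auto simp: h_ext_def)
  have hq: "\<bar>enn2ereal (h s) * ereal q\<bar> \<noteq> \<infinity>" "\<bar>enn2ereal (h t) * ereal q\<bar> \<noteq> \<infinity>"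
    using fU fV unfolding cutoff1 hU by auto
  obtain r1 r2 where r: "enn2ereal (h s) = ereal r1" "enn2ereal (h t) = ereal r2"
    using finite_part[OF hq(1)] finite_part[OF hq(2)] by blast
  have "r1 * q \<le> r2 * q"
  proof (cases "s \<le> t")
    case True
    then have "h t \<le> h s" using h_antimono s(2) t(2) by (auto simp: monotone_on_def)
    then have "r2 \<le> r1" using r by (simp add: less_eq_ennreal.rep_eq)
    moreover have "q \<le> 0"
    proof -
      have "arctan (s - t) \<le> 0" using True by simp
      then show ?thesis unfolding q s(4) t(4) Phi_def using cutoff_bounds by (intro mult_nonpos_nonneg) auto
    qed
    ultimately show ?thesis by (rule mult_right_mono_neg)
  next
    case False
    then have "h s \<le> h t" using h_antimono s(2) t(2) by (auto simp: monotone_on_def)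
    then have "r1 \<le> r2" using r by (simp add: less_eq_ennreal.rep_eq)
    moreover have "0 \<le> q"
    proof -
      have "arctan (s - t) \<ge> 0" using False by simp
      then show ?thesis unfolding q s(4) t(4) Phi_def using cutoff_bounds by (intro mult_nonneg_nonneg) auto
    qed
    ultimately show ?thesis by (rule mult_right_mono)
  qed
  then show ?thesis unfolding cutoff1 hU r by simp
qed simp

lemma pairing_le_0:
  assumes m: "m > 0"
  shows "(LINT x|M. a x (F x) \<bullet> P m x) \<le> (LINT x|M. a x (G x) \<bullet> P m x)"
proof -
  have o1: "\<forall>x. \<bar>f x\<bar> \<ge> 2 * m \<longrightarrow> phi m x = 0 \<and> P m x = 0" using phi_P_outside[OF m] by blast
  have o2: "\<forall>x. \<bar>g x\<bar> \<ge> 2 * m \<longrightarrow> phi m x = 0 \<and> P m x = 0" using phi_P_outside[OF m] by blast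
  note eu = equation[OF u m o1] and ev = equation[OF v m o2]
  have "(LINT x|completion \<mu>d. real_of_ereal (source_term \<Omega> p h (cutoff (2 * m)) u (phi m) x))
    \<le> (LINT x|completion \<mu>d. real_of_ereal (source_term \<Omega> p h (cutoff (2 * m)) v (phi m) x))"
  proof (rule integral_mono_AE[OF eu(2) ev(2)])
    show "AE x in completion \<mu>d. real_of_ereal (source_term \<Omega> p h (cutoff (2 * m)) u (phi m) x) \<le> real_of_ereal (source_term \<Omega> p h (cutoff (2 * m)) v (phi m) x)"
      using eu(1) ev(1) qc_rep_phi[OF m] qc_rep_nonneg[OF u] qc_rep_nonneg[OF v]
    proof eventually_elim
      case (elim x)
      show ?case
        using elim(1,2) unfolding source_term_def by (rule source_le[OF m elim(4,5,3)])
    qed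
  qed
  then show ?thesis using eu(3) ev(3) by (simp only:)
qed

text \<open>Where \<open>P m\<close> is nonzero both solutions are below 2m, and the growth bound
  with \<open>powr_mix\<close> estimates the pairing by the energy density \<open>W (2 * m)\<close>.
  Taking w among u and v keeps its gradient term below the sum of the other two, whence the factor
  3.\<close>

lemma pairing_integrable:
  assumes w: "w \<in> {u, v}" and m: "m > 0"
  shows "integrable M (\<lambda>x. a x (tg w x) \<bullet> P m x)"
proof -
  obtain C where C: "C > 0" "\<And>m s. m > 0 \<Longrightarrow> \<bar>cutoff' m s\<bar> \<le> C / m" using cutoff'_bounded by blast
  define B where "B = 1 + 2 * (C / m)"
  have B: "B > 0" using C(1) m by (simp add: B_def add_pos_nonneg)
  have Pb: "\<bar>Phi1 m s t\<bar> \<le> B" "\<bar>Phi2 m s t\<bar> \<le> B" for s t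
    using Phi_C1_chain[OF m C] by (auto simp: C1_chain_def B_def)
  have wm: "tg w \<in> borel_measurable M" using w Fm Gm by auto
  show ?thesis
  proof (rule Bochner_Integration.integrable_bound)
    show "integrable M (\<lambda>x. (3 * \<beta> * B) * W (2 * m) x)" using W_integrable(1)[of "2 * m"] m by simp
    show "(\<lambda>x. a x (tg w x) \<bullet> P m x) \<in> borel_measurable M"
      by (intro borel_measurable_inner caratheodory_measurable[OF wm] P_measurable[OF m])
    show "AE x in M. norm (a x (tg w x) \<bullet> P m x) \<le> norm ((3 * \<beta> * B) * W (2 * m) x)"
      using growth
    proof eventually_elim
      case (elim x)
      have nn: "0 \<le> (3 * \<beta> * B) * W (2 * m) x" using \<beta>_pos B W_nonneg by simp
      show ?case
      proof (cases "\<bar>f x\<bar> \<ge> 2 * m \<or> \<bar>g x\<bar> \<ge> 2 * m")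
        case True
        then show ?thesis using phi_P_outside(2)[OF m True] nn by simp
      next
        case False
        then have Wx: "W (2 * m) x = norm (F x) powr p + norm (G x) powr p" by (intro W_inside) auto
        let ?s = "norm (F x)" and ?t = "norm (G x)" and ?r = "norm (tg w x)"
        have "norm (P m x) \<le> \<bar>Phi1 m (f x) (g x)\<bar> * ?s + \<bar>Phi2 m (f x) (g x)\<bar> * ?t"
          unfolding P_def by (metis norm_scaleR norm_triangle_ineq)
        also have "\<dots> \<le> B * ?s + B * ?t" by (intro add_mono mult_right_mono Pb) auto
        finally have nP: "norm (P m x) \<le> B * (?s + ?t)" by (simp add: distrib_left)
        have "norm (a x (tg w x) \<bullet> P m x) \<le> norm (a x (tg w x)) * norm (P m x)" by (simp add: Cauchy_Schwarz_ineq2)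
        also have "\<dots> \<le> (\<beta> * ?r powr (p - 1)) * (B * (?s + ?t))"
          using elim nP \<beta>_pos by (intro mult_mono) auto
        also have "\<dots> = (\<beta> * B) * (?r powr (p - 1) * ?s + ?r powr (p - 1) * ?t)" by (simp add: algebra_simps)
        also have "\<dots> \<le> (\<beta> * B) * (3 * (?s powr p + ?t powr p))"
        proof (intro mult_left_mono)
          have "?r powr (p - 1) * ?s + ?r powr (p - 1) * ?t \<le> (?r powr p + ?s powr p) + (?r powr p + ?t powr p)"
            using p_gt_1 by (intro add_mono powr_mix) auto
          moreover have "?r powr p \<le> ?s powr p + ?t powr p" using w by auto
          moreover have "X \<le> a + b + (a + c) \<Longrightarrow> a \<le> b + c \<Longrightarrow> X \<le> 3 * (b + c)" for X a b c :: real by simp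
          ultimately show "?r powr (p - 1) * ?s + ?r powr (p - 1) * ?t \<le> 3 * (?s powr p + ?t powr p)" by blast
        qed (use \<beta>_pos B in simp)
        finally show ?thesis unfolding Wx using nn[unfolded Wx] by (simp add: algebra_simps)
      qed
    qed
  qed
qed

text \<open>\<open>Q m\<close> is the monotone part of the difference of the two pairings;
  \<open>E m\<close> is the part of \<open>P m\<close> in which the derivative falls on a
  cutoff.\<close>

definition Q :: "real \<Rightarrow> 'a \<Rightarrow> real" where
  "Q m x = inverse (1 + (f x - g x)\<^sup>2) * cutoff m (f x) * cutoff m (g x) * ((a x (F x) - a x (G x)) \<bullet> (F x - G x))"

definition E :: "real \<Rightarrow> 'a \<Rightarrow> 'a" where
  "E m x = arctan (f x - g x) *\<^sub>R ((cutoff' m (f x) * cutoff m (g x)) *\<^sub>R F x + (cutoff m (f x) * cutoff' m (g x)) *\<^sub>R G x)"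

lemma P_split: "P m x = (inverse (1 + (f x - g x)\<^sup>2) * cutoff m (f x) * cutoff m (g x)) *\<^sub>R (F x - G x) + E m x"
  unfolding P_def E_def Phi1_def Phi2_def by (simp add: algebra_simps)

lemma Q_nonneg: "AE x in M. 0 \<le> Q m x"
  using strict_monotone
proof eventually_elim
  case (elim x)
  have "0 \<le> (a x (F x) - a x (G x)) \<bullet> (F x - G x)"
    using elim[rule_format, of "F x" "G x"] by (cases "F x = G x") auto
  then show ?case unfolding Q_def using cutoff_bounds inverse_one_plus_square(1)[of "f x - g x"]
    by (intro mult_nonneg_nonneg) auto
qed

text \<open>The integral of \<open>Q m\<close> is the difference of the pairings, nonpositive by
  \<open>pairing_le_0\<close>, minus the pairing with \<open>E m\<close>. The latter is bounded by
  1/m times the energy density below 2m.\<close>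

lemma Q_estimate:
  obtains K where "K > 0" "\<And>m. m > 0 \<Longrightarrow> integrable M (Q m) \<and> (LINT x|M. Q m x) \<le> K / m * (level_energy u (2 * m) + level_energy v (2 * m))"
proof -
  obtain C where C: "C > 0" "\<And>m s. m > 0 \<Longrightarrow> \<bar>cutoff' m s\<bar> \<le> C / m" using cutoff'_bounded by blast
  \<comment> \<open>The 6 is 2 from the bound on arctan times 3 from estimating the four products of
    the two gradients: each pure one is a p-th power, each mixed one is at most the sum of both p-th
    powers.\<close>
  define K where "K = 6 * \<beta> * C"
  have K: "K > 0" using \<beta>_pos C by (simp add: K_def)
  have "integrable M (Q m) \<and> (LINT x|M. Q m x) \<le> K / m * (level_energy u (2 * m) + level_energy v (2 * m))" if m: "m > 0" for m
  proof -
    have m2: "2 * m > 0" using m by simp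
    let ?d = "\<lambda>x. a x (F x) - a x (G x)"
    have iF: "integrable M (\<lambda>x. a x (F x) \<bullet> P m x)" and iG: "integrable M (\<lambda>x. a x (G x) \<bullet> P m x)"
      using pairing_integrable[OF _ m] by auto
    have fgm: "(\<lambda>x. arctan (f x - g x)) \<in> borel_measurable M"
      by (rule comp_measurable[where F = arctan and f = "\<lambda>x. f x - g x"])
         (intro borel_measurable_continuous_onI continuous_on_arctan continuous_on_id, intro borel_measurable_diff fm gm)
    have cm: "(\<lambda>x. cutoff m (k x)) \<in> borel_measurable M" "(\<lambda>x. cutoff' m (k x)) \<in> borel_measurable M" if "k \<in> borel_measurable M" for k
      by (rule comp_measurable[OF borel_measurable_continuous_onI[OF continuous_cutoff] that],
          rule comp_measurable[OF borel_measurable_continuous_onI[OF continuous_cutoff'[OF m]] that])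
    have Em: "E m \<in> borel_measurable M"
      unfolding E_def[abs_def] by (intro borel_measurable_scaleR borel_measurable_add borel_measurable_times fgm cm fm gm Fm Gm)
    have dm: "?d \<in> borel_measurable M" by (intro borel_measurable_diff aF aG)
    have eb: "AE x in M. \<bar>?d x \<bullet> E m x\<bar> \<le> K / m * W (2 * m) x"
      using growth
    proof eventually_elim
      case (elim x)
      have nn: "0 \<le> K / m * W (2 * m) x" using K m W_nonneg by simp
      show ?case
      proof (cases "\<bar>f x\<bar> \<ge> 2 * m \<or> \<bar>g x\<bar> \<ge> 2 * m")
        case True
        then have "E m x = 0" unfolding E_def using cutoff_0[OF m] cutoff'_0[OF m] by auto
        then show ?thesis using nn by simp
      next
        case False
        then have Wx: "W (2 * m) x = norm (F x) powr p + norm (G x) powr p" by (intro W_inside) auto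
        let ?s = "norm (F x)" and ?t = "norm (G x)"
        have cc: "\<bar>cutoff' m (f x) * cutoff m (g x)\<bar> \<le> C / m * 1" "\<bar>cutoff m (f x) * cutoff' m (g x)\<bar> \<le> 1 * (C / m)"
          unfolding abs_mult using C m cutoff_bounds[of m "f x"] cutoff_bounds[of m "g x"] by (intro mult_mono; auto)+
        have "norm ((cutoff' m (f x) * cutoff m (g x)) *\<^sub>R F x + (cutoff m (f x) * cutoff' m (g x)) *\<^sub>R G x) \<le> \<bar>cutoff' m (f x) * cutoff m (g x)\<bar> * ?s + \<bar>cutoff m (f x) * cutoff' m (g x)\<bar> * ?t"
          by (metis norm_scaleR norm_triangle_ineq)
        also have "\<dots> \<le> (C / m * 1) * ?s + (1 * (C / m)) * ?t" by (intro add_mono mult_right_mono cc) auto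
        also have "\<dots> = C / m * (?s + ?t)" by (simp add: distrib_left)
        finally have "norm (E m x) \<le> 2 * (C / m * (?s + ?t))"
          unfolding E_def norm_scaleR using arctan_abs_le_2 by (intro mult_mono) auto
        moreover have "norm (?d x) \<le> \<beta> * ?s powr (p - 1) + \<beta> * ?t powr (p - 1)"
          using norm_triangle_ineq4[of "a x (F x)" "a x (G x)"] elim[rule_format, of "F x"] elim[rule_format, of "G x"] by linarith
        ultimately have "norm (?d x) * norm (E m x) \<le> (\<beta> * ?s powr (p - 1) + \<beta> * ?t powr (p - 1)) * (2 * (C / m * (?s + ?t)))"
          using \<beta>_pos by (intro mult_mono) auto
        also have "\<dots> = (2 * \<beta> * C / m) * (?s powr (p - 1) * ?s + ?s powr (p - 1) * ?t + (?t powr (p - 1) * ?s + ?t powr (p - 1) * ?t))"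
          by (simp add: algebra_simps)
        also have "\<dots> \<le> (2 * \<beta> * C / m) * (3 * (?s powr p + ?t powr p))"
        proof (intro mult_left_mono)
          have e: "norm z powr (p - 1) * norm z = norm z powr p" for z :: 'a by (cases "z = 0") (auto simp: powr_diff)
          show "?s powr (p - 1) * ?s + ?s powr (p - 1) * ?t + (?t powr (p - 1) * ?s + ?t powr (p - 1) * ?t) \<le> 3 * (?s powr p + ?t powr p)"
            using powr_mix[of ?s ?t p] powr_mix[of ?t ?s p] p_gt_1 unfolding e by simp
        qed (use \<beta>_pos C m in simp)
        also have "\<dots> = K / m * W (2 * m) x" unfolding Wx K_def by simp
        finally show ?thesis using Cauchy_Schwarz_ineq2[of "?d x" "E m x"] by linarith
      qed
    qed
    have iW: "integrable M (\<lambda>x. K / m * W (2 * m) x)" using W_integrable(1)[OF m2] by simp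
    have iE: "integrable M (\<lambda>x. ?d x \<bullet> E m x)"
    proof (rule Bochner_Integration.integrable_bound[OF iW])
      show "(\<lambda>x. ?d x \<bullet> E m x) \<in> borel_measurable M" by (intro borel_measurable_inner dm Em)
      show "AE x in M. norm (?d x \<bullet> E m x) \<le> norm (K / m * W (2 * m) x)"
        using eb
      proof eventually_elim
        case (elim x)
        then show ?case unfolding real_norm_def by (rule order_trans[OF _ abs_ge_self])
      qed
    qed
    have Qeq: "Q m x = a x (F x) \<bullet> P m x - a x (G x) \<bullet> P m x - ?d x \<bullet> E m x" for x
      unfolding P_split Q_def by (simp add: inner_diff_left inner_diff_right inner_add_right algebra_simps)
    have Qf: "Q m = (\<lambda>x. a x (F x) \<bullet> P m x - a x (G x) \<bullet> P m x - ?d x \<bullet> E m x)" using Qeq by blast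
    have "(LINT x|M. Q m x) = (LINT x|M. a x (F x) \<bullet> P m x) - (LINT x|M. a x (G x) \<bullet> P m x) - (LINT x|M. ?d x \<bullet> E m x)"
      unfolding Qf using iF iG iE by simp
    also have "\<dots> \<le> - (LINT x|M. ?d x \<bullet> E m x)" using pairing_le_0[OF m] by simp
    also have "\<dots> = (LINT x|M. - (?d x \<bullet> E m x))" by simp
    also have "\<dots> \<le> (LINT x|M. K / m * W (2 * m) x)"
      by (rule integral_mono_AE[OF Bochner_Integration.integrable_minus[OF iE] iW]) (use eb in \<open>eventually_elim, linarith\<close>)
    also have "\<dots> = K / m * (level_energy u (2 * m) + level_energy v (2 * m))" using W_integrable(2)[OF m2] by simp
    finally show ?thesis unfolding Qf using iF iG iE by simp
  qed
  then show ?thesis using K by (intro that[of K]) auto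
qed

section \<open>Passage to the limit along powers of two\<close>

lemma energy_sum_tendsto:
  "(\<lambda>j. K / 2 ^ j * (level_energy u (2 * 2 ^ j) + level_energy v (2 * 2 ^ j))) \<longlonglongrightarrow> 0"
proof -
  have "(\<lambda>j. (2 * K) * (level_energy u (2 ^ Suc j) / 2 ^ Suc j + level_energy v (2 ^ Suc j) / 2 ^ Suc j)) \<longlonglongrightarrow> (2 * K) * (0 + 0)"
    by (intro tendsto_intros LIMSEQ_Suc sol_energy_tendsto u v)
  moreover have "(2 * K) * (level_energy u (2 ^ Suc j) / 2 ^ Suc j + level_energy v (2 ^ Suc j) / 2 ^ Suc j) = K / 2 ^ j * (level_energy u (2 * 2 ^ j) + level_energy v (2 * 2 ^ j))" for j
    by (simp add: add_divide_distrib distrib_left)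
  ultimately show ?thesis by (simp only: add_0_left mult_zero_right)
qed

lemma eventually_below_power: "\<exists>N. \<forall>j\<ge>N. \<bar>s\<bar> \<le> (2::real) ^ j"
proof -
  obtain N where N: "\<bar>s\<bar> < 2 ^ N" using real_arch_pow[of 2 "\<bar>s\<bar>"] by auto
  have "\<bar>s\<bar> \<le> 2 ^ j" if "j \<ge> N" for j
  proof -
    have "(2::real) ^ N \<le> 2 ^ j" using that by (simp add: power_increasing)
    then show ?thesis using N by linarith
  qed
  then show ?thesis by blast
qed

lemma eventually_cutoff: "\<exists>N. \<forall>j\<ge>N. cutoff (2 ^ j) s = 1 \<and> cutoff (2 ^ j) t = 1"
proof -
  obtain N1 N2 where "\<forall>j\<ge>N1. \<bar>s\<bar> \<le> (2::real) ^ j" "\<forall>j\<ge>N2. \<bar>t\<bar> \<le> (2::real) ^ j"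
    using eventually_below_power by meson
  then have "\<forall>j\<ge>max N1 N2. cutoff (2 ^ j) s = 1 \<and> cutoff (2 ^ j) t = 1" by (simp add: cutoff_1)
  then show ?thesis by blast
qed

text \<open>Convergence in mean gives pointwise limits only along a subsequence, but at a fixed
  point the cutoffs are eventually 1 and the full sequence is eventually constant, so the limit
  determines that constant.\<close>

lemma subseq_limit_eventually_const:
  fixes X :: "nat \<Rightarrow> real"
  assumes "strict_mono r" "(\<lambda>n. X (r n)) \<longlonglongrightarrow> l" "\<forall>j\<ge>N. X j = c"
  shows "c = l"
proof -
  have "\<forall>\<^sub>F n in sequentially. X (r n) = c"
    unfolding eventually_sequentially using assms(3) seq_suble[OF assms(1)] order_trans by metis
  then have "(\<lambda>n. X (r n)) \<longlonglongrightarrow> c" by (rule tendsto_eventually)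
  then show ?thesis using assms(2) by (rule LIMSEQ_unique)
qed

text \<open>\<open>Q\<close> tends to 0 in L^1, while at almost every point it is eventually the
  positive weight 1/(1 + (u - v)^2) times the monotonicity product. That product is therefore 0, and
  strict monotonicity forces the gradients to agree.\<close>

lemma gradients_equal: "AE x in M. F x = G x"
proof -
  obtain K where K: "K > 0" "\<And>m. m > 0 \<Longrightarrow> integrable M (Q m) \<and> (LINT x|M. Q m x) \<le> K / m * (level_energy u (2 * m) + level_energy v (2 * m))"
    using Q_estimate by blast
  let ?Q = "\<lambda>j. Q (2 ^ j)"
  have iQ: "integrable M (?Q j)" for j using K(2)[of "2 ^ j"] by simp
  have "(\<lambda>j. LINT x|M. norm (?Q j x)) \<longlonglongrightarrow> 0"
  proof (rule tendsto_sandwich[OF _ _ tendsto_const energy_sum_tendsto[of K]])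
    show "\<forall>\<^sub>F j in sequentially. 0 \<le> (LINT x|M. norm (?Q j x))" by simp
    have "(LINT x|M. norm (?Q j x)) \<le> K / 2 ^ j * (level_energy u (2 * 2 ^ j) + level_energy v (2 * 2 ^ j))" for j
    proof -
      have "(LINT x|M. norm (?Q j x)) = (LINT x|M. ?Q j x)"
        by (rule LINT_cong_AE[OF borel_measurable_integrable[OF iQ]]) (use Q_nonneg[of "2 ^ j"] in \<open>eventually_elim, simp\<close>)
      then show ?thesis using K(2)[of "2 ^ j"] by simp
    qed
    then show "\<forall>\<^sub>F j in sequentially. (LINT x|M. norm (?Q j x)) \<le> K / 2 ^ j * (level_energy u (2 * 2 ^ j) + level_energy v (2 * 2 ^ j))" by simp
  qed
  from tendsto_L1_AE_subseq[OF iQ this] obtain r where r: "strict_mono r" "AE x in M. (\<lambda>n. ?Q (r n) x) \<longlonglongrightarrow> 0" by blast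
  show ?thesis
    using r(2) strict_monotone
  proof eventually_elim
    case (elim x)
    let ?q = "inverse (1 + (f x - g x)\<^sup>2) * ((a x (F x) - a x (G x)) \<bullet> (F x - G x))"
    obtain N where N: "\<forall>j\<ge>N. cutoff (2 ^ j) (f x) = 1 \<and> cutoff (2 ^ j) (g x) = 1" using eventually_cutoff by blast
    then have "\<forall>j\<ge>N. ?Q j x = ?q" by (simp add: Q_def)
    from subseq_limit_eventually_const[OF r(1) elim(1) this] have "?q = 0" .
    then have "(a x (F x) - a x (G x)) \<bullet> (F x - G x) = 0"
      using inverse_one_plus_square(1)[of "f x - g x"] by simp
    then show ?case using elim(2)[rule_format, of "F x" "G x"] by (cases "F x = G x") auto
  qed
qed

text \<open>With equal gradients the terms containing the derivative of arctan cancel, and only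
  derivatives of cutoffs remain, of size 1/m. Their p-th power is at most a constant times 1/m
  because m >= 1 and p > 1.\<close>

lemma P_estimate:
  obtains K where "K > 0" "\<And>m. m \<ge> 1 \<Longrightarrow> (LINT x|M. norm (P m x) powr p) \<le> K / m * (level_energy u (2 * m) + level_energy v (2 * m))"
proof -
  obtain C where C: "C > 0" "\<And>m s. m > 0 \<Longrightarrow> \<bar>cutoff' m s\<bar> \<le> C / m" using cutoff'_bounded by blast
  \<comment> \<open>The factor 4 is the bound 2 for arctan times the two summands that contain a
    derivative of a cutoff.\<close>
  define K where "K = (4 * C) powr p"
  have K: "K > 0" using C by (simp add: K_def)
  have "(LINT x|M. norm (P m x) powr p) \<le> K / m * (level_energy u (2 * m) + level_energy v (2 * m))" if m1: "m \<ge> 1" for m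
  proof -
    have m: "m > 0" "2 * m > 0" using m1 by auto
    have "(LINT x|M. norm (P m x) powr p) \<le> (LINT x|M. K / m * W (2 * m) x)"
    proof (rule integral_mono_AE)
      show "integrable M (\<lambda>x. norm (P m x) powr p)" by (rule LpD(2)[OF H0D(2)[OF W0_grad_phi[OF m(1)]]])
      show "integrable M (\<lambda>x. K / m * W (2 * m) x)" using W_integrable(1)[OF m(2)] by simp
      show "AE x in M. norm (P m x) powr p \<le> K / m * W (2 * m) x"
        using gradients_equal
      proof eventually_elim
        case (elim x)
        have nn: "0 \<le> K / m * W (2 * m) x" using K m W_nonneg by simp
        show ?case
        proof (cases "\<bar>f x\<bar> \<ge> 2 * m \<or> \<bar>g x\<bar> \<ge> 2 * m")
          case True
          then show ?thesis using phi_P_outside(2)[OF m(1) True] nn p_gt_1 by simp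
        next
          case False
          then have Wx: "W (2 * m) x = norm (F x) powr p + norm (G x) powr p" by (intro W_inside) auto
          have c1: "\<bar>cutoff' m (f x) * cutoff m (g x)\<bar> \<le> C / m * 1"
            unfolding abs_mult using C m cutoff_bounds[of m "g x"] by (intro mult_mono) auto
          have c2: "\<bar>cutoff m (f x) * cutoff' m (g x)\<bar> \<le> 1 * (C / m)"
            unfolding abs_mult using C m cutoff_bounds[of m "f x"] by (intro mult_mono) auto
          have cc: "\<bar>cutoff' m (f x) * cutoff m (g x) + cutoff m (f x) * cutoff' m (g x)\<bar> \<le> 2 * (C / m)"
            using c1 c2 by linarith
          have Pe: "P m x = (arctan (f x - g x) * (cutoff' m (f x) * cutoff m (g x) + cutoff m (f x) * cutoff' m (g x))) *\<^sub>R F x"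
            unfolding P_split E_def elim[symmetric] by (simp add: scaleR_add_left[symmetric])
          have "\<bar>arctan (f x - g x) * (cutoff' m (f x) * cutoff m (g x) + cutoff m (f x) * cutoff' m (g x))\<bar> \<le> 2 * (2 * (C / m))"
            unfolding abs_mult[of "arctan _"] using cc arctan_abs_le_2 by (intro mult_mono) auto
          then have "norm (P m x) \<le> (4 * C / m) * norm (F x)"
            unfolding Pe norm_scaleR by (intro mult_right_mono) auto
          then have "norm (P m x) powr p \<le> ((4 * C / m) * norm (F x)) powr p" using p_gt_1 by (intro powr_mono2) auto
          also have "\<dots> = (4 * C / m) powr p * norm (F x) powr p" by (rule powr_mult)
          also have "(4 * C / m) powr p = K / m powr p" using C m by (simp add: powr_divide K_def)
          also have "K / m powr p * norm (F x) powr p \<le> K / m * norm (F x) powr p"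
          proof (intro mult_right_mono divide_left_mono)
            have "m powr 1 \<le> m powr p" using m1 p_gt_1 by (intro powr_mono) auto
            then show "m \<le> m powr p" using m by simp
          qed (use K m in auto)
          also have "\<dots> \<le> K / m * W (2 * m) x" unfolding Wx using K m by (intro mult_left_mono) auto
          finally show ?thesis .
        qed
      qed
    qed
    also have "\<dots> = K / m * (level_energy u (2 * m) + level_energy v (2 * m))" using W_integrable(2)[OF m(2)] by simp
    finally show ?thesis .
  qed
  then show ?thesis using K by (intro that[of K]) auto
qed

theorem solutions_equal: "AE x in M. u x = v x"
proof -
  obtain K where K: "K > 0" "\<And>m. m \<ge> 1 \<Longrightarrow> (LINT x|M. norm (P m x) powr p) \<le> K / m * (level_energy u (2 * m) + level_energy v (2 * m))"
    using P_estimate by blast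
  obtain C where C: "C > 0" "\<And>f G. W0_grad f G \<Longrightarrow> (LINT x|M. \<bar>f x\<bar> powr p) \<le> C * (LINT x|M. norm (G x) powr p)"
    using poincare by blast
  let ?X = "\<lambda>j x. \<bar>phi (2 ^ j) x\<bar> powr p"
  have H: "W0_grad (phi (2 ^ j)) (P (2 ^ j))" for j by (rule W0_grad_phi) simp
  have iX: "integrable M (?X j)" for j using LpD(2)[OF H0D(1)[OF H[of j]]] by simp
  have "(\<lambda>j. LINT x|M. norm (?X j x)) \<longlonglongrightarrow> 0"
  proof (rule tendsto_sandwich[OF _ _ tendsto_const energy_sum_tendsto[of "C * K"]])
    show "\<forall>\<^sub>F j in sequentially. 0 \<le> (LINT x|M. norm (?X j x))" by simp
    have "(LINT x|M. norm (?X j x)) \<le> C * K / 2 ^ j * (level_energy u (2 * 2 ^ j) + level_energy v (2 * 2 ^ j))" for j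
    proof -
      have "(LINT x|M. norm (?X j x)) \<le> C * (LINT x|M. norm (P (2 ^ j) x) powr p)" using C(2)[OF H[of j]] by simp
      also have "\<dots> \<le> C * (K / 2 ^ j * (level_energy u (2 * 2 ^ j) + level_energy v (2 * 2 ^ j)))"
        using C(1) K(2)[of "2 ^ j"] by (intro mult_left_mono) auto
      finally show ?thesis by (simp add: mult.assoc)
    qed
    then show "\<forall>\<^sub>F j in sequentially. (LINT x|M. norm (?X j x)) \<le> C * K / 2 ^ j * (level_energy u (2 * 2 ^ j) + level_energy v (2 * 2 ^ j))" by simp
  qed
  from tendsto_L1_AE_subseq[OF iX this] obtain r where r: "strict_mono r" "AE x in M. (\<lambda>n. ?X (r n) x) \<longlonglongrightarrow> 0" by blast
  show ?thesis
    using r(2) sol_finite(1)[OF u] sol_finite(1)[OF v]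
  proof eventually_elim
    case (elim x)
    obtain N where N: "\<forall>j\<ge>N. cutoff (2 ^ j) (f x) = 1 \<and> cutoff (2 ^ j) (g x) = 1" using eventually_cutoff by blast
    then have "\<forall>j\<ge>N. ?X j x = \<bar>arctan (f x - g x)\<bar> powr p" by (simp add: phi_def Phi_def)
    from subseq_limit_eventually_const[OF r(1) elim(1) this] have "\<bar>arctan (f x - g x)\<bar> powr p = 0" .
    then have "f x = g x" by simp
    then show ?case using elim(2,3) by metis
  qed
qed

end

theorem theorem6p8:
  fixes \<Omega> :: "'a::euclidean_space set"
    and p :: real
    and a :: "'a \<Rightarrow> 'a \<Rightarrow> 'a"
    and \<mu> \<mu>d \<mu>c :: "'a measure"
    and h :: "real \<Rightarrow> ennreal"
    and u v :: "'a \<Rightarrow> ereal"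
  assumes "DIM('a) \<ge> 2"
    and "open \<Omega>" and "bounded \<Omega>"
    and "1 < p" and "p < real DIM('a)"
    and "caratheodory \<Omega> a"
    and "\<exists>\<alpha>>0. \<exists>\<beta>>0. AE x in lebesgue_on \<Omega>. \<forall>\<xi> \<xi>'. \<xi> \<noteq> \<xi>' \<longrightarrow>
           a x \<xi> \<bullet> \<xi> \<ge> \<alpha> * norm \<xi> powr p \<and>
           norm (a x \<xi>) \<le> \<beta> * norm \<xi> powr (p - 1) \<and>
           (a x \<xi> - a x \<xi>') \<bullet> (\<xi> - \<xi>') > 0"
    and "bounded_borel_measure \<Omega> \<mu>"
    and "capacity_decomposition \<Omega> p \<mu> \<mu>d \<mu>c"
    and "\<forall>B\<in>sets \<mu>c. emeasure \<mu>c B = 0"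
    and "\<forall>s\<ge>0. h s > 0"
    and "\<forall>s>0. h s < \<infinity>"
    and "continuous_on {0..} h"
    and "antimono_on {0..} h"
    and "\<exists>\<gamma> c\<^sub>1 s\<^sub>1. 0 \<le> \<gamma> \<and> \<gamma> \<le> 1 \<and> 0 < c\<^sub>1 \<and> 0 < s\<^sub>1 \<and>
           (\<forall>s. 0 < s \<and> s < s\<^sub>1 \<longrightarrow> h s \<le> ennreal (c\<^sub>1 * s powr (- \<gamma>)))"
    and "renormalized_solution \<Omega> p a h \<mu>d \<mu>c u"
    and "renormalized_solution \<Omega> p a h \<mu>d \<mu>c v"
  shows "AE x in lebesgue_on \<Omega>. u x = v x"
proof -
  obtain \<alpha> \<beta> where ab: "\<alpha> > 0" "\<beta> > 0" and ae: "AE x in lebesgue_on \<Omega>. \<forall>\<xi> \<xi>'. \<xi> \<noteq> \<xi>' \<longrightarrow>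
           a x \<xi> \<bullet> \<xi> \<ge> \<alpha> * norm \<xi> powr p \<and>
           norm (a x \<xi>) \<le> \<beta> * norm \<xi> powr (p - 1) \<and>
           (a x \<xi> - a x \<xi>') \<bullet> (\<xi> - \<xi>') > 0"
    using assms(7) by blast
  \<comment> \<open>Coercivity and growth are assumed inside the quantification over distinct pairs;
    to extract them for a single vector, a different partner must exist.\<close>
  have ne: "\<exists>\<xi>'. \<xi> \<noteq> \<xi>'" for \<xi> :: 'a
  proof -
    obtain b :: 'a where "b \<in> Basis" by (metis SOME_Basis)
    then have "b \<noteq> 0" by (rule nonzero_Basis)
    then have "\<xi> \<noteq> \<xi> + b" by simp
    then show ?thesis by blast
  qed
  interpret two_solutions \<Omega> p a h \<mu>d \<mu>c \<alpha> \<beta> u v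
  proof unfold_locales
    show "AE x in lebesgue_on \<Omega>. \<forall>\<xi>. \<alpha> * norm \<xi> powr p \<le> a x \<xi> \<bullet> \<xi>"
      using ae by eventually_elim (use ne in blast)
    show "AE x in lebesgue_on \<Omega>. \<forall>\<xi>. norm (a x \<xi>) \<le> \<beta> * norm \<xi> powr (p - 1)"
      using ae by eventually_elim (use ne in blast)
    show "AE x in lebesgue_on \<Omega>. \<forall>\<xi> \<xi>'. \<xi> \<noteq> \<xi>' \<longrightarrow> (a x \<xi> - a x \<xi>') \<bullet> (\<xi> - \<xi>') > 0"
      using ae by eventually_elim blast
    show "bounded_borel_measure \<Omega> \<mu>d" "diffuse \<Omega> p \<mu>d"
      using assms(9) by (simp_all add: capacity_decomposition_def)
    show "emeasure \<mu>c (space \<mu>c) = 0" using assms(10) by blast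
  qed (use assms ab in auto)
  show ?thesis by (rule solutions_equal)
qed

end
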